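(* Let $M$ and $N$ be rich structures in $\mathcal{K}_3$, and let $\bar a$ in $M$ and $\bar b$ in $N$ be finite tuples such that $\langle\bar a\rangle\le M$, $\langle\bar b\rangle\le N$, and there is an isomorphism $\langle\bar a\rangle\to\langle\bar b\rangle$ mapping $\bar a$ to $\bar b$. Then $(M,\bar a)\equiv_{L_{\infty,\omega}}(N,\bar b)$.
   Context: Fix a finite field $K$. A graded $3$-nilpotent Lie algebra over $K$ is $M=M_1\oplus M_2\oplus M_3$ with $[M_i,M_j]\subseteq M_{i+j}$ ($=0$ if $i+j>3$), viewed as a structure in the language $L$ with $+,-,0$, scalar multiplications, predicates $U_i$ for $M_i$, projections onto $M_i$ and the bracket; substructures are graded subalgebras, $\langle X\rangle$ the generated substructure. For finite $M$: a generating o-system is a homogeneous generating set $X$ with each $X_i=X\cap M_i$ linearly independent modulo the degree-$i$ part of $\langle X_1\cup\dots\cup X_{i-1}\rangle$; $o\text{-}dim_i(M)=|X_i|$. With $F$ free graded $3$-nilpotent on generators ($|X_i|$ of degree $i$), $f:F\to M$ mapping degree-$i$ generators onto $X_i$, $R=\ker f$: $ideal\text{-}dim_i(M)$ ($i=2,3$) is the dimension of $R\cap F_i$ modulo the degree-$i$ part of the ideal generated by $R\cap(F_2\oplus\dots\oplus F_{i-1})$; $\delta_i(M)=\sum_{j\le i}o\text{-}dim_j(M)-\sum_{2\le j\le i}ideal\text{-}dim_j(M)$. For finite $A\subseteq N$, $A\le N$ means $\delta_j(A)\le\delta_j(E)$ ($j=2,3$) for all finite substructures $A\subseteq E\subseteq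 N$. $\mathcal{K}_3$: graded $3$-nilpotent Lie algebras $M$ over $K$ with (i) nonzero $x\in M_i,y\in M_j$, $i+j\le3$, have $[x,y]\ne0$ unless $x\in Ky$; (ii) every finite substructure $A$ with $0<o\text{-}dim(A)\le2$ satisfies $A\le M$. $M\in\mathcal{K}_3$ is rich if for finite $B\le A$ in $\mathcal{K}_3$ every embedding $f:B\to M$ with $f(B)\le M$ extends to an embedding $g:A\to M$ with $g(A)\le M$. *)

theory Defs
  imports Complex_Main "HOL-Library.Function_Algebras"
begin

section \<open>Graded 3-nilpotent Lie algebras\<close>

text \<open>
  The elements of a structure live in an ambient \<open>'k\<close>-vector space, given by a type
  \<open>'a\<close> of class \<open>ab_group_add\<close> and the scalar multiplication \<open>smul\<close>. The algebra is the
  (internal direct) sum of the homogeneous components \<open>grade M 1\<close>, \<open>grade M 2\<close>,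
  \<open>grade M 3\<close>; the bracket is only meaningful on the carrier. All other components are
  required to be \<open>{0}\<close>, so that \<open>[M_i, M_j] \<subseteq> M_(i+j)\<close> includes \<open>[M_i, M_j] = 0\<close>
  for \<open>i + j > 3\<close>.
\<close>

record ('k, 'a) glie =
  smul :: "'k \<Rightarrow> 'a \<Rightarrow> 'a"
  grade :: "nat \<Rightarrow> 'a set"
  bracket :: "'a \<Rightarrow> 'a \<Rightarrow> 'a"

definition carrier :: "('k, 'a::ab_group_add) glie \<Rightarrow> 'a set" where
  "carrier M = {x + y + z | x y z. x \<in> grade M 1 \<and> y \<in> grade M 2 \<and> z \<in> grade M 3}"

definition proj :: "('k, 'a::ab_group_add) glie \<Rightarrow> nat \<Rightarrow> 'a \<Rightarrow> 'a" where
  "proj M i x = (THE c. (\<forall>j. c j \<in> grade M j) \<and> x = c 1 + c 2 + c 3) i"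

definition graded_lie3 :: "('k::field, 'a::ab_group_add) glie \<Rightarrow> bool" where
  "graded_lie3 M \<longleftrightarrow>
     vector_space (smul M) \<and>
     (\<forall>i. module.subspace (smul M) (grade M i)) \<and>
     (\<forall>i. i \<notin> {1, 2, 3} \<longrightarrow> grade M i = {0}) \<and>
     (\<forall>x\<in>grade M 1. \<forall>y\<in>grade M 2. \<forall>z\<in>grade M 3.
        x + y + z = 0 \<longrightarrow> x = 0 \<and> y = 0 \<and> z = 0) \<and>
     (\<forall>i j. \<forall>x\<in>grade M i. \<forall>y\<in>grade M j. bracket M x y \<in> grade M (i + j)) \<and>
     (\<forall>x\<in>carrier M. \<forall>y\<in>carrier M. \<forall>z\<in>carrier M.
        bracket M (x + y) z = bracket M x z + bracket M y z \<and>
        bracket M x (y + z) = bracket M x y + bracket M x z) \<and>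
     (\<forall>c. \<forall>x\<in>carrier M. \<forall>y\<in>carrier M.
        bracket M (smul M c x) y = smul M c (bracket M x y) \<and>
        bracket M x (smul M c y) = smul M c (bracket M x y)) \<and>
     (\<forall>x\<in>carrier M. bracket M x x = 0) \<and>
     (\<forall>x\<in>carrier M. \<forall>y\<in>carrier M. \<forall>z\<in>carrier M.
        bracket M x (bracket M y z) + bracket M y (bracket M z x)
          + bracket M z (bracket M x y) = 0)"

text \<open>Substructures: subsets closed under all operations of the language, including the
  projections, i.e. graded subalgebras.\<close>

definition substructure :: "('k, 'a::ab_group_add) glie \<Rightarrow> 'a set \<Rightarrow> bool" where
  "substructure M A \<longleftrightarrow>
     A \<subseteq> carrier M \<and> 0 \<in> A \<and>
     (\<forall>x\<in>A. \<forall>y\<in>A. x + y \<in> A) \<and> (\<forall>x\<in>A. - x \<in> A) \<and>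
     (\<forall>c. \<forall>x\<in>A. smul M c x \<in> A) \<and>
     (\<forall>i. \<forall>x\<in>A. proj M i x \<in> A) \<and>
     (\<forall>x\<in>A. \<forall>y\<in>A. bracket M x y \<in> A)"

definition restrict_to :: "('k, 'a) glie \<Rightarrow> 'a set \<Rightarrow> ('k, 'a) glie" where
  "restrict_to M A = M\<lparr>grade := \<lambda>i. grade M i \<inter> A\<rparr>"

definition generated :: "('k, 'a::ab_group_add) glie \<Rightarrow> 'a set \<Rightarrow> 'a set" where
  "generated M X = \<Inter>{A. substructure M A \<and> X \<subseteq> A}"

definition lie_hom ::
    "('k, 'a::ab_group_add) glie \<Rightarrow> ('k, 'b::ab_group_add) glie \<Rightarrow> ('a \<Rightarrow> 'b) \<Rightarrow> bool" where
  "lie_hom M N f \<longleftrightarrow>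
     (\<forall>x\<in>carrier M. \<forall>y\<in>carrier M.
        f (x + y) = f x + f y \<and> f (bracket M x y) = bracket N (f x) (f y)) \<and>
     (\<forall>c. \<forall>x\<in>carrier M. f (smul M c x) = smul N c (f x)) \<and>
     (\<forall>i. f ` grade M i \<subseteq> grade N i)"

text \<open>Embeddings and isomorphisms in the sense of the first-order language; preservation
  of \<open>0\<close> and \<open>-\<close> follows from additivity.\<close>

definition embedding ::
    "('k, 'a::ab_group_add) glie \<Rightarrow> ('k, 'b::ab_group_add) glie \<Rightarrow> ('a \<Rightarrow> 'b) \<Rightarrow> bool" where
  "embedding M N f \<longleftrightarrow>
     lie_hom M N f \<and> f ` carrier M \<subseteq> carrier N \<and> inj_on f (carrier M) \<and>
     (\<forall>i. \<forall>x\<in>carrier M. x \<in> grade M i \<longleftrightarrow> f x \<in> grade N i) \<and>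
     (\<forall>i. \<forall>x\<in>carrier M. f (proj M i x) = proj N i (f x))"

definition isomorphism ::
    "('k, 'a::ab_group_add) glie \<Rightarrow> ('k, 'b::ab_group_add) glie \<Rightarrow> ('a \<Rightarrow> 'b) \<Rightarrow> bool" where
  "isomorphism M N f \<longleftrightarrow> embedding M N f \<and> f ` carrier M = carrier N"


section \<open>Dimensions\<close>

definition indep_mod :: "('k::field \<Rightarrow> 'a::ab_group_add \<Rightarrow> 'a) \<Rightarrow> 'a set \<Rightarrow> 'a set \<Rightarrow> bool" where
  "indep_mod s W B \<longleftrightarrow>
     (\<forall>S u. finite S \<and> S \<subseteq> B \<and> (\<Sum>b\<in>S. s (u b) b) \<in> W \<longrightarrow> (\<forall>b\<in>S. u b = 0))"

text \<open>Dimension of \<open>V\<close> modulo a subspace \<open>W\<close> of \<open>V\<close> (of finite codimension): the size of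
  a basis of \<open>V\<close> modulo \<open>W\<close>.\<close>

definition dim_mod :: "('k::field \<Rightarrow> 'a::ab_group_add \<Rightarrow> 'a) \<Rightarrow> 'a set \<Rightarrow> 'a set \<Rightarrow> nat" where
  "dim_mod s V W =
     (THE n. \<exists>B. finite B \<and> B \<subseteq> V \<and> indep_mod s W B \<and> V \<subseteq> module.span s (W \<union> B) \<and> card B = n)"

definition o_system :: "('k::field, 'a::ab_group_add) glie \<Rightarrow> 'a set \<Rightarrow> bool" where
  "o_system M X \<longleftrightarrow>
     X \<subseteq> grade M 1 \<union> grade M 2 \<union> grade M 3 \<and>
     generated M X = carrier M \<and>
     (\<forall>i\<in>{1, 2, 3}.
        indep_mod (smul M)
          (generated M (\<Union>j\<in>{1..<i}. X \<inter> grade M j) \<inter> grade M i) (X \<inter> grade M i))"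

text \<open>\<open>o_dim\<close>, \<open>ideal_dim\<close> and \<open>delta\<close> are meant for finite structures \<open>M\<close> only, where the
  numbers exist and do not depend on the choices made.\<close>

definition o_dim :: "('k::field, 'a::ab_group_add) glie \<Rightarrow> nat \<Rightarrow> nat" where
  "o_dim M i = (THE n. \<exists>X. o_system M X \<and> card (X \<inter> grade M i) = n)"

text \<open>
  \<open>free_lie3 F X e\<close>: the algebra \<open>F\<close> is free graded 3-nilpotent on the generators \<open>e x\<close>,
  where \<open>e x\<close> has degree \<open>i\<close> for \<open>x \<in> X i\<close>. Here and in the definition of richness,
  the ambient type \<open>nat \<Rightarrow> 'k\<close> is used for structures which are quantified over: every
  vector space of countable dimension, hence every finite structure over a finite field, has a
  copy inside it. So, for finite \<open>F\<close>, this is the universal property with respect to all targets,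
  since the image of \<open>F\<close> is finite.
\<close>

definition free_lie3 ::
    "('k::field, 'f::ab_group_add) glie \<Rightarrow> (nat \<Rightarrow> 'x set) \<Rightarrow> ('x \<Rightarrow> 'f) \<Rightarrow> bool" where
  "free_lie3 F X e \<longleftrightarrow>
     graded_lie3 F \<and> (\<forall>i. \<forall>x\<in>X i. e x \<in> grade F i) \<and>
     (\<forall>(H :: ('k, nat \<Rightarrow> 'k) glie) h.
        graded_lie3 H \<and> (\<forall>i. \<forall>x\<in>X i. h x \<in> grade H i) \<longrightarrow>
        (\<exists>g. lie_hom F H g \<and> (\<forall>i. \<forall>x\<in>X i. g (e x) = h x) \<and>
             (\<forall>g'. lie_hom F H g' \<and> (\<forall>i. \<forall>x\<in>X i. g' (e x) = h x) \<longrightarrow>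
                   (\<forall>z\<in>carrier F. g' z = g z))))"

definition lie_ideal :: "('k::field, 'a::ab_group_add) glie \<Rightarrow> 'a set \<Rightarrow> bool" where
  "lie_ideal F I \<longleftrightarrow>
     I \<subseteq> carrier F \<and> module.subspace (smul F) I \<and>
     (\<forall>x\<in>carrier F. \<forall>y\<in>I. bracket F x y \<in> I)"

definition ideal_generated :: "('k::field, 'a::ab_group_add) glie \<Rightarrow> 'a set \<Rightarrow> 'a set" where
  "ideal_generated F S = \<Inter>{I. lie_ideal F I \<and> S \<subseteq> I}"

text \<open>The elements of \<open>F_2 \<oplus> ... \<oplus> F_(i-1)\<close>; this is \<open>{0}\<close> for \<open>i = 2\<close>.\<close>

definition graded_part_2_below :: "('k, 'a::ab_group_add) glie \<Rightarrow> nat \<Rightarrow> 'a set" where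
  "graded_part_2_below F i = {x \<in> carrier F. \<forall>j. j \<notin> {2..<i} \<longrightarrow> proj F j x = 0}"

definition lie_kernel ::
    "('k, 'a::ab_group_add) glie \<Rightarrow> ('a \<Rightarrow> 'b::ab_group_add) \<Rightarrow> 'a set" where
  "lie_kernel F f = {x \<in> carrier F. f x = 0}"

definition ideal_dim :: "('k::field, 'a::ab_group_add) glie \<Rightarrow> nat \<Rightarrow> nat" where
  "ideal_dim M i =
     (THE n. \<exists>X (F :: ('k, nat \<Rightarrow> 'k) glie) e f.
        o_system M X \<and>
        free_lie3 F (\<lambda>j. X \<inter> grade M j) e \<and>
        lie_hom F M f \<and> (\<forall>x\<in>X. f (e x) = x) \<and>
        n = dim_mod (smul F)
              (lie_kernel F f \<inter> grade F i)
              (ideal_generated F (lie_kernel F f \<inter> graded_part_2_below F i) \<inter> grade F i))"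

definition delta :: "('k::field, 'a::ab_group_add) glie \<Rightarrow> nat \<Rightarrow> int" where
  "delta M i = (\<Sum>j=1..i. int (o_dim M j)) - (\<Sum>j=2..i. int (ideal_dim M j))"


section \<open>Strong substructures, the class \<open>K_3\<close>, rich structures\<close>

text \<open>\<open>strong M A\<close> is \<open>A \<le> M\<close>, for a finite substructure \<open>A\<close> of \<open>M\<close>.\<close>

definition strong :: "('k::field, 'a::ab_group_add) glie \<Rightarrow> 'a set \<Rightarrow> bool" where
  "strong M A \<longleftrightarrow>
     substructure M A \<and> finite A \<and>
     (\<forall>E. substructure M E \<and> finite E \<and> A \<subseteq> E \<longrightarrow>
        (\<forall>j\<in>{2, 3}. delta (restrict_to M A) j \<le> delta (restrict_to M E) j))"

definition class_K3 :: "('k::field, 'a::ab_group_add) glie \<Rightarrow> bool" where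
  "class_K3 M \<longleftrightarrow>
     graded_lie3 M \<and>
     (\<forall>i\<in>{1, 2, 3}. \<forall>j\<in>{1, 2, 3}. i + j \<le> 3 \<longrightarrow>
        (\<forall>x\<in>grade M i. \<forall>y\<in>grade M j.
           x \<noteq> 0 \<and> y \<noteq> 0 \<and> \<not> (\<exists>c. x = smul M c y) \<longrightarrow> bracket M x y \<noteq> 0)) \<and>
     (\<forall>A. substructure M A \<and> finite A \<and>
        0 < (\<Sum>i=1..3. o_dim (restrict_to M A) i) \<and>
        (\<Sum>i=1..3. o_dim (restrict_to M A) i) \<le> 2 \<longrightarrow> strong M A)"

definition rich :: "('k::field, 'a::ab_group_add) glie \<Rightarrow> bool" where
  "rich M \<longleftrightarrow>
     class_K3 M \<and>
     (\<forall>(A :: ('k, nat \<Rightarrow> 'k) glie) B f.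
        class_K3 A \<and> finite (carrier A) \<and> class_K3 (restrict_to A B) \<and> strong A B \<and>
        embedding (restrict_to A B) M f \<and> strong M (f ` B) \<longrightarrow>
        (\<exists>g. embedding A M g \<and> (\<forall>x\<in>B. g x = f x) \<and> strong M (g ` carrier A)))"


section \<open>Infinitary logic\<close>

text \<open>
  Terms and formulas of the infinitary logic over the language of graded Lie algebras with
  additional constants \<open>Const i\<close> that name the entries of a tuple.
  Conjunctions range over families of formulas indexed by an arbitrary subset of the type
  \<open>'i\<close>; all set-sized conjunctions are obtained by letting \<open>'i\<close> vary. Disjunctions and
  universal quantifiers are definable. The symbols \<open>InGrade i\<close> and \<open>Proj i\<close> with
  \<open>i \<notin> {1, 2, 3}\<close> are harmless: they are interpreted by \<open>{0}\<close> and by the zero map.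
\<close>

datatype 'k lterm =
    Var nat
  | Const nat
  | Zero
  | Plus "'k lterm" "'k lterm"
  | Minus "'k lterm"
  | Smul 'k "'k lterm"
  | Proj nat "'k lterm"
  | Bracket "'k lterm" "'k lterm"

datatype ('k, 'i) lform =
    Eq "'k lterm" "'k lterm"
  | InGrade nat "'k lterm"
  | Neg "('k, 'i) lform"
  | Conj "'i set" "'i \<Rightarrow> ('k, 'i) lform"
  | Ex nat "('k, 'i) lform"

primrec term_value ::
    "('k, 'a::ab_group_add) glie \<Rightarrow> 'a list \<Rightarrow> (nat \<Rightarrow> 'a) \<Rightarrow> 'k lterm \<Rightarrow> 'a" where
  "term_value M as v (Var n) = v n"
| "term_value M as v (Const i) = as ! i"
| "term_value M as v Zero = 0"
| "term_value M as v (Plus s t) = term_value M as v s + term_value M as v t"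
| "term_value M as v (Minus t) = - term_value M as v t"
| "term_value M as v (Smul c t) = smul M c (term_value M as v t)"
| "term_value M as v (Proj i t) = proj M i (term_value M as v t)"
| "term_value M as v (Bracket s t) = bracket M (term_value M as v s) (term_value M as v t)"

primrec satisfies ::
    "('k, 'a::ab_group_add) glie \<Rightarrow> 'a list \<Rightarrow> (nat \<Rightarrow> 'a) \<Rightarrow> ('k, 'i) lform \<Rightarrow> bool" where
  "satisfies M as v (Eq s t) \<longleftrightarrow> term_value M as v s = term_value M as v t"
| "satisfies M as v (InGrade i t) \<longleftrightarrow> term_value M as v t \<in> grade M i"
| "satisfies M as v (Neg \<phi>) \<longleftrightarrow> \<not> satisfies M as v \<phi>"
| "satisfies M as v (Conj I \<Phi>) \<longleftrightarrow> (\<forall>i\<in>I. satisfies M as v (\<Phi> i))"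
| "satisfies M as v (Ex n \<phi>) \<longleftrightarrow> (\<exists>x\<in>carrier M. satisfies M as (v(n := x)) \<phi>)"

primrec term_vars :: "'k lterm \<Rightarrow> nat set" where
  "term_vars (Var n) = {n}"
| "term_vars (Const i) = {}"
| "term_vars Zero = {}"
| "term_vars (Plus s t) = term_vars s \<union> term_vars t"
| "term_vars (Minus t) = term_vars t"
| "term_vars (Smul c t) = term_vars t"
| "term_vars (Proj i t) = term_vars t"
| "term_vars (Bracket s t) = term_vars s \<union> term_vars t"

primrec term_consts :: "'k lterm \<Rightarrow> nat set" where
  "term_consts (Var n) = {}"
| "term_consts (Const i) = {i}"
| "term_consts Zero = {}"
| "term_consts (Plus s t) = term_consts s \<union> term_consts t"
| "term_consts (Minus t) = term_consts t"
| "term_consts (Smul c t) = term_consts t"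
| "term_consts (Proj i t) = term_consts t"
| "term_consts (Bracket s t) = term_consts s \<union> term_consts t"

primrec free_vars :: "('k, 'i) lform \<Rightarrow> nat set" where
  "free_vars (Eq s t) = term_vars s \<union> term_vars t"
| "free_vars (InGrade i t) = term_vars t"
| "free_vars (Neg \<phi>) = free_vars \<phi>"
| "free_vars (Conj I \<Phi>) = (\<Union>i\<in>I. free_vars (\<Phi> i))"
| "free_vars (Ex n \<phi>) = free_vars \<phi> - {n}"

primrec form_consts :: "('k, 'i) lform \<Rightarrow> nat set" where
  "form_consts (Eq s t) = term_consts s \<union> term_consts t"
| "form_consts (InGrade i t) = term_consts t"
| "form_consts (Neg \<phi>) = form_consts \<phi>"
| "form_consts (Conj I \<Phi>) = (\<Union>i\<in>I. form_consts (\<Phi> i))"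
| "form_consts (Ex n \<phi>) = form_consts \<phi>"

text \<open>\<open>sentence n \<phi>\<close>: \<open>\<phi>\<close> is a sentence of the language expanded by \<open>n\<close> constants.
  The valuation used in \<open>models\<close> is irrelevant for sentences.\<close>

definition sentence :: "nat \<Rightarrow> ('k, 'i) lform \<Rightarrow> bool" where
  "sentence n \<phi> \<longleftrightarrow> free_vars \<phi> = {} \<and> form_consts \<phi> \<subseteq> {..<n}"

definition models :: "('k, 'a::ab_group_add) glie \<Rightarrow> 'a list \<Rightarrow> ('k, 'i) lform \<Rightarrow> bool" where
  "models M as \<phi> \<longleftrightarrow> satisfies M as (\<lambda>_. 0) \<phi>"

text \<open>\<open>(M, as)\<close> and \<open>(N, bs)\<close> satisfy the same infinitary sentences with conjunctions
  indexed by subsets of \<open>'i\<close>. Equivalence in the full infinitary logic is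
  this statement for all types \<open>'i\<close>.\<close>

definition Linf_equiv ::
    "'i itself \<Rightarrow> ('k, 'a::ab_group_add) glie \<Rightarrow> 'a list \<Rightarrow>
     ('k, 'b::ab_group_add) glie \<Rightarrow> 'b list \<Rightarrow> bool" where
  "Linf_equiv T M as N bs \<longleftrightarrow>
     length as = length bs \<and>
     (\<forall>\<phi> :: ('k, 'i) lform. sentence (length as) \<phi> \<longrightarrow> models M as \<phi> = models N bs \<phi>)"

end

(* Write l for the dimension over K. For finite M, counting linear functionals on the parts of degree 2 and 3
of a free presentation (by means of central extensions of M by K) gives
  delta_2(M) = l(M_1) + l(M_2) - l(Alt M_1),   delta_3(M) = delta_2(M) + l(M_3) - l(J(M)),
where Alt denotes alternating bilinear forms and J(M) consists of the bilinear forms b on M_1 x M_2 with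
b(x,[y,z]) + b(y,[z,x]) + b(z,[x,y]) = 0.

The main step is that every finite subset of a structure in K_3 lies in a finite strong substructure; the
theorem follows from this and richness by back and forth. Let E be finite with (delta_3, delta_2)
lexicographically minimal among the finite substructures above the given set. If some E' above E has smaller
delta_2, let V between E_1 and E'_1 minimise D(V) = l(V) + l(E_2 + [V,V]) - l(Alt V), and let E'' be generated
by E and V. The forms in J(E) that do not extend to E'' have codimension n at most dim A for a space A of
functionals on alternating trilinear forms on V. Contracting A with V* gives a family of alternating bilinear
forms which is constrained by condition (ii) of K_3, and a rank bound for such families yields Z between E_1
and V with n <= D(E_1) - D(Z). Hence delta_3(E'') <= delta_3(E) and delta_2(E'') < delta_2(E), a contradiction.

The rank bound is proved over the algebraic closure of K, to which the constraint descends by uniqueness of an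
extremal subspace. It rests on the theorem of Hopf that c bilinear forms on k^n x k^p with c + 2 <= n + p have
a common zero with nonzero arguments. For this, functionals on bihomogeneous polynomials that kill the forms
are arrays with commuting shift operators; a dimension count and minimality of the index sets make two of the
shifts invertible, and a common eigenvector of the quotients of the shifts is the common zero. *)

theory Submission
  imports "HOL-Algebra.Algebraic_Closure_Type" "HOL-Library.Function_Algebras" "HOL-Library.Product_Plus" Defs
begin

section \<open>Dimension and rank\<close>

text \<open>Strength asks for minimality of two numbers at once. Adding generators may lower
  \<open>delta\<close> in degree 2 and yet raise it in degree 3, since forms in J(E) may fail to
  extend; this loss has to be paid out of the gain in degree 2. With a = dim A and b = l(Z) -
  l(E_1), the contractions give matrices t(i,j), i < a, j < b. The array of all their entries has
  rank at least a + b, while its rows come from the bracket relations on Z modulo E, a space of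
  dimension at most D(E_1) - D(Z) + b. So a <= D(E_1) - D(Z).

  Hopf's theorem fails over a finite field: multiplication in an extension of degree n > 1 has no
  zero divisors, but its values span only dimension n < 2n - 1. Condition (ii), on the other hand,
  speaks only of subspaces defined over K. Hence the passage to the closure and the descent.

  Tensor and exterior powers are never constructed. Their duals are sets of functions into the
  field, and one dimension theory for function spaces serves for forms, functionals and functionals
  on forms.\<close>

locale vspace = vector_space scale
 for scale :: "'k::field => 'b::ab_group_add => 'b" (infixr "*s" 75)
begin

text \<open>\<open>dim\<close> is a cardinality, hence 0 for a space with an infinite basis, so
  monotonicity of \<open>dim\<close> needs this hypothesis on the larger set. The set itself need
  not be a subspace.\<close>

definition fin_dim :: "'b set => bool" where
 "fin_dim V \<longleftrightarrow> (\<exists>B. finite B & V <= span B)"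

lemma fin_dimI: "finite B ==> V <= span B ==> fin_dim V"
 by (auto simp: fin_dim_def)

lemma fin_dim_mono: "S <= V ==> fin_dim V ==> fin_dim S"
 by (auto simp: fin_dim_def)

lemma independent_le_dim:
 assumes "independent B" "B <= V" "fin_dim V"
 shows "finite B & card B <= dim V"
proof -
 obtain F where F: "finite F" "V <= span F" using assms(3) by (auto simp: fin_dim_def)
 obtain C where C: "C <= V" "independent C" "V <= span C" "card C = dim V"
  using basis_exists by blast
 have "finite C" using independent_span_bound[OF F(1) C(2)] C(1) F(2) by auto
 moreover have "B <= span C" using assms(2) C(3) by blast
 ultimately show ?thesis using independent_span_bound[OF _ assms(1), of C] C(4) by auto
qed

lemma fin_dim_basis:
 assumes "fin_dim V"
 obtains B where "B <= V" "independent B" "V <= span B" "card B = dim V" "finite B"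
proof -
 obtain C where C: "C <= V" "independent C" "V <= span C" "card C = dim V"
  using basis_exists by blast
 then show ?thesis using that independent_le_dim[OF C(2,1) assms] by auto
qed

lemma dim_mono_fin: "S <= V ==> fin_dim V ==> dim S <= dim V"
proof -
 assume a: "S <= V" "fin_dim V"
 obtain C where C: "C <= S" "independent C" "S <= span C" "card C = dim S"
  using basis_exists by blast
 show ?thesis using independent_le_dim[OF C(2) subset_trans[OF C(1) a(1)] a(2)] C(4) by simp
qed

lemma subspace_eq_dim:
 assumes "subspace S" "S <= V" "fin_dim V" "dim V <= dim S"
 shows "S = V"
proof (rule ccontr)
 assume "S ~= V"
 then obtain v where v: "v \<in> V" "v ~: S" using assms(2) by auto
 obtain B where B: "B <= S" "independent B" "S <= span B" "card B = dim S" "finite B"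
  using fin_dim_basis[OF fin_dim_mono[OF assms(2,3)]] by blast
 have "span B <= S" using B(1) assms(1) by (simp add: span_minimal)
 then have "v ~: span B" using v by auto
 then have "independent (insert v B)" "v ~: B"
  using independent_insertI[OF _ B(2)] span_base[of v B] by auto
 then have "card (insert v B) <= dim V"
  using independent_le_dim[of "insert v B" V] v(1) subset_trans[OF B(1) assms(2)] assms(3) by blast
 then show False using B(4,5) assms(4) \<open>v ~: B\<close> by auto
qed

lemma dim_zero: "dim {0} = 0" "dim {} = 0"
 using dim_eq_card[of "{}" "{0}"] dim_eq_card[of "{}" "{}"] independent_empty by auto

lemma dim_eq_0_fin: "subspace S ==> fin_dim S ==> dim S = 0 \<longleftrightarrow> S = {0}"
 using subspace_eq_dim[of "{0}" S] subspace_0[of S] by (auto simp: dim_zero)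

text \<open>A basis of \<open>S\<close> is extended to one of \<open>V\<close>; the added vectors
  span \<open>T\<close>.\<close>

lemma complement_exists:
 assumes "subspace S" "subspace V" "S <= V" "fin_dim V"
 obtains T where "subspace T" "T <= V" "S \<inter> T = {0}" "!!v. v \<in> V ==> \<exists>s\<in>S. \<exists>t\<in>T. v = s + t"
  "dim V = dim S + dim T"
proof -
 obtain B where B: "B <= S" "independent B" "S <= span B" "card B = dim S" "finite B"
  using fin_dim_basis[OF fin_dim_mono[OF assms(3,4)]] by blast
 obtain C where C: "B <= C" "C <= V" "independent C" "V <= span C"
  using maximal_independent_subset_extend[of B V] B assms(3) by blast
 have fC: "finite C" using independent_le_dim[OF C(3,2) assms(4)] by simp
 let ?T = "span (C - B)"
 have SB: "S = span B" using B(1,3) assms(1) span_minimal by blast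
 have CV: "V = span C" using C(2,4) assms(2) span_minimal by blast
 have iCB: "independent (C - B)" using C(3) independent_mono by blast
 have 1: "S \<inter> ?T = {0}"
 proof -
  { fix x assume x: "x \<in> span B" "x \<in> span (C - B)"
   from x(1) obtain u where u: "x = (\<Sum>b\<in>B. scale (u b) b)" using span_finite[OF B(5)] by auto
   from x(2) fC obtain w where w: "x = (\<Sum>b\<in>C-B. scale (w b) b)" using span_finite[of "C-B"] by auto
   let ?r = "\<lambda>b. if b \<in> B then u b else - w b"
   have "(\<Sum>b\<in>C. scale (?r b) b) = (\<Sum>b\<in>B. scale (?r b) b) + (\<Sum>b\<in>C-B. scale (?r b) b)"
    using C(1) fC by (metis (no_types, lifting) add.commute sum.subset_diff)
   also have "(\<Sum>b\<in>B. scale (?r b) b) = x" using u by simp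
   also have "(\<Sum>b\<in>C-B. scale (?r b) b) = - x" using w by (simp add: sum_negf)
   finally have "(\<Sum>b\<in>C. scale (?r b) b) = 0" by simp
   from independentD[OF C(3) fC subset_refl this] have "\<forall>b\<in>C. ?r b = 0" by blast
   then have "\<forall>b\<in>B. u b = 0" using C(1) by (metis subsetD)
   then have "x = 0" using u by simp }
  then show ?thesis unfolding SB using span_zero by blast
 qed
 have 2: "\<exists>s\<in>S. \<exists>t\<in>?T. v = s + t" if "v \<in> V" for v
 proof -
  have "v \<in> span (B \<union> (C - B))" using that C(1,4) by (simp add: Un_absorb1 subset_iff)
  then show ?thesis unfolding span_Un SB by fast
 qed
 have "dim ?T = card (C - B)" using dim_span_eq_card_independent[OF iCB] .
 moreover have "dim V = card C" using C by (simp add: basis_card_eq_dim)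
 ultimately have 3: "dim V = dim S + dim ?T"
  using B(4) card_Diff_subset[OF B(5) C(1)] card_mono[OF fC C(1)] by simp
 have 4: "?T <= V" unfolding CV by (rule span_mono) blast
 show ?thesis by (rule that[of ?T]) (use 1 2 3 4 in \<open>auto\<close>)
qed

end

locale vspace_pair = vs1: vspace s1 + vs2: vspace s2
 for s1 :: "'k::field => 'b::ab_group_add => 'b" and s2 :: "'k::field => 'c::ab_group_add => 'c"
begin

sublocale vector_space_pair s1 s2 ..

text \<open>Kernel and image are relative to a subspace \<open>V\<close> of the ambient type. A
  complement of the kernel in \<open>V\<close> is mapped bijectively onto the image.\<close>

lemma rank_nullity:
 assumes "Vector_Spaces.linear s1 s2 f" "vs1.subspace V" "vs1.fin_dim V"
 shows "vs1.dim V = vs1.dim {x\<in>V. f x = 0} + vs2.dim (f ` V)" and "vs2.fin_dim (f ` V)"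
proof -
 interpret f: Vector_Spaces.linear s1 s2 f by fact
 let ?N = "{x\<in>V. f x = 0}"
 obtain G where G: "finite G" "V <= vs1.span G" using assms(3) by (auto simp: vs1.fin_dim_def)
 have "f ` V <= vs2.span (f ` G)" using G(2) f.span_image by auto
 then show "vs2.fin_dim (f ` V)" using G(1) vs2.fin_dim_def by blast
 have N: "vs1.subspace ?N"
  using assms(2) by (auto simp: vs1.subspace_def f.zero f.add f.scale)
 obtain T where T: "vs1.subspace T" "T <= V" "?N \<inter> T = {0}"
   "!!v. v \<in> V ==> \<exists>s\<in>?N. \<exists>t\<in>T. v = s + t" "vs1.dim V = vs1.dim ?N + vs1.dim T"
  using vs1.complement_exists[OF N assms(2) _ assms(3)] by blast
 obtain B where B: "B <= T" "vs1.independent B" "T <= vs1.span B" "card B = vs1.dim T" "finite B"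
  using vs1.fin_dim_basis[OF vs1.fin_dim_mono[OF T(2) assms(3)]] by blast
 have TB: "T = vs1.span B" using B T(1) vs1.span_minimal by blast
 have inj: "inj_on f T"
 proof (rule inj_onI)
  fix x y assume xy: "x \<in> T" "y \<in> T" "f x = f y"
  then have "x - y \<in> T" "f (x - y) = 0" using T(1) vs1.subspace_diff f.diff by auto
  then have "x - y \<in> ?N \<inter> T" using T(2) by auto
  then show "x = y" using T(3) by auto
 qed
 have im: "f ` V = f ` T"
 proof
  show "f ` V <= f ` T" using T(4) by (force simp: f.add)
 qed (use T(2) in auto)
 have "vs2.independent (f ` B)"
  using linear_independent_injective_image[OF assms(1) B(2)] inj TB by simp
 moreover have "f ` V <= vs2.span (f ` B)" using im TB f.span_image by auto
 moreover have "f ` B <= f ` V" using B(1) T(2) by auto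
 ultimately have "vs2.dim (f ` V) = card (f ` B)" using vs2.basis_card_eq_dim by simp
 also have "\<dots> = vs1.dim T" using card_image[OF inj_on_subset[OF inj B(1)]] B(4) by simp
 finally show "vs1.dim V = vs1.dim ?N + vs2.dim (f ` V)" using T(5) by linarith
qed

end

section \<open>Function spaces, with evaluations as coordinates\<close>

definition scl :: "'k::field => ('i => 'k) => 'i => 'k" where
 "scl c f = (\<lambda>i. c * f i)"

lemma scl_apply [simp]: "scl c f i = c * f i"
 by (simp add: scl_def)

text \<open>Forms, functionals, arrays and matrices are all functions into the field, so this single
  instance supplies their dimension theory. Objects living on a subspace are functions that are 0
  elsewhere.\<close>

global_interpretation fs: vspace "scl :: 'k::field => ('i => 'k) => 'i => 'k"
 defines fsubspace = fs.subspace and fspan = fs.span and fdim = fs.dim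
  and fdependent = fs.dependent and ffin_dim = fs.fin_dim
proof unfold_locales
 fix a b :: 'k and x y :: "'i => 'k"
 show "scl a (x + y) = scl a x + scl a y" by (rule ext) (simp add: distrib_left)
 show "scl (a + b) x = scl a x + scl b x" by (rule ext) (simp add: distrib_right)
 show "scl a (scl b x) = scl (a * b) x" by (rule ext) simp
 show "scl 1 x = x" by (rule ext) simp
qed

global_interpretation fsp: vspace_pair
 "scl :: 'k::field => ('i => 'k) => 'i => 'k" "scl :: 'k::field => ('j => 'k) => 'j => 'k"
 by (rule vspace_pair.intro) (rule fs.vspace_axioms)+

lemma sum_fun_apply: "(\<Sum>x\<in>A. f x) i = (\<Sum>x\<in>A. f x i)"
 by (induction A rule: infinite_finite_induct) auto

abbreviation "flin \<equiv> Vector_Spaces.linear scl scl"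

lemma linear_fsI:
 assumes "!!x y i. f (x + y) i = f x i + f y i" "!!c x i. f (scl c x) i = c * f x i"
 shows "flin f"
 by unfold_locales (use assms in \<open>auto simp: fun_eq_iff\<close>)

text \<open>Points are split off one at a time: a nonzero function has a point where it does not
  vanish, and the functions vanishing there have dimension one less. The coordinates in the
  resulting basis are evaluations, so expansions commute with everything that acts value by value,
  such as field embeddings and Frobenius.\<close>

lemma dual_points:
 fixes S :: "('i => 'k::field) set"
 assumes "fs.subspace S" "fs.fin_dim S" "fs.dim S = r"
 shows "\<exists>q p. (\<forall>i<r. p i \<in> S) & (\<forall>i<r. \<forall>j<r. p i (q j) = (if i = j then 1 else 0))
   & (\<forall>f\<in>S. f = (\<Sum>i<r. scl (f (q i)) (p i)))"
 using assms
proof (induction r arbitrary: S)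
 case 0
 then have "S = {0}" using fs.dim_eq_0_fin by blast
 then show ?case by auto
next
 case (Suc r)
 have "S ~= {0}" using Suc.prems(3) by (auto simp: fs.dim_zero)
 then obtain f where f: "f \<in> S" "f ~= 0" using fs.subspace_0[OF Suc.prems(1)] by auto
 then obtain q0 where q0: "f q0 ~= 0" by (auto simp: fun_eq_iff)
 let ?S = "{g\<in>S. g q0 = 0}"
 let ?ev = "\<lambda>g. (\<lambda>u::unit. g q0)"
 have lin: "flin ?ev" by (rule linear_fsI) auto
 have sub: "fs.subspace ?S" using Suc.prems(1) by (auto simp: fs.subspace_def)
 have "fs.dim (?ev ` S) = 1"
 proof (rule fs.dim_unique[of "{\<lambda>u. 1}"])
  have "fs.subspace S" using Suc.prems(1) .
  then have "scl (1 / f q0) f \<in> S" using f(1) fs.subspace_scale by blast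
  then have "?ev (scl (1 / f q0) f) \<in> ?ev ` S" by (rule imageI)
  then show "{\<lambda>u. 1} <= ?ev ` S" using q0 by simp
  show "?ev ` S <= fs.span {\<lambda>u. 1}"
  proof
   fix h assume "h \<in> ?ev ` S"
   then have "h = scl (h ()) (\<lambda>u. 1)" by (auto simp: fun_eq_iff)
   then show "h \<in> fs.span {\<lambda>u. 1}" by (metis fs.span_scale fs.span_base singletonI)
  qed
  show "\<not> fdependent {\<lambda>u::unit. 1 :: 'k}" by (simp add: fun_eq_iff fs.dependent_single)
 qed simp
 moreover have "{x\<in>S. ?ev x = 0} = ?S" by (auto simp: fun_eq_iff)
 ultimately have "fs.dim ?S = r"
  using fsp.rank_nullity(1)[OF lin Suc.prems(1,2)] Suc.prems(3) by simp
 then obtain q p where qp: "\<forall>i<r. p i \<in> ?S" "\<forall>i<r. \<forall>j<r. p i (q j) = (if i = j then 1 else 0)"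
   "\<forall>f\<in>?S. f = (\<Sum>i<r. scl (f (q i)) (p i))"
  using Suc.IH[OF sub] fs.fin_dim_mono[OF _ Suc.prems(2), of ?S] by blast
 \<comment> \<open>The function is normalised at the new point and then cleared at the old points;
   the correction does not disturb the value at \<open>q0\<close>, where all old \<open>p i\<close>
   vanish.\<close>
 define f1 where "f1 = scl (1 / f q0) f"
 define f2 where "f2 = f1 - (\<Sum>i<r. scl (f1 (q i)) (p i))"
 have f1: "f1 \<in> S" "f1 q0 = 1" using f q0 Suc.prems(1) fs.subspace_scale by (auto simp: f1_def)
 have f2: "f2 \<in> S" unfolding f2_def
  using f1(1) qp(1) Suc.prems(1) by (intro fs.subspace_diff fs.subspace_sum fs.subspace_scale) auto
 have f2q: "f2 q0 = 1" using f1(2) qp(1) by (simp add: f2_def sum_fun_apply)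
 have f2j: "f2 (q j) = 0" if "j < r" for j
 proof -
  have "(\<Sum>i<r. f1 (q i) * p i (q j)) = (\<Sum>i<r. if i = j then f1 (q i) else 0)"
   using that qp(2) by (intro sum.cong) auto
  then show ?thesis using that by (simp add: f2_def sum_fun_apply)
 qed
 let ?q = "\<lambda>i. if i = r then q0 else q i" and ?p = "\<lambda>i. if i = r then f2 else p i"
 have 3: "g = (\<Sum>i<Suc r. scl (g (?q i)) (?p i))" if "g \<in> S" for g
 proof -
  let ?g = "g - scl (g q0) f2"
  have "?g \<in> ?S" using that f2 f2q Suc.prems(1)
   by (auto intro!: fs.subspace_diff fs.subspace_scale)
  then have "?g = (\<Sum>i<r. scl (?g (q i)) (p i))" using qp(3) by blast
  also have "\<dots> = (\<Sum>i<r. scl (g (q i)) (p i))" using f2j by (intro sum.cong) auto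
  finally have "g = (\<Sum>i<r. scl (g (q i)) (p i)) + scl (g q0) f2" by (metis diff_add_cancel)
  then show ?thesis by simp
 qed
 have 1: "\<forall>i<Suc r. ?p i \<in> S" using qp(1) f2 by auto
 have 2: "\<forall>i<Suc r. \<forall>j<Suc r. ?p i (?q j) = (if i = j then 1 else 0)"
  using qp(1,2) f2q f2j by (auto simp: less_Suc_eq)
 show ?case using 1 2 3 by (intro exI[of _ ?q] exI[of _ ?p]) blast
qed

lemma linear_fs_span:
 assumes "flin f"
 shows "f ` fspan S = fspan (f ` S)"
proof -
 interpret f: Vector_Spaces.linear scl scl f by fact
 show ?thesis using f.span_image[of S] fspan_def by metis
qed

section \<open>Ranks of matrices with arbitrary index sets\<close>

definition rows :: "('p => 'q => 'k::field) => 'p set => 'q set => ('q => 'k) set" where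
 "rows be P Q = fspan ((\<lambda>p q. if q \<in> Q then be p q else 0) ` P)"

text \<open>The index sets may be infinite; later they consist of pairs of vectors. Cutting a row
  down to \<open>Q\<close> by zeros keeps all submatrices in one function space.\<close>

definition rk :: "('p => 'q => 'k::field) => 'p set => 'q set => nat" where
 "rk be P Q = fdim (rows be P Q)"

lemma subspace_rows: "fsubspace (rows be P Q)"
 by (simp add: rows_def fs.subspace_span)

lemma row_in_rows: "p \<in> P ==> (\<lambda>q. if q \<in> Q then be p q else 0) \<in> rows be P Q"
 by (simp add: rows_def fs.span_base)

text \<open>Every row is a combination of \<open>r\<close> fixed functions, with its own values at
  \<open>r\<close> points as coefficients. Hence every column is a combination of the columns at
  these points.\<close>

lemma rows_transpose_aux:
 assumes "ffin_dim (rows be P Q)"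
 shows "ffin_dim (rows (\<lambda>q p. be p q) Q P) & rk (\<lambda>q p. be p q) Q P <= rk be P Q"
proof -
 let ?r = "rk be P Q"
 obtain y p where yp: "\<forall>f\<in>rows be P Q. f = (\<Sum>i<?r. scl (f (y i)) (p i))"
  using dual_points[OF subspace_rows assms, of ?r] by (auto simp: rk_def)
 \<comment> \<open>A point \<open>y i\<close> is not known to lie in \<open>Q\<close>; if it does
   not, all rows are 0 there, which the inner default records.\<close>
 define c where "c i = (\<lambda>a. if a \<in> P then if y i \<in> Q then be a (y i) else 0 else 0)" for i
 have col: "(\<lambda>a. if a \<in> P then be a q else 0) = (\<Sum>i<?r. scl (p i q) (c i))" if q: "q \<in> Q" for q
 proof
  fix a
  show "(if a \<in> P then be a q else 0) = (\<Sum>i<?r. scl (p i q) (c i)) a"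
  proof (cases "a \<in> P")
   case True
   let ?f = "\<lambda>q. if q \<in> Q then be a q else 0"
   have "?f = (\<Sum>i<?r. scl (?f (y i)) (p i))" using yp row_in_rows[OF True] by blast
   then have "?f q = (\<Sum>i<?r. scl (?f (y i)) (p i)) q" by (rule fun_cong)
   then show ?thesis using q True by (auto simp: sum_fun_apply c_def intro!: sum.cong)
  next
   case False
   then show ?thesis by (simp add: sum_fun_apply c_def)
  qed
 qed
 have sub: "rows (\<lambda>q p. be p q) Q P <= fspan (c ` {..<?r})"
  unfolding rows_def
 proof (rule fs.span_minimal[OF _ fs.subspace_span], clarsimp)
  fix q assume "q \<in> Q"
  then show "(\<lambda>qa. if qa \<in> P then be qa q else 0) \<in> fspan (c ` {..<?r})"
   unfolding col[OF \<open>q \<in> Q\<close>] by (intro fs.span_sum fs.span_scale fs.span_base) auto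
 qed
 then have "rk (\<lambda>q p. be p q) Q P <= card (c ` {..<?r})"
  unfolding rk_def by (intro fs.dim_le_card) auto
 then show ?thesis using sub card_image_le[of "{..<?r}" c] fs.fin_dimI[OF _ sub] by simp
qed

lemma rk_transpose:
 assumes "ffin_dim (rows be P Q)"
 shows "ffin_dim (rows (\<lambda>q p. be p q) Q P)" "rk (\<lambda>q p. be p q) Q P = rk be P Q"
 using rows_transpose_aux[OF assms] rows_transpose_aux[of "\<lambda>q p. be p q" Q P] by auto

definition restr :: "'q set => ('q => 'k::field) => 'q => 'k" where
 "restr Q f = (\<lambda>q. if q \<in> Q then f q else 0)"

lemma linear_restr: "flin (restr Q)"
 by (rule linear_fsI) (auto simp: restr_def)

lemma restr_rows: "Q' <= Q ==> restr Q' ` rows be P Q = rows be P Q'"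
 unfolding rows_def linear_fs_span[OF linear_restr] image_image
 by (intro arg_cong[where f = fspan] image_cong) (auto simp: restr_def fun_eq_iff)

lemma rk_mono:
 assumes "P' <= P" "Q' <= Q" "ffin_dim (rows be P Q)"
 shows "ffin_dim (rows be P' Q')" "rk be P' Q' <= rk be P Q"
proof -
 have 1: "rows be P' Q' <= rows be P Q'"
  unfolding rows_def by (intro fs.span_mono image_mono assms)
 note rn = fsp.rank_nullity[OF linear_restr[of Q'] subspace_rows assms(3)]
 have 2: "ffin_dim (rows be P Q')" "fdim (rows be P Q') <= fdim (rows be P Q)"
  using rn unfolding restr_rows[OF assms(2)] by auto
 show "ffin_dim (rows be P' Q')" using fs.fin_dim_mono[OF 1 2(1)] .
 show "rk be P' Q' <= rk be P Q" unfolding rk_def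
  using fs.dim_mono_fin[OF 1 2(1)] 2(2) by simp
qed

text \<open>Block triangular matrices: the rows from \<open>P'\<close> lie in the kernel of the
  restriction of the row space to \<open>Q'\<close>, and the image of this restriction is the row
  space over \<open>Q'\<close>. Lower bounds for ranks are added up in this way.\<close>

lemma rk_zero_block:
 assumes "P' <= P" "Q' <= Q" "ffin_dim (rows be P Q)" "!!p q. p \<in> P' ==> q \<in> Q' ==> be p q = 0"
 shows "rk be P' Q + rk be P Q' <= rk be P Q"
proof -
 let ?K = "{f\<in>rows be P Q. restr Q' f = 0}"
 have K: "fsubspace ?K"
 proof -
  interpret l: Vector_Spaces.linear scl scl "restr Q' :: ('b => 'c) => 'b => 'c" by (rule linear_restr)
  show ?thesis using subspace_rows[of be P Q] by (auto simp: fs.subspace_def l.add l.scale l.zero)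
 qed
 have "rows be P' Q <= ?K" unfolding rows_def
 proof (rule fs.span_minimal)
  show "(\<lambda>p q. if q \<in> Q then be p q else 0) ` P' <= {f\<in>fspan ((\<lambda>p q. if q \<in> Q then be p q else 0) ` P). restr Q' f = 0}"
   using assms(1,2,4) by (auto simp: restr_def fun_eq_iff intro!: fs.span_base)
  show "fsubspace {f\<in>fspan ((\<lambda>p q. if q \<in> Q then be p q else 0) ` P). restr Q' f = 0}"
   using K unfolding rows_def .
 qed
 moreover have "?K <= rows be P Q" by auto
 ultimately have "rk be P' Q <= fdim ?K"
  unfolding rk_def by (intro fs.dim_mono_fin fs.fin_dim_mono[OF _ assms(3)])
 then show ?thesis
  using fsp.rank_nullity(1)[OF linear_restr[of Q'] subspace_rows assms(3)]
  unfolding restr_rows[OF assms(2)] rk_def by linarith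
qed

lemma rk_ge_image:
 assumes "flin L" "fsubspace V" "ffin_dim V"
  "L ` V <= rows be P Q" "ffin_dim (rows be P Q)"
 shows "fdim V <= rk be P Q + fdim {v\<in>V. L v = 0}"
 using fsp.rank_nullity(1)[OF assms(1-3)] fs.dim_mono_fin[OF assms(4,5)] unfolding rk_def by linarith

text \<open>Evaluation at dual points identifies \<open>S\<close> with all tuples of
  \<open>fdim S\<close> scalars.\<close>

lemma card_fs:
 fixes S :: "('i => 'k::{field,finite}) set"
 assumes "fsubspace S" "ffin_dim S"
 shows "finite S" "card S = card (UNIV :: 'k set) ^ fdim S"
proof -
 let ?r = "fdim S"
 obtain q p where qp: "\<forall>i<?r. p i \<in> S" "\<forall>i<?r. \<forall>j<?r. p i (q j) = (if i = j then 1 else 0)"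
   "\<forall>f\<in>S. f = (\<Sum>i<?r. scl (f (q i)) (p i))"
  using dual_points[OF assms refl] by blast
 have "bij_betw (\<lambda>f. \<lambda>i\<in>{..<?r}. f (q i)) S ({..<?r} \<rightarrow>\<^sub>E UNIV)"
 proof (rule bij_betw_byWitness[where f' = "\<lambda>u. \<Sum>i<?r. scl (u i) (p i)"])
  show "\<forall>a\<in>S. (\<Sum>i<?r. scl ((\<lambda>i\<in>{..<?r}. a (q i)) i) (p i)) = a"
  proof
   fix f assume "f \<in> S"
   then have "f = (\<Sum>i<?r. scl (f (q i)) (p i))" using qp(3) by blast
   then show "(\<Sum>i<?r. scl ((\<lambda>i\<in>{..<?r}. f (q i)) i) (p i)) = f" by simp
  qed
  show "\<forall>u\<in>{..<?r} \<rightarrow>\<^sub>E UNIV. (\<lambda>i\<in>{..<?r}. (\<Sum>i<?r. scl (u i) (p i)) (q i)) = u"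
  proof
   fix u :: "nat => 'k" assume u: "u \<in> {..<?r} \<rightarrow>\<^sub>E UNIV"
   have "(\<Sum>i<?r. scl (u i) (p i)) (q j) = u j" if "j < ?r" for j
   proof -
    have "(\<Sum>i<?r. u i * p i (q j)) = (\<Sum>i<?r. if i = j then u i else 0)"
     using qp(2) that by (intro sum.cong) auto
    then show ?thesis using that by (simp add: sum_fun_apply)
   qed
   then show "(\<lambda>i\<in>{..<?r}. (\<Sum>i<?r. scl (u i) (p i)) (q i)) = u"
    using u by (auto simp: fun_eq_iff restrict_def PiE_def extensional_def)
  qed
  show "(\<lambda>u. \<Sum>i<?r. scl (u i) (p i)) ` ({..<?r} \<rightarrow>\<^sub>E UNIV) <= S"
   using qp(1) assms(1) by (auto intro!: fs.subspace_sum fs.subspace_scale)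
  show "(\<lambda>f. \<lambda>i\<in>{..<?r}. f (q i)) ` S <= {..<?r} \<rightarrow>\<^sub>E UNIV"
   by (auto simp: PiE_def)
 qed
 then have *: "finite S \<longleftrightarrow> finite ({..<?r} \<rightarrow>\<^sub>E (UNIV :: 'k set))" "card S = card ({..<?r} \<rightarrow>\<^sub>E (UNIV :: 'k set))"
  using bij_betw_finite[of _ S] bij_betw_same_card[of _ S] by blast+
 show "finite S" using * by (simp add: finite_PiE)
 show "card S = card (UNIV :: 'k set) ^ fdim S" using * by (simp add: card_PiE)
qed

section \<open>Common zeros of bilinear forms\<close>

lemma nonzero_element: "fsubspace S ==> S ~= {0} ==> \<exists>x\<in>S. x ~= 0"
 using fs.subspace_0[of S] by auto

lemma fdim_supported:
 assumes "finite Z"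
 defines "S \<equiv> {f :: 'i => 'k::field. \<forall>x. x ~: Z --> f x = 0}"
 shows "fsubspace S" "ffin_dim S" "fdim S = card Z"
proof -
 show "fsubspace S" by (auto simp: fs.subspace_def S_def)
 define e :: "'i => 'i => 'k" where "e z = (\<lambda>x. if x = z then 1 else 0)" for z
 have inj: "inj e"
 proof (rule injI)
  fix x y assume "e x = e y"
  then have "e x x = e y x" by simp
  then show "x = y" by (simp add: e_def split: if_splits)
 qed
 have sumS: "f = (\<Sum>z\<in>Z. scl (f z) (e z))" if "f \<in> S" for f
 proof
  fix x
  have "(\<Sum>z\<in>Z. f z * e z x) = (\<Sum>z\<in>Z. if z = x then f z else 0)"
   by (intro sum.cong) (auto simp: e_def)
  also have "\<dots> = (if x \<in> Z then f x else 0)" using assms(1) by simp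
  also have "\<dots> = f x" using that unfolding S_def by simp
  finally show "f x = (\<Sum>z\<in>Z. scl (f z) (e z)) x" by (simp only: sum_fun_apply scl_apply)
 qed
 have sp: "S <= fspan (e ` Z)"
 proof
  fix f assume "f \<in> S"
  have "(\<Sum>z\<in>Z. scl (f z) (e z)) \<in> fspan (e ` Z)"
   by (intro fs.span_sum fs.span_scale fs.span_base) auto
  then show "f \<in> fspan (e ` Z)" using sumS[OF \<open>f \<in> S\<close>] by simp
 qed
 show "ffin_dim S" by (rule fs.fin_dimI[OF _ sp]) (use assms(1) in auto)
 have "\<not> fdependent (e ` Z)"
 proof (rule fs.independent_if_scalars_zero)
  show "finite (e ` Z)" using assms(1) by simp
  fix f x assume *: "(\<Sum>x\<in>e ` Z. scl (f x) x) = 0" "x \<in> e ` Z"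
  then obtain z where z: "z \<in> Z" "x = e z" by auto
  have "(\<Sum>y\<in>Z. scl (f (e y)) (e y)) = 0" using *(1) unfolding sum.reindex[OF inj_on_subset[OF inj subset_UNIV]] o_def .
  then have "(\<Sum>y\<in>Z. scl (f (e y)) (e y)) z = 0" by simp
  then have "(\<Sum>y\<in>Z. f (e y) * e y z) = 0" by (simp add: sum_fun_apply)
  moreover have "(\<Sum>y\<in>Z. f (e y) * e y z) = (\<Sum>y\<in>Z. if y = z then f (e y) else 0)"
   by (intro sum.cong) (auto simp: e_def)
  ultimately show "f x = 0" using assms(1) z by simp
 qed
 moreover have "e ` Z <= S" by (auto simp: S_def e_def)
 ultimately have "fdim S = card (e ` Z)" using fs.basis_card_eq_dim[OF _ sp] by simp
 then show "fdim S = card Z" using card_image[OF inj_on_subset[OF inj subset_UNIV]] by simp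
qed

section \<open>Common eigenvectors of commuting operators\<close>

lemma linear_combination_linear:
 "flin (\<lambda>c. \<Sum>i\<in>Z. scl (c i) (w i))"
 by (rule linear_fsI) (auto simp: sum_fun_apply distrib_right sum.distrib sum_distrib_left mult.assoc)

lemmas fun_app = scl_apply plus_fun_apply zero_fun_apply minus_apply uminus_apply

declare fun_app [simp del]

text \<open>The vectors w, t w, t (t w), ... become dependent, which gives a nonzero polynomial p
  with p(t) w = 0; splitting off linear factors must at some stage meet an eigenvector. Linearity of
  \<open>t\<close> is asked on \<open>W\<close> only, because \<open>t\<close> will be a quotient of
  shifts that makes sense just there.\<close>

lemma eigenvector_exists:
 fixes W :: "('i => 'k::alg_closed_field) set"
 assumes W: "fsubspace W" "ffin_dim W" "W ~= {0}"
  and t: "!!u. u \<in> W ==> t u \<in> W"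
   "!!u v. u \<in> W ==> v \<in> W ==> t (u + v) = t u + t v" "!!c u. u \<in> W ==> t (scl c u) = scl c (t u)"
 shows "\<exists>u\<in>W. \<exists>l. u ~= 0 & t u = scl l u"
proof -
 obtain w where w: "w \<in> W" "w ~= 0" using nonzero_element W by blast
 define x where "x i = (t ^^ i) w" for i
 have x: "x i \<in> W" for i by (induction i) (auto simp: x_def w t)
 have xS: "x (Suc i) = t (x i)" for i by (simp add: x_def)
 have t0: "t 0 = 0" using t(3)[OF w(1), of 0] by (simp add: scl_def zero_fun_def)
 have tsum: "t (\<Sum>i\<in>A. scl (c i) (x i)) = (\<Sum>i\<in>A. scl (c i) (x (Suc i)))" for c A
  by (induction A rule: infinite_finite_induct)
   (simp_all add: t0 t xS x W(1) fs.subspace_sum fs.subspace_scale)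
 \<comment> \<open>\<open>pev p\<close> is p(t) w.\<close>
 define pev where "pev p = (\<Sum>i\<le>Polynomial.degree p. scl (coeff p i) (x i))" for p :: "'k poly"
 have pevN: "pev p = (\<Sum>i<N. scl (coeff p i) (x i))" if "Polynomial.degree p < N" for p N
  unfolding pev_def using that
  by (intro sum.mono_neutral_left) (auto simp: coeff_eq_0)
 have mul: "pev ([:-a, 1:] * q) = t (pev q) - scl a (pev q)" for a q
 proof -
  \<comment> \<open>Larger than the degree of the product, with room for the index shift caused by
    multiplication with the variable.\<close>
  let ?N = "Polynomial.degree q + 3"
  have "Polynomial.degree ([:-a, 1:] * q) <= Polynomial.degree [:-a, 1:] + Polynomial.degree q" by (rule degree_mult_le)
  also have "\<dots> < ?N" by simp
  finally have "pev ([:-a, 1:] * q) = (\<Sum>i<?N. scl (coeff ([:-a, 1:] * q) i) (x i))" by (rule pevN)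
  also have "\<dots> = (\<Sum>i<?N. scl (coeff (pCons 0 q) i) (x i)) - (\<Sum>i<?N. scl a (scl (coeff q i) (x i)))"
   unfolding sum_subtractf[symmetric]
   by (intro sum.cong) (auto simp: fun_app fun_eq_iff algebra_simps)
  also have "(\<Sum>i<?N. scl (coeff (pCons 0 q) i) (x i)) = (\<Sum>i<Polynomial.degree q + 2. scl (coeff q i) (x (Suc i)))"
  proof -
   have "?N = Suc (degree q + 2)" by simp
   then show ?thesis by (simp only: sum.lessThan_Suc_shift) (simp add: fun_app fun_eq_iff sum_fun_apply)
  qed
  also have "\<dots> = t (pev q)" unfolding tsum[symmetric] using pevN[of q "Polynomial.degree q + 2"] by simp
  also have "(\<Sum>i<?N. scl a (scl (coeff q i) (x i))) = scl a (pev q)"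
   using pevN[of q ?N] by (simp add: fs.scale_sum_right)
  finally show ?thesis .
 qed
 have pevW: "pev p \<in> W" for p unfolding pev_def using x W(1) by (intro fs.subspace_sum fs.subspace_scale)
 let ?r = "fdim W"
 let ?C = "{c :: nat => 'k. \<forall>i. i ~: {..<Suc ?r} --> c i = 0}"
 let ?f = "\<lambda>c. \<Sum>i\<in>{..<Suc ?r}. scl (c i) (x i)"
 have C: "fsubspace ?C" "ffin_dim ?C" "fdim ?C = Suc ?r"
  using fdim_supported[of "{..<Suc ?r}", where 'k='k] by simp_all
 have "?f ` ?C <= W" using x W(1) by (auto intro!: fs.subspace_sum fs.subspace_scale fs.subspace_add)
 then have "fdim (?f ` ?C) <= ?r" by (rule fs.dim_mono_fin[OF _ W(2)])
 then have "fdim {c\<in>?C. ?f c = 0} ~= 0"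
  using fsp.rank_nullity(1)[OF linear_combination_linear C(1,2), of x "{..<Suc ?r}"] C(3) by linarith
 then have "{c\<in>?C. ?f c = 0} ~= {0}" using fs.dim_zero(1) by metis
 moreover have "0 \<in> {c\<in>?C. ?f c = 0}" by (simp add: fun_app fun_eq_iff sum_fun_apply)
 ultimately obtain c where c: "c \<in> ?C" "?f c = 0" "c ~= 0" by blast
 define p where "p = Poly (map c [0..<Suc ?r])"
 have cp: "coeff p i = c i" for i using c(1)
  by (auto simp: p_def coeff_Poly_eq nth_default_def simp del: upt_Suc)
 have p0: "p ~= 0" using c(3) cp by (auto simp: fun_app fun_eq_iff)
 have "Polynomial.degree p < Suc ?r"
 proof (rule ccontr)
  assume "\<not> ?thesis"
  then have "coeff p (Polynomial.degree p) = 0" using c(1) cp by auto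
  then show False using p0 by simp
 qed
 then have "pev p = 0" using pevN c(2) cp by simp
 then show ?thesis using p0
 proof (induction "Polynomial.degree p" arbitrary: p rule: less_induct)
  case less
  show ?case
  proof (cases "Polynomial.degree p = 0")
   case True
   then obtain a where "p = [:a:]" using degree_eq_zeroE by blast
   then have "scl a w = 0" "a ~= 0" using less.prems by (auto simp: pev_def x_def)
   then show ?thesis using w(2) fs.scale_eq_0_iff by blast
  next
   case False
   then obtain a where "poly p a = 0" using alg_closed_imp_poly_has_root by blast
   then obtain q where q: "p = [:-a, 1:] * q" using poly_eq_0_iff_dvd dvdE by metis
   then have q0: "q ~= 0" using less.prems by auto
   have dq: "Polynomial.degree q < Polynomial.degree p" using q q0 by (simp add: degree_mult_eq del: mult_pCons_left)
   show ?thesis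
   proof (cases "pev q = 0")
    case True
    then show ?thesis using less.hyps[OF dq] q0 by blast
   next
    case False
    have "t (pev q) = scl a (pev q)" using mul[of a q] less.prems(1) q by simp
    then show ?thesis using False pevW by blast
   qed
  qed
 qed
qed

text \<open>An eigenspace of one operator is stable under the operators commuting with it, so the
  induction continues inside the eigenspace.\<close>

lemma common_eigenvector_exists:
 fixes W :: "('i => 'k::alg_closed_field) set"
 assumes "finite K" "fsubspace W" "ffin_dim W" "W ~= {0}"
  and "!!k u. k \<in> K ==> u \<in> W ==> t k u \<in> W"
   "!!k u v. k \<in> K ==> u \<in> W ==> v \<in> W ==> t k (u + v) = t k u + t k v"
   "!!k c u. k \<in> K ==> u \<in> W ==> t k (scl c u) = scl c (t k u)"
   "!!k k' u. k \<in> K ==> k' \<in> K ==> u \<in> W ==> t k (t k' u) = t k' (t k u)"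
 shows "\<exists>u\<in>W. u ~= 0 & (\<forall>k\<in>K. \<exists>l. t k u = scl l u)"
 using assms
proof (induction K arbitrary: W rule: finite_induct)
 case empty
 then show ?case using nonzero_element[of W] by blast
next
 case (insert k K)
 obtain u l where u: "u \<in> W" "u ~= 0" "t k u = scl l u"
  using eigenvector_exists[OF insert.prems(1-3), of "t k"] insert.prems(4-6) by blast
 let ?W = "{u\<in>W. t k u = scl l u}"
 have "\<exists>u\<in>?W. u ~= 0 & (\<forall>k\<in>K. \<exists>l. t k u = scl l u)"
 proof (rule insert.IH)
  show "fsubspace ?W" unfolding fs.subspace_def
   using insert.prems(1,5,6) insert.prems(6)[of k u 0] u(1)
   by (auto simp: fs.subspace_def fs.scale_right_distrib mult.commute)
  show "ffin_dim ?W" by (rule fs.fin_dim_mono[OF _ insert.prems(2)]) auto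
  show "?W ~= {0}" using u by auto
  show "t k' v \<in> ?W" if "k' \<in> K" "v \<in> ?W" for k' v
   using that insert.prems(4,6) insert.prems(7)[of k k' v] by auto
 qed (use insert.prems in auto)
 then show ?case using u by blast
qed

section \<open>Functionals on bihomogeneous polynomials as arrays\<close>

definition monomials :: "nat set => nat => (nat => nat) set" where
 "monomials I d = {al. (\<forall>i. i ~: I --> al i = 0) & sum al I = d}"

text \<open>Multiplication of a monomial, given by its exponents, by the variable with index
  \<open>i\<close>.\<close>

definition inc :: "nat => (nat => nat) => nat => nat" where
 "inc i al = al(i := Suc (al i))"

lemma inc_commute: "inc i (inc j al) = inc j (inc i al)"
 by (auto simp: inc_def fun_eq_iff)

lemma inc_monomials:
 assumes "finite I"
 shows "inc i al \<in> monomials I (Suc d) \<longleftrightarrow> i \<in> I & al \<in> monomials I d"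
proof (cases "i \<in> I")
 case True
 have "sum (inc i al) I = Suc (al i) + sum (inc i al) (I - {i})"
  using sum.remove[OF assms True, of "inc i al"] by (simp add: inc_def)
 also have "sum (inc i al) (I - {i}) = sum al (I - {i})" by (intro sum.cong) (auto simp: inc_def)
 finally have "sum (inc i al) I = Suc (sum al I)" using sum.remove[OF assms True, of al] by simp
 then show ?thesis using True by (auto simp: monomials_def inc_def)
next
 case False
 then show ?thesis by (auto simp: monomials_def inc_def)
qed

lemma monomials_inc_ex:
 assumes "finite I" "al \<in> monomials I (Suc d)"
 obtains i al' where "i \<in> I" "al = inc i al'"
proof -
 have "\<exists>i\<in>I. al i ~= 0" using assms by (metis (mono_tags, lifting) monomials_def mem_Collect_eq nat.distinct(1) sum.neutral)
 then obtain i where i: "i \<in> I" "al i ~= 0" by blast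
 have "al = inc i (al(i := al i - 1))" using i by (auto simp: inc_def fun_eq_iff)
 then show ?thesis using that i by blast
qed

lemma finite_monomials: "finite I ==> finite (monomials I d)"
proof (rule finite_subset)
 assume I: "finite I"
 show "monomials I d <= {al. al ` I <= {..d} & {i. al i ~= 0} <= I}"
 proof
  fix al assume a: "al \<in> monomials I d"
  have "al i <= d" if "i \<in> I" for i
   using a member_le_sum[of i I al] I that by (auto simp: monomials_def)
  then show "al \<in> {al. al ` I <= {..d} & {i. al i ~= 0} <= I}"
   using a by (auto simp: monomials_def)
 qed
 have "finite {al. \<forall>i. (i \<in> I --> al i \<in> {..d}) & (i ~: I --> al i = 0)}"
  by (rule finite_set_of_finite_funs) (use I in auto)
 then show "finite {al. al ` I <= {..d} & {i. al i ~= 0} <= I}"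
  by (rule rev_finite_subset) auto
qed

text \<open>The first \<open>n - 1\<close> exponents may be any numbers below \<open>t\<close>; the
  last exponent takes up the remaining degree.\<close>

lemma card_monomials_ge:
 assumes "n \<ge> 1" "n * t <= d"
 shows "t ^ (n - 1) <= card (monomials {..<n} d)"
proof -
 let ?P = "{..<n-1} \<rightarrow>\<^sub>E {..<t}"
 let ?g = "\<lambda>f i. if i < n - 1 then f i else if i = n - 1 then d - sum f {..<n-1} else (0::nat)"
 have "?g ` ?P <= monomials {..<n} d"
 proof clarify
  fix f assume f: "f \<in> ?P"
  have "sum f {..<n-1} <= (\<Sum>i<n-1. t)" using f by (intro sum_mono) (force simp: PiE_def Pi_def)
  also have "\<dots> <= d" using assms by (simp add: diff_mult_distrib)
  finally have le: "sum f {..<n-1} <= d" .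
  have "{..<n} = insert (n - 1) {..<n-1}" using assms by auto
  then have "sum (?g f) {..<n} = (d - sum f {..<n-1}) + sum (?g f) {..<n-1}" by simp
  also have "sum (?g f) {..<n-1} = sum f {..<n-1}" by (intro sum.cong) auto
  finally show "?g f \<in> monomials {..<n} d" using le assms by (auto simp: monomials_def)
 qed
 moreover have "inj_on ?g ?P"
 proof (rule inj_onI)
  fix f h assume fh: "f \<in> ?P" "h \<in> ?P" "?g f = ?g h"
  show "f = h"
  proof (rule PiE_ext[OF fh(1,2)])
   fix i assume "i \<in> {..<n-1}"
   then show "f i = h i" using fun_cong[OF fh(3), of i] by simp
  qed
 qed
 ultimately have "card ?P <= card (monomials {..<n} d)"
  using card_inj_on_le[OF _ _ finite_monomials[of "{..<n}"]] by blast
 then show ?thesis by (simp add: card_PiE)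
qed

text \<open>An array is a linear functional on polynomials in two groups of variables, given by its
  values on the monomials.\<close>

type_synonym 'k array = "(nat => nat) \<times> (nat => nat) => 'k"

text \<open>The shifts are the transposes of multiplication by a variable of the first or second
  group.\<close>

definition shX :: "nat => 'k::field array => 'k array" where
 "shX i u = (\<lambda>(al, be). u (inc i al, be))"
definition shY :: "nat => 'k::field array => 'k array" where
 "shY j u = (\<lambda>(al, be). u (al, inc j be))"

lemma linear_shX: "flin (shX i)"
 and linear_shY: "flin (shY j)"
 by (rule linear_fsI; auto simp: shX_def shY_def fun_app)+

lemma sh_commute: "shX i (shX i' u) = shX i' (shX i u)" "shY i (shY i' u) = shY i' (shY i u)"
  "shX i (shY j u) = shY j (shX i u)"
 by (auto simp: shX_def shY_def fun_eq_iff inc_commute)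

lemma sh_add: "shX i (u + v) = shX i u + shX i v" "shY i (u + v) = shY i u + shY i v"
 and sh_scl: "shX i (scl c u) = scl c (shX i u)" "shY i (scl c u) = scl c (shY i u)"
 and sh_0: "shX i 0 = 0" "shY i 0 = 0"
 and sh_diff: "shX i (u - v) = shX i u - shX i v" "shY i (u - v) = shY i u - shY i v"
 by (auto simp: shX_def shY_def fun_eq_iff fun_app)

text \<open>Functionals living in bidegree (d, e). Exponents are 0 outside the index sets, so that
  dropping a variable yields a subspace of the same function space.\<close>

definition arrays :: "nat set => nat set => nat => nat => 'k::field array set" where
 "arrays I J d e = {u. \<forall>x. x ~: monomials I d \<times> monomials J e --> u x = 0}"

lemma arrays_fin:
 assumes "finite I" "finite J"
 shows "fsubspace (arrays I J d e)" "ffin_dim (arrays I J d e)"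
  "fdim (arrays I J d e :: 'k::field array set) = card (monomials I d) * card (monomials J e)"
 unfolding arrays_def
 using fdim_supported[of "monomials I d \<times> monomials J e", where 'k='k]
  fdim_supported[of "monomials I d \<times> monomials J e"] finite_monomials assms
 by (auto simp: card_cartesian_product)

lemma shX_arrays: "finite I ==> u \<in> arrays I J (Suc d) e ==> shX i u \<in> arrays I J d e"
 and shY_arrays: "finite J ==> u \<in> arrays I J d (Suc e) ==> shY j u \<in> arrays I J d e"
 by (auto simp: arrays_def shX_def shY_def inc_monomials)

lemma shX_outside: "finite I ==> u \<in> arrays I J (Suc d) e ==> i ~: I ==> shX i u = 0"
 and shY_outside: "finite J ==> u \<in> arrays I J d (Suc e) ==> j ~: J ==> shY j u = 0"
 by (auto simp: arrays_def shX_def shY_def inc_monomials fun_eq_iff fun_app)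

text \<open>Every monomial of positive degree is divisible by some variable.\<close>

lemma shX_all_zero:
 assumes "finite I" "u \<in> arrays I J (Suc d) e" "!!i. i \<in> I ==> shX i u = 0"
 shows "u = 0"
proof (rule ext, clarify)
 fix al be
 show "u (al, be) = 0 (al, be)"
 proof (cases "al \<in> monomials I (Suc d)")
  case True
  then obtain i al' where i: "i \<in> I" "al = inc i al'" using monomials_inc_ex[OF assms(1)] by blast
  show ?thesis using fun_cong[OF assms(3)[OF i(1)], of "(al', be)"] i by (simp add: shX_def fun_app)
 next
  case False
  then show ?thesis using assms(2) by (auto simp: arrays_def fun_app)
 qed
qed

lemma monomials_Diff:
 assumes "finite I" "al \<in> monomials I d" "al i = 0"
 shows "al \<in> monomials (I - {i}) d"
proof -
 have "sum al (I - {i}) = sum al I"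
  by (rule sum.mono_neutral_left) (use assms in auto)
 then show ?thesis using assms by (auto simp: monomials_def)
qed

lemma shX_zero_arrays:
 assumes "finite I" "u \<in> arrays I J (Suc d) e" "shX i u = 0"
 shows "u \<in> arrays (I - {i}) J (Suc d) e"
proof -
 have "u (al, be) = 0" if "al i ~= 0" for al be
 proof -
  have "al = inc i (al(i := al i - 1))" using that by (auto simp: inc_def fun_eq_iff)
  then show ?thesis using fun_cong[OF assms(3), of "(al(i := al i - 1), be)"] by (simp add: shX_def fun_app)
 qed
 note z = this
 have "u (al, be) = 0" if n: "(al, be) ~: monomials (I - {i}) (Suc d) \<times> monomials J e" for al be
 proof (cases "al i = 0")
  case True
  then have "(al, be) ~: monomials I (Suc d) \<times> monomials J e"
   using n monomials_Diff[OF assms(1)] by blast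
  then show ?thesis using assms(2) unfolding arrays_def by blast
 qed (rule z)
 then show ?thesis unfolding arrays_def by (simp add: split_paired_all)
qed

text \<open>Exchanges the two groups of variables, which transfers facts about \<open>shX\<close> to
  \<open>shY\<close>.\<close>

definition swap :: "'k array => 'k array" where "swap u = (\<lambda>(al, be). u (be, al))"

lemma swap_simps: "swap u \<in> arrays J I e d \<longleftrightarrow> u \<in> arrays I J d e" "shX j (swap u) = swap (shY j u)" "swap u = 0 \<longleftrightarrow> u = 0"
 by (auto simp: swap_def arrays_def shX_def shY_def fun_eq_iff fun_app)

lemma shY_all_zero:
 assumes "finite J" "u \<in> arrays I J d (Suc e)" "!!j. j \<in> J ==> shY j u = 0"
 shows "u = 0"
 using shX_all_zero[OF assms(1), of "swap u" I e d] assms(2,3) by (simp add: swap_simps)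

lemma shY_zero_arrays:
 assumes "finite J" "u \<in> arrays I J d (Suc e)" "shY j u = 0"
 shows "u \<in> arrays I (J - {j}) d (Suc e)"
 using shX_zero_arrays[OF assms(1), of "swap u" I e d j] assms(2,3) by (simp add: swap_simps)

section \<open>Hopf's theorem on systems of bilinear forms\<close>

locale bilinear_system =
 fixes F :: "nat => nat => nat => 'k::alg_closed_field" and n p c :: nat
 assumes n: "1 <= n" and p: "1 <= p" and cnp: "c + 2 <= n + p"
begin

text \<open>The transpose of multiplication by the bilinear polynomial with coefficients
  \<open>F l\<close>.\<close>

definition fm :: "nat => 'k array => 'k array" where
 "fm l u = (\<Sum>i<n. \<Sum>j<p. scl (F l i j) (shX i (shY j u)))"

lemma fm_add: "fm l (u + v) = fm l u + fm l v"
 and fm_scl: "fm l (scl a u) = scl a (fm l u)"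
 by (simp_all add: fm_def sh_add sh_scl fs.scale_right_distrib sum.distrib fs.scale_sum_right mult.commute)

lemma fm_0: "fm l 0 = 0" by (simp add: fm_def sh_0)

lemma linear_fm: "flin (fm l)"
 by (rule linear_fsI) (simp_all add: fm_add fm_scl fun_app)

lemma sh_sum: "shX i (\<Sum>x\<in>A. g x) = (\<Sum>x\<in>A. shX i (g x))" "shY i (\<Sum>x\<in>A. g x) = (\<Sum>x\<in>A. shY i (g x))"
 by (induction A rule: infinite_finite_induct) (simp_all add: sh_0 sh_add)

lemma fm_shX: "fm l (shX i u) = shX i (fm l u)"
 unfolding fm_def sh_sum sh_scl by (intro sum.cong refl) (simp add: sh_commute)

lemma fm_shY: "fm l (shY i u) = shY i (fm l u)"
 unfolding fm_def sh_sum sh_scl by (intro sum.cong refl) (simp add: sh_commute)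

lemma fm_sum: "fm l (\<Sum>x\<in>A. g x) = (\<Sum>x\<in>A. fm l (g x))"
 by (induction A rule: infinite_finite_induct) (simp_all add: fm_0 fm_add)

lemma fm_commute: "fm l (fm l' u) = fm l' (fm l u)"
proof -
 have "fm l (fm l' u) = (\<Sum>i<n. \<Sum>j<p. scl (F l' i j) (shX i (shY j (fm l u))))"
  unfolding fm_def[of l' u] fm_sum fm_scl by (simp add: fm_shX fm_shY)
 then show ?thesis by (simp add: fm_def[of l' "fm l u"])
qed

lemma fm_arrays:
 assumes "finite I" "finite J" "u \<in> arrays I J (Suc d) (Suc e)"
 shows "fm l u \<in> arrays I J d e"
 unfolding fm_def
 by (intro fs.subspace_sum fs.subspace_scale arrays_fin assms(1,2) shX_arrays shY_arrays assms(3))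

text \<open>The dual of the part of bidegree (d, e) of the polynomial ring modulo the first
  \<open>l\<close> forms, with the variables outside \<open>I\<close> and \<open>J\<close> set to
  0.\<close>

definition H :: "nat set => nat set => nat => nat => nat => 'k array set" where
 "H I J l d e = {u \<in> arrays I J d e. \<forall>l'<l. fm l' u = 0}"

lemma H_fin:
 assumes "finite I" "finite J"
 shows "fsubspace (H I J l d e)" "ffin_dim (H I J l d e)"
proof -
 have "fsubspace (arrays I J d e :: 'k array set)" by (rule arrays_fin(1)[OF assms])
 then show "fsubspace (H I J l d e)"
  unfolding fs.subspace_def H_def mem_Collect_eq Ball_def by (simp add: fm_add fm_scl fm_0)
 show "ffin_dim (H I J l d e)"
  by (rule fs.fin_dim_mono[OF _ arrays_fin(2)[OF assms]]) (auto simp: H_def)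
qed

lemma H_shX: "finite I ==> u \<in> H I J l (Suc d) e ==> shX i u \<in> H I J l d e"
 and H_shY: "finite J ==> u \<in> H I J l d (Suc e) ==> shY j u \<in> H I J l d e"
 by (simp_all add: H_def fm_shX fm_shY sh_0 shX_arrays shY_arrays)

text \<open>A shift of a functional in a larger bidegree lands in the zero space, and a functional
  of positive degree killed by all shifts is 0.\<close>

lemma H_zero_mono:
 assumes "finite I" "finite J" "H I J l d e = {0}"
 shows "H I J l (d + d') (e + e') = {0}"
proof -
 have 1: "H I J l (Suc d) e = {0}" if "H I J l d e = {0}" for d e
 proof -
  have "u = 0" if u: "u \<in> H I J l (Suc d) e" for u
  proof (rule shX_all_zero[OF assms(1)])
   show "u \<in> arrays I J (Suc d) e" using u by (simp add: H_def)
   show "shX i u = 0" for i using H_shX[OF assms(1) u, of i] \<open>H I J l d e = {0}\<close> by simp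
  qed
  then show ?thesis using fs.subspace_0[OF H_fin(1)[OF assms(1,2)]] by blast
 qed
 have 2: "H I J l d (Suc e) = {0}" if "H I J l d e = {0}" for d e
 proof -
  have "u = 0" if u: "u \<in> H I J l d (Suc e)" for u
  proof (rule shY_all_zero[OF assms(2)])
   show "u \<in> arrays I J d (Suc e)" using u by (simp add: H_def)
   show "shY i u = 0" for i using H_shY[OF assms(2) u, of i] \<open>H I J l d e = {0}\<close> by simp
  qed
  then show ?thesis using fs.subspace_0[OF H_fin(1)[OF assms(1,2)]] by blast
 qed
 have "H I J l (d + d') e = {0}" by (induction d') (use assms(3) 1 in auto)
 then show ?thesis by (induction e') (use 2 in auto)
qed

text \<open>Each form lowers the order of growth along the diagonal by at most one. If nothing
  survived all \<open>c\<close> forms in some diagonal bidegree, the partial sums of the dimensions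
  before imposing any form would be O(D^c). These dimensions are of order at least D^(n+p-2), so the
  sums are of order at least D^(n+p-1), and c < n + p - 1.\<close>

lemma H_all_nonzero: "H {..<n} {..<p} c d d ~= {0}"
proof
 assume z: "H {..<n} {..<p} c d d = {0}"
 define h where "h l d = fdim (H {..<n} {..<p} l d d)" for l d
 \<comment> \<open>\<open>fm l\<close> lowers both degrees by one and preserves being killed by the
   earlier forms; its kernel is what one more form cuts out.\<close>
 have step: "h l (Suc d) <= h (Suc l) (Suc d) + h l d" for l d
 proof -
  let ?V = "H {..<n} {..<p} l (Suc d) (Suc d)"
  have "fm l ` ?V <= H {..<n} {..<p} l d d"
   by (auto simp: H_def fm_arrays) (metis fm_commute fm_0)
  then have "fdim (fm l ` ?V) <= h l d" unfolding h_def
   by (intro fs.dim_mono_fin H_fin) auto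
  moreover have "{u\<in>?V. fm l u = 0} = H {..<n} {..<p} (Suc l) (Suc d) (Suc d)"
   by (auto simp: H_def less_Suc_eq)
  ultimately show ?thesis
   using fsp.rank_nullity(1)[OF linear_fm[of l] H_fin(1) H_fin(2), of "{..<n}" "{..<p}" l "Suc d" "Suc d"]
   by (simp add: h_def)
 qed
 \<comment> \<open>Bounding partial sums instead of single dimensions lets each form that is taken
   back cost one factor \<open>D + 1\<close>.\<close>
 have growth: "\<exists>C. \<forall>D. (\<Sum>e\<le>D. h (c - m) e) <= C * (D + 1) ^ m" if "m <= c" for m
  using that
 proof (induction m)
  case 0
  have hz: "h c e = 0" if "d <= e" for e
   using H_zero_mono[OF _ _ z, of "e - d" "e - d"] that fs.dim_zero(1) by (simp add: h_def)
  have "(\<Sum>e\<le>D. h c e) <= (\<Sum>e\<le>d. h c e)" for D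
  proof -
   have "(\<Sum>e\<le>D. h c e) = (\<Sum>e\<in>{..D} \<inter> {..d}. h c e)"

   proof (rule sum.mono_neutral_right)
    show "\<forall>i\<in>{..D} - {..D} \<inter> {..d}. h c i = 0" by (intro ballI hz) auto
   qed auto
   also have "\<dots> <= (\<Sum>e\<le>d. h c e)" by (rule sum_mono2) auto
   finally show ?thesis .
  qed
  then show ?case by (intro exI[of _ "\<Sum>e\<le>d. h c e"]) simp
 next
  case (Suc m)
  then obtain C where C: "!!D. (\<Sum>e\<le>D. h (c - m) e) <= C * (D + 1) ^ m" by force
  let ?l = "c - Suc m"
  have l: "Suc ?l = c - m" using Suc.prems by simp
  have 1: "h ?l D <= h ?l 0 + (\<Sum>e\<le>D. h (c - m) e)" for D
  proof (induction D)
   case (Suc D)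
   then show ?case using step[of ?l D] l by simp
  qed simp
  have 2: "h ?l e <= (h ?l 0 + C) * (D + 1) ^ m" if "e <= D" for e D
  proof -
   have "h ?l e <= h ?l 0 * 1 + C * (e + 1) ^ m" using 1[of e] C[of e] by simp
   also have "\<dots> <= h ?l 0 * (D + 1) ^ m + C * (D + 1) ^ m"
    using that by (intro add_mono mult_mono power_mono) (auto simp: one_le_power)
   finally show ?thesis by (simp add: distrib_right)
  qed
  have "(\<Sum>e\<le>D. h ?l e) <= (h ?l 0 + C) * (D + 1) ^ Suc m" for D
  proof -
   have "(\<Sum>e\<le>D. h ?l e) <= (\<Sum>e\<le>D. (h ?l 0 + C) * (D + 1) ^ m)" by (intro sum_mono 2) auto
   also have "\<dots> = (h ?l 0 + C) * (D + 1) ^ Suc m" by (simp add: algebra_simps)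
   finally show ?thesis .
  qed
  then show ?case by blast
 qed
 obtain C where C: "!!D. (\<Sum>e\<le>D. h 0 e) <= C * (D + 1) ^ c" using growth[of c] by auto
 have lower: "t ^ (n + p - 2) <= h 0 e" if "(n + p) * t <= e" for t e
 proof -
  have "h 0 e = card (monomials {..<n} e) * card (monomials {..<p} e)"
   using arrays_fin(3)[of "{..<n}" "{..<p}" e e, where 'k='k] by (simp add: h_def H_def)
  moreover have "n * t <= e" "p * t <= e" using that by (auto simp: distrib_right)
  ultimately have "t ^ (n - 1) * t ^ (p - 1) <= h 0 e"
   using card_monomials_ge[OF n] card_monomials_ge[OF p] by (simp add: mult_mono)
  moreover have "n - 1 + (p - 1) = n + p - 2" using n p by simp
  ultimately show ?thesis by (metis power_add)
 qed
 \<comment> \<open>The \<open>t\<close> degrees following \<open>(n + p) * t\<close> contribute at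
   least t^(n+p-2) each, so t^(c+1) is at most a constant times t^c.\<close>
 have ub: "t <= C * (n + p + 2) ^ c" if t: "1 <= t" for t
 proof -
  let ?a = "(n + p) * t" and ?D = "(n + p + 1) * t"
  have "t ^ c * t <= t ^ (n + p - 2) * t" using t cnp by (intro mult_mono power_increasing) auto
  also have "\<dots> = (\<Sum>e\<in>{?a..<?a + t}. t ^ (n + p - 2))" by simp
  also have "\<dots> <= (\<Sum>e\<in>{?a..<?a + t}. h 0 e)" by (intro sum_mono lower) auto
  also have "\<dots> <= (\<Sum>e\<le>?D. h 0 e)" by (rule sum_mono2) (auto simp: distrib_right)
  also have "\<dots> <= C * (?D + 1) ^ c" by (rule C)
  also have "\<dots> <= C * ((n + p + 2) * t) ^ c"
   using t by (intro mult_left_mono power_mono) (auto simp: distrib_right)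
  also have "\<dots> = t ^ c * (C * (n + p + 2) ^ c)" by (simp only: power_mult_distrib ac_simps)
  finally show ?thesis using t by simp
 qed
 show False using ub[of "Suc (C * (n + p + 2) ^ c)"] by simp
qed

text \<open>The variables are reduced to minimal sets for which the quotient ring stays nonzero
  along the diagonal. Minimality makes the shifts by \<open>i0\<close> and \<open>j0\<close>
  injective in large bidegrees; the dimensions then decrease until they stall, and there both shifts
  are bijective. The quotients of the other shifts by these two commute, and their eigenvalues on a
  common eigenvector are the coordinates of the zero.\<close>

theorem common_zero:
 "\<exists>u v. (\<exists>i<n. u i ~= 0) & (\<exists>j<p. v j ~= 0) & (\<forall>l<c. (\<Sum>i<n. \<Sum>j<p. F l i j * u i * v j) = 0)"
proof -
 define good where "good I J \<longleftrightarrow> I <= {..<n} & J <= {..<p} & (\<forall>d. H I J c d d ~= {0})" for I J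
 have "good {..<n} {..<p}" using H_all_nonzero by (simp add: good_def)
 then have "\<exists>x. good (fst x) (snd x)" by auto
 then obtain x where x: "good (fst x) (snd x)"
   "!!y. good (fst y) (snd y) ==> card (fst x) + card (snd x) <= card (fst y) + card (snd y)"
  using ex_has_least_nat[of "\<lambda>x. good (fst x) (snd x)" _ "\<lambda>x. card (fst x) + card (snd x)"] by blast
 obtain I J where IJ: "x = (I, J)" by (cases x)
 have g: "good I J" and gmin: "!!I' J'. good I' J' ==> card I + card J <= card I' + card J'"
  using x IJ by auto
 have fin: "finite I" "finite J" using g finite_subset by (auto simp: good_def)
 have "I ~= {}"
 proof
  assume "I = {}"
  then have "arrays I J 1 1 <= {0 :: 'k array}" by (auto simp: arrays_def monomials_def fun_eq_iff fun_app)
  then have "H I J c 1 1 <= {0}" by (auto simp: H_def)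
  then show False using g fs.subspace_0[OF H_fin(1)[OF fin]] by (auto simp: good_def)
 qed
 then obtain i0 where i0: "i0 \<in> I" by blast
 have "J ~= {}"
 proof
  assume "J = {}"
  then have "arrays I J 1 1 <= {0 :: 'k array}" by (auto simp: arrays_def monomials_def fun_eq_iff fun_app)
  then have "H I J c 1 1 <= {0}" by (auto simp: H_def)
  then show False using g fs.subspace_0[OF H_fin(1)[OF fin]] by (auto simp: good_def)
 qed
 then obtain j0 where j0: "j0 \<in> J" by blast
 have "\<not> good (I - {i0}) J" using gmin[of "I - {i0}" J] i0 fin card_Diff1_less[of I i0] by force
 then obtain dX where dX: "H (I - {i0}) J c dX dX = {0}" using g by (auto simp: good_def)
 have "\<not> good I (J - {j0})" using gmin[of I "J - {j0}"] j0 fin card_Diff1_less[of J j0] by force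
 then obtain dY where dY: "H I (J - {j0}) c dY dY = {0}" using g by (auto simp: good_def)
 \<comment> \<open>Beyond both thresholds, and positive so that one further shift down is
   available.\<close>
 define D where "D = Suc (dX + dY)"
 have injX: "u = 0" if u: "u \<in> H I J c (Suc d) e" "shX i0 u = 0" and de: "dX <= Suc d" "dX <= e" for u d e
 proof -
  have "u \<in> H (I - {i0}) J c (Suc d) e"
   using u shX_zero_arrays[OF fin(1)] by (auto simp: H_def)
  then show ?thesis using H_zero_mono[OF _ _ dX, of "Suc d - dX" "e - dX"] de fin by simp
 qed
 have injY: "u = 0" if u: "u \<in> H I J c d (Suc e)" "shY j0 u = 0" and de: "dY <= d" "dY <= Suc e" for u d e
 proof -
  have "u \<in> H I (J - {j0}) c d (Suc e)"
   using u shY_zero_arrays[OF fin(2)] by (auto simp: H_def)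
  then show ?thesis using H_zero_mono[OF _ _ dY, of "d - dY" "Suc e - dY"] de fin by simp
 qed
 note Hs = H_fin[OF fin]
 have dimX: "fdim (H I J c (Suc d) e) = fdim (shX i0 ` H I J c (Suc d) e)"
  "shX i0 ` H I J c (Suc d) e <= H I J c d e" if "D <= Suc d" "D <= e" for d e
 proof -
  have "{u\<in>H I J c (Suc d) e. shX i0 u = 0} = {0}"
   using injX that fs.subspace_0[OF Hs(1)] by (auto simp: D_def sh_0)
  then show "fdim (H I J c (Suc d) e) = fdim (shX i0 ` H I J c (Suc d) e)"
   using fsp.rank_nullity(1)[OF linear_shX[of i0] Hs(1) Hs(2), of c "Suc d" e] fs.dim_zero(1) by simp
  show "shX i0 ` H I J c (Suc d) e <= H I J c d e" using H_shX[OF fin(1)] by blast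
 qed
 have dimY: "fdim (H I J c d (Suc e)) = fdim (shY j0 ` H I J c d (Suc e))"
  "shY j0 ` H I J c d (Suc e) <= H I J c d e" if "D <= d" "D <= Suc e" for d e
 proof -
  have "{u\<in>H I J c d (Suc e). shY j0 u = 0} = {0}"
   using injY that fs.subspace_0[OF Hs(1)] by (auto simp: D_def sh_0)
  then show "fdim (H I J c d (Suc e)) = fdim (shY j0 ` H I J c d (Suc e))"
   using fsp.rank_nullity(1)[OF linear_shY[of j0] Hs(1) Hs(2), of c d "Suc e"] fs.dim_zero(1) by simp
  show "shY j0 ` H I J c d (Suc e) <= H I J c d e" using H_shY[OF fin(2)] by blast
 qed
 have leX: "fdim (H I J c (Suc d) e) <= fdim (H I J c d e)" if "D <= Suc d" "D <= e" for d e
  using dimX[OF that] fs.dim_mono_fin[OF dimX(2)[OF that] Hs(2)] by simp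
 have leY: "fdim (H I J c d (Suc e)) <= fdim (H I J c d e)" if "D <= d" "D <= Suc e" for d e
  using dimY[OF that] fs.dim_mono_fin[OF dimY(2)[OF that] Hs(2)] by simp
 \<comment> \<open>The dimensions do not increase along the diagonal, and they cannot drop strictly
   at every step.\<close>
 have "\<exists>d\<ge>D. fdim (H I J c (Suc d) (Suc d)) = fdim (H I J c d d)"
 proof (rule ccontr)
  assume "\<not> ?thesis"
  then have lt: "fdim (H I J c (Suc d) (Suc d)) < fdim (H I J c d d)" if "D <= d" for d
   using leX[of d "Suc d"] leY[of d d] that by force
  have "fdim (H I J c (D + m) (D + m)) + m <= fdim (H I J c D D)" for m
  proof (induction m)
   case (Suc m)
   then show ?case using lt[of "D + m"] by simp
  qed simp
  from this[of "Suc (fdim (H I J c D D))"] show False by simp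
 qed
 then obtain d where d: "D <= d" "fdim (H I J c (Suc d) (Suc d)) = fdim (H I J c d d)" by blast
 define W where "W = H I J c (Suc d) (Suc d)"
 have W: "fsubspace W" "ffin_dim W" "W ~= {0}" using Hs g by (auto simp: W_def good_def)
 \<comment> \<open>The dimension in bidegree (d, d + 1) lies between those in (d + 1, d + 1) and (d,
   d), which agree.\<close>
 have surX: "shX i0 ` W = H I J c d (Suc d)"
 proof (rule fs.subspace_eq_dim[OF _ _ Hs(2)])
  show "fsubspace (shX i0 ` W)"
  proof -
   interpret l: Vector_Spaces.linear scl scl "shX i0 :: 'k array => _" by (rule linear_shX)
   show ?thesis using l.subspace_image[OF W(1)[unfolded fsubspace_def]] by (simp add: fsubspace_def)
  qed
  show "shX i0 ` W <= H I J c d (Suc d)" using dimX(2)[of d "Suc d"] d by (simp add: W_def)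
  show "fdim (H I J c d (Suc d)) <= fdim (shX i0 ` W)"
   using dimX(1)[of d "Suc d"] leY[of d d] d by (simp add: W_def)
 qed
 have surY: "shY j0 ` W = H I J c (Suc d) d"
 proof (rule fs.subspace_eq_dim[OF _ _ Hs(2)])
  show "fsubspace (shY j0 ` W)"
  proof -
   interpret l: Vector_Spaces.linear scl scl "shY j0 :: 'k array => _" by (rule linear_shY)
   show ?thesis using l.subspace_image[OF W(1)[unfolded fsubspace_def]] by (simp add: fsubspace_def)
  qed
  show "shY j0 ` W <= H I J c (Suc d) d" using dimY(2)[of "Suc d" d] d by (simp add: W_def)
  show "fdim (H I J c (Suc d) d) <= fdim (shY j0 ` W)"
   using dimY(1)[of "Suc d" d] leX[of d d] d by (simp add: W_def)
 qed
 have iX: "u = v" if "u \<in> W" "v \<in> W" "shX i0 u = shX i0 v" for u v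
  using injX[of "u - v" d "Suc d"] that fs.subspace_diff[OF W(1) that(1,2)] d
  by (simp add: W_def D_def sh_diff)
 have iY: "u = v" if "u \<in> W" "v \<in> W" "shY j0 u = shY j0 v" for u v
  using injY[of "u - v" "Suc d" d] that fs.subspace_diff[OF W(1) that(1,2)] d
  by (simp add: W_def D_def sh_diff)
 have iXX: "u = 0" if "u \<in> W" "shX i0 (shX i0 u) = 0" for u
 proof -
  have "shX i0 u \<in> H I J c (Suc (d - 1)) (Suc d)"
   using that(1) surX d(1) by (auto simp: D_def)
  then have "shX i0 u = 0" using injX[of "shX i0 u" "d - 1" "Suc d"] that(2) d(1) by (simp add: D_def)
  then show ?thesis using iX[OF that(1) fs.subspace_0[OF W(1)]] by (simp add: sh_0)
 qed
 have iYY: "u = 0" if "u \<in> W" "shY j0 (shY j0 u) = 0" for u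
 proof -
  have "shY j0 u \<in> H I J c (Suc d) (Suc (d - 1))"
   using that(1) surY d(1) by (auto simp: D_def)
  then have "shY j0 u = 0" using injY[of "shY j0 u" "Suc d" "d - 1"] that(2) d(1) by (simp add: D_def)
  then show ?thesis using iY[OF that(1) fs.subspace_0[OF W(1)]] by (simp add: sh_0)
 qed
 have iXY: "u = 0" if "u \<in> W" "shX i0 (shY j0 u) = 0" for u
 proof -
  have "shY j0 u \<in> H I J c (Suc d) d" using that(1) surY by auto
  then have "shY j0 u = 0" using injX[of "shY j0 u" d d] that(2) d(1) by (simp add: D_def)
  then show ?thesis using iY[OF that(1) fs.subspace_0[OF W(1)]] by (simp add: sh_0)
 qed
 \<comment> \<open>Shift by one variable and then invert the shift by \<open>i0\<close>,
   respectively \<open>j0\<close>. The chosen preimage is unique by \<open>iX\<close> and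
   \<open>iY\<close>.\<close>
 define t where "t k u = (case k of Inl i => (SOME v. v \<in> W & shX i0 v = shX i u)
   | Inr j => (SOME v. v \<in> W & shY j0 v = shY j u))" for k :: "nat + nat" and u
 have tX: "t (Inl i) u \<in> W" "shX i0 (t (Inl i) u) = shX i u" if "u \<in> W" for i u
 proof -
  have "shX i u \<in> H I J c d (Suc d)" using H_shX[OF fin(1)] that by (simp add: W_def)
  then have "\<exists>v. v \<in> W & shX i0 v = shX i u" using surX by (metis imageE)
  then have "t (Inl i) u \<in> W & shX i0 (t (Inl i) u) = shX i u"
   unfolding t_def sum.case by (rule someI_ex)
  then show "t (Inl i) u \<in> W" "shX i0 (t (Inl i) u) = shX i u" by auto
 qed
 have tY: "t (Inr i) u \<in> W" "shY j0 (t (Inr i) u) = shY i u" if "u \<in> W" for i u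
 proof -
  have "shY i u \<in> H I J c (Suc d) d" using H_shY[OF fin(2)] that by (simp add: W_def)
  then have "\<exists>v. v \<in> W & shY j0 v = shY i u" using surY by (metis imageE)
  then have "t (Inr i) u \<in> W & shY j0 (t (Inr i) u) = shY i u"
   unfolding t_def sum.case by (rule someI_ex)
  then show "t (Inr i) u \<in> W" "shY j0 (t (Inr i) u) = shY i u" by auto
 qed
 have "\<exists>u\<in>W. u ~= 0 & (\<forall>k\<in>Inl ` I \<union> Inr ` J. \<exists>l. t k u = scl l u)"
 proof (rule common_eigenvector_exists[OF _ W])
  show "finite (Inl ` I \<union> Inr ` J)" using fin by simp
  fix k k' :: "nat + nat" and u v a assume u: "u \<in> W"
  show tW: "t k u \<in> W" using tX(1) tY(1) u by (cases k) auto
  show "t k (u + v) = t k u + t k v" if v: "v \<in> W"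
  proof -
   have uv: "u + v \<in> W" using fs.subspace_add[OF W(1) u v] .
   show ?thesis
   proof (cases k)
    case (Inl i)
    show ?thesis unfolding Inl
     by (rule iX) (use uv u v tX in \<open>auto simp: sh_add intro!: fs.subspace_add[OF W(1)]\<close>)
   next
    case (Inr i)
    show ?thesis unfolding Inr
     by (rule iY) (use uv u v tY in \<open>auto simp: sh_add intro!: fs.subspace_add[OF W(1)]\<close>)
   qed
  qed
  show "t k (scl a u) = scl a (t k u)"
  proof -
   have uv: "scl a u \<in> W" using fs.subspace_scale[OF W(1) u] .
   show ?thesis
   proof (cases k)
    case (Inl i)
    show ?thesis unfolding Inl
     by (rule iX) (use uv u tX in \<open>auto simp: sh_scl intro!: fs.subspace_scale[OF W(1)]\<close>)
   next
    case (Inr i)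
    show ?thesis unfolding Inr
     by (rule iY) (use uv u tY in \<open>auto simp: sh_scl intro!: fs.subspace_scale[OF W(1)]\<close>)
   qed
  qed
  show "t k (t k' u) = t k' (t k u)"
  proof -
   have tt: "t k (t k' u) \<in> W" "t k' (t k u) \<in> W" for k k'
    using tX(1) tY(1) u by (cases k; cases k'; simp)+
   have df: "t k (t k' u) - t k' (t k u) \<in> W" for k k' using fs.subspace_diff[OF W(1)] tt by blast
   \<comment> \<open>Quotients of shifts commute because two injective shifts turn both sides into
     the same double shift.\<close>
   have XX: "t (Inl i) (t (Inl i') u) = t (Inl i') (t (Inl i) u)" for i i'
   proof -
    have "shX i0 (shX i0 (t (Inl i) (t (Inl i') u))) = shX i (shX i' u)" for i i'
     using tX u by (metis sh_commute(1))
    then have "shX i0 (shX i0 (t (Inl i) (t (Inl i') u) - t (Inl i') (t (Inl i) u))) = 0"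
     by (simp add: sh_diff sh_commute(1))
    then show ?thesis using iXX[OF df] by simp
   qed
   have YY: "t (Inr i) (t (Inr i') u) = t (Inr i') (t (Inr i) u)" for i i'
   proof -
    have "shY j0 (shY j0 (t (Inr i) (t (Inr i') u))) = shY i (shY i' u)" for i i'
     using tY u by (metis sh_commute(2))
    then have "shY j0 (shY j0 (t (Inr i) (t (Inr i') u) - t (Inr i') (t (Inr i) u))) = 0"
     by (simp add: sh_diff sh_commute(2))
    then show ?thesis using iYY[OF df] by simp
   qed
   have XY: "t (Inl i) (t (Inr j) u) = t (Inr j) (t (Inl i) u)" for i j
   proof -
    have "shX i0 (shY j0 (t (Inl i) (t (Inr j) u))) = shX i (shY j u)"
     using tX tY u by (metis sh_commute(3))
    moreover have "shX i0 (shY j0 (t (Inr j) (t (Inl i) u))) = shX i (shY j u)"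
     using tX tY u by (metis sh_commute(3))
    ultimately have "shX i0 (shY j0 (t (Inl i) (t (Inr j) u) - t (Inr j) (t (Inl i) u))) = 0"
     by (simp add: sh_diff)
    then show ?thesis using iXY[OF df] by simp
   qed
   show ?thesis
    by (cases k; cases k'; hypsubst; (rule XX | rule YY | rule XY | rule XY[symmetric]))
  qed
 qed
 then obtain u where u: "u \<in> W" "u ~= 0" "\<forall>k\<in>Inl ` I \<union> Inr ` J. \<exists>l. t k u = scl l u" by blast
 have uA: "u \<in> arrays I J (Suc d) (Suc d)" using u by (simp add: W_def H_def)
 have "\<forall>i. \<exists>l. shX i u = scl l (shX i0 u)"
 proof
  fix i
  show "\<exists>l. shX i u = scl l (shX i0 u)"
  proof (cases "i \<in> I")
   case True
   then obtain l where "t (Inl i) u = scl l u" using u(3) by blast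
   then have "shX i u = scl l (shX i0 u)" using tX(2)[OF u(1), of i] by (simp add: sh_scl)
   then show ?thesis by blast
  next
   case False
   then show ?thesis using shX_outside[OF fin(1) uA] by (intro exI[of _ 0]) simp
  qed
 qed
 then obtain la where la: "!!i. shX i u = scl (la i) (shX i0 u)" by metis
 have "\<forall>j. \<exists>l. shY j u = scl l (shY j0 u)"
 proof
  fix j
  show "\<exists>l. shY j u = scl l (shY j0 u)"
  proof (cases "j \<in> J")
   case True
   then obtain l where "t (Inr j) u = scl l u" using u(3) by blast
   then have "shY j u = scl l (shY j0 u)" using tY(2)[OF u(1), of j] by (simp add: sh_scl)
   then show ?thesis by blast
  next
   case False
   then show ?thesis using shY_outside[OF fin(2) uA] by (intro exI[of _ 0]) simp
  qed
 qed
 then obtain mu where mu: "!!j. shY j u = scl (mu j) (shY j0 u)" by metis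
 let ?z = "shX i0 (shY j0 u)"
 have z: "?z ~= 0" using iXY u by blast
 \<comment> \<open>The eigenvalue at \<open>i0\<close> is in fact 1, since both sides shift by
   \<open>i0\<close>; likewise at \<open>j0\<close>.\<close>
 have "la i0 ~= 0" using la[of i0] z by (metis fs.scale_zero_left sh_0(2) sh_commute(3))
 moreover have "mu j0 ~= 0" using mu[of j0] z by (metis fs.scale_zero_left sh_0(1))
 moreover have "i0 < n" "j0 < p" using i0 j0 g by (auto simp: good_def)
 moreover have "(\<Sum>i<n. \<Sum>j<p. F l i j * la i * mu j) = 0" if "l < c" for l
 proof -
  have "0 = fm l u" using u(1) that by (simp add: W_def H_def)
  also have "\<dots> = (\<Sum>i<n. \<Sum>j<p. scl (F l i j * la i * mu j) ?z)"
   unfolding fm_def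
  proof (intro sum.cong refl)
   fix i j
   have "shX i (shY j u) = scl (la i * mu j) ?z"
    by (subst mu, subst sh_scl, subst sh_commute(3), subst la, subst sh_scl, subst sh_commute(3)[symmetric])
     (simp add: mult.commute)
   then show "scl (F l i j) (shX i (shY j u)) = scl (F l i j * la i * mu j) ?z"
    by (simp add: mult.assoc)
  qed
  also have "\<dots> = scl (\<Sum>i<n. \<Sum>j<p. F l i j * la i * mu j) ?z"
   by (simp only: fs.scale_sum_left)
  finally have "scl (\<Sum>i<n. \<Sum>j<p. F l i j * la i * mu j) ?z = 0" by (rule sym)
  then show ?thesis using z unfolding fs.scale_eq_0_iff by blast
 qed
 ultimately show ?thesis by blast
qed

end

text \<open>The values of \<open>T\<close> are evaluated at points that are coordinates for their
  span. Each evaluation is a bilinear form in the coefficients of the two arguments, and if the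
  bound failed there would be few enough of them for a common zero.\<close>

theorem hopf:
 fixes T :: "('i => 'k::alg_closed_field) => ('j => 'k) => 'r => 'k"
 assumes T: "!!b. flin (\<lambda>a. T a b)" "!!a. flin (T a)"
  and A: "fsubspace A" "ffin_dim A" "A ~= {0}" and B: "fsubspace B" "ffin_dim B" "B ~= {0}"
  and ns: "!!a b. a \<in> A ==> b \<in> B ==> T a b = 0 ==> a = 0 \<or> b = 0"
 shows "fdim A + fdim B <= fdim (fspan {T a b |a b. a \<in> A & b \<in> B}) + 1"
proof (rule ccontr)
 let ?R = "fspan {T a b |a b. a \<in> A & b \<in> B}"
 assume neg: "\<not> ?thesis"
 obtain qa pa where a: "\<forall>i<fdim A. pa i \<in> A" "\<forall>i<fdim A. \<forall>j<fdim A. pa i (qa j) = (if i = j then 1 else 0)"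
   "\<forall>f\<in>A. f = (\<Sum>i<fdim A. scl (f (qa i)) (pa i))"
  using dual_points[OF A(1,2) refl] by blast
 obtain qb pb where b: "\<forall>i<fdim B. pb i \<in> B" "\<forall>i<fdim B. \<forall>j<fdim B. pb i (qb j) = (if i = j then 1 else 0)"
   "\<forall>f\<in>B. f = (\<Sum>i<fdim B. scl (f (qb i)) (pb i))"
  using dual_points[OF B(1,2) refl] by blast
 have Tsum: "T (\<Sum>i\<in>M. scl (u i) (x i)) (\<Sum>j\<in>N. scl (v j) (y j))
   = (\<Sum>i\<in>M. \<Sum>j\<in>N. scl (u i * v j) (T (x i) (y j)))" for u v x y M N
 proof -
  interpret l: Vector_Spaces.linear scl scl "\<lambda>a. T a b" for b by (rule T(1))
  interpret r: Vector_Spaces.linear scl scl "T a" for a by (rule T(2))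
  show ?thesis
   by (subst sum.swap) (simp add: l.sum l.scale r.sum r.scale fs.scale_sum_right mult.commute)
 qed
 have "?R <= fspan ((\<lambda>(i, j). T (pa i) (pb j)) ` ({..<fdim A} \<times> {..<fdim B}))"
 proof (rule fs.span_minimal[OF _ fs.subspace_span], clarify)
  fix x y assume "x \<in> A" "y \<in> B"
  then have "T x y = T (\<Sum>i<fdim A. scl (x (qa i)) (pa i)) (\<Sum>i<fdim B. scl (y (qb i)) (pb i))"
   by (intro arg_cong2[where f = T] bspec[OF a(3)] bspec[OF b(3)])
  also have "\<dots> \<in> fspan ((\<lambda>(i, j). T (pa i) (pb j)) ` ({..<fdim A} \<times> {..<fdim B}))"
   unfolding Tsum by (intro fs.span_sum fs.span_scale fs.span_base) auto
  finally show "T x y \<in> fspan ((\<lambda>(i, j). T (pa i) (pb j)) ` ({..<fdim A} \<times> {..<fdim B}))" .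
 qed
 then have fR: "ffin_dim ?R" by (rule fs.fin_dimI[rotated]) auto
 obtain q r where R: "\<forall>f\<in>?R. f = (\<Sum>i<fdim ?R. scl (f (q i)) (r i))"
  using dual_points[OF fs.subspace_span fR refl] by (elim exE conjE) (rule that)
 have pos: "1 <= fdim A" "1 <= fdim B"
  using fs.dim_eq_0_fin[OF A(1,2)] A(3) fs.dim_eq_0_fin[OF B(1,2)] B(3) by (simp_all add: Suc_le_eq)
 interpret bilinear_system "\<lambda>l i j. T (pa i) (pb j) (q l)" "fdim A" "fdim B" "fdim ?R"
  by unfold_locales (use pos neg in auto)
 obtain u v where uv: "\<exists>i<fdim A. u i ~= 0" "\<exists>j<fdim B. v j ~= 0"
   "\<forall>l<fdim ?R. (\<Sum>i<fdim A. \<Sum>j<fdim B. T (pa i) (pb j) (q l) * u i * v j) = 0"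
  using common_zero by blast
 let ?x = "\<Sum>i<fdim A. scl (u i) (pa i)" and ?y = "\<Sum>j<fdim B. scl (v j) (pb j)"
 have x: "?x \<in> A" using a(1) by (intro fs.subspace_sum fs.subspace_scale A(1)) auto
 have y: "?y \<in> B" using b(1) by (intro fs.subspace_sum fs.subspace_scale B(1)) auto
 have xq: "?x (qa j) = u j" if "j < fdim A" for j
 proof -
  have "?x (qa j) = (\<Sum>i<fdim A. if i = j then u i else 0)"
   unfolding sum_fun_apply fun_app using a(2) that by (intro sum.cong) auto
  then show ?thesis using that by simp
 qed
 have yq: "?y (qb j) = v j" if "j < fdim B" for j
 proof -
  have "?y (qb j) = (\<Sum>i<fdim B. if i = j then v i else 0)"
   unfolding sum_fun_apply fun_app using b(2) that by (intro sum.cong) auto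
  then show ?thesis using that by simp
 qed
 define x where "x = ?x"
 define y where "y = ?y"
 obtain i where i: "i < fdim A" "u i ~= 0" using uv(1) by blast
 have x0: "x ~= 0" using xq[OF i(1)] i(2) unfolding x_def[symmetric] by (auto simp: fun_app)
 obtain j where j: "j < fdim B" "v j ~= 0" using uv(2) by blast
 have y0: "y ~= 0" using yq[OF j(1)] j(2) unfolding y_def[symmetric] by (auto simp: fun_app)
 have xy: "x \<in> A" "y \<in> B" using x y by (simp_all only: x_def y_def)
 have "T x y = 0"
 proof -
  have "T x y \<in> ?R" by (rule fs.span_base) (use xy in blast)
  then have "T x y = (\<Sum>l<fdim ?R. scl (T x y (q l)) (r l))" by (rule bspec[OF R])
  also have "\<dots> = 0"
  proof (rule sum.neutral, intro ballI)
   fix l assume "l \<in> {..<fdim ?R}"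
   then have "(\<Sum>i<fdim A. \<Sum>j<fdim B. T (pa i) (pb j) (q l) * u i * v j) = 0" using uv(3) by blast
   moreover have "T x y (q l) = (\<Sum>i<fdim A. \<Sum>j<fdim B. T (pa i) (pb j) (q l) * u i * v j)"
    unfolding Tsum sum_fun_apply fun_app x_def y_def by (intro sum.cong refl) simp
   ultimately show "scl (T x y (q l)) (r l) = 0" by simp
  qed
  finally show ?thesis .
 qed
 then show False using ns[OF xy] x0 y0 by blast
qed

declare fun_app [simp]

section \<open>A rank bound for families of alternating forms\<close>

text \<open>\<open>R\<close> is an abstract space of alternating forms on \<open>V\<close>, read
  through \<open>ev\<close>. The last assumption is the constraint coming from K_3: few forms have a
  given proper subspace in their radical. The sets \<open>A0\<close> and \<open>B0\<close>, on which
  \<open>T\<close> takes values in \<open>R\<close>, stay fixed while the induction shrinks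
  \<open>A\<close> and \<open>B\<close>.\<close>

locale alternating_family =
 fixes T :: "('i => 'k::alg_closed_field) => ('j => 'k) => 'r => 'k"
  and ev :: "('r => 'k) => ('x => 'k) => ('x => 'k) => 'k"
  and V :: "('x => 'k) set" and R :: "('r => 'k) set"
  and A0 :: "('i => 'k) set" and B0 :: "('j => 'k) set"
 assumes T_left: "!!b. flin (\<lambda>a. T a b)"
  and T_right: "!!a. flin (T a)"
  and ev_add: "ev (f + g) x y = ev f x y + ev g x y" "ev f (x + x') y = ev f x y + ev f x' y"
   "ev f x (y + y') = ev f x y + ev f x y'"
  and ev_scl: "ev (scl c f) x y = c * ev f x y" "ev f (scl c x) y = c * ev f x y"
   "ev f x (scl c y) = c * ev f x y"
  and ev_alt: "f \<in> R ==> ev f x x = 0"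
  and ev_zero: "f \<in> R ==> (!!x y. x \<in> V ==> y \<in> V ==> ev f x y = 0) ==> f = 0"
  and V: "fsubspace V" "ffin_dim V"
  and R: "fsubspace R" "ffin_dim R" "a \<in> A0 ==> b \<in> B0 ==> T a b \<in> R"
  and pos: "fsubspace N ==> N <= V ==> N ~= V ==>
    fdim {f\<in>R. \<forall>x\<in>N. \<forall>y\<in>V. ev f x y = 0} + fdim N < fdim V"
begin

lemma ev_0 [simp]: "ev 0 x y = 0" "ev f 0 y = 0" "ev f x 0 = 0"
 using ev_scl(1)[of 0 0 x y] ev_scl(2)[of f 0 0 y] ev_scl(3)[of f x 0 0]
 by (simp_all add: scl_def zero_fun_def)

lemma T_add: "T (a + a') b = T a b + T a' b" "T a (b + b') = T a b + T a b'"
 and T_scl: "T (scl c a) b = scl c (T a b)" "T a (scl c b) = scl c (T a b)"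
 and T_0 [simp]: "T 0 b = 0" "T a 0 = 0"
proof -
 interpret l: Vector_Spaces.linear scl scl "\<lambda>a. T a b" by (rule T_left)
 interpret r: Vector_Spaces.linear scl scl "T a" by (rule T_right)
 show "T (a + a') b = T a b + T a' b" "T a (b + b') = T a b + T a b'"
  "T (scl c a) b = scl c (T a b)" "T a (scl c b) = scl c (T a b)"
  "T 0 b = 0" "T a 0 = 0"
  using l.add r.add l.scale r.scale l.zero r.zero by auto
qed

lemma ev_skew: "f \<in> R ==> ev f x y = - ev f y x"
 using ev_alt[of f "x + y"] ev_alt[of f x] ev_alt[of f y]
 by (simp add: ev_add eq_neg_iff_add_eq_0 add.commute)

text \<open>The bilinear pairing of the tensor products of \<open>A\<close> and of \<open>B\<close>
  with \<open>V\<close> that the family induces, as a matrix indexed by pure tensors;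
  \<open>s\<close> is its rank.\<close>

definition tau :: "('i => 'k) \<times> ('x => 'k) => ('j => 'k) \<times> ('x => 'k) => 'k" where
 "tau = (\<lambda>(a, x) (b, y). ev (T a b) x y)"

definition s :: "('i => 'k) set => ('j => 'k) set => nat" where
 "s A B = rk tau (A \<times> V) (B \<times> V)"

definition row :: "(('j => 'k) \<times> ('x => 'k)) set => ('i => 'k) \<times> ('x => 'k) => ('j => 'k) \<times> ('x => 'k) => 'k" where
 "row Q p = (\<lambda>q. if q \<in> Q then tau p q else 0)"

lemma linear_row: "flin (\<lambda>a. row Q (a, x))" "flin (\<lambda>x. row Q (a, x))"
 by (rule linear_fsI; force simp: row_def tau_def T_add ev_add T_scl ev_scl)+

lemma rows_row: "rows tau P Q = fspan (row Q ` P)"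
 by (simp add: rows_def row_def[abs_def])

lemma fin_rows:
 assumes "ffin_dim A"
 shows "ffin_dim (rows tau (A \<times> V) Q)"
proof -
 obtain F where F: "finite F" "A <= fspan F" using assms by (auto simp: fs.fin_dim_def)
 obtain G where G: "finite G" "V <= fspan G" using V(2) by (auto simp: fs.fin_dim_def)
 let ?S = "fspan (row Q ` (F \<times> G))"
 have 1: "row Q (a, x) \<in> ?S" if "a \<in> F" "x \<in> V" for a x
 proof -
  have "row Q (a, x) \<in> (\<lambda>x. row Q (a, x)) ` fspan G" using that G by auto
  also have "\<dots> = fspan ((\<lambda>x. row Q (a, x)) ` G)" by (rule linear_fs_span[OF linear_row(2)])
  also have "\<dots> <= ?S" by (rule fs.span_mono) (use that in auto)
  finally show ?thesis .
 qed
 have 2: "row Q (a, x) \<in> ?S" if "a \<in> A" "x \<in> V" for a x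
 proof -
  have "row Q (a, x) \<in> (\<lambda>a. row Q (a, x)) ` fspan F" using that F by auto
  also have "\<dots> = fspan ((\<lambda>a. row Q (a, x)) ` F)" by (rule linear_fs_span[OF linear_row(1)])
  also have "\<dots> <= ?S" by (rule fs.span_minimal[OF _ fs.subspace_span]) (use that 1 in auto)
  finally show ?thesis .
 qed
 have "rows tau (A \<times> V) Q <= ?S" unfolding rows_row
  by (rule fs.span_minimal[OF _ fs.subspace_span]) (use 2 in auto)
 then show ?thesis by (rule fs.fin_dimI[rotated]) (use F G in auto)
qed

definition annA :: "('i => 'k) set => ('j => 'k) set => ('x => 'k) => ('i => 'k) set" where
 "annA A B x = {a\<in>A. \<forall>b\<in>B. \<forall>y\<in>V. ev (T a b) x y = 0}"
definition annB :: "('i => 'k) set => ('j => 'k) set => ('x => 'k) => ('j => 'k) set" where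
 "annB A B x = {b\<in>B. \<forall>a\<in>A. \<forall>y\<in>V. ev (T a b) x y = 0}"

lemma subspace_annA: "fsubspace A ==> fsubspace (annA A B x)"
 by (auto simp: fs.subspace_def annA_def T_add ev_add T_scl ev_scl)
lemma subspace_annB: "fsubspace B ==> fsubspace (annB A B x)"
 by (auto simp: fs.subspace_def annB_def T_add ev_add T_scl ev_scl)

text \<open>The slice at a fixed \<open>x\<close>: sending \<open>a\<close> to the row of
  \<open>(a, x)\<close> has kernel \<open>annA A B x\<close>.\<close>

lemma rk_row_A:
 assumes "fsubspace A" "ffin_dim A" "x \<in> V"
 shows "fdim A <= rk tau (A \<times> {x}) (B \<times> V) + fdim (annA A B x)"
proof -
 have "{a\<in>A. row (B \<times> V) (a, x) = 0} = annA A B x"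
  by (auto simp: annA_def row_def tau_def fun_eq_iff)
 moreover have "(\<lambda>a. row (B \<times> V) (a, x)) ` A <= rows tau (A \<times> {x}) (B \<times> V)"
  unfolding rows_row by (auto intro!: fs.span_base)
 moreover have "ffin_dim (rows tau (A \<times> {x}) (B \<times> V))"
  using rk_mono(1)[OF _ subset_refl fin_rows[OF assms(2)], of "A \<times> {x}" "B \<times> V"] assms(3) by auto
 ultimately show ?thesis
  using rk_ge_image[OF linear_row(1) assms(1,2), of "B \<times> V" x tau "A \<times> {x}" "B \<times> V"] by simp
qed

text \<open>The slice for columns, through the transposed matrix. Skew symmetry moves
  \<open>x\<close> to the first argument, where \<open>annB\<close> has it.\<close>

lemma rk_col_B:
 assumes "fsubspace B" "ffin_dim B" "ffin_dim A" "x \<in> V" "A <= A0" "B <= B0"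
 shows "fdim B <= rk tau (A \<times> V) (B \<times> {x}) + fdim (annB A B x)"
proof -
 let ?L = "\<lambda>b. \<lambda>p. if p \<in> A \<times> V then tau p (b, x) else 0"
 let ?t = "\<lambda>q p. tau p q"
 have f1: "ffin_dim (rows tau (A \<times> V) (B \<times> {x}))" by (rule fin_rows[OF assms(3)])
 have lin: "flin ?L"
  by (rule linear_fsI; force simp: tau_def T_add ev_add T_scl ev_scl)
 have "{b\<in>B. ?L b = 0} = annB A B x"
 proof -
  have "ev (T a b) y x = 0 \<longleftrightarrow> ev (T a b) x y = 0" if "a \<in> A" "b \<in> B" for a b y
   using ev_skew[OF R(3)[OF subsetD[OF assms(5) that(1)] subsetD[OF assms(6) that(2)]], of x y] by simp
  then show ?thesis by (auto simp: annB_def tau_def fun_eq_iff)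
 qed
 moreover have "?L ` B <= rows ?t (B \<times> {x}) (A \<times> V)"
  unfolding rows_def by (auto intro!: fs.span_base)
 ultimately have "fdim B <= rk ?t (B \<times> {x}) (A \<times> V) + fdim (annB A B x)"
  using rk_ge_image[OF lin assms(1,2), of ?t "B \<times> {x}" "A \<times> V"] rk_transpose(1)[OF f1] by simp
 then show ?thesis using rk_transpose(2)[OF f1] by simp
qed

text \<open>With \<open>a\<close> fixed and the vector varying, the kernel is the common radical of
  the forms \<open>T a b\<close>.\<close>

lemma rk_row_X:
 assumes "a \<in> A" "ffin_dim A"
 shows "fdim V <= s A B + fdim {x\<in>V. \<forall>b\<in>B. \<forall>y\<in>V. ev (T a b) x y = 0}"
proof -
 have "{x\<in>V. row (B \<times> V) (a, x) = 0} = {x\<in>V. \<forall>b\<in>B. \<forall>y\<in>V. ev (T a b) x y = 0}"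
  by (auto simp: row_def tau_def fun_eq_iff)
 moreover have "(\<lambda>x. row (B \<times> V) (a, x)) ` V <= rows tau (A \<times> V) (B \<times> V)"
  unfolding rows_row using assms by (auto intro!: fs.span_base)
 ultimately show ?thesis
  using rk_ge_image[OF linear_row(2) V, of "B \<times> V" a tau "A \<times> V" "B \<times> V"] fin_rows[OF assms(2)]
  by (simp add: s_def)
qed

lemma rk_col_X:
 assumes "b \<in> B" "ffin_dim A" "A <= A0" "B <= B0"
 shows "fdim V <= s A B + fdim {x\<in>V. \<forall>a\<in>A. \<forall>y\<in>V. ev (T a b) x y = 0}"
proof -
 let ?L = "\<lambda>x. \<lambda>p. if p \<in> A \<times> V then tau p (b, x) else 0"
 let ?t = "\<lambda>q p. tau p q"
 have f1: "ffin_dim (rows tau (A \<times> V) (B \<times> V))" by (rule fin_rows[OF assms(2)])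
 have lin: "flin ?L"
  by (rule linear_fsI; force simp: tau_def ev_add ev_scl)
 have "{x\<in>V. ?L x = 0} = {x\<in>V. \<forall>a\<in>A. \<forall>y\<in>V. ev (T a b) x y = 0}"
 proof -
  have "ev (T a b) y x = 0 \<longleftrightarrow> ev (T a b) x y = 0" if "a \<in> A" for a x y
   using ev_skew[OF R(3)[OF subsetD[OF assms(3) that] subsetD[OF assms(4,1)]], of x y] by simp
  then show ?thesis by (auto simp: tau_def fun_eq_iff)
 qed
 moreover have "?L ` V <= rows ?t (B \<times> V) (A \<times> V)"
  unfolding rows_def using assms(1) by (auto intro!: fs.span_base)
 ultimately have "fdim V <= rk ?t (B \<times> V) (A \<times> V) + fdim {x\<in>V. \<forall>a\<in>A. \<forall>y\<in>V. ev (T a b) x y = 0}"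
  using rk_ge_image[OF lin V, of ?t "B \<times> V" "A \<times> V"] rk_transpose(1)[OF f1] by simp
 then show ?thesis using rk_transpose(2)[OF f1] by (simp add: s_def)
qed

text \<open>If \<open>T\<close> has a zero with nonzero arguments, the matrix is block triangular
  with two smaller faithful families on the diagonal. Otherwise Hopf's theorem and the constraint on
  radicals make \<open>V\<close> large compared with \<open>A\<close> and \<open>B\<close>, so that
  the slice of one single element already has enough rank; alternation is used to control the
  radicals of such slices.\<close>

theorem rank_bound:
 assumes "fsubspace A" "ffin_dim A" "A ~= {0}" "A <= A0"
  "fsubspace B" "ffin_dim B" "B ~= {0}" "B <= B0"
  "!!a. a \<in> A ==> (!!b. b \<in> B ==> T a b = 0) ==> a = 0"
  "!!b. b \<in> B ==> (!!a. a \<in> A ==> T a b = 0) ==> b = 0"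
 shows "fdim A + fdim B <= s A B"
 using assms
proof (induction "fdim A + fdim B" arbitrary: A B rule: less_induct)
 case less
 note sA = less.prems(1) and fA = less.prems(2) and sB = less.prems(5) and fB = less.prems(6)
  and fA0 = less.prems(9) and fB0 = less.prems(10)
 have fin: "ffin_dim (rows tau (A \<times> V) (B \<times> V))" by (rule fin_rows[OF fA])
 have smono: "s A' B' <= s A B" if "A' <= A" "B' <= B" for A' B'
  unfolding s_def by (rule rk_mono[OF _ _ fin]) (use that in auto)
 show ?case
 proof (cases "\<exists>a0\<in>A. \<exists>b0\<in>B. a0 ~= 0 & b0 ~= 0 & T a0 b0 = 0")
  case True
  then obtain a0 b0 where ab: "a0 \<in> A" "b0 \<in> B" "a0 ~= 0" "b0 ~= 0" "T a0 b0 = 0" by blast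
  \<comment> \<open>\<open>A1\<close> and \<open>B1\<close> annihilate each other, and the pairs
    (\<open>A1\<close>, \<open>B2\<close>) and (\<open>A2\<close>, \<open>B1\<close>) are faithful
    again: an element of \<open>B2\<close> killed by \<open>a0\<close> lies in \<open>B1\<close>, an
    element of \<open>A2\<close> killed by \<open>B1\<close> lies in \<open>A1\<close>.\<close>
  define B1 where "B1 = {b\<in>B. T a0 b = 0}"
  define A1 where "A1 = {a\<in>A. \<forall>b\<in>B1. T a b = 0}"
  have sub: "fsubspace A1" "fsubspace B1" using sA sB
   by (auto simp: fs.subspace_def A1_def B1_def T_add T_scl)
  have le: "A1 <= A" "B1 <= B" by (auto simp: A1_def B1_def)
  have a01: "a0 \<in> A1" "b0 \<in> B1" using ab by (auto simp: A1_def B1_def)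
  obtain A2 where A2: "fsubspace A2" "A2 <= A" "A1 \<inter> A2 = {0}" "!!v. v \<in> A ==> \<exists>s\<in>A1. \<exists>t\<in>A2. v = s + t"
    "fdim A = fdim A1 + fdim A2"
   using fs.complement_exists[OF sub(1) sA le(1) fA] by blast
  obtain B2 where B2: "fsubspace B2" "B2 <= B" "B1 \<inter> B2 = {0}" "!!v. v \<in> B ==> \<exists>s\<in>B1. \<exists>t\<in>B2. v = s + t"
    "fdim B = fdim B1 + fdim B2"
   using fs.complement_exists[OF sub(2) sB le(2) fB] by blast
  have fd: "ffin_dim A1" "ffin_dim A2" "ffin_dim B1" "ffin_dim B2"
   using fs.fin_dim_mono fA fB le A2(2) B2(2) by blast+
  have A2n: "A2 ~= {0}"
  proof
   assume "A2 = {0}"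
   then have "A <= A1" using A2(4) by fastforce
   then have "b0 = 0" using fB0[OF ab(2)] a01 by (auto simp: A1_def)
   then show False using ab by simp
  qed
  have B2n: "B2 ~= {0}"
  proof
   assume "B2 = {0}"
   then have "B <= B1" using B2(4) by fastforce
   then have "a0 = 0" using fA0[OF ab(1)] by (auto simp: B1_def)
   then show False using ab by simp
  qed
  have d1: "0 < fdim A1" "0 < fdim B1" using a01 ab(3,4) fs.dim_eq_0_fin fd sub by fastforce+
  have d2: "0 < fdim A2" "0 < fdim B2" using A2n B2n fs.dim_eq_0_fin fd A2(1) B2(1) by auto
  have z: "T a b = 0" if "a \<in> A1" "b \<in> B1" for a b using that by (auto simp: A1_def)
  have i1: "fdim A1 + fdim B2 <= s A1 B2"
  proof (rule less.hyps)
   show "fdim A1 + fdim B2 < fdim A + fdim B" using d1 d2 A2(5) B2(5) by simp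
   show "A1 ~= {0}" "A1 <= A0" "B2 <= B0" using a01 ab le B2(2) less.prems by auto
   show "a = 0" if a: "a \<in> A1" and h: "!!b. b \<in> B2 ==> T a b = 0" for a
   proof (rule fA0)
    show "a \<in> A" using a le by auto
    show "T a b = 0" if "b \<in> B" for b using B2(4)[OF that] a h z by (auto simp: T_add)
   qed
   show "b = 0" if b: "b \<in> B2" and h: "!!a. a \<in> A1 ==> T a b = 0" for b
   proof -
    have "b \<in> B1" using h[OF a01(1)] b B2(2) by (auto simp: B1_def)
    then show ?thesis using b B2(3) by auto
   qed
  qed (use sub fd B2 B2n in auto)
  have i2: "fdim A2 + fdim B1 <= s A2 B1"
  proof (rule less.hyps)
   show "fdim A2 + fdim B1 < fdim A + fdim B" using d1 d2 A2(5) B2(5) by simp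
   show "B1 ~= {0}" "A2 <= A0" "B1 <= B0" using a01 ab le A2(2) less.prems by auto
   show "a = 0" if a: "a \<in> A2" and h: "!!b. b \<in> B1 ==> T a b = 0" for a
   proof -
    have "a \<in> A1" using h a A2(2) by (auto simp: A1_def)
    then show ?thesis using a A2(3) by auto
   qed
   show "b = 0" if b: "b \<in> B1" and h: "!!a. a \<in> A2 ==> T a b = 0" for b
   proof (rule fB0)
    show "b \<in> B" using b le by auto
    show "T a b = 0" if "a \<in> A" for a using A2(4)[OF that] b h z by (auto simp: T_add)
   qed
  qed (use sub fd A2 A2n in auto)
  have "rk tau (A1 \<times> V) (B \<times> V) + rk tau (A \<times> V) (B1 \<times> V) <= rk tau (A \<times> V) (B \<times> V)"
   by (rule rk_zero_block) (use le fin z in \<open>auto simp: tau_def\<close>)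
  moreover have "rk tau (A1 \<times> V) (B2 \<times> V) <= rk tau (A1 \<times> V) (B \<times> V)"
   by (rule rk_mono(2)) (use B2(2) fin_rows[OF fd(1)] in auto)
  moreover have "rk tau (A2 \<times> V) (B1 \<times> V) <= rk tau (A \<times> V) (B1 \<times> V)"
   by (rule rk_mono(2)) (use A2(2) fin_rows[OF fA] in auto)
  ultimately show ?thesis using i1 i2 A2(5) B2(5) by (simp add: s_def)
 next
  case False
  then have ns: "!!a b. a \<in> A ==> b \<in> B ==> T a b = 0 ==> a = 0 \<or> b = 0" by blast
  \<comment> \<open>The common radical. Since every value of \<open>T\<close> has it in its radical,
    the constraint bounds the span of the values; with Hopf's inequality this leaves dim A + dim B +
    dim \<open>X0\<close> <= dim V.\<close>
  define X0 where "X0 = {x\<in>V. \<forall>a\<in>A. \<forall>b\<in>B. \<forall>y\<in>V. ev (T a b) x y = 0}"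
  obtain a0 b0 where ab: "a0 \<in> A" "b0 \<in> B" "a0 ~= 0" "b0 ~= 0"
   using less.prems(3,7) fs.subspace_0[OF sA] fs.subspace_0[OF sB] by auto
  have TR: "T a b \<in> R" if "a \<in> A" "b \<in> B" for a b using R(3) that less.prems(4,8) by auto
  have X0: "fsubspace X0" "X0 <= V" using V(1) by (auto simp: fs.subspace_def X0_def ev_add ev_scl)
  have X0n: "X0 ~= V"
  proof
   assume "X0 = V"
   then have "T a0 b0 = 0" using ev_zero[OF TR[OF ab(1,2)]] ab by (auto simp: X0_def)
   then show False using ns ab by blast
  qed
  let ?R1 = "fspan {T a b |a b. a \<in> A & b \<in> B}"
  let ?RX = "{f\<in>R. \<forall>x\<in>X0. \<forall>y\<in>V. ev f x y = 0}"
  have RX: "fsubspace ?RX" using R(1) by (auto simp: fs.subspace_def ev_add ev_scl)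
  have "?R1 <= ?RX" by (rule fs.span_minimal[OF _ RX]) (use TR in \<open>auto simp: X0_def\<close>)
  then have "fdim ?R1 <= fdim ?RX"
   by (rule fs.dim_mono_fin) (rule fs.fin_dim_mono[OF _ R(2)], auto)
  then have "fdim ?R1 + fdim X0 < fdim V" using pos[OF X0 X0n] by linarith
  moreover have "fdim A + fdim B <= fdim ?R1 + 1"
   by (rule hopf[OF T_left T_right sA fA less.prems(3) sB fB less.prems(7)]) (rule ns)
  ultimately have D: "fdim A + fdim B + fdim X0 <= fdim V" by linarith
  show ?thesis
  proof (rule ccontr)
   assume "\<not> ?thesis"
   then have lt: "s A B < fdim A + fdim B" by simp
   \<comment> \<open>Let alpha and beta be the dimensions of \<open>annA\<close> and
     \<open>annB\<close> at \<open>x\<close>. The zero blocks give s >= (dim A - alpha) + (dim B -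
     beta), and with the induction hypothesis s >= 2 dim A - alpha + beta if beta > 0 and s >= 2 dim
     B - beta + alpha if alpha > 0. Both zero contradicts the first bound, both positive the sum of
     the other two; so exactly one vanishes, and it belongs to the smaller side.\<close>
   have main: "(annA A B x = {0} & fdim A < fdim B) \<or> (annB A B x = {0} & fdim B < fdim A)"
    if x: "x \<in> V" "x ~: X0" for x
   proof -
    let ?A = "annA A B x" and ?B = "annB A B x"
    have le: "?A <= A" "?B <= B" by (auto simp: annA_def annB_def)
    have sub: "fsubspace ?A" "fsubspace ?B" using subspace_annA subspace_annB sA sB by auto
    have fd: "ffin_dim ?A" "ffin_dim ?B" using fs.fin_dim_mono le fA fB by blast+
    have ne: "?A ~= A" "?B ~= B" using x by (auto simp: annA_def annB_def X0_def)
    have dl: "fdim ?A < fdim A" "fdim ?B < fdim B"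
     using fs.subspace_eq_dim[OF sub(1) le(1) fA] fs.subspace_eq_dim[OF sub(2) le(2) fB] ne
     by linarith+
    have rA: "fdim A <= rk tau (A \<times> {x}) (B \<times> V) + fdim ?A" by (rule rk_row_A[OF sA fA x(1)])
    have rB: "fdim B <= rk tau (A \<times> V) (B \<times> {x}) + fdim ?B"
     by (rule rk_col_B[OF sB fB fA x(1) less.prems(4,8)])
    \<comment> \<open>Alternation enters here: entries with the same \<open>x\<close> on both sides
      vanish.\<close>
    have E1: "rk tau (A \<times> {x}) (B \<times> V) + rk tau (A \<times> V) (B \<times> {x}) <= s A B"
     unfolding s_def by (rule rk_zero_block) (use x fin ev_alt TR in \<open>auto simp: tau_def\<close>)
    have E2: "rk tau (A \<times> {x}) (B \<times> V) + rk tau (A \<times> V) (?B \<times> V) <= s A B"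
     unfolding s_def by (rule rk_zero_block) (use x fin le in \<open>auto simp: tau_def annB_def\<close>)
    have E3: "rk tau (?A \<times> V) (B \<times> V) + rk tau (A \<times> V) (B \<times> {x}) <= s A B"
     unfolding s_def
    proof (rule rk_zero_block[OF _ _ fin])
     fix p q assume p: "p \<in> ?A \<times> V" and q: "q \<in> B \<times> {x}"
     obtain a y b where "p = (a, y)" "q = (b, x)" using p q by auto
     then show "tau p q = 0" using p q ev_skew[OF TR, of a b y x]
      by (auto simp: tau_def annA_def)
    qed (use x le in auto)
    have iB: "fdim A + fdim ?B <= s A ?B" if nz: "?B ~= {0}"
    proof (rule less.hyps)
     obtain b1 where b1: "b1 \<in> ?B" "b1 ~= 0" using nonzero_element[OF sub(2) nz] by blast
     show "fdim A + fdim ?B < fdim A + fdim B" using dl by simp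
     show "a = 0" if a: "a \<in> A" and h: "!!b. b \<in> ?B ==> T a b = 0" for a
      using ns[OF a _ h[OF b1(1)]] b1 le by auto
     show "b = 0" if b: "b \<in> ?B" and h: "!!a. a \<in> A ==> T a b = 0" for b
      using ns[OF ab(1) _ h[OF ab(1)]] ab le b by auto
    qed (use sA fA less.prems(3,4,8) sub fd nz le in auto)
    have iA: "fdim ?A + fdim B <= s ?A B" if nz: "?A ~= {0}"
    proof (rule less.hyps)
     obtain a1 where a1: "a1 \<in> ?A" "a1 ~= 0" using nonzero_element[OF sub(1) nz] by blast
     show "fdim ?A + fdim B < fdim A + fdim B" using dl by simp
     show "b = 0" if b: "b \<in> B" and h: "!!a. a \<in> ?A ==> T a b = 0" for b
      using ns[OF _ b h[OF a1(1)]] a1 le by auto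
     show "a = 0" if a: "a \<in> ?A" and h: "!!b. b \<in> B ==> T a b = 0" for a
      using ns[OF _ ab(2) h[OF ab(2)]] ab le a by auto
    qed (use sB fB less.prems(4,7,8) sub fd nz le in auto)
    have z: "fdim ?A = 0" if "?A = {0}" using that fs.dim_zero by simp
    have z': "fdim ?B = 0" if "?B = {0}" using that fs.dim_zero by simp
    have rs: "s A ?B = rk tau (A \<times> V) (?B \<times> V)" "s ?A B = rk tau (?A \<times> V) (B \<times> V)"
     by (simp_all add: s_def)
    show ?thesis
    proof (cases "?A = {0}")
     case True
     then show ?thesis using z E1 E2 iB rA rB lt dl z' rs by (cases "?B = {0}") linarith+
    next
     case False
     then show ?thesis using z' E1 E2 E3 iA iB rA rB lt dl rs by (cases "?B = {0}") linarith+
    qed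
   qed
   obtain x1 where x1: "x1 \<in> V" "x1 ~: X0" using X0n X0(2) by auto
   show False
   proof (cases "fdim A < fdim B")
    case True
    \<comment> \<open>The common radical of the forms \<open>T a0 b\<close> is now contained in
      \<open>X0\<close>, so the slice at \<open>a0\<close> alone has rank at least dim V - dim
      \<open>X0\<close>, which is too much.\<close>
    then have *: "annA A B x = {0}" if "x \<in> V" "x ~: X0" for x using main[OF that] by auto
    have "{x\<in>V. \<forall>b\<in>B. \<forall>y\<in>V. ev (T a0 b) x y = 0} <= X0"
    proof clarify
     fix x assume x: "x \<in> V" "\<forall>b\<in>B. \<forall>y\<in>V. ev (T a0 b) x y = 0"
     then have "a0 \<in> annA A B x" using ab by (auto simp: annA_def)
     then show "x \<in> X0" using * x ab by blast
    qed
    then have "fdim {x\<in>V. \<forall>b\<in>B. \<forall>y\<in>V. ev (T a0 b) x y = 0} <= fdim X0"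
     by (rule fs.dim_mono_fin[OF _ fs.fin_dim_mono[OF X0(2) V(2)]])
    then show False using rk_row_X[OF ab(1) fA, of B] D lt by linarith
   next
    case False
    then have *: "annB A B x = {0}" if "x \<in> V" "x ~: X0" for x using main[OF that] by auto
    have "{x\<in>V. \<forall>a\<in>A. \<forall>y\<in>V. ev (T a b0) x y = 0} <= X0"
    proof clarify
     fix x assume x: "x \<in> V" "\<forall>a\<in>A. \<forall>y\<in>V. ev (T a b0) x y = 0"
     then have "b0 \<in> annB A B x" using ab by (auto simp: annB_def)
     then show "x \<in> X0" using * x ab by blast
    qed
    then have "fdim {x\<in>V. \<forall>a\<in>A. \<forall>y\<in>V. ev (T a b0) x y = 0} <= fdim X0"
     by (rule fs.dim_mono_fin[OF _ fs.fin_dim_mono[OF X0(2) V(2)]])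
    then show False using rk_col_X[OF ab(2) fA less.prems(4,8)] D lt by linarith
   qed
  qed
 qed
qed

end

section \<open>Galois descent\<close>

declare fun_app [simp del]

lemma (in vspace) dim_direct:
 assumes "subspace A" "subspace T" "subspace C" "A <= C" "T <= C" "A \<inter> T = {0}" "fin_dim C"
 shows "dim A + dim T <= dim C"
proof -
 obtain B where B: "B <= A" "independent B" "A <= span B" "card B = dim A" "finite B"
  using fin_dim_basis[OF fin_dim_mono[OF assms(4,7)]] by blast
 obtain D where D: "D <= T" "independent D" "T <= span D" "card D = dim T" "finite D"
  using fin_dim_basis[OF fin_dim_mono[OF assms(5,7)]] by blast
 have nz: "0 ~: B"
 proof
  assume "0 \<in> B"
  then have "dependent B" by (rule dependent_zero)
  then show False using B(2) by simp
 qed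
 have disj: "B \<inter> D = {}"
 proof (rule equals0I)
  fix x assume x: "x \<in> B \<inter> D"
  then have "x \<in> A \<inter> T" using B(1) D(1) by auto
  then have "x = 0" unfolding assms(6) by simp
  then show False using x nz by simp
 qed
 have "independent (B \<union> D)"
 proof (rule independent_if_scalars_zero)
  show "finite (B \<union> D)" using B D by simp
  fix f x assume s: "(\<Sum>x\<in>B \<union> D. scale (f x) x) = 0" and x: "x \<in> B \<union> D"
  have "(\<Sum>x\<in>B. scale (f x) x) + (\<Sum>x\<in>D. scale (f x) x) = 0"
   using s sum.union_disjoint[OF B(5) D(5) disj, of "\<lambda>x. scale (f x) x"] by simp
  then have e: "(\<Sum>x\<in>B. scale (f x) x) = - (\<Sum>x\<in>D. scale (f x) x)" by (simp add: eq_neg_iff_add_eq_0)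
  have "(\<Sum>x\<in>B. scale (f x) x) \<in> A" using B(1) by (intro subspace_sum subspace_scale assms(1)) auto
  moreover have "(\<Sum>x\<in>D. scale (f x) x) \<in> T" using D(1) by (intro subspace_sum subspace_scale assms(2)) auto
  then have "(\<Sum>x\<in>B. scale (f x) x) \<in> T" unfolding e by (rule subspace_neg[OF assms(2)])
  ultimately have z: "(\<Sum>x\<in>B. scale (f x) x) = 0" using assms(6) by blast
  then have z': "(\<Sum>x\<in>D. scale (f x) x) = 0" using e by simp
  show "f x = 0" using x independentD[OF B(2) B(5) subset_refl z] independentD[OF D(2) D(5) subset_refl z'] by blast
 qed
 moreover have "B \<union> D <= C" using B(1) D(1) assms(4,5) by blast
 ultimately have "card (B \<union> D) <= dim C" using independent_le_dim assms(7) by blast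
 then show ?thesis using card_Un_disjoint[OF B(5) D(5) disj] B(4) D(4) by simp
qed

text \<open>A complement of the intersection inside \<open>B\<close> is independent of
  \<open>A\<close>. This inequality is what makes dimension counts supermodular below.\<close>

lemma (in vspace) dim_modular:
 assumes "subspace A" "subspace B" "subspace C" "A <= C" "B <= C" "fin_dim C"
 shows "dim A + dim B <= dim C + dim (A \<inter> B)"
proof -
 have AB: "subspace (A \<inter> B)" by (rule subspace_inter[OF assms(1,2)])
 obtain T where T: "subspace T" "T <= B" "A \<inter> B \<inter> T = {0}" "dim B = dim (A \<inter> B) + dim T"
  by (rule complement_exists[OF AB assms(2) Int_lower2 fin_dim_mono[OF assms(5,6)]])
 have "A \<inter> T = {0}" using T(2,3) by blast
 then have "dim A + dim T <= dim C"
  using dim_direct[OF assms(1) T(1) assms(3,4) _ _ assms(6)] T(2) assms(5) by blast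
 then show ?thesis using T(4) by simp
qed

text \<open>Converse of \<open>dual_points\<close>: dual points force a family to be independent,
  and evaluations recover the coefficients.\<close>

lemma dual_family:
 fixes p :: "nat => 'i => 'k::field"
 assumes "!!i j. i < r ==> j < r ==> p i (q j) = (if i = j then 1 else 0)"
 shows "fdim (fspan (p ` {..<r})) = r" "ffin_dim (fspan (p ` {..<r}))"
  "g \<in> fspan (p ` {..<r}) ==> g = (\<Sum>i<r. scl (g (q i)) (p i))"
proof -
 show "ffin_dim (fspan (p ` {..<r}))" by (rule fs.fin_dimI[of "p ` {..<r}"]) auto
 have inj: "inj_on p {..<r}"
 proof (rule inj_onI)
  fix i j assume ij: "i \<in> {..<r}" "j \<in> {..<r}" "p i = p j"
  then have "p i (q i) = p j (q i)" by simp
  then show "i = j" using assms[of i i] assms[of j i] ij by (auto split: if_splits)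
 qed
 have ev: "(\<Sum>i<r. scl (c i) (p i)) (q j) = c j" if "j < r" for c j
 proof -
  have "(\<Sum>i<r. scl (c i) (p i)) (q j) = (\<Sum>i<r. if i = j then c i else 0)"
   unfolding sum_fun_apply fun_app using assms that by (intro sum.cong) auto
  then show ?thesis using that by simp
 qed
 have "\<not> fdependent (p ` {..<r})"
 proof (rule fs.independent_if_scalars_zero)
  fix f x assume s: "(\<Sum>x\<in>p ` {..<r}. scl (f x) x) = 0" and "x \<in> p ` {..<r}"
  then obtain j where j: "j < r" "x = p j" by auto
  have "(\<Sum>i<r. scl (f (p i)) (p i)) = 0" using s unfolding sum.reindex[OF inj] o_def .
  then show "f x = 0" using ev[OF j(1), of "\<lambda>i. f (p i)"] j(2) by (simp add: fun_app)
 qed simp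
 then show "fdim (fspan (p ` {..<r})) = r"
  using fs.dim_span_eq_card_independent[of "p ` {..<r}"] card_image[OF inj] by (simp del: fs.dim_span)
 assume "g \<in> fspan (p ` {..<r})"
 then obtain u where "g = (\<Sum>x\<in>p ` {..<r}. scl (u x) x)"
  using fs.span_finite[of "p ` {..<r}"] by auto
 then have g: "g = (\<Sum>i<r. scl (u (p i)) (p i))" unfolding sum.reindex[OF inj] o_def .
 have "g (q i) = u (p i)" if "i < r" for i unfolding g by (rule ev[OF that])
 then show "g = (\<Sum>i<r. scl (g (q i)) (p i))" by (subst g) (intro sum.cong, auto)
qed

section \<open>Base change to the algebraic closure\<close>

definition emb :: "('i => 'k::field) => 'i => 'k alg_closure" where
 "emb f = (\<lambda>i. to_ac (f i))"

lemma emb_simps: "emb (f + g) = emb f + emb g" "emb (scl c f) = scl (to_ac c) (emb f)" "emb 0 = 0"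
  "emb (f - g) = emb f - emb g"
 and emb_sum: "emb (\<Sum>x\<in>A. h x) = (\<Sum>x\<in>A. emb (h x))"
proof -
 show a: "emb (f + g) = emb f + emb g" "emb (scl c f) = scl (to_ac c) (emb f)" "emb 0 = 0"
  "emb (f - g) = emb f - emb g" for f g c
  by (auto simp: emb_def fun_eq_iff fun_app)
 show "emb (\<Sum>x\<in>A. h x) = (\<Sum>x\<in>A. emb (h x))"
  by (induction A rule: infinite_finite_induct) (simp_all add: a)
qed

lemma emb_inj: "emb f = emb g \<longleftrightarrow> f = g"
 by (auto simp: emb_def fun_eq_iff)

text \<open>A basis of \<open>S\<close> with dual points remains one after the embedding. A vector
  over K in the extended span has its values at those points as coefficients, so these lie in
  K.\<close>

lemma span_emb:
 fixes S :: "('i => 'k::field) set"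
 assumes "fsubspace S" "ffin_dim S"
 shows "fdim (fspan (emb ` S)) = fdim S" "ffin_dim (fspan (emb ` S))"
  "emb f \<in> fspan (emb ` S) ==> f \<in> S"
proof -
 let ?r = "fdim S"
 obtain q p where qp: "\<forall>i<?r. p i \<in> S" "\<forall>i<?r. \<forall>j<?r. p i (q j) = (if i = j then 1 else 0)"
   "\<forall>f\<in>S. f = (\<Sum>i<?r. scl (f (q i)) (p i))"
  using dual_points[OF assms refl] by blast
 let ?p = "\<lambda>i. emb (p i)"
 have d: "?p i (q j) = (if i = j then 1 else 0)" if "i < ?r" "j < ?r" for i j
  using qp(2) that by (simp add: emb_def)
 have eq: "fspan (emb ` S) = fspan (?p ` {..<?r})"
 proof
  show "fspan (?p ` {..<?r}) <= fspan (emb ` S)" using qp(1) by (intro fs.span_mono) auto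
  show "fspan (emb ` S) <= fspan (?p ` {..<?r})"
  proof (rule fs.span_minimal[OF _ fs.subspace_span], clarify)
   fix f assume "f \<in> S"
   then have "f = (\<Sum>i<?r. scl (f (q i)) (p i))" using qp(3) by blast
   then have "emb f = (\<Sum>i<?r. scl (to_ac (f (q i))) (?p i))" by (metis (no_types, lifting) emb_simps(2) emb_sum sum.cong)
   moreover have "(\<Sum>i<?r. scl (to_ac (f (q i))) (?p i)) \<in> fspan (?p ` {..<?r})"
    by (intro fs.span_sum fs.span_scale fs.span_base) auto
   ultimately show "emb f \<in> fspan (?p ` {..<?r})" by simp
  qed
 qed
 note df = dual_family[of ?r ?p q, OF d]
 show "fdim (fspan (emb ` S)) = fdim S" "ffin_dim (fspan (emb ` S))" unfolding eq using df(1,2) by blast+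
 assume "emb f \<in> fspan (emb ` S)"
 then have "emb f = (\<Sum>i<?r. scl (emb f (q i)) (?p i))" unfolding eq using df(3) by blast
 also have "\<dots> = emb (\<Sum>i<?r. scl (f (q i)) (p i))" by (simp add: emb_sum emb_simps emb_def[of f])
 finally have "f = (\<Sum>i<?r. scl (f (q i)) (p i))" by (simp add: emb_inj)
 moreover have "(\<Sum>i<?r. scl (f (q i)) (p i)) \<in> S"
  using qp(1) by (intro fs.subspace_sum fs.subspace_scale assms(1)) auto
 ultimately show "f \<in> S" by simp
qed

section \<open>The Frobenius map\<close>

lemma finite_field_power_card:
 fixes x :: "'k::{field,finite}"
 shows "x ^ card (UNIV :: 'k set) = x"
proof (cases "x = 0")
 case False
 have "(\<Prod>y\<in>UNIV-{0}. x * y) = (\<Prod>y\<in>UNIV-{0}. y)"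
  by (rule prod.reindex_bij_witness[of _ "\<lambda>y. y / x" "\<lambda>y. x * y"]) (use False in auto)
 then have "x ^ card (UNIV - {0 :: 'k}) * (\<Prod>y\<in>UNIV-{0}. y) = (\<Prod>y\<in>UNIV-{0}. y)"
  by (simp add: prod.distrib)
 then have 1: "x ^ card (UNIV - {0 :: 'k}) = 1" by simp
 have 2: "card (UNIV :: 'k set) = Suc (card (UNIV - {0 :: 'k}))"
  by (rule card.remove) auto
 have "x ^ card (UNIV :: 'k set) = x * x ^ card (UNIV - {0 :: 'k})" by (subst 2) (rule power_Suc)
 then show ?thesis using 1 by simp
qed (simp add: finite_UNIV_card_ge_0)

text \<open>The binomial coefficients vanish because \<open>(X + 1)^q - X^q - 1\<close> has degree less than \<open>q\<close>
 and vanishes on the whole field.\<close>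

lemma finite_field_binomial:
 assumes "0 < i" "i < card (UNIV :: 'k::{field,finite} set)"
 shows "(of_nat (card (UNIV :: 'k set) choose i) :: 'k) = 0"
proof -
 let ?q = "card (UNIV :: 'k set)"
 define P :: "'k poly" where "P = (\<Sum>j\<in>{0<..<?q}. monom (of_nat (?q choose j)) j)"
 have cP: "coeff P j = (if 0 < j & j < ?q then of_nat (?q choose j) else 0)" for j
  by (auto simp: P_def coeff_sum)
 have "poly P x = 0" for x
 proof -
  have "(x + 1) ^ ?q = (\<Sum>k\<le>?q. of_nat (?q choose k) * x ^ k)"
   using binomial_ring[of x 1 ?q] by simp
  also have "{..?q} = insert 0 (insert ?q {0<..<?q})" using assms by auto
  also have "(\<Sum>k\<in>insert 0 (insert ?q {0<..<?q}). of_nat (?q choose k) * x ^ k)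
   = 1 + (x ^ ?q + (\<Sum>k\<in>{0<..<?q}. of_nat (?q choose k) * x ^ k))"
   using assms by (subst sum.insert; (subst sum.insert)?) auto
  finally have "(\<Sum>k\<in>{0<..<?q}. of_nat (?q choose k) * x ^ k) = 0"
   by (simp add: finite_field_power_card)
  then show ?thesis by (simp add: P_def poly_sum poly_monom)
 qed
 then have "{x. poly P x = 0} = UNIV" by auto
 have "P = 0"
 proof (rule ccontr)
  assume P: "P ~= 0"
  have "Polynomial.degree P < ?q"
  proof (rule ccontr)
   assume "\<not> ?thesis"
   then have "coeff P (Polynomial.degree P) = 0" using cP by auto
   then show False using P by simp
  qed
  then show False using card_poly_roots_bound[OF P] \<open>{x. poly P x = 0} = UNIV\<close> by simp
 qed
 then show ?thesis using cP[of i] assms by simp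
qed

definition fr :: "nat => ('i => 'k::field) => 'i => 'k" where
 "fr q f = (\<lambda>i. f i ^ q)"

context
 fixes q :: nat and K :: "'k::{field,finite} itself"
 assumes q: "q = card (UNIV :: 'k set)"
begin

lemma q_pos: "0 < q" unfolding q by (simp add: finite_UNIV_card_ge_0)

lemma frob_add: "((x::'k alg_closure) + y) ^ q = x ^ q + y ^ q"
proof -
 have z: "(of_nat (q choose i) :: 'k alg_closure) = 0" if "0 < i" "i < q" for i
 proof -
  have "to_ac (of_nat (q choose i) :: 'k) = 0" using finite_field_binomial[of i, where 'k='k] that q by simp
  then show ?thesis by simp
 qed
 have "(x + y) ^ q = (\<Sum>k\<le>q. of_nat (q choose k) * x ^ k * y ^ (q - k))" by (rule binomial_ring)
 also have "\<dots> = (\<Sum>k\<in>{0, q}. of_nat (q choose k) * x ^ k * y ^ (q - k))"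
  by (rule sum.mono_neutral_right) (auto simp: z)
 also have "\<dots> = x ^ q + y ^ q" using q_pos by simp
 finally show ?thesis .
qed

lemma frob_minus: "((x::'k alg_closure) - y) ^ q = x ^ q - y ^ q"
 using frob_add[of "x - y" y] by (simp add: algebra_simps)

text \<open>The polynomial X^q - X has at most q roots, and K supplies q of them.\<close>

lemma frob_fixed: "(x::'k alg_closure) ^ q = x \<longleftrightarrow> x \<in> range to_ac"
proof
 assume "x \<in> range to_ac"
 then show "x ^ q = x" using finite_field_power_card q by (metis imageE to_ac_power)
next
 assume x: "x ^ q = x"
 have "card (UNIV :: 'k set) \<ge> card {0, 1 :: 'k}" by (rule card_mono) auto
 then have q2: "2 <= q" unfolding q by simp
 define P :: "'k alg_closure poly" where "P = monom 1 q - monom 1 1"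
 have "coeff P q = 1" using q2 by (simp add: P_def)
 then have P0: "P ~= 0" by auto
 have dP: "Polynomial.degree P <= q"
  unfolding P_def using q2 by (intro degree_diff_le) (auto simp: degree_monom_eq)
 let ?Z = "{x. poly P x = 0}"
 have Z: "?Z = {x. x ^ q = x}" by (auto simp: P_def poly_monom)
 have sub: "range to_ac <= ?Z" unfolding Z using finite_field_power_card q by (metis (mono_tags, lifting) image_subsetI mem_Collect_eq to_ac_power)
 have "card (range (to_ac :: 'k => _)) = q" unfolding q by (rule card_image) (rule inj_to_ac)
 then have "card ?Z <= card (range (to_ac :: 'k => _))" using card_poly_roots_bound[OF P0] dP by linarith
 then have "range to_ac = ?Z" using sub poly_roots_finite[OF P0] card_seteq by blast
 then show "x \<in> range to_ac" using x Z by blast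
qed

text \<open>The existence of q-th roots of scalars makes the image of a subspace under the
  semilinear map \<open>fr\<close> closed under scaling.\<close>

lemma frob_surj: "\<exists>y. (y::'k alg_closure) ^ q = x"
proof -
 have "Polynomial.degree (monom 1 q - [:x:]) = q"
 proof (rule antisym)
  show "Polynomial.degree (monom 1 q - [:x:]) <= q" by (intro degree_diff_le) (auto simp: degree_monom_eq)
  show "q <= Polynomial.degree (monom 1 q - [:x:])"
   using q_pos by (intro le_degree) (auto simp: coeff_pCons split: nat.splits)
 qed
 then obtain y where "poly (monom 1 q - [:x:]) y = 0"
  using alg_closed_imp_poly_has_root[of "monom 1 q - [:x:]"] q_pos by auto
 then show ?thesis by (auto simp: poly_monom)
qed

lemma fr_simps:
 fixes f g :: "'i => 'k alg_closure"
 shows "fr q (f + g) = fr q f + fr q g" "fr q (f - g) = fr q f - fr q g" "fr q (scl c f) = scl (c ^ q) (fr q f)" "fr q (0 :: 'i => 'k alg_closure) = 0"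
 "fr q f = 0 \<longleftrightarrow> f = 0"
 using q_pos by (auto simp: fr_def fun_eq_iff fun_app frob_add frob_minus power_mult_distrib)

lemma fr_sum: "fr q (\<Sum>x\<in>A. h x :: 'i => 'k alg_closure) = (\<Sum>x\<in>A. fr q (h x))"
 by (induction A rule: infinite_finite_induct) (simp_all add: fr_simps)

lemma fr_emb [simp]: "fr q (emb (f :: 'i => 'k)) = emb f"
 using frob_fixed by (auto simp: fr_def emb_def)

lemma fr_fixed:
 fixes f :: "'i => 'k alg_closure"
 assumes "fr q f = f"
 shows "\<exists>g. f = emb g"
proof -
 have "\<forall>i. \<exists>x. f i = to_ac x" using assms frob_fixed by (auto simp: fr_def fun_eq_iff image_iff)
 then obtain g where "!!i. f i = to_ac (g i)" by metis
 then show ?thesis by (auto simp: emb_def)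
qed

lemma subspace_fr:
 fixes S :: "('i => 'k alg_closure) set"
 assumes "fsubspace S"
 shows "fsubspace (fr q ` S)"
 unfolding fs.subspace_def
proof (intro conjI ballI allI)
 show "0 \<in> fr q ` S" using fr_simps(4) fs.subspace_0[OF assms] by (metis image_eqI)
 show "x + y \<in> fr q ` S" if "x \<in> fr q ` S" "y \<in> fr q ` S" for x y
  using that fs.subspace_add[OF assms] by (auto simp: fr_simps(1)[symmetric])
 show "scl c x \<in> fr q ` S" if xS: "x \<in> fr q ` S" for c x
 proof -
  obtain f where "x = fr q f" "f \<in> S" using xS by blast
  moreover obtain d where "d ^ q = c" using frob_surj by blast
  ultimately
  show ?thesis using fs.subspace_scale[OF assms, of f d] by (auto simp: fr_simps(3)[symmetric])
 qed
qed

text \<open>Frobenius fixes 0 and 1, so a basis with dual points is carried to a basis with the same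
  dual points.\<close>

lemma fdim_fr:
 fixes S :: "('i => 'k alg_closure) set"
 assumes "fsubspace S" "ffin_dim S"
 shows "fdim (fr q ` S) = fdim S" "ffin_dim (fr q ` S)"
proof -
 let ?r = "fdim S"
 obtain x p where qp: "\<forall>i<?r. p i \<in> S" "\<forall>i<?r. \<forall>j<?r. p i (x j) = (if i = j then 1 else 0)"
   "\<forall>f\<in>S. f = (\<Sum>i<?r. scl (f (x i)) (p i))"
  using dual_points[OF assms refl] by blast
 let ?p = "\<lambda>i. fr q (p i)"
 have d: "?p i (x j) = (if i = j then 1 else 0)" if "i < ?r" "j < ?r" for i j
  using qp(2) that q_pos by (simp add: fr_def)
 have eq: "fr q ` S = fspan (?p ` {..<?r})"
 proof
  show "fspan (?p ` {..<?r}) <= fr q ` S" using qp(1) by (intro fs.span_minimal subspace_fr assms) auto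
  show "fr q ` S <= fspan (?p ` {..<?r})"
  proof clarify
   fix f assume "f \<in> S"
   then have "f = (\<Sum>i<?r. scl (f (x i)) (p i))" using qp(3) by blast
   then have "fr q f = (\<Sum>i<?r. scl (f (x i) ^ q) (?p i))" by (metis (no_types, lifting) fr_simps(3) fr_sum sum.cong)
   moreover have "(\<Sum>i<?r. scl (f (x i) ^ q) (?p i)) \<in> fspan (?p ` {..<?r})"
    by (intro fs.span_sum fs.span_scale fs.span_base) auto
   ultimately show "fr q f \<in> fspan (?p ` {..<?r})" by simp
  qed
 qed
 show "fdim (fr q ` S) = fdim S" "ffin_dim (fr q ` S)"
  unfolding eq using dual_family(1,2)[of ?r ?p x, OF d] by blast+
qed

text \<open>Galois descent: a nonzero vector of minimal support, normalised at one coordinate, is fixed by the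
 Frobenius map.\<close>

lemma frobenius_descent:
 fixes U :: "('i => 'k alg_closure) set"
 assumes U: "fsubspace U" and fin: "finite Z" "!!u i. u \<in> U ==> i ~: Z ==> u i = 0"
  and st: "!!u. u \<in> U ==> fr q u \<in> U"
 shows "U = fspan (emb ` {f. emb f \<in> U})"
proof
 show "fspan (emb ` {f. emb f \<in> U}) <= U" by (rule fs.span_minimal[OF _ U]) auto
 let ?W = "fspan (emb ` {f. emb f \<in> U})"
 define sp where "sp u = {i. u i ~= (0 :: 'k alg_closure)}" for u :: "'i => 'k alg_closure"
 have fsp: "finite (sp u)" if "u \<in> U" for u
  by (rule finite_subset[OF _ fin(1)]) (use fin(2) that in \<open>auto simp: sp_def\<close>)
 have "u \<in> ?W" if "u \<in> U" for u
  using that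
 proof (induction "card (sp u)" arbitrary: u rule: less_induct)
  case less
  show ?case
  proof (cases "u = 0")
   case True
   then show ?thesis by (simp add: fs.span_zero)
  next
   case False
   let ?P = "\<lambda>w. w \<in> U & w ~= 0 & sp w <= sp u"
   have "?P u" using False less.prems by simp
   then obtain w where w: "?P w" "!!v. ?P v ==> card (sp w) <= card (sp v)"
    using ex_has_least_nat[of ?P u "\<lambda>w. card (sp w)"] by blast
   then obtain i where i: "w i ~= 0" by (auto simp: fun_eq_iff fun_app)
   define v where "v = scl (1 / w i) w"
   have v: "v \<in> U" "v i = 1" "sp v = sp w"
    using w(1) i fs.subspace_scale[OF U] by (auto simp: v_def sp_def fun_app)
   have fu: "fr q v - v \<in> U" using fs.subspace_diff[OF U st[OF v(1)] v(1)] .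
   have "sp (fr q v - v) <= sp v - {i}" using v(2) q_pos by (auto simp: sp_def fr_def fun_app)
   then have "card (sp (fr q v - v)) < card (sp w)"
    using fsp[OF v(1)] v(2,3) by (metis (mono_tags, lifting) card_Diff1_less card_mono finite_Diff
      i le_less_trans mem_Collect_eq sp_def)
   moreover have "sp (fr q v - v) <= sp u" using \<open>sp (fr q v - v) <= sp v - {i}\<close> v(3) w(1) by blast
   ultimately have "fr q v - v = 0" using w(2) fu not_less by blast
   then have "fr q v = v" by simp
   then obtain g where g: "v = emb g" using fr_fixed by blast
   have vW: "v \<in> ?W" using v(1) g by (auto intro!: fs.span_base)
   \<comment> \<open>Subtracting a multiple of the vector found over K removes \<open>i\<close> from
     the support of \<open>u\<close>, and the induction applies to the difference.\<close>
   let ?u = "u - scl (u i) v"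
   have uU: "?u \<in> U" using fs.subspace_diff[OF U less.prems fs.subspace_scale[OF U v(1)]] .
   have ui: "i \<in> sp u" using w(1) i by (auto simp: sp_def)
   have "sp ?u <= sp u - {i}" using v(2,3) w(1) by (auto simp: sp_def fun_app)
   then have "card (sp ?u) < card (sp u)"
    using ui fsp[OF less.prems] by (meson card_Diff1_less card_mono finite_Diff le_less_trans)
   then have "?u \<in> ?W" using less.hyps uU by blast
   then have "?u + scl (u i) v \<in> ?W" using vW by (intro fs.span_add fs.span_scale)
   then show ?thesis by simp
  qed
 qed
 then show "U <= ?W" by blast
qed

text \<open>The relations over the closure form a Frobenius-stable space, which is therefore spanned
  by relations over K, and these are all 0.\<close>

lemma independent_emb:
 fixes f :: "nat => 'i => 'k"
 assumes "!!al. (\<Sum>i<a. scl (al i) (f i)) = 0 ==> \<forall>i<a. al i = 0"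
  and "(\<Sum>i<a. scl (be i) (emb (f i))) = 0" "i < a"
 shows "be i = 0"
proof -
 let ?U = "{be :: nat => 'k alg_closure. (\<forall>i. i ~: {..<a} --> be i = 0) & (\<Sum>i<a. scl (be i) (emb (f i))) = 0}"
 have 1: "fsubspace ?U"
  unfolding fs.subspace_def mem_Collect_eq Ball_def
  by (auto simp: fun_app fs.scale_left_distrib sum.distrib fs.scale_scale[symmetric] fs.scale_sum_right[symmetric] simp del: fs.scale_scale)
 have 2: "fr q u \<in> ?U" if "u \<in> ?U" for u
 proof -
  have "fr q (\<Sum>i<a. scl (u i) (emb (f i))) = 0" using that by (simp add: fr_simps)
  then have "(\<Sum>i<a. scl (fr q u i) (emb (f i))) = 0" by (simp add: fr_sum fr_simps fr_def[of q u])
  then show ?thesis using that q_pos by (auto simp: fr_def)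
 qed
 have "?U = fspan (emb ` {f. emb f \<in> ?U})"
  by (rule frobenius_descent[OF 1 finite_lessThan[of a] _ 2]) auto
 also have "{f. emb f \<in> ?U} <= {0}"
 proof clarify
  fix al assume s: "(\<Sum>i<a. scl (emb al i) (emb (f i))) = 0" and z: "\<forall>i. i ~: {..<a} --> emb al i = 0"
  have "emb (\<Sum>i<a. scl (al i) (f i)) = emb 0" using s by (simp add: emb_sum emb_simps emb_def[of al])
  then have "\<forall>i<a. al i = 0" using assms(1) by (simp add: emb_inj)
  moreover have "al i = 0" if "\<not> i < a" for i using z that by (simp add: emb_def)
  ultimately show "al = 0" by (metis ext zero_fun_apply)
 qed
 then have "fspan (emb ` {f. emb f \<in> ?U}) <= fspan {0}" by (intro fs.span_mono) (auto simp: emb_simps)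
 finally have "?U <= {0}" by simp
 moreover have "(\<lambda>i. if i < a then be i else 0) \<in> ?U" using assms(2) by simp
 ultimately have "(\<lambda>i. if i < a then be i else 0) \<in> {0}" by (rule subsetD)
 then have "(\<lambda>i. if i < a then be i else 0) = 0" by (rule singletonD)
 from fun_cong[OF this, of i] show ?thesis using assms(3) by (simp add: fun_app)
qed

end

section \<open>Families of alternating matrices over a finite field\<close>

definition vecs :: "nat => (nat => 'k::field) set" where
 "vecs m = {x. \<forall>i. i ~: {..<m} --> x i = 0}"

lemma vecs_fin: "fsubspace (vecs m)" "ffin_dim (vecs m)" "fdim (vecs m :: (nat => 'k::field) set) = m"
proof -
 show "fsubspace (vecs m)" "ffin_dim (vecs m)"
  unfolding vecs_def by (rule fdim_supported(1,2)[OF finite_lessThan])+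
 show "fdim (vecs m :: (nat => 'k::field) set) = m"
  unfolding vecs_def by (subst fdim_supported(3)[OF finite_lessThan]) simp
qed

definition sqr :: "nat => (nat \<times> nat => 'k::field) set" where
 "sqr m = {f. \<forall>p. p ~: {..<m} \<times> {..<m} --> f p = 0}"

lemma sqr_fin: "fsubspace (sqr m)" "ffin_dim (sqr m)"
 unfolding sqr_def by (rule fdim_supported(1,2); simp)+

definition bil :: "nat => (nat \<times> nat => 'k::field) => (nat => 'k) => (nat => 'k) => 'k" where
 "bil m f x y = (\<Sum>i<m. \<Sum>j<m. x i * y j * f (i, j))"

lemma bil_add: "bil m (f + g) x y = bil m f x y + bil m g x y" "bil m f (x + x') y = bil m f x y + bil m f x' y"
   "bil m f x (y + y') = bil m f x y + bil m f x y'"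
 by (simp_all add: bil_def fun_app algebra_simps sum.distrib)

lemma bil_scl: "bil m (scl c f) x y = c * bil m f x y" "bil m f (scl c x) y = c * bil m f x y"
   "bil m f x (scl c y) = c * bil m f x y"
 by (simp_all add: bil_def fun_app sum_distrib_left mult_ac)

lemma bil_0: "bil m 0 x y = 0" "bil m f 0 y = 0" "bil m f x 0 = 0"
 by (simp_all add: bil_def fun_app)

lemma bil_unit:
 assumes "i < m" "j < m"
 shows "bil m f (\<lambda>k. if k = i then 1 else 0) (\<lambda>k. if k = j then 1 else 0) = f (i, j)"
proof -
 have "bil m f (\<lambda>k. if k = i then 1 else 0) (\<lambda>k. if k = j then 1 else 0)
   = (\<Sum>i'<m. \<Sum>j'<m. if i' = i then if j' = j then f (i', j') else 0 else 0)"
  unfolding bil_def by (intro sum.cong) auto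
 also have "\<dots> = (\<Sum>i'<m. if i' = i then f (i', j) else 0)"
  using assms by (intro sum.cong) auto
 finally show ?thesis using assms by simp
qed

lemma bil_zero:
 assumes "f \<in> sqr m" "!!x y. x \<in> vecs m ==> y \<in> vecs m ==> bil m f x y = 0"
 shows "f = 0"
proof (rule ext, clarify)
 fix i j
 show "f (i, j) = 0 (i, j)"
 proof (cases "i < m & j < m")
  case True
  then have "bil m f (\<lambda>k. if k = i then 1 else 0) (\<lambda>k. if k = j then 1 else 0) = 0"
   by (intro assms(2)) (auto simp: vecs_def)
  then show ?thesis using bil_unit[of i m j f] True by (simp add: fun_app)
 next
  case False
  then show ?thesis using assms(1) by (auto simp: sqr_def fun_app)
 qed
qed

definition kil :: "nat => (nat \<times> nat => 'k::field) set => (nat => 'k) set => (nat \<times> nat => 'k) set" where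
 "kil m R N = {f\<in>R. \<forall>x\<in>N. \<forall>y\<in>vecs m. bil m f x y = 0}"

lemma subspace_kil: "fsubspace R ==> fsubspace (kil m R N)"
 unfolding fs.subspace_def kil_def mem_Collect_eq by (auto simp: bil_add bil_scl bil_0)

text \<open>The constraint of \<open>alternating_family\<close> in coordinates, stated over any
  field so that it can be transferred to the closure. For m > 0 the subspace 0 gives fdim R <
  m.\<close>

definition positive :: "nat => (nat \<times> nat => 'k::field) set => bool" where
 "positive m R \<longleftrightarrow> (\<forall>N. fsubspace N & N <= vecs m & N ~= vecs m --> fdim (kil m R N) + fdim N < m)"

definition setsum2 :: "('i => 'k::field) set => ('i => 'k) set => ('i => 'k) set" where
 "setsum2 S T = {x + y |x y. x \<in> S & y \<in> T}"

text \<open>A subspace maximising the supermodular function \<open>N \<mapsto> fdim (kil N) + fdim N\<close>, of minimal dimension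
 among those, is unique, hence stable under the Frobenius map and defined over the finite field.\<close>

lemma positive_emb:
 fixes R :: "(nat \<times> nat => 'k::{field,finite}) set"
 assumes R: "fsubspace R" "R <= sqr m" and pos: "positive m R"
 shows "positive m (fspan (emb ` R))"
 unfolding positive_def
proof (intro allI impI, elim conjE, rule ccontr)
 fix N0 :: "(nat => 'k alg_closure) set"
 assume N0: "fsubspace N0" "N0 <= vecs m" "N0 ~= vecs m"
 define Rk where "Rk = fspan (emb ` R)"
 define q where "q = card (UNIV :: 'k set)"
 define V where "V = (vecs m :: (nat => 'k alg_closure) set)"
 have V: "fsubspace V" "ffin_dim V" "fdim V = m" using vecs_fin by (simp_all add: V_def)
 let ?fr = "fr q"
 note q = q_def
 define d where "d N = fdim (kil m Rk N) + fdim N" for N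
 assume "\<not> fdim (kil m (fspan (emb ` R)) N0) + fdim N0 < m"
 then have d0: "m <= d N0" by (simp add: d_def Rk_def)
 have Rf: "ffin_dim R" by (rule fs.fin_dim_mono[OF R(2) sqr_fin(2)])
 have Rk: "fsubspace Rk" "ffin_dim Rk" using span_emb(2)[OF R(1) Rf] by (auto simp: Rk_def fs.subspace_span)
 have Rks: "Rk <= sqr m" unfolding Rk_def
  by (rule fs.span_minimal[OF _ sqr_fin(1)]) (use R(2) in \<open>auto simp: sqr_def emb_def\<close>)
 have kf: "fsubspace (kil m Rk N)" "ffin_dim (kil m Rk N)" for N
  using subspace_kil[OF Rk(1)] fs.fin_dim_mono[OF _ Rk(2), of "kil m Rk N"] by (auto simp: kil_def)
 have kV: "kil m Rk V = {0}"
 proof -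
  have "f = 0" if "f \<in> kil m Rk V" for f
   by (rule bil_zero[of f m]) (use that Rks in \<open>auto simp: kil_def V_def\<close>)
  then show ?thesis using fs.subspace_0[OF kf(1)] by blast
 qed
 have dV: "d V = m" unfolding d_def kV using V(3) by (simp add: fs.dim_zero)
 define P where "P N \<longleftrightarrow> fsubspace N & N <= V" for N
 have fN: "ffin_dim N" if "P N" for N using that fs.fin_dim_mono V(2) unfolding P_def by blast
 have bnd: "d N <= fdim Rk + m" if "P N" for N
 proof -
  have "fdim (kil m Rk N) <= fdim Rk" by (rule fs.dim_mono_fin[OF _ Rk(2)]) (auto simp: kil_def)
  moreover have "fdim N <= m" using that fs.dim_mono_fin[OF _ V(2), of N] V(3) by (simp add: P_def)
  ultimately show ?thesis by (simp add: d_def)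
 qed
 have PN0: "P N0" using N0 by (simp add: P_def V_def)
 obtain Nm where Nm: "P Nm" "!!N. P N ==> d N <= d Nm"
  using ex_has_greatest_nat[of P N0 d "fdim Rk + m + 1"] PN0 bnd by (metis le_imp_less_Suc Suc_eq_plus1)
 define Q where "Q N \<longleftrightarrow> P N & d N = d Nm" for N
 \<comment> \<open>If the maximum is attained at the violating subspace \<open>N0\<close>, this is a
   proper maximiser; otherwise the maximum exceeds \<open>m = d V\<close> and no maximiser is
   \<open>V\<close>.\<close>
 have "\<exists>N. Q N & N ~= V"
 proof (cases "d N0 = d Nm")
  case True
  then show ?thesis using PN0 N0(3) by (auto simp: Q_def V_def)
 next
  case False
  then have "m < d Nm" using d0 Nm(2)[OF PN0] by simp
  then have "Nm ~= V" using dV by auto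
  then show ?thesis using Nm(1) by (auto simp: Q_def)
 qed
 then obtain N1 where N1: "Q N1" "N1 ~= V" by blast
 obtain N where N: "Q N" "!!N'. Q N' ==> fdim N <= fdim N'"
  using ex_has_least_nat[of Q N1 fdim] N1(1) by blast
 have PN: "P N" using N(1) by (simp add: Q_def)
 have NV: "N ~= V"
 proof
  assume "N = V"
  then have "fdim V <= fdim N1" using N(2)[OF N1(1)] by simp
  then have "N1 = V" using fs.subspace_eq_dim[of N1 V] N1(1) V by (auto simp: Q_def P_def)
  then show False using N1(2) by simp
 qed
 \<comment> \<open>Both summands of \<open>d\<close> are supermodular, so the intersection of two
   maximisers is again a maximiser; minimal dimension then makes it equal to both.\<close>
 have uniq: "N' = N" if N': "Q N'" "fdim N' = fdim N" for N'
 proof -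
  have PN': "P N'" using N' by (simp add: Q_def)
  have sub: "fsubspace N" "fsubspace N'" "N <= V" "N' <= V" using PN PN' by (auto simp: P_def)
  let ?S = "setsum2 N N'"
  have S: "fsubspace ?S" unfolding setsum2_def using fs.subspace_sums[OF sub(1,2)] .
  have leS: "N <= ?S" "N' <= ?S"
   unfolding setsum2_def using fs.subspace_0[OF sub(1)] fs.subspace_0[OF sub(2)] by force+
  have SV: "?S <= V" unfolding setsum2_def using sub fs.subspace_add[OF V(1)] by blast
  have PS: "P ?S" "P (N \<inter> N')" using S SV sub fs.subspace_inter by (auto simp: P_def)
  have "fdim N + fdim N' <= fdim ?S + fdim (N \<inter> N')"
   by (rule fs.dim_modular[OF sub(1,2) S leS fN[OF PS(1)]])
  moreover have "kil m Rk N \<inter> kil m Rk N' = kil m Rk ?S"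
  proof
   show "kil m Rk N \<inter> kil m Rk N' <= kil m Rk ?S" by (auto simp: kil_def setsum2_def bil_add)
   show "kil m Rk ?S <= kil m Rk N \<inter> kil m Rk N'" using leS by (auto simp: kil_def)
  qed
  then have "fdim (kil m Rk N) + fdim (kil m Rk N') <= fdim (kil m Rk (N \<inter> N')) + fdim (kil m Rk ?S)"
   using fs.dim_modular[OF kf(1) kf(1) kf(1) _ _ kf(2), of N "N \<inter> N'" N'] by (auto simp: kil_def)
  ultimately have "d N + d N' <= d (N \<inter> N') + d ?S" unfolding d_def by linarith
  moreover have "d N = d Nm" "d N' = d Nm" "d ?S <= d Nm" "d (N \<inter> N') <= d Nm"
   using N(1) N'(1) Nm(2) PS by (auto simp: Q_def)
  ultimately have "Q (N \<inter> N')" using PS by (simp add: Q_def)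
  then have "fdim N <= fdim (N \<inter> N')" by (rule N(2))
  then have "N \<inter> N' = N" "N \<inter> N' = N'"
   using fs.subspace_eq_dim[of "N \<inter> N'" N] fs.subspace_eq_dim[of "N \<inter> N'" N'] PS(2) fN[OF PN] fN[OF PN'] N'(2)
   by (auto simp: P_def)
  then show ?thesis by blast
 qed
 have frV: "?fr x \<in> V" if "x \<in> V" for x using that q_pos[OF q] by (auto simp: V_def vecs_def fr_def)
 have frRk: "?fr f \<in> Rk" if "f \<in> Rk" for f
 proof -
  have "?fr ` Rk <= Rk"
  proof -
   have "Rk <= {f. ?fr f \<in> Rk}" unfolding Rk_def
   proof (rule fs.span_minimal)
    show "emb ` R <= {f. ?fr f \<in> fspan (emb ` R)}" by (auto simp: fr_emb[OF q] intro!: fs.span_base)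
    show "fsubspace {f. ?fr f \<in> fspan (emb ` R)}"
     unfolding fs.subspace_def mem_Collect_eq Ball_def
     by (auto simp: fr_simps[OF q] fs.span_zero fs.span_add fs.span_scale)
   qed
   then show ?thesis by blast
  qed
  then show ?thesis using that by blast
 qed
 have frbil: "bil m (?fr f) (?fr x) (?fr y) = bil m f x y ^ q" for f :: "nat \<times> nat => 'k alg_closure" and x y
 proof -
  have s: "(\<Sum>i\<in>A. h i) ^ q = (\<Sum>i\<in>A. h i ^ q)" for h :: "nat => 'k alg_closure" and A
   by (induction A rule: infinite_finite_induct) (use q_pos[OF q] in \<open>auto simp: frob_add[OF q] power_0_left\<close>)
  show ?thesis by (simp add: bil_def s fr_def power_mult_distrib)
 qed
 \<comment> \<open>The second argument of a form ranges over all of \<open>V\<close>, so it has to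
   be written as a Frobenius image before \<open>frbil\<close> can be used.\<close>
 have Vsurj: "\<exists>y\<in>V. ?fr y = x" if "x \<in> V" for x
 proof -
  have "\<forall>i. \<exists>z. z ^ q = x i" using frob_surj[OF q] by blast
  then obtain y where y: "!!i. y i ^ q = x i" by metis
  then have "?fr y = x" by (simp add: fr_def)
  moreover have "y \<in> V" unfolding V_def vecs_def
  proof (intro CollectI allI impI)
   fix i assume "i ~: {..<m}"
   then have "y i ^ q = 0" using y[of i] that by (simp add: V_def vecs_def)
   then show "y i = 0" by simp
  qed
  ultimately show ?thesis by blast
 qed
 have Qfr: "Q (?fr ` N)" "fdim (?fr ` N) = fdim N"
 proof -
  show e: "fdim (?fr ` N) = fdim N" using fdim_fr(1)[OF q] PN fN[OF PN] by (auto simp: P_def)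
  have P': "P (?fr ` N)" using subspace_fr[OF q] PN frV by (auto simp: P_def)
  have "?fr ` kil m Rk N <= kil m Rk (?fr ` N)"
  proof clarify
   fix f assume f: "f \<in> kil m Rk N"
   have "bil m (?fr f) (?fr x) y = 0" if x: "x \<in> N" and y: "y \<in> V" for x y
   proof -
    obtain z where z: "z \<in> V" "?fr z = y" using Vsurj[OF y] by blast
    have "bil m f x z = 0" using f x z(1) by (simp add: kil_def V_def)
    then show ?thesis using frbil[of f x z] z(2) q_pos[OF q] by simp
   qed
   then show "?fr f \<in> kil m Rk (?fr ` N)" using f frRk by (auto simp: kil_def V_def)
  qed
  then have "fdim (kil m Rk N) <= fdim (kil m Rk (?fr ` N))"
   using fs.dim_mono_fin[OF _ kf(2)] fdim_fr(1)[OF q kf] by metis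
  then have "d N <= d (?fr ` N)" using e by (simp add: d_def)
  then show "Q (?fr ` N)" using N(1) Nm(2)[OF P'] P' by (simp add: Q_def)
 qed
 then have frN: "?fr ` N = N" by (rule uniq)
 have frk: "?fr f \<in> kil m Rk N" if f: "f \<in> kil m Rk N" for f
 proof -
  have "bil m (?fr f) x y = 0" if x: "x \<in> N" and y: "y \<in> V" for x y
  proof -
   obtain z where z: "z \<in> V" "?fr z = y" using Vsurj[OF y] by blast
   obtain w where w: "w \<in> N" "?fr w = x" using frN x by (metis imageE)
   have "bil m f w z = 0" using f w z(1) by (simp add: kil_def V_def)
   then show ?thesis using frbil[of f w z] z(2) w(2) q_pos[OF q] by simp
  qed
  then show ?thesis using f frRk by (auto simp: kil_def V_def)
 qed
 \<comment> \<open>The maximiser and the forms having it in their radical are both Frobenius-stable;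
   their dimensions can thus be read off over K, where the constraint is known.\<close>
 define NK where "NK = {f. emb f \<in> N}"
 define kK where "kK = {f. emb f \<in> kil m Rk N}"
 have subN: "fsubspace N" "N <= V" using PN by (auto simp: P_def)
 have eN: "N = fspan (emb ` NK)" unfolding NK_def
  by (rule frobenius_descent[OF q subN(1), of "{..<m}"]) (use subN(2) frN in \<open>auto simp: V_def vecs_def\<close>)
 have ek: "kil m Rk N = fspan (emb ` kK)" unfolding kK_def
  by (rule frobenius_descent[OF q kf(1), of "{..<m} \<times> {..<m}"]) (use Rks frk in \<open>auto simp: kil_def sqr_def\<close>)
 have NK: "fsubspace NK" unfolding NK_def fs.subspace_def mem_Collect_eq Ball_def
  by (auto simp: emb_simps fs.subspace_0[OF subN(1)] fs.subspace_add[OF subN(1)] fs.subspace_scale[OF subN(1)])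
 have kK: "fsubspace kK" unfolding kK_def fs.subspace_def mem_Collect_eq Ball_def
  by (auto simp: emb_simps fs.subspace_0[OF kf(1)] fs.subspace_add[OF kf(1)] fs.subspace_scale[OF kf(1)])
 have NKv: "NK <= vecs m" using subN(2) by (auto simp: NK_def V_def vecs_def emb_def)
 have kKR: "kK <= kil m R NK"
 proof
  fix f assume f: "f \<in> kK"
  then have "emb f \<in> Rk" by (simp add: kK_def kil_def)
  then have fR: "f \<in> R" using span_emb(3)[OF R(1) Rf] by (simp add: Rk_def)
  have "bil m f x y = 0" if "x \<in> NK" "y \<in> vecs m" for x y
  proof -
   have "emb y \<in> vecs m" using that(2) by (auto simp: vecs_def emb_def)
   then have "bil m (emb f) (emb x) (emb y) = 0" using f that(1) by (auto simp: kK_def kil_def NK_def)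
   moreover have "bil m (emb f) (emb x) (emb y) = to_ac (bil m f x y)"
    by (simp add: bil_def emb_def to_ac_sum)
   ultimately show ?thesis by simp
  qed
  then show "f \<in> kil m R NK" using fR by (simp add: kil_def)
 qed
 have fin: "ffin_dim NK" "ffin_dim kK" "ffin_dim (kil m R NK)"
  using fs.fin_dim_mono[OF NKv vecs_fin(2)] fs.fin_dim_mono[OF kKR] fs.fin_dim_mono[OF _ Rf, of "kil m R NK"]
  by (auto simp: kil_def)
 have d1: "fdim N = fdim NK" unfolding eN by (rule span_emb(1)[OF NK fin(1)])
 have d2: "fdim (kil m Rk N) = fdim kK" unfolding ek by (rule span_emb(1)[OF kK fin(2)])
 have "NK ~= vecs m"
 proof
  assume "NK = vecs m"
  then have "fdim N = m" using d1 vecs_fin(3) by simp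
  then have "N = V" using fs.subspace_eq_dim[OF subN V(2)] V(3) by simp
  then show False using NV by simp
 qed
 then have "fdim (kil m R NK) + fdim NK < m" using pos NK NKv by (simp add: positive_def)
 moreover have "fdim kK <= fdim (kil m R NK)" by (rule fs.dim_mono_fin[OF kKR fin(3)])
 ultimately have "d N < m" using d1 d2 by (simp add: d_def)
 moreover have "m <= d N" using d0 Nm(2)[OF PN0] N(1) by (simp add: Q_def)
 ultimately show False by simp
qed

text \<open>The rank bound for matrices over K. The family is extended bilinearly to the closure,
  where the constraint survives by \<open>positive_emb\<close> and faithfulness by
  \<open>independent_emb\<close>. In the array on the right the rows are indexed by (i, p) and the
  columns by (j, r). Characteristic 2 makes the zero diagonal a separate condition.\<close>

theorem alternating_rank_bound:
 fixes t :: "nat => nat => nat \<times> nat => 'k::{field,finite}"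
 assumes R: "fsubspace R" "R <= sqr m" "positive m R"
  and alt: "!!f i j. f \<in> R ==> f (i, j) = - f (j, i)" "!!f i. f \<in> R ==> f (i, i) = 0"
  and t: "!!i j. i < a ==> j < b ==> t i j \<in> R"
  and ab: "0 < a" "0 < b"
  and fa: "!!al. (!!j. j < b ==> (\<Sum>i<a. scl (al i) (t i j)) = 0) ==> \<forall>i<a. al i = 0"
  and fb: "!!be. (!!i. i < a ==> (\<Sum>j<b. scl (be j) (t i j)) = 0) ==> \<forall>j<b. be j = 0"
 shows "a + b <= fdim (fspan {(\<lambda>(j, r). if j < b & r < m then t i j (p, r) else 0) |i p. i < a & p < m})"
proof -
 define Rk where "Rk = fspan (emb ` R)"
 define q where "q = card (UNIV :: 'k set)"
 note q = q_def
 have Rf: "ffin_dim R" by (rule fs.fin_dim_mono[OF R(2) sqr_fin(2)])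
 have Rk: "fsubspace Rk" "ffin_dim Rk" using span_emb(2)[OF R(1) Rf] by (auto simp: Rk_def fs.subspace_span)
 have Rks: "Rk <= sqr m" unfolding Rk_def
  by (rule fs.span_minimal[OF _ sqr_fin(1)]) (use R(2) in \<open>auto simp: sqr_def emb_def\<close>)
 have Rkalt: "Rk <= {f. (\<forall>i j. f (i, j) = - f (j, i)) & (\<forall>i. f (i, i) = 0)}" unfolding Rk_def
 proof (rule fs.span_minimal)
  show "emb ` R <= {f. (\<forall>i j. f (i, j) = - f (j, i)) & (\<forall>i. f (i, i) = 0)}"
  proof (intro image_subsetI CollectI conjI allI)
   fix f i j assume f: "f \<in> R"
   show "emb f (i, j) = - emb f (j, i)"
    unfolding emb_def by (subst alt(1)[OF f, of i j]) (rule to_ac_minus)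
   show "emb f (i, i) = 0" unfolding emb_def by (subst alt(2)[OF f]) (rule to_ac_0)
  qed
  show "fsubspace {f :: nat \<times> nat => 'k alg_closure. (\<forall>i j. f (i, j) = - f (j, i)) & (\<forall>i. f (i, i) = 0)}"
   unfolding fs.subspace_def mem_Collect_eq Ball_def fun_app
  proof (intro conjI allI impI)
   fix x y :: "nat \<times> nat => 'k alg_closure" and i j c
   assume x: "(\<forall>i j. x (i, j) = - x (j, i)) & (\<forall>i. x (i, i) = 0)"
   have 1: "x (i, j) = - x (j, i)" "x (i, i) = 0" using x by blast+
   show "c * x (i, j) = - (c * x (j, i))" "c * x (i, i) = 0" unfolding 1(1) using 1(2) by simp_all
   assume y: "(\<forall>i j. y (i, j) = - y (j, i)) & (\<forall>i. y (i, i) = 0)"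
   have 2: "y (i, j) = - y (j, i)" "y (i, i) = 0" using y by blast+
   show "x (i, j) + y (i, j) = - (x (j, i) + y (j, i))" "x (i, i) + y (i, i) = 0"
    unfolding 1(1) 2(1) using 1(2) 2(2) by simp_all
  qed simp_all
 qed
 \<comment> \<open>Induction on the size: off-diagonal terms cancel in pairs, diagonal terms are
   0.\<close>
 have bil_alt: "bil m f x x = 0" if f: "f \<in> Rk" for f x
 proof -
  have f1: "!!i j. f (i, j) = - f (j, i)" "!!i. f (i, i) = 0" using Rkalt f by auto
  have "(\<Sum>i<n. \<Sum>j<n. x i * x j * f (i, j)) = 0" for n
  proof (induction n)
   case (Suc n)
   have "(\<Sum>i<n. x i * x n * f (i, n)) = - (\<Sum>j<n. x n * x j * f (n, j))"
    unfolding sum_negf[symmetric]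
   proof (rule sum.cong[OF refl])
    fix i show "x i * x n * f (i, n) = - (x n * x i * f (n, i))" using f1(1)[of i n] by simp
   qed
   then show ?case using Suc f1(2) by (simp add: sum.distrib)
  qed simp
  then show ?thesis by (simp add: bil_def)
 qed
 define T where "T al be = (\<Sum>i<a. \<Sum>j<b. scl (al i * be j) (emb (t i j)))" for al be :: "nat => 'k alg_closure"
 have Tl: "flin (\<lambda>al. T al be)" for be
  by (rule linear_fsI) (simp_all add: T_def sum_fun_apply fun_app algebra_simps sum.distrib sum_distrib_left)
 have Tr: "flin (T al)" for al
  by (rule linear_fsI) (simp_all add: T_def sum_fun_apply fun_app algebra_simps sum.distrib sum_distrib_left)
 have TR: "T al be \<in> Rk" for al be
  unfolding T_def Rk_def using t by (intro fs.span_sum fs.span_scale fs.span_base) auto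
 interpret alternating_family T "bil m" "vecs m" Rk UNIV UNIV
 proof (rule alternating_family.intro)
  show "fdim {f \<in> Rk. \<forall>x\<in>N. \<forall>y\<in>vecs m. bil m f x y = 0} + fdim N < fdim (vecs m :: (nat => 'k alg_closure) set)"
   if "fsubspace N" "N <= vecs m" "N ~= vecs m" for N
   using positive_emb[OF R] that by (simp add: positive_def kil_def Rk_def vecs_fin(3))
  show "f = 0" if "f \<in> Rk" "!!x y. x \<in> vecs m ==> y \<in> vecs m ==> bil m f x y = 0" for f
   using bil_zero[of f m] that Rks by blast
 qed (use Tl Tr TR Rk vecs_fin bil_alt in \<open>simp_all add: bil_add bil_scl\<close>)
 let ?A = "vecs a :: (nat => 'k alg_closure) set" and ?B = "vecs b :: (nat => 'k alg_closure) set"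
 let ?X = "vecs m :: (nat => 'k alg_closure) set"
 have unit: "(\<lambda>k. if k = i then 1 else 0) \<in> vecs n" if "i < n" for i n
  using that by (auto simp: vecs_def)
 have Tunit1: "T al (\<lambda>k. if k = j then 1 else 0) = (\<Sum>i<a. scl (al i) (emb (t i j)))" if "j < b" for al j
  unfolding T_def
 proof (rule sum.cong[OF refl])
  fix i
  have "(\<Sum>k<b. scl (al i * (if k = j then 1 else 0)) (emb (t i k))) = (\<Sum>k<b. if k = j then scl (al i) (emb (t i k)) else 0)"
   by (intro sum.cong) auto
  then show "(\<Sum>k<b. scl (al i * (if k = j then 1 else 0)) (emb (t i k))) = scl (al i) (emb (t i j))"
   using that by simp
 qed
 have Tunit2: "T (\<lambda>k. if k = i then 1 else 0) be = (\<Sum>j<b. scl (be j) (emb (t i j)))" if "i < a" for be i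
 proof -
  have "T (\<lambda>k. if k = i then 1 else 0) be = (\<Sum>k<a. if k = i then (\<Sum>j<b. scl (be j) (emb (t k j))) else 0)"
   unfolding T_def by (intro sum.cong) auto
  then show ?thesis using that by simp
 qed
 \<comment> \<open>Joining the matrices \<open>t i j\<close> for all \<open>j\<close> turns
   faithfulness in the first argument into independence of one single family, as
   \<open>independent_emb\<close> requires; \<open>gb\<close> does the same for the second
   argument.\<close>
 define ga where "ga i = (\<lambda>(j, p). if j < b then t i j p else 0)" for i
 define gb where "gb j = (\<lambda>(i, p). if i < a then t i j p else 0)" for j
 have ga0: "\<forall>i<a. al i = 0" if "(\<Sum>i<a. scl (al i) (ga i)) = 0" for al
 proof (rule fa)
  fix j assume j: "j < b"
  show "(\<Sum>i<a. scl (al i) (t i j)) = 0"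
  proof
   fix p
   have "(\<Sum>i<a. scl (al i) (ga i)) (j, p) = 0 (j, p)" by (simp only: that)
   then show "(\<Sum>i<a. scl (al i) (t i j)) p = 0 p" using j by (simp add: sum_fun_apply fun_app ga_def)
  qed
 qed
 have gb0: "\<forall>j<b. be j = 0" if "(\<Sum>j<b. scl (be j) (gb j)) = 0" for be
 proof (rule fb)
  fix i assume i: "i < a"
  show "(\<Sum>j<b. scl (be j) (t i j)) = 0"
  proof
   fix p
   have "(\<Sum>j<b. scl (be j) (gb j)) (i, p) = 0 (i, p)" by (simp only: that)
   then show "(\<Sum>j<b. scl (be j) (t i j)) p = 0 p" using i by (simp add: sum_fun_apply fun_app gb_def)
  qed
 qed
 have main: "fdim ?A + fdim ?B <= s ?A ?B"
 proof (rule rank_bound)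
  show "?A ~= {0}"
  proof
   assume "?A = {0}"
   then have "fdim ?A = 0" by (simp add: fs.dim_zero)
   then show False using ab(1) by (simp add: vecs_fin(3))
  qed
  show "?B ~= {0}"
  proof
   assume "?B = {0}"
   then have "fdim ?B = 0" by (simp add: fs.dim_zero)
   then show False using ab(2) by (simp add: vecs_fin(3))
  qed
  show "al = 0" if A: "al \<in> ?A" and h: "!!be. be \<in> ?B ==> T al be = 0" for al
  proof -
   have z: "(\<Sum>i<a. scl (al i) (emb (t i j))) = 0" if "j < b" for j
    using Tunit1[OF that] h[OF unit[OF that]] by simp
   have "(\<Sum>i<a. scl (al i) (emb (ga i))) = 0"
   proof (rule ext, clarify)
    fix j p1 p2
    show "(\<Sum>i<a. scl (al i) (emb (ga i))) (j, p1, p2) = 0 (j, p1, p2)"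
    proof (cases "j < b")
     case True
     then show ?thesis using fun_cong[OF z[OF True], of "(p1, p2)"]
      by (simp add: sum_fun_apply fun_app ga_def emb_def)
    qed (simp add: sum_fun_apply fun_app ga_def emb_def)
   qed
   then have "al i = 0" if "i < a" for i using independent_emb[OF q ga0] that by blast
   moreover have "al i = 0" if "\<not> i < a" for i using A that by (simp add: vecs_def)
   ultimately show ?thesis by (intro ext) (metis zero_fun_apply)
  qed
  show "be = 0" if B: "be \<in> ?B" and h: "!!al. al \<in> ?A ==> T al be = 0" for be
  proof -
   have z: "(\<Sum>j<b. scl (be j) (emb (t i j))) = 0" if "i < a" for i
    using Tunit2[OF that] h[OF unit[OF that]] by simp
   have "(\<Sum>j<b. scl (be j) (emb (gb j))) = 0"
   proof (rule ext, clarify)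
    fix i p1 p2
    show "(\<Sum>j<b. scl (be j) (emb (gb j))) (i, p1, p2) = 0 (i, p1, p2)"
    proof (cases "i < a")
     case True
     then show ?thesis using fun_cong[OF z[OF True], of "(p1, p2)"]
      by (simp add: sum_fun_apply fun_app gb_def emb_def)
    qed (simp add: sum_fun_apply fun_app gb_def emb_def)
   qed
   then have "be i = 0" if "i < b" for i using independent_emb[OF q gb0] that by blast
   moreover have "be i = 0" if "\<not> i < b" for i using B that by (simp add: vecs_def)
   ultimately show ?thesis by (intro ext) (metis zero_fun_apply)
  qed
 qed (simp_all add: vecs_fin)
 let ?row = "\<lambda>i p. (\<lambda>(j, r). if j < b & r < m then t i j (p, r) else 0)"
 define S where "S = fspan {?row i p |i p. i < a & p < m}"
 have Sf: "fsubspace S" "ffin_dim S"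
 proof -
  have "S <= fspan ((\<lambda>(i, p). ?row i p) ` ({..<a} \<times> {..<m}))" unfolding S_def by (rule fs.span_mono) auto
  then show "ffin_dim S" by (rule fs.fin_dimI[rotated]) auto
 qed (simp add: S_def fs.subspace_span)
 \<comment> \<open>Extends a row of the coordinate array bilinearly to all pairs of vectors. The
   image of the extended row space contains all rows of \<open>tau\<close>, so the rank of
   \<open>tau\<close> is at most that of the array.\<close>
 define L where "L g = (\<lambda>(be, y). if be \<in> ?B & y \<in> ?X then \<Sum>j<b. \<Sum>r<m. be j * y r * g (j, r) else 0)"
  for g :: "nat \<times> nat => 'k alg_closure"
 have Llin: "flin L"
  by (rule linear_fsI) (auto simp: L_def fun_app algebra_simps sum.distrib sum_distrib_left)
 let ?E = "fspan (emb ` S)"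
 have row: "row (?B \<times> ?X) (al, x) \<in> L ` ?E" for al x
 proof -
  let ?g = "\<Sum>i<a. \<Sum>p<m. scl (al i * x p) (emb (?row i p))"
  have "?g \<in> ?E" by (intro fs.span_sum fs.span_scale fs.span_base imageI) (auto simp: S_def intro!: fs.span_base)
  moreover have "row (?B \<times> ?X) (al, x) = L ?g"
  proof (rule ext, clarify)
   fix be y
   show "row (?B \<times> ?X) (al, x) (be, y) = L ?g (be, y)"
   proof (cases "be \<in> ?B & y \<in> ?X")
    case True
    have "L ?g (be, y) = (\<Sum>j<b. \<Sum>r<m. \<Sum>i<a. \<Sum>p<m. be j * y r * (al i * x p * to_ac (t i j (p, r))))"
     using True by (simp add: L_def sum_fun_apply fun_app emb_def sum_distrib_left)
    also have "\<dots> = (\<Sum>(j, r, i, p)\<in>{..<b} \<times> {..<m} \<times> {..<a} \<times> {..<m}. be j * y r * (al i * x p * to_ac (t i j (p, r))))"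
     by (simp add: sum.cartesian_product)
    also have "\<dots> = (\<Sum>(p, r, i, j)\<in>{..<m} \<times> {..<m} \<times> {..<a} \<times> {..<b}. x p * y r * (al i * be j * to_ac (t i j (p, r))))"
     by (rule sum.reindex_bij_witness[of _ "\<lambda>(p, r, i, j). (j, r, i, p)" "\<lambda>(j, r, i, p). (p, r, i, j)"]) (auto simp: mult_ac)
    also have "\<dots> = (\<Sum>p<m. \<Sum>r<m. \<Sum>i<a. \<Sum>j<b. x p * y r * (al i * be j * to_ac (t i j (p, r))))"
     by (simp add: sum.cartesian_product)
    also have "\<dots> = row (?B \<times> ?X) (al, x) (be, y)"
     using True by (simp add: row_def tau_def bil_def T_def sum_fun_apply fun_app emb_def sum_distrib_left)
    finally show ?thesis by simp
   qed (auto simp: row_def L_def)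
  qed
  ultimately show ?thesis by blast
 qed
 have sE: "fsubspace (L ` ?E)"
 proof -
  have "L ` ?E = fspan (L ` emb ` S)" by (rule linear_fs_span[OF Llin])
  then show ?thesis by (simp add: fs.subspace_span)
 qed
 note rn = fsp.rank_nullity[OF Llin fs.subspace_span span_emb(2)[OF Sf]]
 have "rows tau (?A \<times> ?X) (?B \<times> ?X) <= L ` ?E"
  unfolding rows_row by (rule fs.span_minimal[OF _ sE]) (use row in auto)
 then have "s ?A ?B <= fdim (L ` ?E)" unfolding s_def rk_def by (rule fs.dim_mono_fin[OF _ rn(2)])
 also have "\<dots> <= fdim ?E" using rn(1) by linarith
 also have "\<dots> = fdim S" by (rule span_emb(1)[OF Sf])
 finally show ?thesis using main by (simp add: vecs_fin(3) S_def)
qed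

declare fun_app [simp]

section \<open>Graded 3-nilpotent Lie algebras\<close>

text \<open>Every substructure is a sum of this kind of its homogeneous parts.\<close>

definition comb :: "'a::ab_group_add set => 'a set => 'a set => 'a set" where
 "comb A B C = {x + y + z |x y z. x \<in> A & y \<in> B & z \<in> C}"

lemma carrier_comb: "carrier M = comb (grade M 1) (grade M 2) (grade M 3)"
 by (simp add: carrier_def comb_def)

locale lie3 =
 fixes M :: "('k::{field,finite}, 'a::ab_group_add) glie"
 assumes lie: "graded_lie3 M"
begin

sublocale vs: vspace "smul M"
 using lie by (simp add: graded_lie3_def vspace_def)

abbreviation G :: "nat => 'a set" where "G \<equiv> grade M"
abbreviation br :: "'a => 'a => 'a" where "br \<equiv> bracket M"

lemma G_sub: "vs.subspace (G i)"
 using lie by (simp add: graded_lie3_def)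

lemma G_other: "i ~= 1 ==> i ~= 2 ==> i ~= 3 ==> G i = {0}"
 using lie by (simp add: graded_lie3_def)

lemma G_direct: "x \<in> G 1 ==> y \<in> G 2 ==> z \<in> G 3 ==> x + y + z = 0 ==> x = 0 & y = 0 & z = 0"
 using lie unfolding graded_lie3_def by blast

lemma br_G: "x \<in> G i ==> y \<in> G j ==> br x y \<in> G (i + j)"
 using lie unfolding graded_lie3_def by blast

lemma br_G11: "x \<in> G 1 ==> y \<in> G 1 ==> br x y \<in> G 2"
 and br_G12: "x \<in> G 1 ==> y \<in> G 2 ==> br x y \<in> G 3"
 using br_G[of x 1 y 1] br_G[of x 1 y 2] br_G[of x 2 y 1] by (simp_all add: numeral_eq_Suc)

lemma br_high: "x \<in> G i ==> y \<in> G j ==> 3 < i + j ==> br x y = 0"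
 using br_G[of x i y j] G_other[of "i + j"] by auto

lemma G0 [simp]: "0 \<in> G i" by (rule vs.subspace_0[OF G_sub])

lemma G_carrier: "i \<in> {1, 2, 3} ==> x \<in> G i ==> x \<in> carrier M"
proof -
 assume "i \<in> {1, 2, 3}" "x \<in> G i"
 then have "x \<in> G 1 \<or> x \<in> G 2 \<or> x \<in> G 3" by auto
 moreover have "x = x + 0 + 0" "x = 0 + x + 0" "x = 0 + 0 + x" by simp_all
 ultimately show ?thesis unfolding carrier_comb comb_def using G0 by blast
qed

lemma G1c [simp]: "x \<in> G (Suc 0) ==> x \<in> carrier M"
 and G2c [simp]: "x \<in> G 2 ==> x \<in> carrier M" and G3c [simp]: "x \<in> G 3 ==> x \<in> carrier M"
 using G_carrier[of 1 x] G_carrier[of 2 x] G_carrier[of 3 x] by simp_all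

lemma Gc: "x \<in> G i ==> x \<in> carrier M"
 using G_carrier[of i x] G_other[of i] G1c[of 0] by (cases "i \<in> {1,2,3}") auto

lemma comb_subspace:
 assumes "vs.subspace A" "vs.subspace B" "vs.subspace C"
 shows "vs.subspace (comb A B C)"
proof -
 have "comb A B C = {x + y |x y. x \<in> {x + y |x y. x \<in> A & y \<in> B} & y \<in> C}"
  unfolding comb_def by blast
 then show ?thesis using vs.subspace_sums[OF vs.subspace_sums[OF assms(1,2)] assms(3)] by simp
qed

lemma carrier_subspace: "vs.subspace (carrier M)"
 unfolding carrier_comb by (intro comb_subspace G_sub)

lemma carrier_0 [simp]: "0 \<in> carrier M" by (rule vs.subspace_0[OF carrier_subspace])
lemma carrier_add: "x \<in> carrier M ==> y \<in> carrier M ==> x + y \<in> carrier M"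
 by (rule vs.subspace_add[OF carrier_subspace])

lemma br_add_left: "x \<in> carrier M ==> y \<in> carrier M ==> z \<in> carrier M ==> br (x + y) z = br x z + br y z"
 and br_add_right: "x \<in> carrier M ==> y \<in> carrier M ==> z \<in> carrier M ==> br x (y + z) = br x y + br x z"
 and br_smul_left: "x \<in> carrier M ==> y \<in> carrier M ==> br (smul M c x) y = smul M c (br x y)"
 and br_smul_right: "x \<in> carrier M ==> y \<in> carrier M ==> br x (smul M c y) = smul M c (br x y)"
 and br_self: "x \<in> carrier M ==> br x x = 0"
 and jacobi: "x \<in> carrier M ==> y \<in> carrier M ==> z \<in> carrier M ==>
   br x (br y z) + br y (br z x) + br z (br x y) = 0"
 using lie unfolding graded_lie3_def by blast+

lemma br_0 [simp]: "x \<in> carrier M ==> br 0 x = 0" "x \<in> carrier M ==> br x 0 = 0"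
 using br_add_left[of 0 0 x] br_add_right[of x 0 0] by auto

lemma br_anti: "x \<in> carrier M ==> y \<in> carrier M ==> br y x = - br x y"
 using br_self[of "x + y"] br_self[of x] br_self[of y]
 by (simp add: br_add_left br_add_right carrier_add eq_neg_iff_add_eq_0 add.commute)

lemma direct_unique:
 assumes "x \<in> G 1" "y \<in> G 2" "z \<in> G 3" "x' \<in> G 1" "y' \<in> G 2" "z' \<in> G 3" "x + y + z = x' + y' + z'"
 shows "x = x' & y = y' & z = z'"
 using G_direct[of "x - x'" "y - y'" "z - z'"] assms vs.subspace_diff[OF G_sub]
 by (simp add: algebra_simps)

text \<open>\<open>proj\<close> is a definite description of a whole family of components;
  directness of the sum makes the family unique, with 0 in all other degrees.\<close>

lemma proj_sum:
 assumes "x \<in> G 1" "y \<in> G 2" "z \<in> G 3"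
 shows "proj M i (x + y + z) = (if i = 1 then x else if i = 2 then y else if i = 3 then z else 0)"
proof -
 let ?c = "\<lambda>i::nat. if i = 1 then x else if i = 2 then y else if i = 3 then z else 0"
 have "(THE c. (\<forall>j. c j \<in> G j) & x + y + z = c 1 + c 2 + c 3) = ?c"
 proof (rule the_equality)
  show "(\<forall>j. ?c j \<in> G j) & x + y + z = ?c 1 + ?c 2 + ?c 3" using assms by simp
  fix c :: "nat => 'a" assume c: "(\<forall>j. c j \<in> G j) & x + y + z = c 1 + c 2 + c 3"
  then have "x = c 1 & y = c 2 & z = c 3" using direct_unique[of x y z "c 1" "c 2" "c 3"] assms by blast
  moreover have "c j = 0" if "j ~= 1" "j ~= 2" "j ~= 3" for j using c G_other[OF that] by blast
  ultimately show "c = ?c" by auto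
 qed
 then show ?thesis unfolding proj_def by simp
qed

lemma carrierE:
 assumes "x \<in> carrier M"
 obtains a b c where "x = a + b + c" "a \<in> G 1" "b \<in> G 2" "c \<in> G 3"
 using assms unfolding carrier_def by blast

lemma proj_decomp: "x \<in> carrier M ==> x = proj M 1 x + proj M 2 x + proj M 3 x"
 and proj_G: "x \<in> carrier M ==> proj M i x \<in> G i"
 by (erule carrierE, simp add: proj_sum)+

lemma proj_hom: "x \<in> G i ==> proj M j x = (if i = j then x else 0)"
proof -
 assume x: "x \<in> G i"
 consider "i = 1" | "i = 2" | "i = 3" | "x = 0" using x G_other[of i] by blast
 then show ?thesis
  using x proj_sum[of x 0 0 j] proj_sum[of 0 x 0 j] proj_sum[of 0 0 x j] proj_sum[of 0 0 0 j]
  by cases auto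
qed

lemma G_Int: "x \<in> G i ==> x \<in> G j ==> i ~= j ==> x = 0"
 using proj_hom[of x i i] proj_hom[of x j i] by simp

lemma proj_add: "x \<in> carrier M ==> y \<in> carrier M ==> proj M i (x + y) = proj M i x + proj M i y"
proof -
 assume x: "x \<in> carrier M" and y: "y \<in> carrier M"
 obtain a b c where 1: "x = a + b + c" "a \<in> G 1" "b \<in> G 2" "c \<in> G 3" using x by (rule carrierE)
 obtain a' b' c' where 2: "y = a' + b' + c'" "a' \<in> G 1" "b' \<in> G 2" "c' \<in> G 3" using y by (rule carrierE)
 have "x + y = (a + a') + (b + b') + (c + c')" unfolding 1 2 by (simp add: algebra_simps)
 moreover have "proj M i (a + a' + (b + b') + (c + c')) = proj M i (a + b + c) + proj M i (a' + b' + c')"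
  using 1 2 by (simp add: proj_sum vs.subspace_add[OF G_sub])
 ultimately show ?thesis by (simp only: 1(1) 2(1))
qed

lemma proj_smul: "x \<in> carrier M ==> proj M i (smul M r x) = smul M r (proj M i x)"
proof -
 assume x: "x \<in> carrier M"
 obtain a b c where 1: "x = a + b + c" "a \<in> G 1" "b \<in> G 2" "c \<in> G 3" using x by (rule carrierE)
 have "smul M r x = smul M r a + smul M r b + smul M r c" unfolding 1 by (simp add: vs.scale_right_distrib)
 moreover have "proj M i (smul M r a + smul M r b + smul M r c) = smul M r (proj M i (a + b + c))"
  using 1 by (simp add: proj_sum vs.subspace_scale[OF G_sub])
 ultimately show ?thesis by (simp only: 1(1))
qed

lemma br_expand:
 assumes "a \<in> G 1" "b \<in> G 2" "c \<in> G 3" "a' \<in> G 1" "b' \<in> G 2" "c' \<in> G 3"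
 shows "br (a + b + c) (a' + b' + c') = br a a' + (br a b' + br b a')"
proof -
 have z: "br a c' = 0" "br b b' = 0" "br b c' = 0" "br c a' = 0" "br c b' = 0" "br c c' = 0"
  using assms by (auto intro: br_high[of _ 1 _ 3] br_high[of _ 2 _ 2] br_high[of _ 2 _ 3]
   br_high[of _ 3 _ 1] br_high[of _ 3 _ 2] br_high[of _ 3 _ 3])
 have c: "a \<in> carrier M" "b \<in> carrier M" "c \<in> carrier M" "a' \<in> carrier M" "b' \<in> carrier M" "c' \<in> carrier M"
  using assms by auto
 show ?thesis using c z by (simp add: br_add_left br_add_right carrier_add)
qed

lemma substructureD:
 assumes "substructure M A"
 shows "A <= carrier M" "vs.subspace A" "!!i x. x \<in> A ==> proj M i x \<in> A" "!!x y. x \<in> A ==> y \<in> A ==> br x y \<in> A"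
  "A = comb (A \<inter> G 1) (A \<inter> G 2) (A \<inter> G 3)" "vs.subspace (A \<inter> G i)"
proof -
 show 1: "A <= carrier M" "!!i x. x \<in> A ==> proj M i x \<in> A" "!!x y. x \<in> A ==> y \<in> A ==> br x y \<in> A"
  and 2: "vs.subspace A"
  using assms by (auto simp: substructure_def vs.subspace_def)
 show "vs.subspace (A \<inter> G i)" by (rule vs.subspace_inter[OF 2 G_sub])
 show "A = comb (A \<inter> G 1) (A \<inter> G 2) (A \<inter> G 3)"
 proof
  show "A <= comb (A \<inter> G 1) (A \<inter> G 2) (A \<inter> G 3)"
  proof
   fix x assume x: "x \<in> A"
   then have "x = proj M 1 x + proj M 2 x + proj M 3 x" using 1(1) proj_decomp by blast
   moreover have "proj M i x \<in> A \<inter> G i" for i using x 1(1,2) proj_G by blast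
   ultimately show "x \<in> comb (A \<inter> G 1) (A \<inter> G 2) (A \<inter> G 3)" unfolding comb_def by blast
  qed
  show "comb (A \<inter> G 1) (A \<inter> G 2) (A \<inter> G 3) <= A"
   unfolding comb_def using vs.subspace_add[OF 2] by blast
 qed
qed

text \<open>Brackets of total degree above 3 vanish and [M_2, M_1] is the negative of [M_1, M_2], so
  two closure conditions suffice.\<close>

lemma comb_substructure:
 assumes sub: "vs.subspace A" "vs.subspace B" "vs.subspace C" and G: "A <= G 1" "B <= G 2" "C <= G 3"
  and br11: "!!x y. x \<in> A ==> y \<in> A ==> br x y \<in> B" and br12: "!!x y. x \<in> A ==> y \<in> B ==> br x y \<in> C"
 shows "substructure M (comb A B C)" "comb A B C \<inter> G 1 = A" "comb A B C \<inter> G 2 = B" "comb A B C \<inter> G 3 = C"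
proof -
 have S: "vs.subspace (comb A B C)" by (rule comb_subspace[OF sub])
 have z: "0 \<in> A" "0 \<in> B" "0 \<in> C" using sub vs.subspace_0 by blast+
 have inc: "A <= comb A B C" "B <= comb A B C" "C <= comb A B C"

 proof -
  have "x = x + 0 + 0" "x = 0 + x + 0" "x = 0 + 0 + x" for x :: 'a by simp_all
  then show "A <= comb A B C" "B <= comb A B C" "C <= comb A B C" unfolding comb_def using z by blast+
 qed
 have pr: "proj M 1 x \<in> A" "proj M 2 x \<in> B" "proj M 3 x \<in> C" if "x \<in> comb A B C" for x
  using that proj_sum G unfolding comb_def by (force simp: subset_iff)+
 show "substructure M (comb A B C)"
  unfolding substructure_def
 proof (intro conjI ballI allI)
  show "comb A B C <= carrier M" unfolding carrier_comb comb_def using G by blast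
  show "0 \<in> comb A B C" "!!x. x \<in> comb A B C ==> - x \<in> comb A B C"
   "!!x y. x \<in> comb A B C ==> y \<in> comb A B C ==> x + y \<in> comb A B C"
   "!!c x. x \<in> comb A B C ==> smul M c x \<in> comb A B C"
   using S vs.subspace_0 vs.subspace_neg vs.subspace_add vs.subspace_scale by blast+
  show "proj M i x \<in> comb A B C" if "x \<in> comb A B C" for i x
  proof -
   have "proj M i x = 0" if "i ~= 1" "i ~= 2" "i ~= 3"
    using \<open>x \<in> comb A B C\<close> G that proj_sum unfolding comb_def by (force simp: subset_iff)
   then show ?thesis using pr[OF that] inc z by (cases "i = 1 \<or> i = 2 \<or> i = 3") auto
  qed
  show "br x y \<in> comb A B C" if xy: "x \<in> comb A B C" "y \<in> comb A B C" for x y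
  proof -
   obtain a b c where 1: "x = a + b + c" "a \<in> A" "b \<in> B" "c \<in> C" using xy(1) unfolding comb_def by blast
   obtain a' b' c' where 2: "y = a' + b' + c'" "a' \<in> A" "b' \<in> B" "c' \<in> C" using xy(2) unfolding comb_def by blast
   have e: "br x y = br a a' + (br a b' + br b a')"
    unfolding 1(1) 2(1) by (rule br_expand) (use 1 2 G in auto)
   have "br b a' = - br a' b" by (rule br_anti) (use 1 2 G in auto)
   then have "br b a' \<in> C" using br12[OF 2(2) 1(3)] vs.subspace_neg[OF sub(3)] by simp
   then have "br a b' + br b a' \<in> C" using br12[OF 1(2) 2(3)] vs.subspace_add[OF sub(3)] by blast
   then have "br a b' + br b a' \<in> comb A B C" using inc by blast
   moreover have "br a a' \<in> comb A B C" using br11 1 2 inc by blast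
   ultimately show ?thesis unfolding e using vs.subspace_add[OF S] by blast
  qed
 qed
 show "comb A B C \<inter> G 1 = A" "comb A B C \<inter> G 2 = B" "comb A B C \<inter> G 3 = C"
 proof -
  have "x \<in> A" if "x \<in> comb A B C \<inter> G 1" for x using pr(1)[of x] proj_hom[of x 1 1] that by simp
  then show "comb A B C \<inter> G 1 = A" using inc G by blast
  have "x \<in> B" if "x \<in> comb A B C \<inter> G 2" for x using pr(2)[of x] proj_hom[of x 2 2] that by simp
  then show "comb A B C \<inter> G 2 = B" using inc G by blast
  have "x \<in> C" if "x \<in> comb A B C \<inter> G 3" for x using pr(3)[of x] proj_hom[of x 3 3] that by simp
  then show "comb A B C \<inter> G 3 = C" using inc G by blast
 qed
qed

lemma carrier_substructure: "substructure M (carrier M)"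
 unfolding carrier_comb by (rule comb_substructure) (auto simp: G_sub br_G11[simplified] br_G12[simplified])

lemma carrier_Int: "carrier M \<inter> G i = G i"
 by (rule Int_absorb1) (rule subsetI, rule Gc)

lemma Inter_substructure:
 assumes "\<A> ~= {}" "!!A. A \<in> \<A> ==> substructure M A"
 shows "substructure M (\<Inter>\<A>)"
proof -
 obtain A where A: "A \<in> \<A>" using assms(1) by blast
 have D: "substructure M B" if "B \<in> \<A>" for B by (rule assms(2)[OF that])
 show ?thesis unfolding substructure_def
 proof (intro conjI ballI allI)
  show "\<Inter>\<A> <= carrier M" using A D[OF A] unfolding substructure_def by blast
  show "0 \<in> \<Inter>\<A>" using D by (simp add: substructure_def)
  fix x assume x: "x \<in> \<Inter>\<A>"
  show "- x \<in> \<Inter>\<A>" "smul M c x \<in> \<Inter>\<A>" "proj M i x \<in> \<Inter>\<A>" for c i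
   using x D by (auto simp: substructure_def)
  fix y assume y: "y \<in> \<Inter>\<A>"
  show "x + y \<in> \<Inter>\<A>" "br x y \<in> \<Inter>\<A>" using x y D by (auto simp: substructure_def)
 qed
qed

lemma generated_substructure: "Y <= carrier M ==> substructure M (generated M Y)"
 unfolding generated_def by (rule Inter_substructure) (use carrier_substructure in auto)

lemma generated_incl: "Y <= generated M Y"
 unfolding generated_def by blast

lemma generated_minimal: "substructure M A ==> Y <= A ==> generated M Y <= A"
 unfolding generated_def by blast

lemma carrier_restrict: "substructure M A ==> carrier (restrict_to M A) = A"
 using substructureD(5)[of A] unfolding carrier_comb restrict_to_def by (simp add: Int_commute)

lemma restrict_sel [simp]: "smul (restrict_to M A) = smul M" "bracket (restrict_to M A) = bracket M"
 "grade (restrict_to M A) i = G i \<inter> A"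
 by (simp_all add: restrict_to_def)

lemma restrict_lie:
 assumes "substructure M A"
 shows "graded_lie3 (restrict_to M A)"
proof -
 note D = substructureD[OF assms]
 have Ac: "x \<in> A ==> x \<in> carrier M" for x using D(1) by blast
 show ?thesis
  unfolding graded_lie3_def carrier_restrict[OF assms] restrict_sel
 proof (intro conjI allI impI ballI)
  show "vector_space (smul M)" by (rule vs.vector_space_axioms)
  show "module.subspace (smul M) (G i \<inter> A)" for i using D(6) by (simp add: Int_commute)
  show "G i \<inter> A = {0}" if "i ~: {1, 2, 3}" for i
   using G_other[of i] that vs.subspace_0[OF D(2)] by auto
  show "bracket M x y \<in> G (i + j) \<inter> A" if "x \<in> G i \<inter> A" "y \<in> G j \<inter> A" for x y i j
   using that br_G D(4) by blast
 next
  fix x y z assume "x \<in> G 1 \<inter> A" "y \<in> G 2 \<inter> A" "z \<in> G 3 \<inter> A" "x + y + z = 0"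
  then show "x = 0" "y = 0" "z = 0" using G_direct[of x y z] by auto
 qed (simp_all add: Ac br_add_left br_add_right br_smul_left br_smul_right br_self jacobi)
qed

lemma proj_restrict:
 assumes "substructure M A" "x \<in> A"
 shows "proj (restrict_to M A) i x = proj M i x"
proof -
 interpret R: lie3 "restrict_to M A" by unfold_locales (rule restrict_lie[OF assms(1)])
 note D = substructureD[OF assms(1)]
 have x: "x = proj M 1 x + proj M 2 x + proj M 3 x" using assms D(1) proj_decomp by blast
 have p: "proj M j x \<in> G j \<inter> A" for j using assms D(1,3) proj_G by blast
 have "proj (restrict_to M A) i (proj M 1 x + proj M 2 x + proj M 3 x) = proj M i (proj M 1 x + proj M 2 x + proj M 3 x)"
  using R.proj_sum[of "proj M 1 x" "proj M 2 x" "proj M 3 x" i] proj_sum[of "proj M 1 x" "proj M 2 x" "proj M 3 x" i] p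
  by auto
 then show ?thesis using x by simp
qed

lemma substructure_restrict:
 assumes "substructure M A"
 shows "substructure (restrict_to M A) B \<longleftrightarrow> substructure M B & B <= A"
proof -
 have "B <= A ==> (\<forall>i. \<forall>x\<in>B. proj (restrict_to M A) i x \<in> B) = (\<forall>i. \<forall>x\<in>B. proj M i x \<in> B)"
  using proj_restrict[OF assms] by (metis subsetD)
 then show ?thesis
  using substructureD(1)[OF assms] unfolding substructure_def carrier_restrict[OF assms] restrict_sel by blast
qed

lemma restrict_carrier: "restrict_to M (carrier M) = M"
proof -
 have "(\<lambda>i. G i \<inter> carrier M) = G" using carrier_Int by (auto simp: Int_commute)
 then show ?thesis unfolding restrict_to_def by simp
qed

end

section \<open>Counting in vector spaces over a finite field\<close>

declare fun_app [simp del]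

text \<open>All nonempty fibres are translates of the kernel. No scalars occur, so the map may
  connect spaces with different scalar multiplications.\<close>

lemma additive_card:
 fixes f :: "'a::ab_group_add => 'b::ab_group_add"
 assumes "finite S" "!!x y. x \<in> S ==> y \<in> S ==> x - y \<in> S" "0 \<in> S"
  and f: "!!x y. x \<in> S ==> y \<in> S ==> f (x - y) = f x - f y"
 shows "card S = card {x\<in>S. f x = 0} * card (f ` S)"
proof -
 have "card S = (\<Sum>y\<in>f ` S. card {x\<in>S. f x = y})"
  using sum.image_gen[OF assms(1), of "\<lambda>_. 1 :: nat" f] by simp
 also have "\<dots> = (\<Sum>y\<in>f ` S. card {x\<in>S. f x = 0})"
 proof (rule sum.cong[OF refl])
  fix y assume "y \<in> f ` S"
  then obtain x0 where x0: "x0 \<in> S" "y = f x0" by blast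
  have add: "x + x0 \<in> S" "f (x + x0) = f x + f x0" if "x \<in> S" for x
  proof -
   have n: "- x0 \<in> S" using assms(2)[OF assms(3) x0(1)] by simp
   show "x + x0 \<in> S" using assms(2)[OF that n] by simp
   have "f (- x0) = - f x0" using f[OF assms(3) x0(1)] f[OF assms(3,3)] by simp
   then show "f (x + x0) = f x + f x0" using f[OF that n] by simp
  qed
  have "bij_betw (\<lambda>x. x - x0) {x\<in>S. f x = y} {x\<in>S. f x = 0}"
   by (rule bij_betw_byWitness[where f' = "\<lambda>x. x + x0"])
    (use x0 add assms(2) f in \<open>auto simp: image_subset_iff\<close>)
  then show "card {x\<in>S. f x = y} = card {x\<in>S. f x = 0}" by (rule bij_betw_same_card)
 qed
 also have "\<dots> = card {x\<in>S. f x = 0} * card (f ` S)" by (simp add: mult.commute)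
 finally show ?thesis .
qed

lemma card_field_gt_1: "1 < card (UNIV :: 'k::{field,finite} set)"
proof -
 have "card {0, 1 :: 'k} <= card (UNIV :: 'k set)" by (rule card_mono) auto
 then show ?thesis by simp
qed

text \<open>Over a finite field the dimension is determined by the cardinality. Dimensions in
  different ambient types can therefore be compared by counting elements.\<close>

locale fin_vspace = vspace scale
 for scale :: "'k::{field,finite} => 'b::ab_group_add => 'b" (infixr "*f" 75)
begin

lemma finite_span: "finite B ==> finite (span B)"
proof (induction B rule: finite_induct)
 case (insert b B)
 have "span (insert b B) <= (\<lambda>(k, x). x + k *f b) ` (UNIV \<times> span B)"
 proof
  fix x assume "x \<in> span (insert b B)"
  then obtain k where "x - k *f b \<in> span B" unfolding span_insert by blast
  then have "(k, x - k *f b) \<in> UNIV \<times> span B" by simp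
  then have "(\<lambda>(k, x). x + k *f b) (k, x - k *f b) \<in> (\<lambda>(k, x). x + k *f b) ` (UNIV \<times> span B)" by (rule imageI)
  then show "x \<in> (\<lambda>(k, x). x + k *f b) ` (UNIV \<times> span B)" by simp
 qed
 then show ?case by (rule finite_subset) (use insert.IH in simp)
qed simp

lemma fin_dim_finite: "finite S ==> fin_dim S"
 by (rule fin_dimI[of S]) (auto intro: span_base)

lemma card_span_independent:
 assumes "finite B" "independent B"
 shows "card (span B) = card (UNIV :: 'k set) ^ card B"
 using assms
proof (induction B rule: finite_induct)
 case empty
 then show ?case by simp
next
 case (insert b B)
 have nb: "b ~: span B" and iB: "independent B"
  using insert.prems insert.hyps(2) independent_insert by auto
 have "bij_betw (\<lambda>(k, x). x + k *f b) (UNIV \<times> span B) (span (insert b B))"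
  unfolding bij_betw_def
 proof
  show "inj_on (\<lambda>(k, x). x + k *f b) (UNIV \<times> span B)"
  proof (rule inj_onI, clarify)
   fix k x l y assume xy: "x \<in> span B" "y \<in> span B" and e: "x + k *f b = y + l *f b"
   have "(k - l) *f b = y - x" using e by (simp add: scale_left_diff_distrib algebra_simps)
   then have s: "(k - l) *f b \<in> span B" using xy span_diff by simp
   have "k - l = 0"
   proof (rule ccontr)
    assume "k - l ~= 0"
    then have "b = (1 / (k - l)) *f ((k - l) *f b)" by simp
    also have "\<dots> \<in> span B" by (rule span_scale[OF s])
    finally show False using nb by simp
   qed
   then show "k = l & x = y" using e by simp
  qed
  show "(\<lambda>(k, x). x + k *f b) ` (UNIV \<times> span B) = span (insert b B)"
  proof
   show "(\<lambda>(k, x). x + k *f b) ` (UNIV \<times> span B) <= span (insert b B)"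
    using span_mono[of B "insert b B"] by (auto intro!: span_add span_scale intro: span_base)
   show "span (insert b B) <= (\<lambda>(k, x). x + k *f b) ` (UNIV \<times> span B)"
   proof
    fix x assume "x \<in> span (insert b B)"
    then obtain k where "x - k *f b \<in> span B" unfolding span_insert by blast
    then have "(k, x - k *f b) \<in> UNIV \<times> span B" by simp
    then have "(\<lambda>(k, x). x + k *f b) (k, x - k *f b) \<in> (\<lambda>(k, x). x + k *f b) ` (UNIV \<times> span B)" by (rule imageI)
    then show "x \<in> (\<lambda>(k, x). x + k *f b) ` (UNIV \<times> span B)" by simp
   qed
  qed
 qed
 then have "card (span (insert b B)) = card ((UNIV :: 'k set) \<times> span B)"
  by (rule bij_betw_same_card[symmetric])
 then show ?case using insert iB by (simp add: card_cartesian_product)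
qed

lemma card_dim: "subspace S ==> finite S ==> card S = card (UNIV :: 'k set) ^ dim S"
proof -
 assume S: "subspace S" "finite S"
 obtain B where B: "B <= S" "independent B" "S <= span B" "card B = dim S" "finite B"
  using fin_dim_basis[OF fin_dim_finite[OF S(2)]] by blast
 then have "S = span B" using S(1) span_minimal by blast
 then show ?thesis using card_span_independent[OF B(5,2)] B(4) by simp
qed

lemma indep_modD:
 assumes "subspace W" "indep_mod scale W B" "finite B"
 shows "independent B" "span B \<inter> W = {0}"
proof -
 show "independent B"
 proof (rule independent_if_scalars_zero[OF assms(3)])
  fix f x assume s: "(\<Sum>x\<in>B. f x *f x) = 0" and x: "x \<in> B"
  have "(\<Sum>x\<in>B. f x *f x) \<in> W" unfolding s by (rule subspace_0[OF assms(1)])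
  then show "f x = 0" using assms(2,3) x unfolding indep_mod_def by blast
 qed
 have "x = 0" if x: "x \<in> span B" "x \<in> W" for x
 proof -
  obtain u where u: "x = (\<Sum>b\<in>B. u b *f b)" using x(1) span_finite[OF assms(3)] by auto
  then have "\<forall>b\<in>B. u b = 0" using assms(2,3) x(2) unfolding indep_mod_def by blast
  then show ?thesis using u by simp
 qed
 then show "span B \<inter> W = {0}" using span_zero subspace_0[OF assms(1)] by auto
qed

lemma indep_mod_card:
 assumes "subspace V" "subspace W" "W <= V" "finite V" "B <= V" "indep_mod scale W B" "V <= span (W \<union> B)"
 shows "card B = dim V - dim W" "dim V = dim W + card B"
proof -
 have fB: "finite B" using assms(4,5) finite_subset by blast
 note i = indep_modD[OF assms(2,6) fB]
 have fV: "fin_dim V" using assms(4) by (rule fin_dim_finite)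
 have sB: "span B <= V" using assms(1,5) span_minimal by blast
 have "W \<inter> span B = {0}" using i(2) by (simp add: Int_commute)
 then have 1: "dim W + dim (span B) <= dim V"
  using dim_direct[OF assms(2) subspace_span assms(1,3) sB _ fV] by simp
 have dB: "dim (span B) = card B" using dim_span_eq_card_independent[OF i(1)] .
 obtain C where C: "C <= W" "independent C" "W <= span C" "card C = dim W" "finite C"
  using fin_dim_basis[OF fin_dim_mono[OF assms(3) fV]] by blast
 have "span (W \<union> B) <= span (C \<union> B)"
 proof (rule span_minimal[OF _ subspace_span])
  show "W \<union> B <= span (C \<union> B)"
   using C(3) span_mono[of C "C \<union> B"] span_superset[of "C \<union> B"] by auto
 qed
 then have "dim V <= card (C \<union> B)" using dim_le_card[of V "C \<union> B"] assms(7) C(5) fB by auto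
 then have "dim V <= dim W + card B" using card_Un_le[of C B] C(4) by linarith
 then show "dim V = dim W + card B" "card B = dim V - dim W" using 1 dB by auto
qed

lemma indep_mod_exists:
 assumes "subspace V" "subspace W" "W <= V" "finite V"
 obtains B where "finite B" "B <= V" "indep_mod scale W B" "V <= span (W \<union> B)"
proof (rule complement_exists[OF assms(2,1,3) fin_dim_finite[OF assms(4)]])
 fix T
 assume T: "subspace T" "T <= V" "W \<inter> T = {0}" "!!v. v \<in> V ==> \<exists>s\<in>W. \<exists>t\<in>T. v = s + t"
 have "finite T" using T(2) assms(4) finite_subset by blast
 then obtain B where B: "B <= T" "independent B" "T <= span B" "finite B"
  using fin_dim_basis[OF fin_dim_finite] by metis
 show ?thesis
 proof (rule that[of B])
  show "finite B" "B <= V" using B T by auto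
  show "indep_mod scale W B"
   unfolding indep_mod_def
  proof (intro allI impI ballI, elim conjE)
   fix S u b assume S: "finite S" "S <= B" "(\<Sum>b\<in>S. u b *f b) \<in> W" and b: "b \<in> S"
   have "(\<Sum>b\<in>S. u b *f b) \<in> T" using S(2) B(1) by (intro subspace_sum subspace_scale T(1)) auto
   then have "(\<Sum>b\<in>S. u b *f b) = 0" using S(3) T(3) by blast
   then show "u b = 0" using independentD[OF B(2) S(1,2)] b by blast
  qed
  show "V <= span (W \<union> B)"
  proof
   fix v assume "v \<in> V"
   then obtain s t where st: "s \<in> W" "t \<in> T" "v = s + t" using T(4) by blast
   have "s \<in> span (W \<union> B)" using st(1) by (intro span_base) simp
   moreover have "t \<in> span (W \<union> B)" using st(2) B(3) span_mono[of B "W \<union> B"] by auto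
   ultimately show "v \<in> span (W \<union> B)" unfolding st(3) by (rule span_add)
  qed
 qed
qed

lemma dim_mod_eq:
 assumes "subspace V" "subspace W" "W <= V" "finite V"
 shows "dim_mod scale V W = dim V - dim W"
 unfolding dim_mod_def
proof (rule the_equality)
 obtain B where "finite B" "B <= V" "indep_mod scale W B" "V <= span (W \<union> B)"
  using indep_mod_exists[OF assms] by blast
 then show "\<exists>B. finite B & B <= V & indep_mod scale W B & V <= span (W \<union> B) & card B = dim V - dim W"
  using indep_mod_card(1)[OF assms] by blast
 show "n = dim V - dim W"
  if "\<exists>B. finite B & B <= V & indep_mod scale W B & V <= span (W \<union> B) & card B = n" for n
  using that indep_mod_card(1)[OF assms] by blast
qed

end

section \<open>Generated subalgebras and homomorphisms\<close>

context lie3 begin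

sublocale vs: fin_vspace "smul M" ..

text \<open>The closure is reached degree by degree: brackets are added in degree 2, then in degree
  3, and nothing happens beyond. Finiteness of generated subalgebras and the form of o-systems are
  read off from this.\<close>

lemma generated_explicit:
 assumes "Y1 <= G 1" "Y2 <= G 2" "Y3 <= G 3"
 defines "A \<equiv> vs.span Y1"
 defines "B \<equiv> vs.span (Y2 \<union> {br x y |x y. x \<in> A & y \<in> A})"
 defines "C \<equiv> vs.span (Y3 \<union> {br x y |x y. x \<in> A & y \<in> B})"
 shows "generated M (Y1 \<union> Y2 \<union> Y3) = comb A B C"
  "generated M (Y1 \<union> Y2 \<union> Y3) \<inter> G 1 = A" "generated M (Y1 \<union> Y2 \<union> Y3) \<inter> G 2 = B"
  "generated M (Y1 \<union> Y2 \<union> Y3) \<inter> G 3 = C"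
proof -
 have A: "A <= G 1" unfolding A_def by (rule vs.span_minimal[OF assms(1) G_sub])
 have B: "B <= G 2" unfolding B_def
  by (rule vs.span_minimal[OF _ G_sub]) (use assms(2) A in \<open>auto simp: subset_iff intro!: br_G11[simplified]\<close>)
 have C: "C <= G 3" unfolding C_def
  by (rule vs.span_minimal[OF _ G_sub]) (use assms(3) A B in \<open>auto simp: subset_iff intro!: br_G12[simplified]\<close>)
 have s: "vs.subspace A" "vs.subspace B" "vs.subspace C" unfolding A_def B_def C_def by simp_all
 have b1: "br x y \<in> B" if "x \<in> A" "y \<in> A" for x y unfolding B_def using that by (intro vs.span_base) blast
 have b2: "br x y \<in> C" if "x \<in> A" "y \<in> B" for x y unfolding C_def using that by (intro vs.span_base) blast
 note cs = comb_substructure[OF s A B C b1 b2]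
 show e: "generated M (Y1 \<union> Y2 \<union> Y3) = comb A B C"
 proof
  have "Y1 <= A" "Y2 <= B" "Y3 <= C" unfolding A_def B_def C_def using vs.span_base by blast+
  moreover have "A <= comb A B C" "B <= comb A B C" "C <= comb A B C" using cs(2-4) by blast+
  ultimately have "Y1 \<union> Y2 \<union> Y3 <= comb A B C" by blast
  then show "generated M (Y1 \<union> Y2 \<union> Y3) <= comb A B C" using cs(1) generated_minimal by blast
  have "Y1 \<union> Y2 \<union> Y3 <= carrier M" using assms(1-3) by auto
  then have sg: "substructure M (generated M (Y1 \<union> Y2 \<union> Y3))" by (rule generated_substructure)
  note sD = substructureD[OF sg]
  have inc: "Y1 \<union> Y2 \<union> Y3 <= generated M (Y1 \<union> Y2 \<union> Y3)" by (rule generated_incl)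
  have 1: "A <= generated M (Y1 \<union> Y2 \<union> Y3)" unfolding A_def
   by (rule vs.span_minimal[OF _ sD(2)]) (use inc in blast)
  have 2: "B <= generated M (Y1 \<union> Y2 \<union> Y3)" unfolding B_def
   by (rule vs.span_minimal[OF _ sD(2)]) (use inc 1 sD(4) in blast)
  have 3: "C <= generated M (Y1 \<union> Y2 \<union> Y3)" unfolding C_def
   by (rule vs.span_minimal[OF _ sD(2)]) (use inc 1 2 sD(4) in blast)
  show "comb A B C <= generated M (Y1 \<union> Y2 \<union> Y3)"
  proof
   fix x assume "x \<in> comb A B C"
   then obtain a b c where "x = a + b + c" "a \<in> A" "b \<in> B" "c \<in> C" unfolding comb_def by blast
   then show "x \<in> generated M (Y1 \<union> Y2 \<union> Y3)" using 1 2 3 vs.subspace_add[OF sD(2)] by blast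
  qed
 qed
 show "generated M (Y1 \<union> Y2 \<union> Y3) \<inter> G 1 = A" "generated M (Y1 \<union> Y2 \<union> Y3) \<inter> G 2 = B"
  "generated M (Y1 \<union> Y2 \<union> Y3) \<inter> G 3 = C" unfolding e using cs by blast+
qed

lemma finite_brackets: "finite A ==> finite B ==> finite {br x y |x y. x \<in> A & y \<in> B}"
proof -
 assume "finite A" "finite B"
 then have "finite ((\<lambda>(x, y). br x y) ` (A \<times> B))" by simp
 moreover have "{br x y |x y. x \<in> A & y \<in> B} = (\<lambda>(x, y). br x y) ` (A \<times> B)" by auto
 ultimately show ?thesis by simp
qed

lemma finite_comb: "finite A ==> finite B ==> finite C ==> finite (comb A B C)"
proof -
 assume "finite A" "finite B" "finite C"
 then have "finite ((\<lambda>(x, y, z). x + y + z) ` (A \<times> B \<times> C))" by simp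
 moreover have "comb A B C = (\<lambda>(x, y, z). x + y + z) ` (A \<times> B \<times> C)" unfolding comb_def by force
 ultimately show ?thesis by simp
qed

text \<open>The generators may be inhomogeneous; they lie in the subalgebra generated by their
  projections, which is a sum of spans of finite sets.\<close>

lemma finite_generated:
 assumes "finite Y" "Y <= carrier M"
 shows "finite (generated M Y)"
proof -
 let ?Y = "\<lambda>i. (proj M i) ` Y"
 have sub: "?Y i <= G i" for i using proj_G assms(2) by blast
 have "Y <= generated M (?Y 1 \<union> ?Y 2 \<union> ?Y 3)"
 proof
  fix y assume y: "y \<in> Y"
  have "?Y 1 \<union> ?Y 2 \<union> ?Y 3 <= carrier M" using sub Gc by blast
  then have sg: "substructure M (generated M (?Y 1 \<union> ?Y 2 \<union> ?Y 3))" by (rule generated_substructure)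
  have "proj M i y \<in> generated M (?Y 1 \<union> ?Y 2 \<union> ?Y 3)" if "i \<in> {1,2,3}" for i
   using generated_incl[of "?Y 1 \<union> ?Y 2 \<union> ?Y 3"] y that by auto
  then have "proj M 1 y + proj M 2 y + proj M 3 y \<in> generated M (?Y 1 \<union> ?Y 2 \<union> ?Y 3)"
   using vs.subspace_add[OF substructureD(2)[OF sg]] by simp
  then show "y \<in> generated M (?Y 1 \<union> ?Y 2 \<union> ?Y 3)" using proj_decomp[of y] y assms(2) by auto
 qed
 moreover have "?Y 1 \<union> ?Y 2 \<union> ?Y 3 <= carrier M" using sub Gc by blast
 ultimately have "generated M Y <= generated M (?Y 1 \<union> ?Y 2 \<union> ?Y 3)"
  using generated_minimal generated_substructure by blast
 moreover have "finite (generated M (?Y 1 \<union> ?Y 2 \<union> ?Y 3))"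
  unfolding generated_explicit(1)[OF sub sub sub] using assms(1)
  by (intro finite_comb vs.finite_span finite_UnI finite_brackets finite_imageI)
 ultimately show ?thesis by (rule finite_subset)
qed

lemma hom_facts:
 assumes N: "graded_lie3 N" and f: "lie_hom M N h"
 shows "h 0 = 0" "!!x. x \<in> carrier M ==> h x \<in> carrier N"
  "!!x i. x \<in> carrier M ==> h (proj M i x) = proj N i (h x)"
  "!!x y. x \<in> carrier M ==> y \<in> carrier M ==> h (x + y) = h x + h y"
  "!!x y. x \<in> carrier M ==> y \<in> carrier M ==> h (x - y) = h x - h y"
  "!!x y. x \<in> carrier M ==> y \<in> carrier M ==> h (br x y) = bracket N (h x) (h y)"
  "!!x c. x \<in> carrier M ==> h (smul M c x) = smul N c (h x)"
  "!!x i. x \<in> G i ==> h x \<in> grade N i"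
proof -
 interpret N: lie3 N by unfold_locales (rule N)
 show h0: "h 0 = 0" using f carrier_0 unfolding lie_hom_def by (metis add_cancel_left_left)
 show ha: "h (x + y) = h x + h y" if "x \<in> carrier M" "y \<in> carrier M" for x y
  using f that unfolding lie_hom_def by blast
 show "h (br x y) = bracket N (h x) (h y)" if "x \<in> carrier M" "y \<in> carrier M" for x y
  using f that unfolding lie_hom_def by blast
 show "h (smul M c x) = smul N c (h x)" if "x \<in> carrier M" for c x
  using f that unfolding lie_hom_def by blast
 show G: "h x \<in> grade N i" if "x \<in> G i" for x i
  using f that unfolding lie_hom_def by blast
 have hs: "h x = h (proj M 1 x) + h (proj M 2 x) + h (proj M 3 x)" if x: "x \<in> carrier M" for x
 proof -
  have c: "proj M j x \<in> carrier M" for j using Gc proj_G[OF x] by blast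
  have "h x = h (proj M 1 x + proj M 2 x + proj M 3 x)" using proj_decomp[OF x] by simp
  then show ?thesis using ha c carrier_add by simp
 qed
 show "h x \<in> carrier N" if x: "x \<in> carrier M" for x
  unfolding hs[OF x] carrier_comb comb_def using G[OF proj_G[OF x]] by blast
 show "h (proj M i x) = proj N i (h x)" if x: "x \<in> carrier M" for x i
 proof -
  have "proj N i (h x) = (if i = 1 then h (proj M 1 x) else if i = 2 then h (proj M 2 x) else if i = 3 then h (proj M 3 x) else 0)"
   unfolding hs[OF x] by (rule N.proj_sum) (rule G[OF proj_G[OF x]])+
  moreover have "h (proj M i x) = 0" if "i ~= 1" "i ~= 2" "i ~= 3"
   using proj_G[OF x, of i] G_other[OF that] h0 by simp
  ultimately show ?thesis by auto
 qed
 show "h (x - y) = h x - h y" if "x \<in> carrier M" "y \<in> carrier M" for x y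
  using ha[of "x - y" y] that vs.subspace_diff[OF carrier_subspace] by (simp add: algebra_simps)
qed

text \<open>The equaliser of two homomorphisms is a substructure.\<close>

lemma hom_eq_generated:
 assumes N: "graded_lie3 N" and f: "lie_hom M N f" "lie_hom M N g" and Y: "Y <= carrier M" "!!y. y \<in> Y ==> f y = g y"
  and x: "x \<in> generated M Y"
 shows "f x = g x"
proof -
 note F = hom_facts[OF N f(1)] and H = hom_facts[OF N f(2)]
 let ?E = "{x\<in>carrier M. f x = g x}"
 have E: "substructure M ?E"
  unfolding substructure_def
 proof (intro conjI ballI allI)
  show "?E <= carrier M" "0 \<in> ?E" using F(1) H(1) by auto
  fix x assume x: "x \<in> ?E"
  have n: "0 - x \<in> carrier M" using x vs.subspace_diff[OF carrier_subspace carrier_0] by blast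
  show "- x \<in> ?E" using x n F(5)[of 0 x] H(5)[of 0 x] F(1) H(1) by simp
  show "smul M c x \<in> ?E" for c
   using x F(7) H(7) vs.subspace_scale[OF carrier_subspace] by simp
  show "proj M i x \<in> ?E" for i using x F(3) H(3) Gc[OF proj_G] by simp
  fix y assume y: "y \<in> ?E"
  show "x + y \<in> ?E" using x y F(4) H(4) carrier_add by simp
  show "br x y \<in> ?E" using x y F(6) H(6) substructureD(4)[OF carrier_substructure] by simp
 qed
 show ?thesis using generated_minimal[OF E, of Y] Y x by auto
qed

end

section \<open>Embeddings, isomorphisms and copies\<close>

lemma lie_homI:
 assumes "!!x y. x \<in> carrier M ==> y \<in> carrier M ==> f (x + y) = f x + f y"
  "!!x y. x \<in> carrier M ==> y \<in> carrier M ==> f (bracket M x y) = bracket N (f x) (f y)"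
  "!!c x. x \<in> carrier M ==> f (smul M c x) = smul N c (f x)"
  "!!i x. x \<in> grade M i ==> f x \<in> grade N i"
 shows "lie_hom M N f"
 using assms unfolding lie_hom_def by blast

text \<open>Degrees are reflected automatically: homomorphisms commute with projections, so by
  injectivity a component of the wrong degree must be 0.\<close>

lemma embeddingI:
 fixes M :: "('k::{field,finite}, 'a::ab_group_add) glie" and N :: "('k, 'b::ab_group_add) glie"
 assumes M: "graded_lie3 M" and N: "graded_lie3 N" and f: "lie_hom M N f" "inj_on f (carrier M)"
 shows "embedding M N f"
proof -
 interpret M: lie3 M by unfold_locales (rule M)
 interpret N: lie3 N by unfold_locales (rule N)
 note F = M.hom_facts[OF N f(1)]
 have z: "x = 0" if "x \<in> carrier M" "f x = 0" for x
  using inj_onD[OF f(2), of x 0] that F(1) M.carrier_0 by simp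
 have "x \<in> grade M i" if x: "x \<in> carrier M" and g: "f x \<in> grade N i" for x i
 proof -
  have p: "proj M j x = 0" if "j ~= i" for j
   using z[OF M.Gc[OF M.proj_G[OF x]]] F(3)[OF x, of j] N.proj_hom[OF g, of j] that by simp
  show ?thesis
  proof (cases "i \<in> {1, 2, 3}")
   case True
   then have "x = proj M i x" using M.proj_decomp[OF x] p[of 1] p[of 2] p[of 3] by auto
   then show ?thesis using M.proj_G[OF x, of i] by simp
  next
   case False
   then have "x = 0" using M.proj_decomp[OF x] p[of 1] p[of 2] p[of 3] by auto
   then show ?thesis by simp
  qed
 qed
 then show ?thesis unfolding embedding_def using f F by blast
qed

lemma (in lie3) isomorphism_inv:
 assumes N: "graded_lie3 N" and f: "isomorphism M N f"
 shows "isomorphism N M (inv_into (carrier M) f)"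
proof -
 interpret N: lie3 N by unfold_locales (rule N)
 let ?g = "inv_into (carrier M) f"
 have h: "lie_hom M N f" and inj: "inj_on f (carrier M)" and im: "f ` carrier M = carrier N"
  and gr: "!!i x. x \<in> carrier M ==> x \<in> grade M i \<longleftrightarrow> f x \<in> grade N i"
  using f unfolding isomorphism_def embedding_def by blast+
 note F = hom_facts[OF N h]
 have gc: "?g y \<in> carrier M" "f (?g y) = y" if "y \<in> carrier N" for y
  using inv_into_into[of y f "carrier M"] f_inv_into_f[of y f "carrier M"] that im by auto
 have gu: "?g y = x" if "x \<in> carrier M" "f x = y" for x y
  using inv_into_f_f[OF inj that(1)] that(2) by simp
 have "lie_hom N M ?g"
 proof (rule lie_homI)
  fix x y assume xy: "x \<in> carrier N" "y \<in> carrier N"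
  note gx = gc[OF xy(1)] and gy = gc[OF xy(2)]
  show "?g (x + y) = ?g x + ?g y" by (rule gu) (use gx gy F carrier_add in auto)
  show "?g (bracket N x y) = bracket M (?g x) (?g y)"
   by (rule gu) (use gx gy F substructureD(4)[OF carrier_substructure] in auto)
 next
  fix c x assume x: "x \<in> carrier N"
  show "?g (smul N c x) = smul M c (?g x)"
   by (rule gu) (use gc[OF x] F vs.subspace_scale[OF carrier_subspace] in auto)
 next
  fix i x assume x: "x \<in> grade N i"
  show "?g x \<in> grade M i" using gr[OF gc(1)] gc(2) N.Gc[OF x] x by simp
 qed
 moreover have "inj_on ?g (carrier N)" unfolding im[symmetric] by (rule inj_on_inv_into) simp
 moreover have "?g ` carrier N = carrier M"
  using inv_into_image_cancel[OF inj subset_refl] im by simp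
 ultimately show ?thesis unfolding isomorphism_def using embeddingI[OF N lie] by blast
qed

lemma embedding_comp: "embedding M N f ==> embedding N P g ==> embedding M P (g \<circ> f)"
proof -
 assume f: "embedding M N f" and g: "embedding N P g"
 have fc: "x \<in> carrier M ==> f x \<in> carrier N" for x using f unfolding embedding_def by blast
 have "inj_on (g \<circ> f) (carrier M)"
  using f g unfolding embedding_def by (meson comp_inj_on inj_on_subset)
 moreover have "lie_hom M P (g \<circ> f)"
  using f g fc unfolding embedding_def lie_hom_def by (auto simp: image_subset_iff)
 moreover have "(g \<circ> f) ` carrier M <= carrier P"
  using fc g unfolding embedding_def by auto
 ultimately show ?thesis using f g fc unfolding embedding_def by simp
qed

lemma isomorphism_comp: "isomorphism M N f ==> isomorphism N P g ==> isomorphism M P (g \<circ> f)"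
 using embedding_comp[of M N f P g] unfolding isomorphism_def by (metis image_comp)

lemma (in lie3) embedding_image:
 assumes N: "graded_lie3 N" and f: "embedding M N f" and A: "substructure M A"
 shows "substructure N (f ` A)" "isomorphism (restrict_to M A) (restrict_to N (f ` A)) f"
proof -
 interpret N: lie3 N by unfold_locales (rule N)
 have h: "lie_hom M N f" and inj: "inj_on f (carrier M)" using f unfolding embedding_def by blast+
 note F = hom_facts[OF N h] and D = substructureD[OF A]
 have c: "x \<in> carrier M" if "x \<in> A" for x using D(1) that by blast
 have op: "x + y \<in> A" "smul M r x \<in> A" "- x \<in> A" "br x y \<in> A" if "x \<in> A" "y \<in> A" for x y r
  using vs.subspace_add[OF D(2)] vs.subspace_scale[OF D(2)] vs.subspace_neg[OF D(2)] D(4) that by blast+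
 show S: "substructure N (f ` A)"
  unfolding substructure_def
 proof (intro conjI ballI allI)
  show "f ` A <= carrier N" using F(2) c by blast
  show "0 \<in> f ` A" using F(1) vs.subspace_0[OF D(2)] by (metis image_eqI)
  fix u assume "u \<in> f ` A"
  then obtain x where x: "x \<in> A" "u = f x" by blast
  have "- u = f (0 - x)" using F(5)[of 0 x] F(1) x c by simp
  then show "- u \<in> f ` A" using op(3)[OF x(1) x(1)] by (simp add: image_iff) metis
  show "smul N r u \<in> f ` A" for r using F(7)[OF c[OF x(1)], of r] op(2)[OF x(1) x(1), of r] x(2) by (metis image_eqI)
  show "proj N i u \<in> f ` A" for i using F(3)[OF c[OF x(1)], of i] D(3)[OF x(1), of i] x(2) by (metis image_eqI)
  fix v assume "v \<in> f ` A"
  then obtain y where y: "y \<in> A" "v = f y" by blast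
  show "u + v \<in> f ` A" using F(4)[OF c[OF x(1)] c[OF y(1)]] op(1)[OF x(1) y(1)] x(2) y(2) by (metis image_eqI)
  show "bracket N u v \<in> f ` A" using F(6)[OF c[OF x(1)] c[OF y(1)]] op(4)[OF x(1) y(1)] x(2) y(2) by (metis image_eqI)
 qed
 have "lie_hom (restrict_to M A) (restrict_to N (f ` A)) f"
  by (rule lie_homI) (use F c in \<open>auto simp: carrier_restrict[OF A]\<close>)
 moreover have "inj_on f (carrier (restrict_to M A))"
  unfolding carrier_restrict[OF A] using inj D(1) by (rule inj_on_subset)
 ultimately have "embedding (restrict_to M A) (restrict_to N (f ` A)) f"
  by (intro embeddingI restrict_lie A N.restrict_lie S)
 then show "isomorphism (restrict_to M A) (restrict_to N (f ` A)) f"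
  unfolding isomorphism_def carrier_restrict[OF A] N.carrier_restrict[OF S] by simp
qed

lemma (in lie3) transport:
 fixes s :: "'k => 'b::ab_group_add => 'b"
 assumes s: "vector_space s"
  and add: "!!x y. x \<in> carrier M ==> y \<in> carrier M ==> \<theta> (x + y) = \<theta> x + \<theta> y"
  and scale: "!!c x. x \<in> carrier M ==> \<theta> (smul M c x) = s c (\<theta> x)"
  and inj: "inj_on \<theta> (carrier M)"
 obtains N :: "('k, 'b) glie" where "graded_lie3 N" "isomorphism M N \<theta>"
proof -
 let ?i = "inv_into (carrier M) \<theta>"
 define N :: "('k, 'b) glie" where
  "N = \<lparr>smul = s, grade = \<lambda>i. \<theta> ` G i, bracket = \<lambda>u v. \<theta> (br (?i u) (?i v))\<rparr>"
 interpret s: vector_space s by (rule s)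
 have inv: "?i (\<theta> x) = x" if "x \<in> carrier M" for x using inv_into_f_f[OF inj that] .
 have cN: "carrier N = \<theta> ` carrier M"
 proof
  show "carrier N <= \<theta> ` carrier M"
  proof
   fix u assume "u \<in> carrier N"
   then obtain x y z where xyz: "x \<in> G 1" "y \<in> G 2" "z \<in> G 3" "u = \<theta> x + \<theta> y + \<theta> z"
    unfolding carrier_def N_def by auto
   then have "u = \<theta> (x + y + z)" using add carrier_add by simp
   moreover have "x + y + z \<in> carrier M" using xyz carrier_add by simp
   ultimately show "u \<in> \<theta> ` carrier M" by blast
  qed
  show "\<theta> ` carrier M <= carrier N"
  proof clarify
   fix x assume "x \<in> carrier M"
   then obtain a b c where "x = a + b + c" "a \<in> G 1" "b \<in> G 2" "c \<in> G 3" by (rule carrierE)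
   moreover from this have "\<theta> x = \<theta> a + \<theta> b + \<theta> c" using add carrier_add by simp
   ultimately show "\<theta> x \<in> carrier N" unfolding carrier_def N_def by auto
  qed
 qed
 have t0: "\<theta> 0 = 0" using add[OF carrier_0 carrier_0] by simp
 have brc: "br x y \<in> carrier M" if "x \<in> carrier M" "y \<in> carrier M" for x y
  using substructureD(4)[OF carrier_substructure] that by blast
 have brN: "bracket N (\<theta> x) (\<theta> y) = \<theta> (br x y)" if "x \<in> carrier M" "y \<in> carrier M" for x y
  using inv that by (simp add: N_def)
 have gN: "grade N i = \<theta> ` G i" "smul N = s" for i by (simp_all add: N_def)
 have sub: "s.subspace (\<theta> ` G i)" for i
  unfolding s.subspace_def
 proof (intro conjI ballI allI)
  show "0 \<in> \<theta> ` G i" using t0 G0 by (metis image_eqI)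
  fix u assume "u \<in> \<theta> ` G i"
  then obtain x where x: "x \<in> G i" "u = \<theta> x" by blast
  show "s c u \<in> \<theta> ` G i" for c
   using x scale[OF Gc[OF x(1)], of c] vs.subspace_scale[OF G_sub x(1), of c] by (metis image_eqI)
  fix v assume "v \<in> \<theta> ` G i"
  then obtain y where y: "y \<in> G i" "v = \<theta> y" by blast
  show "u + v \<in> \<theta> ` G i"
   using x y add[OF Gc[OF x(1)] Gc[OF y(1)]] vs.subspace_add[OF G_sub x(1) y(1)] by (metis image_eqI)
 qed
 have N: "graded_lie3 N"
  unfolding graded_lie3_def
 proof (intro conjI allI impI ballI)
  show "vector_space (smul N)" unfolding gN by (rule s)
  show "module.subspace (smul N) (grade N i)" for i unfolding gN by (rule sub)
  show "grade N i = {0}" if "i ~: {1, 2, 3}" for i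
   unfolding gN using G_other[of i] that t0 by simp
  show "bracket N x y \<in> grade N (i + j)" if "x \<in> grade N i" "y \<in> grade N j" for x y i j
   using that brN Gc br_G unfolding gN by auto
  show "bracket N (smul N c x) y = smul N c (bracket N x y)"
   "bracket N x (smul N c y) = smul N c (bracket N x y)" if xy: "x \<in> carrier N" "y \<in> carrier N" for x y c
  proof -
   obtain a b where ab: "a \<in> carrier M" "b \<in> carrier M" "x = \<theta> a" "y = \<theta> b" using xy unfolding cN by blast
   show "bracket N (smul N c x) y = smul N c (bracket N x y)"
    "bracket N x (smul N c y) = smul N c (bracket N x y)"
    using ab brN vs.subspace_scale[OF carrier_subspace] scale brc br_smul_left br_smul_right
    unfolding gN by (metis (no_types, lifting))+
  qed
  show "bracket N x x = 0" if "x \<in> carrier N" for x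
   using that brN br_self t0 unfolding cN by auto
  show "bracket N (x + y) z = bracket N x z + bracket N y z"
   "bracket N x (y + z) = bracket N x y + bracket N x z"
   "bracket N x (bracket N y z) + bracket N y (bracket N z x) + bracket N z (bracket N x y) = 0"
   if xyz: "x \<in> carrier N" "y \<in> carrier N" "z \<in> carrier N" for x y z
  proof -
   obtain a b c where ab: "a \<in> carrier M" "b \<in> carrier M" "c \<in> carrier M" "x = \<theta> a" "y = \<theta> b" "z = \<theta> c"
    using xyz unfolding cN by blast
   show "bracket N (x + y) z = bracket N x z + bracket N y z"
    unfolding ab(4-6) using ab(1-3) by (simp add: add[symmetric] brN carrier_add brc br_add_left)
   show "bracket N x (y + z) = bracket N x y + bracket N x z"
    unfolding ab(4-6) using ab(1-3) by (simp add: add[symmetric] brN carrier_add brc br_add_right)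
   show "bracket N x (bracket N y z) + bracket N y (bracket N z x) + bracket N z (bracket N x y) = 0"
    unfolding ab(4-6) using ab(1-3) jacobi[OF ab(1-3)] t0 by (simp add: add[symmetric] brN carrier_add brc)
  qed
 next
  fix x y z assume "x \<in> grade N 1" "y \<in> grade N 2" "z \<in> grade N 3" and s0: "x + y + z = 0"
  then obtain a b c where ab: "a \<in> G 1" "b \<in> G 2" "c \<in> G 3" "x = \<theta> a" "y = \<theta> b" "z = \<theta> c"
   unfolding gN by blast
  have ac: "a \<in> carrier M" "b \<in> carrier M" "c \<in> carrier M" using ab by simp_all
  have "\<theta> (a + b + c) = \<theta> 0" using s0 ab ac t0 add carrier_add by simp
  then have "a + b + c = 0" using inj_onD[OF inj] ac carrier_add by simp
  then have "a = 0 & b = 0 & c = 0" using G_direct ab by blast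
  then show "x = 0" "y = 0" "z = 0" using ab t0 by simp_all
 qed
 moreover have "lie_hom M N \<theta>"
  by (rule lie_homI) (use add scale brN gN in auto)
 then have "embedding M N \<theta>" using embeddingI[OF lie N] inj by blast
 then have "isomorphism M N \<theta>" unfolding isomorphism_def cN by simp
 ultimately show ?thesis using that by blast
qed

text \<open>Free algebras and richness are defined with structures on the ambient type
  \<open>nat => 'k\<close>; coordinates in a basis move a finite structure there.\<close>

lemma (in lie3) finite_copy:
 assumes fin: "finite (carrier M)"
 obtains N :: "('k, nat => 'k) glie" and \<theta> where "graded_lie3 N" "isomorphism M N \<theta>"
proof -
 obtain B where B: "B <= carrier M" "vs.independent B" "carrier M <= vs.span B" "finite B"
  using vs.fin_dim_basis[OF vs.fin_dim_finite[OF fin]] by metis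
 obtain f :: "nat => 'a" and n where f: "bij_betw f {..<n} B"
  using ex_bij_betw_nat_finite[OF B(4)] by (auto simp: atLeast0LessThan)
 define \<theta> where "\<theta> x = (\<lambda>i. if i < n then vs.representation B x (f i) else 0)" for x
 have sp: "x \<in> vs.span B" if "x \<in> carrier M" for x using B(3) that by blast
 have add: "\<theta> (x + y) = \<theta> x + \<theta> y" if "x \<in> carrier M" "y \<in> carrier M" for x y
  using vs.representation_add[OF B(2) sp[OF that(2)] sp[OF that(1)]]
  by (auto simp: \<theta>_def fun_eq_iff fun_app)
 have scale: "\<theta> (smul M c x) = scl c (\<theta> x)" if "x \<in> carrier M" for x c
  using vs.representation_scale[OF B(2) sp[OF that]] by (auto simp: \<theta>_def fun_eq_iff fun_app)
 have inj: "inj_on \<theta> (carrier M)"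
 proof (rule inj_onI)
  fix x y assume xy: "x \<in> carrier M" "y \<in> carrier M" "\<theta> x = \<theta> y"
  have "vs.representation B x b = vs.representation B y b" if b: "b \<in> B" for b
  proof -
   obtain i where "i < n" "b = f i" using f b unfolding bij_betw_def by auto
   then show ?thesis using fun_cong[OF xy(3), of i] by (simp add: \<theta>_def)
  qed
  then have "(\<Sum>b\<in>B. smul M (vs.representation B x b) b) = (\<Sum>b\<in>B. smul M (vs.representation B y b) b)"
   by simp
  then show "x = y"
   using vs.sum_representation_eq[OF B(2) sp[OF xy(1)] B(4) subset_refl]
    vs.sum_representation_eq[OF B(2) sp[OF xy(2)] B(4) subset_refl] by simp
 qed
 have "vector_space (scl :: 'k => (nat => 'k) => nat => 'k)"
  using fs.vspace_axioms by (simp add: vspace_def)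
 from transport[OF this add scale inj] show ?thesis using that by blast
qed

section \<open>Products and the existence of free algebras\<close>

definition lie_product :: "('j => ('k, 'a::ab_group_add) glie) => ('k, 'j => 'a) glie" where
 "lie_product C = \<lparr>smul = \<lambda>c u j. smul (C j) c (u j), grade = \<lambda>i. {u. \<forall>j. u j \<in> grade (C j) i},
   bracket = \<lambda>u v j. bracket (C j) (u j) (v j)\<rparr>"

lemma lie_product:
 fixes C :: "'j => ('k::{field,finite}, 'a::ab_group_add) glie"
 assumes C: "!!j. graded_lie3 (C j)"
 shows "graded_lie3 (lie_product C)" "lie_hom (lie_product C) (C j) (\<lambda>u. u j)"
proof -
 have l: "lie3 (C j)" for j by unfold_locales (rule C)
 let ?P = "lie_product C"
 have sel: "smul ?P = (\<lambda>c u j. smul (C j) c (u j))" "grade ?P i = {u. \<forall>j. u j \<in> grade (C j) i}"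
   "bracket ?P = (\<lambda>u v j. bracket (C j) (u j) (v j))" for i
  by (simp_all add: lie_product_def)
 have car: "u j \<in> carrier (C j)" if u: "u \<in> carrier ?P" for u j
 proof -
  obtain a b c where "u = a + b + c" "a \<in> grade ?P 1" "b \<in> grade ?P 2" "c \<in> grade ?P 3"
   using u unfolding carrier_def by blast
  then have "u j = a j + b j + c j" "a j \<in> grade (C j) 1" "b j \<in> grade (C j) 2" "c j \<in> grade (C j) 3"
   unfolding sel by (simp_all add: fun_app)
  then show ?thesis unfolding carrier_def by blast
 qed
 have vC: "vector_space (smul (C j))" for j using C[of j] by (simp add: graded_lie3_def)
 have vP: "vector_space (smul ?P)"
 proof unfold_locales
  fix a b :: 'k and x y :: "'j => 'a"
  note V = vector_space.vector_space_assms[OF vC]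
  show "smul ?P a (x + y) = smul ?P a x + smul ?P a y" "smul ?P (a + b) x = smul ?P a x + smul ?P b x"
   "smul ?P a (smul ?P b x) = smul ?P (a * b) x" "smul ?P 1 x = x"
   unfolding sel by (simp_all add: fun_eq_iff fun_app V)
 qed
 interpret P: vector_space "smul ?P" by (rule vP)
 show "graded_lie3 ?P"
  unfolding graded_lie3_def
 proof (intro conjI allI impI ballI)
  show "vector_space (smul ?P)" by (rule vP)
  show "module.subspace (smul ?P) (grade ?P i)" for i
   unfolding P.subspace_def
  proof (intro conjI ballI allI)
   show "0 \<in> grade ?P i" unfolding sel using lie3.G0[OF l] by (simp add: fun_app)
   fix u assume u: "u \<in> grade ?P i"
   have s: "smul (C j) c (u j) \<in> grade (C j) i" for j c
   proof -
    interpret L: lie3 "C j" by (rule l)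
    show ?thesis using L.vs.subspace_scale[OF L.G_sub] u unfolding sel by blast
   qed
   then show "smul ?P c u \<in> grade ?P i" for c unfolding sel by simp
   fix v assume v: "v \<in> grade ?P i"
   have "u j + v j \<in> grade (C j) i" for j
   proof -
    interpret L: lie3 "C j" by (rule l)
    show ?thesis using L.vs.subspace_add[OF L.G_sub] u v unfolding sel by blast
   qed
   then show "u + v \<in> grade ?P i" unfolding sel by (simp add: fun_app)
  qed
  show "grade ?P i = {0}" if "i ~: {1, 2, 3}" for i
   unfolding sel using lie3.G_other[OF l, of i] that by (auto simp: fun_eq_iff fun_app)
  show "bracket ?P x y \<in> grade ?P (i + j)" if "x \<in> grade ?P i" "y \<in> grade ?P j" for x y i j
   using that lie3.br_G[OF l] unfolding sel by blast
 next
  fix x y z assume "x \<in> grade ?P 1" "y \<in> grade ?P 2" "z \<in> grade ?P 3" and s0: "x + y + z = 0"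
  then have G: "x j \<in> grade (C j) 1" "y j \<in> grade (C j) 2" "z j \<in> grade (C j) 3" for j
   unfolding sel by simp_all
  have "x j + y j + z j = 0" for j using arg_cong[OF s0, of "\<lambda>u. u j"] by (simp only: fun_app)
  then have "x j = 0 & y j = 0 & z j = 0" for j using lie3.G_direct[OF l G] by blast
  then show "x = 0" "y = 0" "z = 0" by (simp_all add: fun_eq_iff fun_app)
 qed (simp_all add: sel fun_eq_iff fun_app car lie3.br_add_left[OF l] lie3.br_add_right[OF l]
   lie3.br_smul_left[OF l] lie3.br_smul_right[OF l] lie3.br_self[OF l] lie3.jacobi[OF l])
 show "lie_hom ?P (C j) (\<lambda>u. u j)"
  by (rule lie_homI) (auto simp: sel fun_app)
qed

text \<open>All candidate targets (H, h) on the ambient type \<open>nat => 'k\<close> form a type,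
  so their product can be taken. The tuples of images of the generators generate a subalgebra in
  which projections give the required maps, unique because these tuples generate. Being finitely
  generated it is finite, and it is copied back into the same ambient type.\<close>

theorem free_lie3_exists:
 fixes Y :: "nat => 'x set"
 assumes fin: "finite (\<Union>i. Y i)" and Y: "!!i. i ~: {1, 2, 3} ==> Y i = {}"
 obtains F :: "('k::{field,finite}, nat => 'k) glie" and e where "free_lie3 F Y e"
proof -
 define valid :: "('k, nat => 'k) glie \<times> ('x => nat => 'k) => bool" where
  "valid j \<longleftrightarrow> graded_lie3 (fst j) & (\<forall>i. \<forall>x\<in>Y i. snd j x \<in> grade (fst j) i)" for j
 define triv :: "('k, nat => 'k) glie" where "triv = \<lparr>smul = scl, grade = \<lambda>i. {0}, bracket = \<lambda>x y. 0\<rparr>"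
 have triv: "graded_lie3 triv"
 proof -
  have "vector_space (scl :: 'k => (nat => 'k) => nat => 'k)" using fs.vspace_axioms by (simp add: vspace_def)
  moreover have "module.subspace (scl :: 'k => (nat => 'k) => nat => 'k) {0}"
   using fs.subspace_single_0 unfolding fsubspace_def .
  moreover have "scl c 0 = (0 :: nat => 'k)" for c by (rule fs.scale_zero_right)
  ultimately show ?thesis unfolding graded_lie3_def triv_def carrier_def by simp
 qed
 \<comment> \<open>Indices that are not valid targets contribute the zero algebra.\<close>
 define C where "C j = (if valid j then fst j else triv)" for j
 have C: "graded_lie3 (C j)" for j using triv by (simp add: C_def valid_def)
 interpret P: lie3 "lie_product C" by unfold_locales (rule lie_product(1)[OF C])
 define e0 where "e0 x = (\<lambda>j. if valid j then snd j x else 0)" for x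
 have e0: "e0 x \<in> grade (lie_product C) i" if "x \<in> Y i" for x i
  using that unfolding lie_product_def by (auto simp: e0_def C_def valid_def triv_def)
 define Z where "Z = e0 ` (\<Union>i. Y i)"
 have Zc: "Z <= carrier (lie_product C)" unfolding Z_def using e0 P.Gc by blast
 define S where "S = generated (lie_product C) Z"
 have S: "substructure (lie_product C) S" unfolding S_def by (rule P.generated_substructure[OF Zc])
 have finS: "finite S" unfolding S_def by (rule P.finite_generated[OF _ Zc]) (use fin in \<open>simp add: Z_def\<close>)
 have ZS: "Z <= S" unfolding S_def by (rule P.generated_incl)
 define F0 where "F0 = restrict_to (lie_product C) S"
 interpret F0: lie3 F0 unfolding F0_def by unfold_locales (rule P.restrict_lie[OF S])
 have cF0: "carrier F0 = S" unfolding F0_def by (rule P.carrier_restrict[OF S])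
 obtain F :: "('k, nat => 'k) glie" and \<theta> where F: "graded_lie3 F" and iso: "isomorphism F0 F \<theta>"
  using F0.finite_copy finS unfolding cF0 by blast
 interpret F: lie3 F by unfold_locales (rule F)
 have hom: "lie_hom F0 F \<theta>" and im: "\<theta> ` S = carrier F"
  using iso unfolding isomorphism_def embedding_def cF0 by blast+
 note ii = F0.isomorphism_inv[OF F iso]
 let ?inv = "inv_into (carrier F0) \<theta>"
 have homi: "lie_hom F F0 ?inv" using ii unfolding isomorphism_def embedding_def by blast
 have inv: "?inv (\<theta> x) = x" if "x \<in> S" for x
  using iso that unfolding isomorphism_def embedding_def cF0 by (simp add: inv_into_f_f)
 have genS: "generated F0 Z = S"
 proof
  have "substructure F0 (generated F0 Z)" by (rule F0.generated_substructure) (use ZS cF0 in simp)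
  then have "substructure (lie_product C) (generated F0 Z)" unfolding F0_def P.substructure_restrict[OF S] by blast
  then show "S <= generated F0 Z" unfolding S_def using P.generated_minimal F0.generated_incl by blast
  show "generated F0 Z <= S" by (rule F0.generated_minimal[OF _ ZS]) (use F0.carrier_substructure cF0 in simp)
 qed
 have e0S: "e0 x \<in> S" if "x \<in> Y i" for x i using ZS that unfolding Z_def by blast
 have e0F: "e0 x \<in> grade F0 i" if "x \<in> Y i" for x i
  unfolding F0_def P.restrict_sel using e0[OF that] e0S[OF that] by blast
 have homcomp: "lie_hom A D (g \<circ> f)" if f: "lie_hom A B f" and g: "lie_hom B D g" and c: "f ` carrier A <= carrier B"
  for f g and A :: "('k, 'p::ab_group_add) glie" and B :: "('k, 'q::ab_group_add) glie" and D :: "('k, 'r::ab_group_add) glie"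
  using f g c unfolding lie_hom_def by (auto simp: image_subset_iff)
 have "free_lie3 F Y (\<lambda>x. \<theta> (e0 x))"
  unfolding free_lie3_def
 proof (intro conjI allI impI ballI)
  show "graded_lie3 F" by (rule F)
  show "\<theta> (e0 x) \<in> grade F i" if "x \<in> Y i" for x i using F0.hom_facts(8)[OF F hom] e0F[OF that] by blast
  fix H :: "('k, nat => 'k) glie" and h
  assume Hh: "graded_lie3 H & (\<forall>i. \<forall>x\<in>Y i. h x \<in> grade H i)"
  then have v: "valid (H, h)" by (simp add: valid_def)
  then have CH: "C (H, h) = H" by (simp add: C_def)
  have "lie_hom (lie_product C) (C (H, h)) (\<lambda>u. u (H, h))" by (rule lie_product(2)) (rule C)
  then have lp: "lie_hom (lie_product C) H (\<lambda>u. u (H, h))" unfolding CH .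
  have pr: "lie_hom F0 H (\<lambda>u. u (H, h))"
  proof (rule lie_homI)
   have c: "x \<in> carrier (lie_product C)" if "x \<in> carrier F0" for x
    using that P.substructureD(1)[OF S] unfolding cF0 by blast
   note ph = P.hom_facts[OF conjunct1[OF Hh] lp]
   show "(x + y) (H, h) = x (H, h) + y (H, h)" "bracket F0 x y (H, h) = bracket H (x (H, h)) (y (H, h))"
    if "x \<in> carrier F0" "y \<in> carrier F0" for x y
    using ph(4,6)[OF c[OF that(1)] c[OF that(2)]] unfolding F0_def P.restrict_sel by simp_all
   show "smul F0 r x (H, h) = smul H r (x (H, h))" if "x \<in> carrier F0" for r x
    using ph(7)[OF c[OF that]] unfolding F0_def P.restrict_sel by simp
   show "x (H, h) \<in> grade H i" if "x \<in> grade F0 i" for x i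
    using ph(8) that unfolding F0_def P.restrict_sel by blast
  qed
  let ?g = "(\<lambda>u. u (H, h)) \<circ> ?inv"
  have g: "lie_hom F H ?g" by (rule homcomp[OF homi pr]) (use F.hom_facts(2)[OF F0.lie homi] in blast)
  have ge: "?g (\<theta> (e0 x)) = h x" if "x \<in> Y i" for x i
   using inv[OF e0S[OF that]] v by (simp add: e0_def)
  show "\<exists>g. lie_hom F H g & (\<forall>i. \<forall>x\<in>Y i. g (\<theta> (e0 x)) = h x) &
    (\<forall>g'. lie_hom F H g' & (\<forall>i. \<forall>x\<in>Y i. g' (\<theta> (e0 x)) = h x) --> (\<forall>z\<in>carrier F. g' z = g z))"
  proof (intro exI[of _ ?g] conjI allI impI ballI)
   show "lie_hom F H ?g" by (rule g)
   show "?g (\<theta> (e0 x)) = h x" if "x \<in> Y i" for x i by (rule ge[OF that])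
   fix g' z assume g': "lie_hom F H g' & (\<forall>i. \<forall>x\<in>Y i. g' (\<theta> (e0 x)) = h x)" and z: "z \<in> carrier F"
   obtain u where u: "u \<in> S" "z = \<theta> u" using z im by blast
   have c: "\<theta> ` carrier F0 <= carrier F" using im cF0 by simp
   have "(g' \<circ> \<theta>) u = (?g \<circ> \<theta>) u"
   proof (rule F0.hom_eq_generated[where f = "g' \<circ> \<theta>" and g = "?g \<circ> \<theta>" and x = u and Y = Z and N = H])
    show "graded_lie3 H" using Hh by blast
    show "lie_hom F0 H (g' \<circ> \<theta>)" by (rule homcomp[OF hom _ c]) (use g' in blast)
    show "lie_hom F0 H (?g \<circ> \<theta>)" by (rule homcomp[OF hom g c])
    show "Z <= carrier F0" using ZS cF0 by simp
    show "u \<in> generated F0 Z" using u(1) genS by simp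
    show "(g' \<circ> \<theta>) y = (?g \<circ> \<theta>) y" if "y \<in> Z" for y
     using that g' ge unfolding Z_def by auto
   qed
   then show "g' z = ?g z" using u(2) by simp
  qed
 qed
 then show ?thesis using that by blast
qed

section \<open>Functionals and bilinear forms on subspaces\<close>

context fin_vspace begin

text \<open>The dual of \<open>V\<close> modulo \<open>W\<close>. The value 0 outside
  \<open>V\<close> makes each functional one single function, so that the dimension theory of
  function spaces applies.\<close>

definition dual_ann :: "'b set => 'b set => ('b => 'k) set" where
 "dual_ann V W = {fi. (\<forall>x. x ~: V --> fi x = 0) & (\<forall>x\<in>V. \<forall>y\<in>V. fi (x + y) = fi x + fi y)
   & (\<forall>c. \<forall>x\<in>V. fi (c *f x) = c * fi x) & (\<forall>x\<in>W. fi x = 0)}"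

lemma indep_mod_0:
 assumes "indep_mod scale W B" "0 \<in> W"
 shows "0 ~: B"
proof
 assume B: "0 \<in> B"
 have "(\<Sum>b\<in>{0}. 1 *f b) = 0" by simp
 then have "\<forall>b\<in>{0}. (1 :: 'k) = 0"
  using assms(1)[unfolded indep_mod_def, rule_format, of "{0}" "\<lambda>_. 1"] B assms(2) by simp
 then show False by simp
qed

lemma subspace_dual_ann: "fsubspace (dual_ann V W)"
 unfolding dual_ann_def fs.subspace_def mem_Collect_eq Ball_def
 by (simp add: fun_app algebra_simps)

lemma linear_functional_exists:
 assumes "independent B"
 shows "\<exists>g :: 'b => 'k. (\<forall>x y. g (x + y) = g x + g y) & (\<forall>c x. g (c *f x) = c * g x) & (\<forall>b\<in>B. g b = u b)"
proof -
 interpret v: vector_space "(*) :: 'k => 'k => 'k" by unfold_locales (auto simp: algebra_simps)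
 interpret p: vector_space_pair scale "(*) :: 'k => 'k => 'k" ..
 obtain g where g: "Vector_Spaces.linear scale (*) g" "\<forall>x\<in>B. g x = u x"
  using p.linear_independent_extend[OF assms, of u] by blast
 interpret g: Vector_Spaces.linear scale "(*)" g by (rule g(1))
 show ?thesis using g.add g.scale g(2) by blast
qed

text \<open>Restriction to a basis of a complement of \<open>W\<close> in \<open>V\<close> is a
  bijection onto all functions on that basis.\<close>

lemma fdim_dual_ann:
 assumes "subspace V" "subspace W" "W <= V" "finite V"
 shows "fdim (dual_ann V W) + dim W = dim V" "ffin_dim (dual_ann V W)"
proof (rule_tac [!] complement_exists[OF assms(2,1,3) fin_dim_finite[OF assms(4)]])
 fix T
 assume T: "subspace T" "T <= V" "W \<inter> T = {0}" "!!v. v \<in> V ==> \<exists>s\<in>W. \<exists>t\<in>T. v = s + t" "dim V = dim W + dim T"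
 have fT: "finite T" "finite W" using T(2) assms(3,4) finite_subset by blast+
 obtain B where B: "B <= T" "independent B" "T <= span B" "card B = dim T" "finite B"
  using fin_dim_basis[OF fin_dim_finite[OF fT(1)]] by blast
 obtain D where D: "D <= W" "independent D" "W <= span D" "card D = dim W" "finite D"
  using fin_dim_basis[OF fin_dim_finite[OF fT(2)]] by blast
 let ?S = "{f :: 'b => 'k. \<forall>x. x ~: B --> f x = 0}"
 note S = fdim_supported[OF B(5)]
 have vb: "x \<in> B ==> x \<in> V" for x using B(1) T(2) by blast
 have ext: "fi = ps" if pq: "fi \<in> dual_ann V W" "ps \<in> dual_ann V W" "!!b. b \<in> B ==> fi b = ps b" for fi ps
 proof -
  have E: "subspace {x\<in>V. fi x = ps x}"
   using assms(1) pq(1,2) unfolding subspace_def dual_ann_def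
   by (auto) (metis mult_zero_left scale_zero_left)+
  have "span B <= {x\<in>V. fi x = ps x}" by (rule span_minimal[OF _ E]) (use pq(3) vb in auto)
  then have t: "fi x = ps x" if "x \<in> T" for x using B(3) that by blast
  have "fi x = ps x" for x
  proof (cases "x \<in> V")
   case True
   then obtain s t' where st: "s \<in> W" "t' \<in> T" "x = s + t'" using T(4) by blast
   then have "s \<in> V" "t' \<in> V" using assms(3) T(2) by blast+
   then have "fi x = fi s + fi t'" "ps x = ps s + ps t'" using pq(1,2) st(3) unfolding dual_ann_def by blast+
   moreover have "fi s = 0" "ps s = 0" using pq(1,2) st(1) unfolding dual_ann_def by blast+
   ultimately show ?thesis using t[OF st(2)] by simp
  next
   case False
   then show ?thesis using pq(1,2) unfolding dual_ann_def by simp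
  qed
  then show ?thesis by blast
 qed
 have im: "restr B ` dual_ann V W = ?S"
 proof
  show "restr B ` dual_ann V W <= ?S" by (auto simp: restr_def)
  show "?S <= restr B ` dual_ann V W"
  proof
   fix u :: "'b => 'k" assume u: "u \<in> ?S"
   have ind: "independent (B \<union> D)"
   proof (rule independent_if_scalars_zero)
    show "finite (B \<union> D)" using B D by simp
    have nz: "0 ~: B" using B(2) dependent_zero by (metis (no_types))
    have disj: "B \<inter> D = {}"
    proof (rule equals0I)
     fix x assume x: "x \<in> B \<inter> D"
     then have "x \<in> W \<inter> T" using B(1) D(1) by auto
     then have "x = 0" unfolding T(3) by simp
     then show False using x nz by simp
    qed
    fix f x assume s: "(\<Sum>x\<in>B \<union> D. f x *f x) = 0" and x: "x \<in> B \<union> D"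
    have "(\<Sum>x\<in>B. f x *f x) + (\<Sum>x\<in>D. f x *f x) = 0"
     using s sum.union_disjoint[OF B(5) D(5) disj, of "\<lambda>x. f x *f x"] by simp
    then have e: "(\<Sum>x\<in>B. f x *f x) = - (\<Sum>x\<in>D. f x *f x)" by (simp add: eq_neg_iff_add_eq_0)
    have "(\<Sum>x\<in>B. f x *f x) \<in> T" using B(1) by (intro subspace_sum subspace_scale T(1)) auto
    moreover have "(\<Sum>x\<in>D. f x *f x) \<in> W" using D(1) by (intro subspace_sum subspace_scale assms(2)) auto
    then have "(\<Sum>x\<in>B. f x *f x) \<in> W" unfolding e by (rule subspace_neg[OF assms(2)])
    ultimately have z: "(\<Sum>x\<in>B. f x *f x) = 0" using T(3) by blast
    then have z': "(\<Sum>x\<in>D. f x *f x) = 0" using e by simp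
    show "f x = 0" using x independentD[OF B(2) B(5) subset_refl z] independentD[OF D(2) D(5) subset_refl z'] by blast
   qed
   obtain g :: "'b => 'k" where gg: "\<forall>x y. g (x + y) = g x + g y" "\<forall>c x. g (c *f x) = c * g x"
     "\<forall>b\<in>B \<union> D. g b = (if b \<in> B then u b else 0)"
    using linear_functional_exists[OF ind, of "\<lambda>b. if b \<in> B then u b else 0"] by (elim exE conjE) (rule that)
   have g: "g (x + y) = g x + g y" "g (c *f x) = c * g x"
     "b \<in> B \<union> D ==> g b = (if b \<in> B then u b else 0)" for x y c b
    using gg by simp_all
   have nz: "0 ~: B" using B(2) dependent_zero by (metis (no_types))
   have gD: "g b = 0" if "b \<in> D" for b
   proof -
    have "b ~: B"
    proof
     assume "b \<in> B"
     then have "b \<in> W \<inter> T" using that B(1) D(1) by auto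
     then have "b = 0" unfolding T(3) by simp
     then show False using \<open>b \<in> B\<close> nz by simp
    qed
    then show ?thesis using g(3)[of b] that by simp
   qed
   have g0: "g 0 = 0" using g(2)[of 0 0] by simp
   have "subspace {x. g x = 0}" unfolding subspace_def by (simp add: g g0)
   then have "span D <= {x. g x = 0}" by (rule span_minimal[rotated]) (use gD in auto)
   then have gW: "g x = 0" if "x \<in> W" for x using D(3) that by blast
   let ?h = "\<lambda>x. if x \<in> V then g x else 0"
   have "?h \<in> dual_ann V W"
    unfolding dual_ann_def using g(1,2) gW subspace_add[OF assms(1)] subspace_scale[OF assms(1)] by simp
   moreover have "restr B ?h = u"
    using u g(3) vb by (auto simp: restr_def fun_eq_iff)
   ultimately show "u \<in> restr B ` dual_ann V W" by blast
  qed
 qed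
 have fd: "ffin_dim (dual_ann V W)"
 proof (rule fs.fin_dim_mono[OF _ fdim_supported(2)[OF assms(4)]])
  show "dual_ann V W <= {f. \<forall>x. x ~: V --> f x = 0}" by (auto simp: dual_ann_def)
 qed
 then show "ffin_dim (dual_ann V W)" .
 have "{fi\<in>dual_ann V W. restr B fi = 0} = {0}"
 proof -
  have "fi = 0" if "fi \<in> dual_ann V W" "restr B fi = 0" for fi
  proof (rule ext[OF that(1) fs.subspace_0[OF subspace_dual_ann]])
   fix b assume "b \<in> B"
   then show "fi b = 0 b" using fun_cong[OF that(2), of b] by (simp add: restr_def fun_app)
  qed
  moreover have "restr B (0 :: 'b => 'k) = 0" by (auto simp: restr_def fun_eq_iff fun_app)
  ultimately show ?thesis using fs.subspace_0[OF subspace_dual_ann] by auto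
 qed
 then have "fdim (dual_ann V W) = fdim ?S"
  using fsp.rank_nullity(1)[OF linear_restr subspace_dual_ann fd, of B] unfolding im by (simp add: fs.dim_zero)
 then show "fdim (dual_ann V W) + dim W = dim V" using S(3) B(4) T(5) by simp
qed

lemma card_dual_ann:
 assumes "subspace V" "subspace W" "W <= V" "finite V"
 shows "card (dual_ann V W) * card W = card V"
proof -
 have "finite W" using assms(3,4) finite_subset by blast
 then show ?thesis
  using card_fs(2)[OF subspace_dual_ann fdim_dual_ann(2)[OF assms]] card_dim[OF assms(2)] card_dim[OF assms(1,4)]
   fdim_dual_ann(1)[OF assms] by (metis power_add)
qed

definition bil_on :: "'b set => 'b set => ('b \<times> 'b => 'k) set" where
 "bil_on U W = {b. (\<forall>p. p ~: U \<times> W --> b p = 0)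
   & (\<forall>x\<in>U. \<forall>y\<in>U. \<forall>z\<in>W. b (x + y, z) = b (x, z) + b (y, z))
   & (\<forall>x\<in>U. \<forall>z\<in>W. \<forall>w\<in>W. b (x, z + w) = b (x, z) + b (x, w))
   & (\<forall>c. \<forall>x\<in>U. \<forall>z\<in>W. b (c *f x, z) = c * b (x, z) & b (x, c *f z) = c * b (x, z))}"

definition alt_on :: "'b set => ('b \<times> 'b => 'k) set" where
 "alt_on U = {b\<in>bil_on U U. \<forall>x\<in>U. b (x, x) = 0}"

lemma bil_onD:
 assumes "b \<in> bil_on U W"
 shows "p ~: U \<times> W ==> b p = 0" "x \<in> U ==> y \<in> U ==> z \<in> W ==> b (x + y, z) = b (x, z) + b (y, z)"
  "x \<in> U ==> z \<in> W ==> w \<in> W ==> b (x, z + w) = b (x, z) + b (x, w)"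
  "x \<in> U ==> z \<in> W ==> b (c *f x, z) = c * b (x, z)" "x \<in> U ==> z \<in> W ==> b (x, c *f z) = c * b (x, z)"
 using assms unfolding bil_on_def by blast+

lemma bil_on_0: "b \<in> bil_on U W ==> b (0, z) = 0" "b \<in> bil_on U W ==> b (x, 0) = 0"
proof -
 assume b: "b \<in> bil_on U W"
 show "b (0, z) = 0"
  using bil_onD(1)[OF b, of "(0, z)"] bil_onD(4)[OF b, of 0 z 0] by (cases "(0, z) \<in> U \<times> W") auto
 show "b (x, 0) = 0"
  using bil_onD(1)[OF b, of "(x, 0)"] bil_onD(5)[OF b, of x 0 0] by (cases "(x, 0) \<in> U \<times> W") auto
qed

lemma subspace_bil_on: "fsubspace (bil_on U W)"
 unfolding bil_on_def fs.subspace_def mem_Collect_eq Ball_def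
 by (simp add: fun_app algebra_simps)

lemma subspace_alt_on: "fsubspace (alt_on U)"
 using subspace_bil_on[of U U] unfolding alt_on_def fs.subspace_def mem_Collect_eq Ball_def
 by (simp add: fun_app)

lemma bil_on_fin: "finite U ==> finite W ==> ffin_dim (bil_on U W)"
proof (rule fs.fin_dim_mono[OF _ fdim_supported(2)])
 show "bil_on U W <= {f. \<forall>x. x ~: U \<times> W --> f x = 0}" by (auto simp: bil_on_def)
qed simp

lemma alt_on_fin: "finite U ==> ffin_dim (alt_on U)"
 by (rule fs.fin_dim_mono[OF _ bil_on_fin[of U U]]) (auto simp: alt_on_def)

end

section \<open>The cyclic identity and o-systems\<close>

context lie3 begin

text \<open>With the two homogeneous parts of M as arguments this is J(M): the forms that may serve
  as bracket of a central extension by K in degree 3.\<close>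

definition jac :: "'a set => 'a set => ('a \<times> 'a => 'k) set" where
 "jac U W = {b\<in>vs.bil_on U W. \<forall>x\<in>U. \<forall>y\<in>U. \<forall>z\<in>U. b (x, br y z) + b (y, br z x) + b (z, br x y) = 0}"

lemma subspace_jac: "fsubspace (jac U W)"
proof -
 have "fsubspace (vs.bil_on U W)" by (rule vs.subspace_bil_on)
 then show ?thesis unfolding jac_def fs.subspace_def mem_Collect_eq Ball_def
  by (simp add: fun_app algebra_simps) (metis distrib_left mult_zero_right)
qed

lemma jac_fin: "finite U ==> finite W ==> ffin_dim (jac U W)"
 by (rule fs.fin_dim_mono[OF _ vs.bil_on_fin[of U W]]) (auto simp: jac_def)

text \<open>The elements of degree 2, respectively 3, that are generated by lower degrees.\<close>

definition D2 :: "'a set" where "D2 = vs.span {br x y |x y. x \<in> G 1 & y \<in> G 1}"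
definition D3 :: "'a set" where "D3 = vs.span {br x y |x y. x \<in> G 1 & y \<in> G 2}"

lemma D_sub: "D2 <= G 2" "D3 <= G 3"
 unfolding D2_def D3_def by (rule vs.span_minimal[OF _ G_sub]; use br_G11 br_G12 in auto)+

lemma finite_G: "finite (carrier M) ==> finite (G i)"
 by (rule finite_subset[of _ "carrier M"]) (auto intro: Gc)

lemma span_Un_brackets: "vs.span (Z \<union> B) = vs.span (vs.span B \<union> Z)"
proof
 show "vs.span (Z \<union> B) <= vs.span (vs.span B \<union> Z)"
  by (rule vs.span_mono) (auto intro: vs.span_base)
 show "vs.span (vs.span B \<union> Z) <= vs.span (Z \<union> B)"
  by (rule vs.span_minimal) (use vs.span_mono[of B "Z \<union> B"] in \<open>auto intro: vs.span_base\<close>)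
qed

text \<open>Once the lower degrees are spanned, the subalgebras in the definition of an o-system
  have \<open>D2\<close> and \<open>D3\<close> as their parts of degree 2 and 3. An o-system is thus
  a basis modulo decomposable elements in each degree.\<close>

lemma o_system_iff:
 assumes "finite (carrier M)" "Z <= G 1 \<union> G 2 \<union> G 3"
 shows "o_system M Z \<longleftrightarrow> indep_mod (smul M) {0} (Z \<inter> G 1) & indep_mod (smul M) D2 (Z \<inter> G 2)
   & indep_mod (smul M) D3 (Z \<inter> G 3) & G 1 = vs.span ({0} \<union> (Z \<inter> G 1)) & G 2 = vs.span (D2 \<union> (Z \<inter> G 2))
   & G 3 = vs.span (D3 \<union> (Z \<inter> G 3))" (is "_ \<longleftrightarrow> ?I1 & ?I2 & ?I3 & ?S1 & ?S2 & ?S3")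
proof -
 define z1 z2 z3 where z: "z1 = Z \<inter> G 1" "z2 = Z \<inter> G 2" "z3 = Z \<inter> G 3"
 define B1 where "B1 = {br x y |x y. x \<in> G 1 & y \<in> G 1}"
 define B2 where "B2 = {br x y |x y. x \<in> G 1 & y \<in> G 2}"
 have zG: "z1 <= G 1" "z2 <= G 2" "z3 <= G 3" and Zu: "Z = z1 \<union> z2 \<union> z3" using assms(2) unfolding z by blast+
 note ge = generated_explicit[OF zG, folded Zu]
 have s0: "vs.span ({0} \<union> z1) = vs.span z1" by simp
 have sp: "vs.span (z2 \<union> B1) = vs.span (D2 \<union> z2)" "vs.span (z3 \<union> B2) = vs.span (D3 \<union> z3)"
  unfolding D2_def D3_def B1_def[symmetric] B2_def[symmetric] by (rule span_Un_brackets)+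
 have gen: "generated M Z = carrier M \<longleftrightarrow> G 1 = vs.span z1 & G 2 = vs.span (z2 \<union> B1) & G 3 = vs.span (z3 \<union> B2)"
 proof
  assume g: "generated M Z = carrier M"
  have 1: "vs.span z1 = G 1" using ge(2) unfolding g carrier_Int by (rule sym)
  have 2: "vs.span (z2 \<union> B1) = G 2" using ge(3) unfolding g 1 carrier_Int B1_def by (rule sym)
  have 3: "vs.span (z3 \<union> B2) = G 3"
   using ge(4) unfolding g 1 carrier_Int B1_def[symmetric] 2 B2_def[symmetric] by (rule sym)
  show "G 1 = vs.span z1 & G 2 = vs.span (z2 \<union> B1) & G 3 = vs.span (z3 \<union> B2)"
   unfolding 1 2 3 by simp
 next
  assume S: "G 1 = vs.span z1 & G 2 = vs.span (z2 \<union> B1) & G 3 = vs.span (z3 \<union> B2)"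
  have 1: "vs.span z1 = G 1" and 2: "vs.span (z2 \<union> B1) = G 2" and 3: "vs.span (z3 \<union> B2) = G 3"
   using S by argo+
  show "generated M Z = carrier M"
   using ge(1) unfolding 1 B1_def[symmetric] 2 B2_def[symmetric] 3 carrier_comb .
 qed
 have w1: "generated M {} \<inter> G 1 = {0}"
 proof -
  have "generated M ({} \<union> {} \<union> {}) \<inter> G 1 = vs.span {}" by (rule generated_explicit(2)) auto
  then show ?thesis by simp
 qed
 have w2: "generated M z1 \<inter> G 2 = D2" if 1: "vs.span z1 = G 1"
 proof -
  have "generated M (z1 \<union> {} \<union> {}) \<inter> G 2 = vs.span ({} \<union> {br x y |x y. x \<in> vs.span z1 & y \<in> vs.span z1})"
   by (rule generated_explicit(3)[OF zG(1)]) auto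
  then show ?thesis unfolding 1 D2_def Un_empty_left Un_empty_right .
 qed
 have w3: "generated M (z1 \<union> z2) \<inter> G 3 = D3" if 1: "vs.span z1 = G 1" and 2: "vs.span (z2 \<union> B1) = G 2"
 proof -
  have "generated M (z1 \<union> z2 \<union> {}) \<inter> G 3
   = vs.span ({} \<union> {br x y |x y. x \<in> vs.span z1 & y \<in> vs.span (z2 \<union> {br x y |x y. x \<in> vs.span z1 & y \<in> vs.span z1})})"
   by (rule generated_explicit(4)[OF zG(1,2)]) auto
  then show ?thesis unfolding 1 B1_def[symmetric] 2 D3_def Un_empty_left Un_empty_right .
 qed
 have U: "(\<Union>j\<in>{1..<1}. Z \<inter> G j) = {}" "(\<Union>j\<in>{1..<2}. Z \<inter> G j) = z1"
  "(\<Union>j\<in>{1..<3}. Z \<inter> G j) = z1 \<union> z2"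
 proof -
  have e: "{1..<2} = {1::nat}" "{1..<3} = {1, 2::nat}" by auto
  show "(\<Union>j\<in>{1..<1}. Z \<inter> G j) = {}" "(\<Union>j\<in>{1..<2}. Z \<inter> G j) = z1"
   "(\<Union>j\<in>{1..<3}. Z \<inter> G j) = z1 \<union> z2" unfolding e z by simp_all
 qed
 have "o_system M Z \<longleftrightarrow> (G 1 = vs.span z1 & G 2 = vs.span (z2 \<union> B1) & G 3 = vs.span (z3 \<union> B2)) & indep_mod (smul M) (generated M {} \<inter> G 1) z1
  & indep_mod (smul M) (generated M z1 \<inter> G 2) z2
  & indep_mod (smul M) (generated M (z1 \<union> z2) \<inter> G 3) z3"
  unfolding o_system_def gen ball_simps U z[symmetric] using assms(2) by argo
 also have "\<dots> \<longleftrightarrow> (G 1 = vs.span z1 & G 2 = vs.span (z2 \<union> B1) & G 3 = vs.span (z3 \<union> B2)) & indep_mod (smul M) {0} z1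
  & indep_mod (smul M) D2 z2 & indep_mod (smul M) D3 z3"
 proof (rule conj_cong[OF refl])
  assume S: "G 1 = vs.span z1 & G 2 = vs.span (z2 \<union> B1) & G 3 = vs.span (z3 \<union> B2)"
  have 1: "vs.span z1 = G 1" and 2: "vs.span (z2 \<union> B1) = G 2" using S by argo+
  show "(indep_mod (smul M) (generated M {} \<inter> G 1) z1
  & indep_mod (smul M) (generated M z1 \<inter> G 2) z2
  & indep_mod (smul M) (generated M (z1 \<union> z2) \<inter> G 3) z3) = (indep_mod (smul M) {0} z1
  & indep_mod (smul M) D2 z2 & indep_mod (smul M) D3 z3)"
   unfolding w1 w2[OF 1] w3[OF 1 2] by (rule refl)
 qed
 finally show ?thesis unfolding z[symmetric] s0 sp by argo
qed

lemma o_system_card: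
 assumes fin: "finite (carrier M)" and o: "o_system M Z"
 shows "card (Z \<inter> G 1) = vs.dim (G 1)" "vs.dim (G 2) = vs.dim D2 + card (Z \<inter> G 2)"
  "vs.dim (G 3) = vs.dim D3 + card (Z \<inter> G 3)" "finite Z" "0 ~: Z"
proof -
 have Z: "Z <= G 1 \<union> G 2 \<union> G 3" using o unfolding o_system_def by blast
 note i = o_system_iff[OF fin Z, THEN iffD1, OF o]
 have D: "vs.subspace D2" "vs.subspace D3" unfolding D2_def D3_def by (rule vs.subspace_span)+
 show "card (Z \<inter> G 1) = vs.dim (G 1)"
  using vs.indep_mod_card(2)[OF G_sub vs.subspace_single_0 _ finite_G[OF fin], of 1 "Z \<inter> G 1"] i by (simp add: vs.dim_zero)
 show "vs.dim (G 2) = vs.dim D2 + card (Z \<inter> G 2)"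
  by (rule vs.indep_mod_card(2)[OF G_sub D(1) D_sub(1) finite_G[OF fin]]) (use i in blast)+
 show "vs.dim (G 3) = vs.dim D3 + card (Z \<inter> G 3)"
  by (rule vs.indep_mod_card(2)[OF G_sub D(2) D_sub(2) finite_G[OF fin]]) (use i in blast)+
 show "finite Z" using Z finite_G[OF fin] finite_subset by blast
 note no = vs.indep_mod_0
 show "0 ~: Z" using no[of "{0}" "Z \<inter> G 1"] i by auto
qed

lemma o_system_exists:
 assumes fin: "finite (carrier M)"
 obtains Z where "o_system M Z"
proof -
 have D: "vs.subspace D2" "vs.subspace D3" unfolding D2_def D3_def by (rule vs.subspace_span)+
 have G10: "{0} <= G 1" by simp
 obtain Z1 where "finite Z1" and Z1: "Z1 <= G 1" "indep_mod (smul M) {0} Z1" "G 1 <= vs.span ({0} \<union> Z1)"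
  by (rule vs.indep_mod_exists[OF G_sub vs.subspace_single_0 G10 finite_G[OF fin]])
 obtain Z2 where "finite Z2" and Z2: "Z2 <= G 2" "indep_mod (smul M) D2 Z2" "G 2 <= vs.span (D2 \<union> Z2)"
  by (rule vs.indep_mod_exists[OF G_sub D(1) D_sub(1) finite_G[OF fin]])
 obtain Z3 where "finite Z3" and Z3: "Z3 <= G 3" "indep_mod (smul M) D3 Z3" "G 3 <= vs.span (D3 \<union> Z3)"
  by (rule vs.indep_mod_exists[OF G_sub D(2) D_sub(2) finite_G[OF fin]])
 note no = vs.indep_mod_0
 have n0: "0 ~: Z1" "0 ~: Z2" "0 ~: Z3"
  using no[OF Z1(2)] no[OF Z2(2) vs.subspace_0[OF D(1)]] no[OF Z3(2) vs.subspace_0[OF D(2)]] by simp_all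
 have dj: "B \<inter> G j = {}" if "B <= G i" "0 ~: B" "i ~= j" for B i j
 proof (rule equals0I)
  fix x assume x: "x \<in> B \<inter> G j"
  then have "x = 0" using G_Int[of x i j] that by blast
  then show False using x that(2) by simp
 qed
 have "Z2 \<inter> G 1 = {}" "Z3 \<inter> G 1 = {}" "Z1 \<inter> G 2 = {}" "Z3 \<inter> G 2 = {}" "Z1 \<inter> G 3 = {}" "Z2 \<inter> G 3 = {}"
  using dj[OF Z1(1) n0(1)] dj[OF Z2(1) n0(2)] dj[OF Z3(1) n0(3)] by simp_all
 then have I: "(Z1 \<union> Z2 \<union> Z3) \<inter> G 1 = Z1" "(Z1 \<union> Z2 \<union> Z3) \<inter> G 2 = Z2" "(Z1 \<union> Z2 \<union> Z3) \<inter> G 3 = Z3"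
  unfolding Int_Un_distrib2 using Z1(1) Z2(1) Z3(1) by (simp_all add: Int_absorb2)
 have "vs.span ({0} \<union> Z1) <= G 1" "vs.span (D2 \<union> Z2) <= G 2" "vs.span (D3 \<union> Z3) <= G 3"
  by (rule vs.span_minimal[OF _ G_sub]; use Z1(1) Z2(1) Z3(1) D_sub in auto)+
 then have S: "G 1 = vs.span ({0} \<union> Z1)" "G 2 = vs.span (D2 \<union> Z2)" "G 3 = vs.span (D3 \<union> Z3)"
  using Z1(3) Z2(3) Z3(3) by (simp_all only: subset_antisym)
 have ZG: "Z1 \<union> Z2 \<union> Z3 <= G 1 \<union> G 2 \<union> G 3" using Z1(1) Z2(1) Z3(1) by blast
 have "o_system M (Z1 \<union> Z2 \<union> Z3)"
  unfolding o_system_iff[OF fin ZG] I using S Z1(2) Z2(2) Z3(2) by argo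
 then show ?thesis using that by blast
qed

lemma o_dim_eq:
 assumes fin: "finite (carrier M)"
 shows "o_dim M 1 = vs.dim (G 1)" "o_dim M 2 + vs.dim D2 = vs.dim (G 2)" "o_dim M 3 + vs.dim D3 = vs.dim (G 3)"
proof -
 obtain Z where Z: "o_system M Z" using o_system_exists[OF fin] by blast
 note c = o_system_card[OF fin]
 have "o_dim M 1 = vs.dim (G 1)" unfolding o_dim_def
  by (rule the_equality) (use Z c(1) in auto)
 moreover have "o_dim M 2 = vs.dim (G 2) - vs.dim D2" unfolding o_dim_def
 proof (rule the_equality)
  show "\<exists>Y. o_system M Y & card (Y \<inter> G 2) = vs.dim (G 2) - vs.dim D2" using Z c(2)[OF Z] by auto
  show "n = vs.dim (G 2) - vs.dim D2" if "\<exists>Y. o_system M Y & card (Y \<inter> G 2) = n" for n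
   using that c(2) by auto
 qed
 moreover have "o_dim M 3 = vs.dim (G 3) - vs.dim D3" unfolding o_dim_def
 proof (rule the_equality)
  show "\<exists>Y. o_system M Y & card (Y \<inter> G 3) = vs.dim (G 3) - vs.dim D3" using Z c(3)[OF Z] by auto
  show "n = vs.dim (G 3) - vs.dim D3" if "\<exists>Y. o_system M Y & card (Y \<inter> G 3) = n" for n
   using that c(3) by auto
 qed
 ultimately show "o_dim M 1 = vs.dim (G 1)" "o_dim M 2 + vs.dim D2 = vs.dim (G 2)" "o_dim M 3 + vs.dim D3 = vs.dim (G 3)"
  using c(2,3)[OF Z] by auto
qed

end

section \<open>Presentations and the dimension formula\<close>

lemma lie_hom_comp:
 assumes f: "lie_hom A B f" and g: "lie_hom B D g" and c: "!!x. x \<in> carrier A ==> f x \<in> carrier B"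
 shows "lie_hom A D (g \<circ> f)"
 using assms unfolding lie_hom_def by (auto simp: image_subset_iff)

text \<open>Freeness is defined through targets on \<open>nat => 'k\<close>; a finite target on
  another type is replaced by a copy.\<close>

lemma free_lie3_universal:
 fixes F :: "('k::{field,finite}, nat => 'k) glie" and H :: "('k, 'b::ab_group_add) glie"
 assumes F: "free_lie3 F Y e" and H: "graded_lie3 H" "finite (carrier H)"
  and h: "!!i x. x \<in> Y i ==> h x \<in> grade H i"
 shows "\<exists>g. lie_hom F H g & (\<forall>i. \<forall>x\<in>Y i. g (e x) = h x)"
proof -
 interpret H: lie3 H by unfold_locales (rule H(1))
 have gF: "graded_lie3 F" using F unfolding free_lie3_def by blast
 interpret F: lie3 F by unfold_locales (rule gF)
 obtain N :: "('k, nat => 'k) glie" and \<theta> where N: "graded_lie3 N" and iso: "isomorphism H N \<theta>"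
  by (rule H.finite_copy[OF H(2)])
 interpret N: lie3 N by unfold_locales (rule N)
 have hom: "lie_hom H N \<theta>" and inj: "inj_on \<theta> (carrier H)" using iso unfolding isomorphism_def embedding_def by blast+
 have "\<forall>i. \<forall>x\<in>Y i. (\<theta> \<circ> h) x \<in> grade N i"
  using h H.hom_facts(8)[OF N hom] by simp
 then obtain g where g: "lie_hom F N g" "\<forall>i. \<forall>x\<in>Y i. g (e x) = (\<theta> \<circ> h) x"
  using F N unfolding free_lie3_def by blast
 let ?i = "inv_into (carrier H) \<theta>"
 have ih: "lie_hom N H ?i" using H.isomorphism_inv[OF N iso] unfolding isomorphism_def embedding_def by blast
 have 1: "lie_hom F H (?i \<circ> g)" by (rule lie_hom_comp[OF g(1) ih]) (rule F.hom_facts(2)[OF N g(1)])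
 have 2: "(?i \<circ> g) (e x) = h x" if "x \<in> Y i" for i x
  using g(2) that inv_into_f_f[OF inj H.Gc[OF h[OF that]]] by simp
 show ?thesis by (intro exI[of _ "?i \<circ> g"] conjI allI ballI 1 2)
qed

text \<open>The homomorphism to the generated subalgebra that fixes the generators is the identity,
  by uniqueness.\<close>

lemma free_lie3_generated:
 fixes F :: "('k::{field,finite}, nat => 'k) glie"
 assumes F: "free_lie3 F Y e"
 shows "carrier F = generated F (\<Union>i. e ` Y i)"
proof -
 have gF: "graded_lie3 F" and e: "!!i x. x \<in> Y i ==> e x \<in> grade F i" using F unfolding free_lie3_def by blast+
 interpret F: lie3 F by unfold_locales (rule gF)
 let ?S = "generated F (\<Union>i. e ` Y i)"
 have sub: "(\<Union>i. e ` Y i) <= carrier F" using e F.Gc by blast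
 have S: "substructure F ?S" by (rule F.generated_substructure[OF sub])
 have eS: "e x \<in> grade (restrict_to F ?S) i" if "x \<in> Y i" for x i
  using e[OF that] F.generated_incl[of "\<Union>i. e ` Y i"] that unfolding F.restrict_sel by blast
 have "graded_lie3 (restrict_to F ?S) & (\<forall>i. \<forall>x\<in>Y i. e x \<in> grade (restrict_to F ?S) i)"
  using F.restrict_lie[OF S] eS by blast
 then obtain g where g: "lie_hom F (restrict_to F ?S) g" "\<forall>i. \<forall>x\<in>Y i. g (e x) = e x"
  using F unfolding free_lie3_def by blast
 have g': "lie_hom F F g"
  using g(1) unfolding lie_hom_def F.restrict_sel by (simp add: image_subset_iff)
 have idh: "lie_hom F F (\<lambda>x. x)" by (rule lie_homI) auto
 have "\<exists>g. lie_hom F F g & (\<forall>i. \<forall>x\<in>Y i. g (e x) = e x) &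
   (\<forall>g'. lie_hom F F g' & (\<forall>i. \<forall>x\<in>Y i. g' (e x) = e x) --> (\<forall>z\<in>carrier F. g' z = g z))"
  using F e gF unfolding free_lie3_def by blast
 then have eq: "g z = z" if "z \<in> carrier F" for z using g' g(2) idh that by metis
 have "z \<in> ?S" if "z \<in> carrier F" for z
  using F.hom_facts(2)[OF F.restrict_lie[OF S] g(1) that] unfolding F.carrier_restrict[OF S] eq[OF that] .
 then show ?thesis using F.substructureD(1)[OF S] by blast
qed

context lie3 begin

definition psm :: "'k => 'a \<times> 'k => 'a \<times> 'k" where
 "psm c p = (smul M c (fst p), c * snd p)"

lemma psm_vector_space: "vector_space psm"
 by unfold_locales (simp_all add: psm_def prod_eq_iff vs.scale_right_distrib vs.scale_left_distrib algebra_simps)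

text \<open>The algebra with M_1 in degree 1, K in degree 2 and \<open>b\<close> as bracket.
  Homomorphisms into it convert an alternating form into a functional on the degree 2 part of a free
  algebra.\<close>

lemma alt_extension:
 assumes b: "b \<in> vs.alt_on (G 1)"
 defines "H \<equiv> \<lparr>smul = psm, grade = \<lambda>i. if i = 1 then G 1 \<times> {0} else if i = 2 then {0} \<times> UNIV else {0},
   bracket = \<lambda>p q. (0, b (fst p, fst q))\<rparr>"
 shows "graded_lie3 H"
proof -
 have bb: "b \<in> vs.bil_on (G 1) (G 1)" and self: "!!x. x \<in> G 1 ==> b (x, x) = 0" using b unfolding vs.alt_on_def by blast+
 note B = vs.bil_onD[OF bb] and B0 = vs.bil_on_0[OF bb]
 interpret p: vector_space psm by (rule psm_vector_space)
 have sel: "smul H = psm" "bracket H p q = (0, b (fst p, fst q))"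
  "grade H i = (if i = 1 then G 1 \<times> {0} else if i = 2 then {0} \<times> UNIV else {0})" for p q i
  by (simp_all add: H_def)
 have car: "fst p \<in> G 1" if p: "p \<in> carrier H" for p
 proof -
  obtain x y z where xyz: "p = x + y + z" "x \<in> grade H 1" "y \<in> grade H 2" "z \<in> grade H 3"
   using p unfolding carrier_def by blast
  then have "fst x \<in> G 1" "fst y = 0" "fst z = 0" unfolding sel by (auto simp: zero_prod_def simp del: One_nat_def)
  then show ?thesis using xyz(1) by simp
 qed
 show ?thesis
  unfolding graded_lie3_def
 proof (intro conjI allI impI ballI)
  show "vector_space (smul H)" unfolding sel by (rule psm_vector_space)
  show "module.subspace (smul H) (grade H i)" for i
   unfolding sel p.subspace_def using vs.subspace_add[OF G_sub] vs.subspace_scale[OF G_sub]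
   by (auto simp: psm_def zero_prod_def)
  show "grade H i = {0}" if "i ~: {1, 2, 3}" for i using that unfolding sel by simp
  show "bracket H x y \<in> grade H (i + j)" if "x \<in> grade H i" "y \<in> grade H j" for x y i j
  proof (cases "i = 1 & j = 1")
   case True
   then show ?thesis unfolding sel by simp
  next
   case False
   then have "fst x = 0 \<or> fst y = 0" using that unfolding sel by (auto split: if_splits)
   then have "bracket H x y = 0" unfolding sel using B0 by (auto simp: zero_prod_def)
   moreover have "0 \<in> grade H n" for n unfolding sel by (simp add: zero_prod_def)
   ultimately show ?thesis by simp
  qed
 next
  fix x y z assume "x \<in> grade H 1" "y \<in> grade H 2" "z \<in> grade H 3" "x + y + z = 0"
  then show "x = 0" "y = 0" "z = 0" unfolding sel by (auto simp: zero_prod_def)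
 qed (simp_all add: sel psm_def car B B0 self zero_prod_def del: One_nat_def)
qed

text \<open>M_3 is replaced by K and the bracket of M_1 with M_2 by \<open>b\<close>; the Jacobi
  identity of the new algebra is the cyclic condition on \<open>b\<close>.\<close>

lemma jac_extension:
 assumes b: "b \<in> jac (G 1) (G 2)"
 defines "H \<equiv> \<lparr>smul = psm, grade = \<lambda>i. if i = 1 then G 1 \<times> {0} else if i = 2 then G 2 \<times> {0} else if i = 3 then {0} \<times> UNIV else {0},
   bracket = \<lambda>p q. (br (proj M 1 (fst p)) (proj M 1 (fst q)),
    b (proj M 1 (fst p), proj M 2 (fst q)) - b (proj M 1 (fst q), proj M 2 (fst p)))\<rparr>"
 shows "graded_lie3 H"
proof -
 have bb: "b \<in> vs.bil_on (G 1) (G 2)" and J: "!!x y z. x \<in> G 1 ==> y \<in> G 1 ==> z \<in> G 1 ==>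
   b (x, br y z) + b (y, br z x) + b (z, br x y) = 0" using b unfolding jac_def by blast+
 note B = vs.bil_onD[OF bb] and B0 = vs.bil_on_0[OF bb]
 interpret p: vector_space psm by (rule psm_vector_space)
 let ?p1 = "\<lambda>p. proj M 1 (fst p)" and ?p2 = "\<lambda>p. proj M 2 (fst p)"
 have sel: "smul H = psm" "bracket H p q = (br (?p1 p) (?p1 q), b (?p1 p, ?p2 q) - b (?p1 q, ?p2 p))"
  "grade H i = (if i = 1 then G 1 \<times> {0} else if i = 2 then G 2 \<times> {0} else if i = 3 then {0} \<times> UNIV else {0})" for p q i
  by (simp_all add: H_def)
 have car: "fst p \<in> carrier M" if p: "p \<in> carrier H" for p
 proof -
  obtain x y z where xyz: "p = x + y + z" "x \<in> grade H 1" "y \<in> grade H 2" "z \<in> grade H 3"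
   using p unfolding carrier_def by blast
  then have "fst x \<in> G 1" "fst y \<in> G 2" "fst z = 0" unfolding sel by (auto simp: zero_prod_def simp del: One_nat_def)
  then show ?thesis using xyz(1) carrier_add Gc by simp
 qed
 have P: "?p1 p \<in> G 1" "?p2 p \<in> G 2" if "p \<in> carrier H" for p using proj_G[OF car[OF that]] by blast+
 have Pa: "proj M i (fst (p + q)) = proj M i (fst p) + proj M i (fst q)" if "p \<in> carrier H" "q \<in> carrier H" for p q i
  using proj_add[OF car[OF that(1)] car[OF that(2)]] by simp
 have Ps: "proj M i (fst (psm c p)) = smul M c (proj M i (fst p))" if "p \<in> carrier H" for p c i
  using proj_smul[OF car[OF that]] by (simp add: psm_def)
 have Pb: "?p1 (bracket H p q) = 0" "?p2 (bracket H p q) = br (?p1 p) (?p1 q)" if "p \<in> carrier H" "q \<in> carrier H" for p q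
  using br_G11[OF P(1)[OF that(1)] P(1)[OF that(2)]] proj_hom[of "br (?p1 p) (?p1 q)" 2] unfolding sel by simp_all
 show ?thesis
  unfolding graded_lie3_def
 proof (intro conjI allI impI ballI)
  show "vector_space (smul H)" unfolding sel by (rule psm_vector_space)
  show "module.subspace (smul H) (grade H i)" for i
   unfolding sel p.subspace_def using vs.subspace_add[OF G_sub] vs.subspace_scale[OF G_sub]
   by (auto simp: psm_def zero_prod_def)
  show "grade H i = {0}" if "i ~: {1, 2, 3}" for i using that unfolding sel by simp
  show "bracket H x y \<in> grade H (i + j)" if "x \<in> grade H i" "y \<in> grade H j" for x y i j
  proof -
   have fx: "fst x \<in> G i" "fst y \<in> G j" using that unfolding sel by (auto split: if_splits)
   have px: "?p1 x = (if i = 1 then fst x else 0)" "?p1 y = (if j = 1 then fst y else 0)"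
     "?p2 x = (if i = 2 then fst x else 0)" "?p2 y = (if j = 2 then fst y else 0)"
    using proj_hom[OF fx(1), of 1] proj_hom[OF fx(2), of 1] proj_hom[OF fx(1), of 2] proj_hom[OF fx(2), of 2] by simp_all
   have z3: "0 \<in> grade H n" for n unfolding sel by (simp add: zero_prod_def)
   consider "i = 1" "j = 1" | "i = 1" "j = 2" | "i = 2" "j = 1" | "bracket H x y = 0"
    unfolding sel px using B0 br_0[OF Gc[OF fx(1)]] br_0[OF Gc[OF fx(2)]]
    by (cases "i = 1"; cases "j = 1"; cases "i = 2"; cases "j = 2") (auto simp: zero_prod_def)
   then show ?thesis
   proof cases
    case 1
    then have "br (fst x) (fst y) \<in> G 2" using br_G11 fx by simp
    moreover have "b (fst x, 0) = 0" "b (fst y, 0) = 0" using B0 by simp_all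
    ultimately show ?thesis using 1 unfolding sel px by simp
   next
    case 2
    then show ?thesis using fx unfolding sel px by simp
   next
    case 3
    then show ?thesis using fx unfolding sel px by simp
   qed (simp add: z3)
  qed
  show "bracket H (x + y) z = bracket H x z + bracket H y z"
   "bracket H x (y + z) = bracket H x y + bracket H x z"
   if "x \<in> carrier H" "y \<in> carrier H" "z \<in> carrier H" for x y z
   unfolding sel Pa[OF that(1,2)] Pa[OF that(2,3)]
   using P[OF that(1)] P[OF that(2)] P[OF that(3)]
   by (simp_all add: B br_add_left br_add_right)
  show "bracket H (smul H c x) y = smul H c (bracket H x y)"
   "bracket H x (smul H c y) = smul H c (bracket H x y)" if "x \<in> carrier H" "y \<in> carrier H" for x y c
   unfolding sel Ps[OF that(1)] Ps[OF that(2)] using P[OF that(1)] P[OF that(2)]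
   by (simp_all add: B psm_def br_smul_left br_smul_right algebra_simps)
  show "bracket H x x = 0" if "x \<in> carrier H" for x
   unfolding sel using P[OF that] by (simp add: br_self zero_prod_def)
  show "bracket H x (bracket H y z) + bracket H y (bracket H z x) + bracket H z (bracket H x y) = 0"
   if "x \<in> carrier H" "y \<in> carrier H" "z \<in> carrier H" for x y z
  proof -
   have "bracket H x (bracket H y z) = (0, b (?p1 x, br (?p1 y) (?p1 z)))" if "x \<in> carrier H" "y \<in> carrier H" "z \<in> carrier H" for x y z
    unfolding sel(2)[of x] Pb[OF that(2,3)] using P[OF that(1)] B0 by simp
   then show ?thesis using that J[OF P(1)[OF that(1)] P(1)[OF that(2)] P(1)[OF that(3)]] by (simp add: zero_prod_def)
  qed
 next
  fix x y z assume "x \<in> grade H 1" "y \<in> grade H 2" "z \<in> grade H 3" and s: "x + y + z = 0"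
  then have 1: "fst x \<in> G 1" "fst y \<in> G 2" "snd x = 0" "snd y = 0" "fst z = 0" unfolding sel by auto
  have s1: "fst x + fst y + 0 = 0" using arg_cong[OF s, of fst] 1 by simp
  have s2: "snd z = 0" using arg_cong[OF s, of snd] 1 by simp
  show "x = 0" "y = 0" "z = 0"
   using G_direct[OF 1(1,2) G0 s1] 1 s2 by (simp_all add: prod_eq_iff)
 qed
qed

end

section \<open>Counting the relations of a free presentation\<close>

locale lie_presentation = lie3 M for M :: "('k::{field,finite}, 'a::ab_group_add) glie" +
 fixes Z :: "'a set" and F :: "('k, nat => 'k) glie" and e :: "'a => nat => 'k" and f :: "(nat => 'k) => 'a"
 assumes fin: "finite (carrier M)" and o: "o_system M Z"
  and free: "free_lie3 F (\<lambda>j. Z \<inter> grade M j) e" and hom: "lie_hom F M f" and fe: "!!x. x \<in> Z ==> f (e x) = x"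
begin

sublocale F: lie3 F
 using free by unfold_locales (simp add: free_lie3_def)

lemma ZG: "Z <= G 1 \<union> G 2 \<union> G 3" using o unfolding o_system_def by blast
lemma Z_facts: "finite Z" "0 ~: Z" using o_system_card[OF fin o] by blast+

lemma e_grade: "x \<in> Z ==> x \<in> G i ==> e x \<in> F.G i"
 using free unfolding free_lie3_def by blast

abbreviation "Z1 \<equiv> Z \<inter> G 1"
abbreviation "Z2 \<equiv> Z \<inter> G 2"
abbreviation "Z3 \<equiv> Z \<inter> G 3"

lemma F_generated: "carrier F = generated F (e ` Z1 \<union> e ` Z2 \<union> e ` Z3)"
proof -
 have z: "Z \<inter> G i = {}" if "i ~: {1, 2, 3}" for i using G_other[of i] that Z_facts(2) by auto
 have "(\<Union>i. e ` (Z \<inter> G i)) = e ` Z1 \<union> e ` Z2 \<union> e ` Z3"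
 proof
  show "(\<Union>i. e ` (Z \<inter> G i)) <= e ` Z1 \<union> e ` Z2 \<union> e ` Z3"
  proof (rule UN_least)
   fix i :: nat
   show "e ` (Z \<inter> G i) <= e ` Z1 \<union> e ` Z2 \<union> e ` Z3"
    using z[of i] by (cases "i = 1 \<or> i = 2 \<or> i = 3") auto
  qed
 qed blast
 then show ?thesis using free_lie3_generated[OF free] by simp
qed

lemma F_span: "F.G 1 = F.vs.span (e ` Z1)" "F.G 2 = F.vs.span (e ` Z2 \<union> {F.br x y |x y. x \<in> F.G 1 & y \<in> F.G 1})"
 "F.G 3 = F.vs.span (e ` Z3 \<union> {F.br x y |x y. x \<in> F.G 1 & y \<in> F.G 2})"
proof -
 have s: "e ` Z1 <= F.G 1" "e ` Z2 <= F.G 2" "e ` Z3 <= F.G 3" using e_grade by blast+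
 note ge = F.generated_explicit[OF s, folded F_generated, unfolded F.carrier_Int]
 show 1: "F.G 1 = F.vs.span (e ` Z1)" by (rule ge(2))
 show 2: "F.G 2 = F.vs.span (e ` Z2 \<union> {F.br x y |x y. x \<in> F.G 1 & y \<in> F.G 1})"
  using ge(3) unfolding 1[symmetric] .
 show "F.G 3 = F.vs.span (e ` Z3 \<union> {F.br x y |x y. x \<in> F.G 1 & y \<in> F.G 2})"
  using ge(4) unfolding 1[symmetric] 2[symmetric] .
qed

lemma F_finite: "finite (carrier F)"
proof -
 have s: "e ` Z1 \<union> e ` Z2 \<union> e ` Z3 <= carrier F" using e_grade F.Gc by blast
 show ?thesis unfolding F_generated by (rule F.finite_generated[OF _ s]) (use Z_facts in simp)
qed

lemmas fh = F.hom_facts[OF lie hom]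

lemma image_subspace:
 assumes "F.vs.subspace V" "V <= carrier F"
 shows "vs.subspace (f ` V)"
 unfolding vs.subspace_def
proof (intro conjI ballI allI)
 show "0 \<in> f ` V" using fh(1) F.vs.subspace_0[OF assms(1)] by (metis image_eqI)
 fix u assume "u \<in> f ` V"
 then obtain x where x: "x \<in> V" "u = f x" by blast
 then have xc: "x \<in> carrier F" using assms(2) by blast
 show "smul M c u \<in> f ` V" for c
  using fh(7)[OF xc, of c] F.vs.subspace_scale[OF assms(1) x(1), of c] x(2) by (metis image_eqI)
 fix v assume "v \<in> f ` V"
 then obtain y where y: "y \<in> V" "v = f y" by blast
 then have yc: "y \<in> carrier F" using assms(2) by blast
 show "u + v \<in> f ` V"
  using fh(4)[OF xc yc] F.vs.subspace_add[OF assms(1) x(1) y(1)] x(2) y(2) by (metis image_eqI)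
qed

lemma FGc: "F.G i <= carrier F" using F.Gc by blast

lemma onto: "f ` F.G 1 = G 1" "f ` F.G 2 = G 2" "f ` F.G 3 = G 3"
proof -
 have sub: "f ` F.G i <= G i" for i using fh(8) by blast
 have s: "vs.subspace (f ` F.G i)" for i by (rule image_subspace[OF F.G_sub FGc])
 have Zi: "Z \<inter> G i <= f ` F.G i" for i
 proof
  fix x assume x: "x \<in> Z \<inter> G i"
  then have "f (e x) = x" "e x \<in> F.G i" using fe e_grade by blast+
  then show "x \<in> f ` F.G i" by (metis image_eqI)
 qed
 note oi = o_system_iff[OF fin ZG, THEN iffD1, OF o]
 have "G 1 <= f ` F.G 1"
 proof -
  have "vs.span ({0} \<union> Z1) <= f ` F.G 1" by (rule vs.span_minimal[OF _ s]) (use Zi[of 1] vs.subspace_0[OF s] in auto)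
  then show ?thesis using oi by argo
 qed
 then show 1: "f ` F.G 1 = G 1" using sub by blast
 have "D2 <= f ` F.G 2" unfolding D2_def
 proof (rule vs.span_minimal[OF _ s], clarify)
  fix x y assume "x \<in> G 1" "y \<in> G 1"
  then obtain u v where uv: "u \<in> F.G 1" "x = f u" "v \<in> F.G 1" "y = f v" using 1 by blast
  then have "br x y = f (F.br u v)" using fh(6) FGc by (metis subsetD)
  then show "br x y \<in> f ` F.G 2" using F.br_G11[OF uv(1,3)] by blast
 qed
 then have "vs.span (D2 \<union> Z2) <= f ` F.G 2" by (intro vs.span_minimal[OF _ s] Un_least Zi)
 then have "G 2 <= f ` F.G 2" using oi by argo
 then show 2: "f ` F.G 2 = G 2" using sub by blast
 have "D3 <= f ` F.G 3" unfolding D3_def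
 proof (rule vs.span_minimal[OF _ s], clarify)
  fix x y assume "x \<in> G 1" "y \<in> G 2"
  then obtain u v where uv: "u \<in> F.G 1" "x = f u" "v \<in> F.G 2" "y = f v" using 1 2 by blast
  then have "br x y = f (F.br u v)" using fh(6) FGc by (metis subsetD)
  then show "br x y \<in> f ` F.G 3" using F.br_G12[OF uv(1,3)] by blast
 qed
 then have "vs.span (D3 \<union> Z3) <= f ` F.G 3" by (intro vs.span_minimal[OF _ s] Un_least Zi)
 then have "G 3 <= f ` F.G 3" using oi by argo
 then show "f ` F.G 3 = G 3" using sub by blast
qed

lemma finFG: "finite (F.G i)" by (rule F.finite_G[OF F_finite])

text \<open>The generators of degree 1 are mapped to a basis of M_1, so \<open>F\<close> has no more
  elements in degree 1 than \<open>M\<close>, and \<open>f\<close> is onto.\<close>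

lemma inj1: "inj_on f (F.G 1)"
proof (rule eq_card_imp_inj_on[OF finFG])
 have "F.vs.dim (F.G 1) <= card (e ` Z1)" using F_span(1) Z_facts(1) by (intro F.vs.dim_le_card) auto
 also have "\<dots> <= card Z1" using Z_facts(1) by (intro card_image_le) auto
 also have "\<dots> = vs.dim (G 1)" by (rule o_system_card(1)[OF fin o])
 finally have "card (F.G 1) <= card (G 1)"
  unfolding F.vs.card_dim[OF F.G_sub finFG] vs.card_dim[OF G_sub finite_G[OF fin]]
  using card_field_gt_1[where 'k='k] by (intro power_increasing) auto
 moreover have "card (f ` F.G 1) <= card (F.G 1)" by (rule card_image_le[OF finFG])
 ultimately show "card (f ` F.G 1) = card (F.G 1)" using onto(1) by simp
qed

definition ker :: "nat => (nat => 'k) set" where "ker i = {z\<in>F.G i. f z = 0}"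

lemma ker_subspace: "F.vs.subspace (ker i)"
 unfolding F.vs.subspace_def ker_def
 using fh(1) fh(4)[OF F.Gc F.Gc] fh(7)[OF F.Gc] F.vs.subspace_add[OF F.G_sub] F.vs.subspace_scale[OF F.G_sub]
 by auto

lemma card_ker: "f ` F.G i = G i ==> card (F.G i) = card (ker i) * card (G i)"
proof -
 assume o: "f ` F.G i = G i"
 have "card (F.G i) = card {x\<in>F.G i. f x = 0} * card (f ` F.G i)"
  by (rule additive_card[OF finFG]) (use F.vs.subspace_diff[OF F.G_sub] fh(5)[OF F.Gc F.Gc] in auto)
 then show ?thesis unfolding o ker_def .
qed

text \<open>\<open>g1\<close> inverts \<open>f\<close> in degree 1, whereas \<open>g2\<close> is
  merely a chosen section in degree 2 and need not be linear.\<close>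

definition g1 :: "'a => nat => 'k" where "g1 x = inv_into (F.G 1) f x"
definition g2 :: "'a => nat => 'k" where "g2 x = inv_into (F.G 2) f x"

lemma g1: "x \<in> G 1 ==> g1 x \<in> F.G 1" "x \<in> G 1 ==> f (g1 x) = x"
 and g2: "x \<in> G 2 ==> g2 x \<in> F.G 2" "x \<in> G 2 ==> f (g2 x) = x"
 and g1_unique: "u \<in> F.G 1 ==> g1 (f u) = u"
 unfolding g1_def g2_def using inv_into_into[of x f "F.G 1"] f_inv_into_f[of x f "F.G 1"]
  inv_into_into[of x f "F.G 2"] f_inv_into_f[of x f "F.G 2"] onto inv_into_f_f[OF inj1] by auto

lemma g1_add: "x \<in> G 1 ==> y \<in> G 1 ==> g1 (x + y) = g1 x + g1 y"
 and g1_smul: "x \<in> G 1 ==> g1 (smul M c x) = smul F c (g1 x)"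
proof -
 show "g1 (x + y) = g1 x + g1 y" if "x \<in> G 1" "y \<in> G 1"
  using g1_unique[of "g1 x + g1 y"] g1[OF that(1)] g1[OF that(2)] F.vs.subspace_add[OF F.G_sub] fh(4) F.Gc by simp
 show "g1 (smul M c x) = smul F c (g1 x)" if "x \<in> G 1"
  using g1_unique[of "smul F c (g1 x)"] g1[OF that] F.vs.subspace_scale[OF F.G_sub] fh(7) F.Gc by simp
qed

text \<open>Applied with \<open>fst\<close> for \<open>l\<close>, to see that a homomorphism to a
  central extension lies over \<open>f\<close> in low degrees.\<close>

lemma hom_on_span:
 assumes Y: "Y <= carrier F" and g: "lie_hom F N g" "lie_hom F N' g'" and N: "graded_lie3 N" "graded_lie3 N'"
  and l: "!!x y. l (x + y) = l x + l y" "!!c x. l (smul N c x) = smul N' c (l x)" "l 0 = 0"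
  and eq: "!!y. y \<in> Y ==> l (g y) = g' y"
  and x: "x \<in> F.vs.span Y"
 shows "l (g x) = g' x"
proof -
 note G = F.hom_facts[OF N(1) g(1)] and G' = F.hom_facts[OF N(2) g(2)]
 have "F.vs.subspace {x\<in>carrier F. l (g x) = g' x}"
  unfolding F.vs.subspace_def mem_Collect_eq Ball_def
  by (simp add: G(1,4,7) G'(1,4,7) l F.carrier_add F.vs.subspace_scale[OF F.carrier_subspace])
 then have "F.vs.span Y <= {x\<in>carrier F. l (g x) = g' x}"
  by (rule F.vs.span_minimal[rotated]) (use Y eq in auto)
 then show ?thesis using x by blast
qed

end

context fin_vspace begin

lemma dual_annD:
 assumes "fi \<in> dual_ann V W"
 shows "x ~: V ==> fi x = 0" "x \<in> V ==> y \<in> V ==> fi (x + y) = fi x + fi y"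
  "x \<in> V ==> fi (c *f x) = c * fi x" "x \<in> W ==> fi x = 0" "0 \<in> V ==> fi 0 = 0"
proof -
 show 3: "x \<in> V ==> fi (c *f x) = c * fi x" for x c using assms unfolding dual_ann_def by blast
 show "0 \<in> V ==> fi 0 = 0" using 3[of 0 0] by simp
qed (use assms in \<open>unfold dual_ann_def, blast\<close>)+

lemma dual_annI:
 assumes V: "subspace V" and l: "!!x y. x \<in> V ==> y \<in> V ==> l (x + y) = l x + l y"
  "!!c x. x \<in> V ==> l (c *f x) = c * l x" "!!x. x \<in> S ==> l x = 0" and S: "S <= V"
 shows "(\<lambda>x. if x \<in> V then l x else 0) \<in> dual_ann V (span S)"
proof -
 have l0: "l 0 = 0" using l(2)[of 0 0] subspace_0[OF V] by simp
 have "subspace {x\<in>V. l x = 0}"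
  unfolding subspace_def using V l(1,2) l0 by (simp add: subspace_def)
 then have "span S <= {x\<in>V. l x = 0}" by (rule span_minimal[rotated]) (use S l(3) in auto)
 then show ?thesis
  unfolding dual_ann_def using l(1,2) subspace_add[OF V] subspace_scale[OF V] by auto
qed

lemma dual_ann_ext:
 assumes p: "fi \<in> dual_ann V W" "ps \<in> dual_ann V W'" and V: "subspace V" "S <= V" "V <= span S"
  and eq: "!!x. x \<in> S ==> fi x = ps x"
 shows "fi = ps"
proof
 fix x
 note d = dual_annD[OF p(1)] dual_annD[OF p(2)]
 have "subspace {x\<in>V. fi x = ps x}"
  unfolding subspace_def using V(1) by (simp add: d subspace_def)
 then have "span S <= {x\<in>V. fi x = ps x}" by (rule span_minimal[rotated]) (use V(2) eq in auto)
 then show "fi x = ps x" using V(3) d(1,6) by (cases "x \<in> V") auto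
qed

end

context lie_presentation begin

lemma card_supported: "finite Y ==> card {u :: 'a => 'k. \<forall>x. x ~: Y --> u x = 0} = card (UNIV :: 'k set) ^ card Y"
 using card_fs(2)[OF fdim_supported(1,2)[of Y, where 'k='k]] fdim_supported(3)[of Y, where 'k='k] by simp

lemma g1_surj: assumes "u \<in> F.G 1" obtains x where "x \<in> G 1" "u = g1 x"
 by (rule that[of "f u"]) (use assms fh(8) g1_unique in auto)

lemma Z_disjoint: "x \<in> Z ==> x \<in> G i ==> x \<in> G j ==> i = j"
 using G_Int[of x i j] Z_facts(2) by blast

lemma H_hom:
 assumes H: "graded_lie3 H" "finite (carrier H)" and h: "!!x i. x \<in> Z ==> x \<in> G i ==> h x \<in> grade H i"
 shows "\<exists>g. lie_hom F H g & (\<forall>x\<in>Z. g (e x) = h x)"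
proof -
 have "!!i x. x \<in> Z \<inter> G i ==> h x \<in> grade H i" using h by blast
 then obtain g where g: "lie_hom F H g" "\<forall>i. \<forall>x\<in>Z \<inter> G i. g (e x) = h x"
  using free_lie3_universal[OF free H, of h] by blast
 show ?thesis using g ZG by blast
qed

text \<open>A functional on F_2 is determined by its values on the generators of degree 2 and on
  brackets, and the latter values form an alternating form on M_1. Every such pair occurs, by
  freeness applied to the extension belonging to the form.\<close>

lemma card_degree2: "card (F.G 2) = card (UNIV :: 'k set) ^ card Z2 * card (vs.alt_on (G 1))"
proof -
 let ?D = "F.vs.dual_ann (F.G 2) {0}"
 let ?S = "{u :: 'a => 'k. \<forall>x. x ~: Z2 --> u x = 0}"
 define P where "P fi = (\<lambda>x. if x \<in> Z2 then fi (e x) else 0 :: 'k)" for fi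
 define Q where "Q fi = (\<lambda>p. if p \<in> G 1 \<times> G 1 then fi (F.br (g1 (fst p)) (g1 (snd p))) else 0 :: 'k)" for fi
 have brg: "F.br (g1 x) (g1 y) \<in> F.G 2" if "x \<in> G 1" "y \<in> G 1" for x y
  by (rule F.br_G11[OF g1(1)[OF that(1)] g1(1)[OF that(2)]])
 have gc: "g1 x \<in> carrier F" if "x \<in> G 1" for x using g1(1)[OF that] F.Gc by blast
 have span2: "F.G 2 <= F.vs.span (e ` Z2 \<union> {F.br x y |x y. x \<in> F.G 1 & y \<in> F.G 1})"
  using F_span(2) by blast
 have sub2: "e ` Z2 \<union> {F.br x y |x y. x \<in> F.G 1 & y \<in> F.G 1} <= F.G 2"
  using e_grade F.br_G11 by blast
 have inj: "inj_on (\<lambda>fi. (P fi, Q fi)) ?D"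
 proof (rule inj_onI)
  fix fi ps assume a: "fi \<in> ?D" "ps \<in> ?D" "(P fi, Q fi) = (P ps, Q ps)"
  show "fi = ps"
  proof (rule F.vs.dual_ann_ext[OF a(1,2) F.G_sub sub2 span2], elim UnE)
   fix z assume "z \<in> e ` Z2"
   then obtain x where x: "x \<in> Z2" "z = e x" by blast
   have "P fi x = P ps x" using a(3) by simp
   then show "fi z = ps z" using x unfolding P_def by simp
  next
   fix z assume "z \<in> {F.br x y |x y. x \<in> F.G 1 & y \<in> F.G 1}"
   then obtain u v where uv: "u \<in> F.G 1" "v \<in> F.G 1" "z = F.br u v" by blast
   obtain x where x: "x \<in> G 1" "u = g1 x" by (rule g1_surj[OF uv(1)])
   obtain y where y: "y \<in> G 1" "v = g1 y" by (rule g1_surj[OF uv(2)])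
   have "Q fi (x, y) = Q ps (x, y)" using a(3) by simp
   then show "fi z = ps z" using x y uv(3) unfolding Q_def by (simp del: One_nat_def)
  qed
 qed
 have im: "(\<lambda>fi. (P fi, Q fi)) ` ?D = ?S \<times> vs.alt_on (G 1)"
 proof (intro equalityI subsetI)
  fix w assume "w \<in> (\<lambda>fi. (P fi, Q fi)) ` ?D"
  then obtain fi where p: "fi \<in> ?D" "w = (P fi, Q fi)" by blast
  note d = F.vs.dual_annD[OF p(1)]
  have "Q fi \<in> vs.alt_on (G 1)"
   unfolding vs.alt_on_def vs.bil_on_def Q_def
   using vs.subspace_add[OF G_sub[of 1]] vs.subspace_scale[OF G_sub[of 1]]
   by (simp add: g1_add g1_smul F.br_add_left F.br_add_right F.br_smul_left F.br_smul_right F.br_self gc brg d del: One_nat_def)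
  then show "w \<in> ?S \<times> vs.alt_on (G 1)" unfolding p(2) P_def by simp
 next
  fix w assume "w \<in> ?S \<times> vs.alt_on (G 1)"
  then obtain ps b where w: "w = (ps, b)" "ps \<in> ?S" and b: "b \<in> vs.alt_on (G 1)" by blast
  define H where "H = \<lparr>smul = psm, grade = \<lambda>i. if i = 1 then G 1 \<times> {0} else if i = 2 then {0} \<times> (UNIV :: 'k set) else {0},
   bracket = \<lambda>p q. (0 :: 'a, b (fst p, fst q))\<rparr>"
  have H: "graded_lie3 H" unfolding H_def by (rule alt_extension[OF b])
  interpret H: lie3 H by unfold_locales (rule H)
  have sel: "smul H = psm" "bracket H p q = (0, b (fst p, fst q))"
   "H.G i = (if i = 1 then G 1 \<times> {0} else if i = 2 then {0} \<times> UNIV else {0})" for p q i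
   by (simp_all add: H_def)
  have fH: "finite (carrier H)"
   unfolding carrier_comb by (rule H.finite_comb) (use finite_G[OF fin] in \<open>simp_all add: sel del: One_nat_def\<close>)
  define h where "h x = (if x \<in> G 1 then (x, 0) else if x \<in> G 2 then (0, ps x) else 0)" for x
  have h: "h x \<in> H.G i" if "x \<in> Z" "x \<in> G i" for x i
  proof -
   have "i = 1 \<or> i = 2 \<or> i = 3" using that ZG Z_disjoint by blast
   then show ?thesis
    using that Z_disjoint[of x i 1] Z_disjoint[of x i 2] unfolding h_def sel by (auto simp: zero_prod_def)
  qed
  obtain g where g0: "lie_hom F H g & (\<forall>x\<in>Z. g (e x) = h x)"
   by (rule exE[OF H_hom[OF H fH h]])
  then have g: "lie_hom F H g" "!!x. x \<in> Z ==> g (e x) = h x" by blast+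
  note gh = F.hom_facts[OF H g(1)]
  have f1: "fst (g x) = f x" if "x \<in> F.G 1" for x
  proof (rule hom_on_span[OF _ g(1) hom H lie, of "e ` Z1" fst])
   show "e ` Z1 <= carrier F" using e_grade F.Gc by blast
   show "x \<in> F.vs.span (e ` Z1)" using that F_span(1) by blast
   fix y assume "y \<in> e ` Z1"
   then show "fst (g y) = f y" using g(2) fe unfolding h_def by auto
  qed (simp_all add: sel psm_def)
  let ?p = "\<lambda>z. if z \<in> F.G 2 then snd (g z) else 0"
  have pD: "?p \<in> F.vs.dual_ann (F.G 2) (F.vs.span {0})"
   by (rule F.vs.dual_annI[OF F.G_sub]) (simp_all add: gh(1,4,7) F.Gc sel psm_def)
  have "P ?p = ps"
  proof
   fix x
   show "P ?p x = ps x"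
   proof (cases "x \<in> Z2")
    case True
    then have "x ~: G 1" using Z_disjoint[of x 1 2] by auto
    then have "snd (h x) = ps x" using True unfolding h_def by simp
    then show ?thesis using True g(2)[of x] e_grade[of x 2] unfolding P_def by simp
   next
    case False
    then show ?thesis using w(2) unfolding P_def by auto
   qed
  qed
  moreover have "Q ?p = b"
  proof
   fix p
   have bb: "b \<in> vs.bil_on (G 1) (G 1)" using b unfolding vs.alt_on_def by blast
   show "Q ?p p = b p"
   proof (cases "p \<in> G 1 \<times> G 1")
    case True
    then obtain x y where xy: "p = (x, y)" "x \<in> G 1" "y \<in> G 1" by blast
    have "snd (g (F.br (g1 x) (g1 y))) = b (x, y)"
     using gh(6)[OF gc[OF xy(2)] gc[OF xy(3)]] f1[OF g1(1)[OF xy(2)]] f1[OF g1(1)[OF xy(3)]]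
      g1(2)[OF xy(2)] g1(2)[OF xy(3)] unfolding sel by simp
    then show ?thesis using xy brg[OF xy(2,3)] unfolding Q_def by (simp del: One_nat_def)
   next
    case False
    then show ?thesis using vs.bil_onD(1)[OF bb] unfolding Q_def by (simp del: One_nat_def)
   qed
  qed
  ultimately have "w = (P ?p, Q ?p)" using w(1) by simp
  moreover have "?p \<in> ?D" using pD by simp
  ultimately show "w \<in> (\<lambda>fi. (P fi, Q fi)) ` ?D" by blast
 qed
 have "card ?D = card (?S \<times> vs.alt_on (G 1))"
  unfolding im[symmetric] by (rule card_image[OF inj, symmetric])
 moreover have "card ?D * card {0 :: nat => 'k} = card (F.G 2)"
  by (rule F.vs.card_dual_ann[OF F.G_sub F.vs.subspace_single_0 _ finFG]) simp
 ultimately show ?thesis using card_supported[of Z2] Z_facts(1) by (simp add: card_cartesian_product)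
qed

text \<open>The degree 3 part of the ideal generated by the relations of degree 2.\<close>

definition I3 :: "(nat => 'k) set" where "I3 = F.vs.span {F.br x y |x y. x \<in> F.G 1 & y \<in> ker 2}"

lemma ker_G: "ker i <= F.G i" unfolding ker_def by blast

lemma I3_sub: "F.vs.subspace I3" "I3 <= ker 3" "I3 <= F.G 3"
proof -
 show "F.vs.subspace I3" unfolding I3_def by simp
 have "F.br x y \<in> ker 3" if x: "x \<in> F.G 1" and y: "y \<in> ker 2" for x y
 proof -
  have y2: "y \<in> F.G 2" "f y = 0" using y unfolding ker_def by auto
  have "f (F.br x y) = br (f x) 0" using fh(6)[OF F.Gc[OF x] F.Gc[OF y2(1)]] y2(2) by simp
  then show ?thesis using F.br_G12[OF x y2(1)] br_0(2)[OF fh(2)[OF F.Gc[OF x]]] unfolding ker_def by simp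
 qed
 then show "I3 <= ker 3" unfolding I3_def by (intro F.vs.span_minimal ker_subspace) blast
 then show "I3 <= F.G 3" using ker_G by blast
qed

text \<open>The pattern of degree 2 with brackets of F_1 and F_2. Killing \<open>I3\<close> makes
  the value on a bracket depend only on the images in M_1 and M_2, so a bilinear form results
  although the section \<open>g2\<close> need not be linear.\<close>

lemma card_degree3: "card (F.vs.dual_ann (F.G 3) I3) = card (UNIV :: 'k set) ^ card Z3 * card (jac (G 1) (G 2))"
proof -
 let ?D = "F.vs.dual_ann (F.G 3) I3"
 let ?S = "{u :: 'a => 'k. \<forall>x. x ~: Z3 --> u x = 0}"
 define P where "P fi = (\<lambda>x. if x \<in> Z3 then fi (e x) else 0 :: 'k)" for fi
 define Q where "Q fi = (\<lambda>p. if p \<in> G 1 \<times> G 2 then fi (F.br (g1 (fst p)) (g2 (snd p))) else 0 :: 'k)" for fi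
 have span3: "F.G 3 <= F.vs.span (e ` Z3 \<union> {F.br x y |x y. x \<in> F.G 1 & y \<in> F.G 2})"
  using F_span(3) by blast
 have sub3: "e ` Z3 \<union> {F.br x y |x y. x \<in> F.G 1 & y \<in> F.G 2} <= F.G 3"
  using e_grade F.br_G12 by blast
 \<comment> \<open>The two lifts \<open>v\<close> and \<open>g2 (f v)\<close> differ by an element
   of \<open>ker 2\<close>, whose brackets with F_1 lie in \<open>I3\<close>.\<close>
 have key: "fi (F.br u v) = Q fi (f u, f v)" if p: "fi \<in> ?D" and u: "u \<in> F.G 1" and v: "v \<in> F.G 2" for fi u v
 proof -
  note d = F.vs.dual_annD[OF p]
  have fu: "f u \<in> G 1" "f v \<in> G 2" using fh(8) u v by blast+
  let ?v = "g2 (f v)"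
  have v': "?v \<in> F.G 2" by (rule g2(1)[OF fu(2)])
  have k: "v - ?v \<in> ker 2"
   unfolding ker_def using F.vs.subspace_diff[OF F.G_sub v v'] fh(5)[OF F.Gc[OF v] F.Gc[OF v']] g2(2)[OF fu(2)] by simp
  have vd: "v - ?v \<in> F.G 2" by (rule F.vs.subspace_diff[OF F.G_sub v v'])
  have i: "F.br u (v - ?v) \<in> I3" unfolding I3_def by (rule F.vs.span_base) (use u k in blast)
  have "F.br u v = F.br u ?v + F.br u (v - ?v)"
   using F.br_add_right[OF F.Gc[OF u] F.Gc[OF v'] F.Gc[OF vd]] by simp
  then have "fi (F.br u v) = fi (F.br u ?v) + fi (F.br u (v - ?v))"
   using d(2)[OF F.br_G12[OF u v'] F.br_G12[OF u vd]] by simp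
  then show ?thesis using d(4)[OF i] fu g1_unique[OF u] unfolding Q_def by (simp del: One_nat_def)
 qed
 have inj: "inj_on (\<lambda>fi. (P fi, Q fi)) ?D"
 proof (rule inj_onI)
  fix fi ps assume a: "fi \<in> ?D" "ps \<in> ?D" "(P fi, Q fi) = (P ps, Q ps)"
  show "fi = ps"
  proof (rule F.vs.dual_ann_ext[OF a(1,2) F.G_sub sub3 span3], elim UnE)
   fix z assume "z \<in> e ` Z3"
   then obtain x where x: "x \<in> Z3" "z = e x" by blast
   have "P fi x = P ps x" using a(3) by simp
   then show "fi z = ps z" using x unfolding P_def by simp
  next
   fix z assume "z \<in> {F.br x y |x y. x \<in> F.G 1 & y \<in> F.G 2}"
   then obtain u v where uv: "u \<in> F.G 1" "v \<in> F.G 2" "z = F.br u v" by blast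
   then show "fi z = ps z" using key[OF a(1) uv(1,2)] key[OF a(2) uv(1,2)] a(3) by simp
  qed
 qed
 have im: "(\<lambda>fi. (P fi, Q fi)) ` ?D = ?S \<times> jac (G 1) (G 2)"
 proof (intro equalityI subsetI)
  fix w assume "w \<in> (\<lambda>fi. (P fi, Q fi)) ` ?D"
  then obtain fi where p: "fi \<in> ?D" "w = (P fi, Q fi)" by blast
  note d = F.vs.dual_annD[OF p(1)] and k = key[OF p(1)]
  have q: "Q fi (x, y) = fi (F.br (g1 x) v)" if "x \<in> G 1" "v \<in> F.G 2" "f v = y" for x y v
   using k[OF g1(1)[OF that(1)] that(2)] g1(2)[OF that(1)] that(3) by simp
  have gc: "x \<in> G 1 ==> g1 x \<in> carrier F" "x \<in> G 2 ==> g2 x \<in> carrier F" for x using g1(1) g2(1) F.Gc by blast+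
  have brg: "x \<in> G 1 ==> y \<in> G 2 ==> F.br (g1 x) (g2 y) \<in> F.G 3" for x y by (rule F.br_G12[OF g1(1) g2(1)])
  have qq: "Q fi (x, y) = fi (F.br (g1 x) (g2 y))" if "x \<in> G 1" "y \<in> G 2" for x y using that unfolding Q_def by simp
  have "Q fi \<in> vs.bil_on (G 1) (G 2)"
   unfolding vs.bil_on_def
  proof (intro CollectI conjI allI ballI impI)
   show "Q fi p = 0" if "p ~: G 1 \<times> G 2" for p using that unfolding Q_def by simp
   fix x z assume x: "x \<in> G 1" and z: "z \<in> G 2"
   show "Q fi (smul M c x, z) = c * Q fi (x, z)" for c
    using qq[OF vs.subspace_scale[OF G_sub x] z] qq[OF x z] F.br_smul_left[OF gc(1)[OF x] gc(2)[OF z]]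
     d(3)[OF brg[OF x z]] by (simp add: g1_smul[OF x])
   have "F.vs.subspace (F.G 2)" by (rule F.G_sub)
   then show "Q fi (x, smul M c z) = c * Q fi (x, z)" for c
    using q[OF x F.vs.subspace_scale[OF F.G_sub g2(1)[OF z], of c], of "smul M c z"] qq[OF x z]
     fh(7)[OF gc(2)[OF z]] g2(2)[OF z] F.br_smul_right[OF gc(1)[OF x] gc(2)[OF z]] d(3)[OF brg[OF x z]] by simp
   show "Q fi (x + y, z) = Q fi (x, z) + Q fi (y, z)" if y: "y \<in> G 1" for y
    using qq[OF vs.subspace_add[OF G_sub x y] z] qq[OF x z] qq[OF y z] F.br_add_left[OF gc(1)[OF x] gc(1)[OF y] gc(2)[OF z]]
     d(2)[OF brg[OF x z] brg[OF y z]] by (simp add: g1_add[OF x y])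
   show "Q fi (x, z + w) = Q fi (x, z) + Q fi (x, w)" if w: "w \<in> G 2" for w
    using q[OF x F.vs.subspace_add[OF F.G_sub g2(1)[OF z] g2(1)[OF w]], of "z + w"] qq[OF x z] qq[OF x w]
     fh(4)[OF gc(2)[OF z] gc(2)[OF w]] g2(2)[OF z] g2(2)[OF w] F.br_add_right[OF gc(1)[OF x] gc(2)[OF z] gc(2)[OF w]]
     d(2)[OF brg[OF x z] brg[OF x w]] by simp
  qed
  moreover have "Q fi (x, br y z) + Q fi (y, br z x) + Q fi (z, br x y) = 0"
   if x: "x \<in> G 1" and y: "y \<in> G 1" and z: "z \<in> G 1" for x y z
  proof -
   have a: "Q fi (x, br y z) = fi (F.br (g1 x) (F.br (g1 y) (g1 z)))" "F.br (g1 x) (F.br (g1 y) (g1 z)) \<in> F.G 3"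
    if x: "x \<in> G 1" and y: "y \<in> G 1" and z: "z \<in> G 1" for x y z
   proof -
    show "Q fi (x, br y z) = fi (F.br (g1 x) (F.br (g1 y) (g1 z)))"
     by (rule q[OF x F.br_G11[OF g1(1)[OF y] g1(1)[OF z]]]) (simp add: fh(6)[OF gc(1)[OF y] gc(1)[OF z]] g1(2)[OF y] g1(2)[OF z])
    show "F.br (g1 x) (F.br (g1 y) (g1 z)) \<in> F.G 3"
     by (rule F.br_G12[OF g1(1)[OF x] F.br_G11[OF g1(1)[OF y] g1(1)[OF z]]])
   qed
   note X1 = a[OF x y z] and X2 = a[OF y z x] and X3 = a[OF z x y]
   have "Q fi (x, br y z) + Q fi (y, br z x) + Q fi (z, br x y) = fi (F.br (g1 x) (F.br (g1 y) (g1 z))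
    + F.br (g1 y) (F.br (g1 z) (g1 x)) + F.br (g1 z) (F.br (g1 x) (g1 y)))"
    unfolding X1(1) X2(1) X3(1) d(2)[OF F.vs.subspace_add[OF F.G_sub X1(2) X2(2)] X3(2)] d(2)[OF X1(2) X2(2)] ..
   also have "\<dots> = fi 0" unfolding F.jacobi[OF gc(1)[OF x] gc(1)[OF y] gc(1)[OF z]] ..
   also have "\<dots> = 0" by (rule d(5)) simp
   finally show ?thesis .
  qed
  ultimately have "Q fi \<in> jac (G 1) (G 2)" unfolding jac_def by blast
  then show "w \<in> ?S \<times> jac (G 1) (G 2)" unfolding p(2) P_def by simp
 next
  fix w assume "w \<in> ?S \<times> jac (G 1) (G 2)"
  then obtain ps b where w: "w = (ps, b)" "ps \<in> ?S" and b: "b \<in> jac (G 1) (G 2)" by blast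
  have bb: "b \<in> vs.bil_on (G 1) (G 2)" using b unfolding jac_def by blast
  define H where "H = \<lparr>smul = psm, grade = \<lambda>i. if i = 1 then G 1 \<times> {0} else if i = 2 then G 2 \<times> {0} else if i = 3 then {0} \<times> (UNIV :: 'k set) else {0},
   bracket = \<lambda>p q. (br (proj M 1 (fst p)) (proj M 1 (fst q)),
    b (proj M 1 (fst p), proj M 2 (fst q)) - b (proj M 1 (fst q), proj M 2 (fst p)))\<rparr>"
  have H: "graded_lie3 H" unfolding H_def by (rule jac_extension[OF b])
  interpret H: lie3 H by unfold_locales (rule H)
  have sel: "smul H = psm" "bracket H p q = (br (proj M 1 (fst p)) (proj M 1 (fst q)),
    b (proj M 1 (fst p), proj M 2 (fst q)) - b (proj M 1 (fst q), proj M 2 (fst p)))"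
   "H.G i = (if i = 1 then G 1 \<times> {0} else if i = 2 then G 2 \<times> {0} else if i = 3 then {0} \<times> UNIV else {0})" for p q i
   by (simp_all add: H_def)
  have fH: "finite (carrier H)"
   unfolding carrier_comb by (rule H.finite_comb) (use finite_G[OF fin] in \<open>simp_all add: sel del: One_nat_def\<close>)
  define h where "h x = (if x \<in> G 3 then (0, ps x) else (x, 0))" for x
  have h: "h x \<in> H.G i" if "x \<in> Z" "x \<in> G i" for x i
  proof -
   have "i = 1 \<or> i = 2 \<or> i = 3" using that ZG Z_disjoint by blast
   then show ?thesis
    using that Z_disjoint[of x i 3] unfolding h_def sel by (auto simp: zero_prod_def)
  qed
  obtain g where g0: "lie_hom F H g & (\<forall>x\<in>Z. g (e x) = h x)"
   by (rule exE[OF H_hom[OF H fH h]])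
  then have g: "lie_hom F H g" "!!x. x \<in> Z ==> g (e x) = h x" by blast+
  note gh = F.hom_facts[OF H g(1)]
  have fh': "fst (g (e x)) = f (e x)" if "x \<in> Z" "x ~: G 3" for x
   using g(2)[OF that(1)] fe[OF that(1)] that(2) unfolding h_def by simp
  have n3: "x ~: G 3" if "x \<in> Z1 \<or> x \<in> Z2" for x
   using that Z_disjoint[of x 1 3] Z_disjoint[of x 2 3] by auto
  have f1: "fst (g x) = f x" if "x \<in> F.G 1" for x
  proof (rule hom_on_span[OF _ g(1) hom H lie, of "e ` Z1" fst])
   show "e ` Z1 <= carrier F" using e_grade F.Gc by blast
   show "x \<in> F.vs.span (e ` Z1)" using that F_span(1) by blast
   fix y assume "y \<in> e ` Z1"
   then show "fst (g y) = f y" using fh' n3 by auto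
  qed (simp_all add: sel psm_def)
  have p1: "proj M 1 (fst (g x)) = f x" "proj M 2 (fst (g x)) = 0" if "x \<in> F.G 1" for x
   using proj_hom[OF fh(8)[OF that], of 1] proj_hom[OF fh(8)[OF that], of 2] f1[OF that] by simp_all
  have f2: "fst (g x) = f x" if "x \<in> F.G 2" for x
  proof (rule hom_on_span[OF _ g(1) hom H lie, of "e ` Z2 \<union> {F.br x y |x y. x \<in> F.G 1 & y \<in> F.G 1}" fst])
   show "e ` Z2 \<union> {F.br x y |x y. x \<in> F.G 1 & y \<in> F.G 1} <= carrier F" using e_grade F.Gc F.br_G11 by blast
   show "x \<in> F.vs.span (e ` Z2 \<union> {F.br x y |x y. x \<in> F.G 1 & y \<in> F.G 1})" using that F_span(2) by blast
   fix y assume "y \<in> e ` Z2 \<union> {F.br x y |x y. x \<in> F.G 1 & y \<in> F.G 1}"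
   then show "fst (g y) = f y"
   proof
    assume "y \<in> e ` Z2"
    then show ?thesis using fh' n3 by auto
   next
    assume "y \<in> {F.br x y |x y. x \<in> F.G 1 & y \<in> F.G 1}"
    then obtain u v where uv: "u \<in> F.G 1" "v \<in> F.G 1" "y = F.br u v" by blast
    show ?thesis unfolding uv(3) gh(6)[OF F.Gc[OF uv(1)] F.Gc[OF uv(2)]] fh(6)[OF F.Gc[OF uv(1)] F.Gc[OF uv(2)]] sel
     using p1[OF uv(1)] p1[OF uv(2)] by simp
   qed
  qed (simp_all add: sel psm_def)
  have p2: "proj M 1 (fst (g x)) = 0" "proj M 2 (fst (g x)) = f x" if "x \<in> F.G 2" for x
   using proj_hom[OF fh(8)[OF that], of 1] proj_hom[OF fh(8)[OF that], of 2] f2[OF that] by simp_all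
  have val: "snd (g (F.br u v)) = b (f u, f v)" if "u \<in> F.G 1" "v \<in> F.G 2" for u v
   unfolding gh(6)[OF F.Gc[OF that(1)] F.Gc[OF that(2)]] sel
   using p1[OF that(1)] p2[OF that(2)] vs.bil_on_0[OF bb] by simp
  let ?p = "\<lambda>z. if z \<in> F.G 3 then snd (g z) else 0"
  have pD: "?p \<in> ?D" unfolding I3_def
  proof (rule F.vs.dual_annI[OF F.G_sub])
   fix z assume "z \<in> {F.br x y |x y. x \<in> F.G 1 & y \<in> ker 2}"
   then obtain u v where uv: "u \<in> F.G 1" "v \<in> F.G 2" "f v = 0" "z = F.br u v" unfolding ker_def by blast
   then show "snd (g z) = 0" using val[OF uv(1,2)] vs.bil_on_0[OF bb] by simp
  next
   show "{F.br x y |x y. x \<in> F.G 1 & y \<in> ker 2} <= F.G 3" using F.br_G12 ker_G by blast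
  qed (simp_all add: gh(4,7) F.Gc sel psm_def)
  have "P ?p = ps"
  proof
   fix x
   show "P ?p x = ps x"
   proof (cases "x \<in> Z3")
    case True
    then have "snd (h x) = ps x" unfolding h_def by simp
    then show ?thesis using True g(2)[of x] e_grade[of x 3] unfolding P_def by simp
   next
    case False
    then show ?thesis using w(2) unfolding P_def by auto
   qed
  qed
  moreover have "Q ?p = b"
  proof
   fix p
   show "Q ?p p = b p"
   proof (cases "p \<in> G 1 \<times> G 2")
    case True
    then obtain x y where xy: "p = (x, y)" "x \<in> G 1" "y \<in> G 2" by blast
    have "snd (g (F.br (g1 x) (g2 y))) = b (x, y)"
     using val[OF g1(1)[OF xy(2)] g2(1)[OF xy(3)]] g1(2)[OF xy(2)] g2(2)[OF xy(3)] by simp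
    then show ?thesis using xy F.br_G12[OF g1(1)[OF xy(2)] g2(1)[OF xy(3)]] unfolding Q_def by (simp del: One_nat_def)
   next
    case False
    then show ?thesis using vs.bil_onD(1)[OF bb] unfolding Q_def by (simp del: One_nat_def)
   qed
  qed
  ultimately have "w = (P ?p, Q ?p)" using w(1) by simp
  then show "w \<in> (\<lambda>fi. (P fi, Q fi)) ` ?D" using pD by blast
 qed
 have "card ?D = card (?S \<times> jac (G 1) (G 2))"
  unfolding im[symmetric] by (rule card_image[OF inj, symmetric])
 then show ?thesis using card_supported[of Z3] Z_facts(1) by (simp add: card_cartesian_product)
qed

lemma kernel_degree: "lie_kernel F f \<inter> F.G i = ker i"
 unfolding lie_kernel_def ker_def using F.Gc by blast

lemma ideal_degree2: "ideal_generated F (lie_kernel F f \<inter> graded_part_2_below F 2) \<inter> F.G 2 = {0}"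
proof -
 have e: "lie_kernel F f \<inter> graded_part_2_below F 2 = {0}"
 proof
  show "lie_kernel F f \<inter> graded_part_2_below F 2 <= {0}"
   unfolding graded_part_2_below_def using F.proj_decomp by fastforce
  show "{0} <= lie_kernel F f \<inter> graded_part_2_below F 2"
   unfolding graded_part_2_below_def lie_kernel_def using fh(1) F.proj_hom[OF F.G0] by simp
 qed
 have i: "lie_ideal F {0}" unfolding lie_ideal_def using F.vs.subspace_single_0 by simp
 have "ideal_generated F {0} = {0}" unfolding ideal_generated_def
  using i by (intro equalityI Inter_lower Inter_greatest) auto
 then show ?thesis unfolding e by simp
qed

text \<open>The sum of \<open>ker 2\<close> and \<open>I3\<close> is already an ideal, since further
  brackets have degree above 3.\<close>

lemma ideal_degree3: "ideal_generated F (lie_kernel F f \<inter> graded_part_2_below F 3) \<inter> F.G 3 = I3"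
proof -
 have e: "lie_kernel F f \<inter> graded_part_2_below F 3 = ker 2"
 proof (intro equalityI subsetI)
  fix x assume "x \<in> lie_kernel F f \<inter> graded_part_2_below F 3"
  then have x: "x \<in> carrier F" "f x = 0" "proj F 1 x = 0" "proj F 3 x = 0"
   unfolding graded_part_2_below_def lie_kernel_def by auto
  then have "x = proj F 2 x" using F.proj_decomp[OF x(1)] by simp
  then show "x \<in> ker 2" using F.proj_G[OF x(1), of 2] x(2) unfolding ker_def by simp
 next
  fix x assume x: "x \<in> ker 2"
  then have x2: "x \<in> F.G 2" "f x = 0" unfolding ker_def by auto
  have "proj F j x = 0" if "j ~: {2..<3}" for j using F.proj_hom[OF x2(1), of j] that by auto
  then show "x \<in> lie_kernel F f \<inter> graded_part_2_below F 3"
   unfolding graded_part_2_below_def lie_kernel_def using x2 F.Gc by blast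
 qed
 have cs: "F.vs.subspace {0}" "F.vs.subspace (ker 2)" "{0} <= F.G 1" "ker 2 <= F.G 2"
  using F.vs.subspace_single_0 ker_subspace ker_G by auto
 note c = F.comb_substructure[OF cs(1,2) I3_sub(1) cs(3,4) I3_sub(3)]
 have c0: "F.br x y \<in> ker 2" if "x \<in> {0}" "y \<in> {0}" for x y using that F.vs.subspace_0[OF cs(2)] by simp
 have c1: "F.br x y \<in> I3" if "x \<in> {0}" "y \<in> ker 2" for x y
  using that F.br_0(1)[OF F.Gc[OF subsetD[OF ker_G that(2)]]] F.vs.subspace_0[OF I3_sub(1)] by simp
 let ?I = "comb {0} (ker 2) I3"
 note cc = c[OF c0 c1]
 have ideal: "lie_ideal F ?I"
  unfolding lie_ideal_def
 proof (intro conjI ballI)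
  show "?I <= carrier F" using F.substructureD(1)[OF cc(1)] by blast
  show "F.vs.subspace ?I" by (rule F.comb_subspace[OF cs(1,2) I3_sub(1)])
  fix x y assume x: "x \<in> carrier F" and y: "y \<in> ?I"
  obtain a b d where x': "x = a + b + d" "a \<in> F.G 1" "b \<in> F.G 2" "d \<in> F.G 3" by (rule F.carrierE[OF x])
  obtain b' d' where y': "y = 0 + b' + d'" "b' \<in> ker 2" "d' \<in> I3" using y unfolding comb_def by blast
  have y2: "b' \<in> F.G 2" "d' \<in> F.G 3" using y'(2,3) ker_G I3_sub(3) by blast+
  have "F.br x y = F.br a b'"
   unfolding x'(1) y'(1) F.br_expand[OF x'(2-4) F.G0 y2] using F.Gc[OF x'(2)] F.Gc[OF x'(3)] by simp
  then have "F.br x y \<in> I3" unfolding I3_def using x'(2) y'(2) by (auto intro: F.vs.span_base)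
  then show "F.br x y \<in> ?I" using cc(4) by blast
 qed
 have "ideal_generated F (ker 2) <= ?I"
  unfolding ideal_generated_def by (rule Inter_lower) (use ideal cc(3) in blast)
 then have "ideal_generated F (ker 2) \<inter> F.G 3 <= I3" using cc(4) by blast
 moreover have "I3 <= I" if I: "lie_ideal F I" "ker 2 <= I" for I
  unfolding I3_def
 proof (rule F.vs.span_minimal)
  show "F.vs.subspace I" using I(1) unfolding lie_ideal_def by blast
  show "{F.br x y |x y. x \<in> F.G 1 & y \<in> ker 2} <= I" using I F.Gc unfolding lie_ideal_def by blast
 qed
 then have "I3 <= ideal_generated F (ker 2)" unfolding ideal_generated_def by blast
 ultimately show ?thesis unfolding e using I3_sub(3) by blast
qed

text \<open>The dimension of F_i is that of the kernel plus that of M_i. In degree 3 the functionals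
  were counted modulo \<open>I3\<close>, which is exactly the part of the kernel that the relations
  of degree 2 account for.\<close>

lemma relation_dim:
 "dim_mod (smul F) (lie_kernel F f \<inter> F.G 2)
   (ideal_generated F (lie_kernel F f \<inter> graded_part_2_below F 2) \<inter> F.G 2) + vs.dim (G 2) = card Z2 + fdim (vs.alt_on (G 1))"
 "dim_mod (smul F) (lie_kernel F f \<inter> F.G 3)
   (ideal_generated F (lie_kernel F f \<inter> graded_part_2_below F 3) \<inter> F.G 3) + vs.dim (G 3) = card Z3 + fdim (jac (G 1) (G 2))"
proof -
 let ?q = "card (UNIV :: 'k set)"
 have q: "1 < ?q" by (rule card_field_gt_1)
 have fk: "finite (ker i)" for i using ker_G finFG finite_subset by blast
 have ck: "F.vs.dim (F.G i) = F.vs.dim (ker i) + vs.dim (G i)" if "f ` F.G i = G i" for i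
 proof -
  have "?q ^ F.vs.dim (F.G i) = ?q ^ (F.vs.dim (ker i) + vs.dim (G i))"
   using card_ker[OF that] F.vs.card_dim[OF F.G_sub finFG] F.vs.card_dim[OF ker_subspace fk] vs.card_dim[OF G_sub finite_G[OF fin]]
   by (simp add: power_add)
  then show ?thesis using q by (simp add: power_inject_exp)
 qed
 have "?q ^ F.vs.dim (F.G 2) = ?q ^ (card Z2 + fdim (vs.alt_on (G 1)))"
  using card_degree2 F.vs.card_dim[OF F.G_sub finFG, of 2] card_fs(2)[OF vs.subspace_alt_on vs.alt_on_fin[OF finite_G[OF fin]], of 1]
  by (simp add: power_add)
 then have d2: "F.vs.dim (F.G 2) = card Z2 + fdim (vs.alt_on (G 1))" using power_inject_exp[OF q] by blast
 have z: "0 \<in> ker 2" using F.vs.subspace_0[OF ker_subspace] by blast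
 have "dim_mod (smul F) (ker 2) {0} = F.vs.dim (ker 2)"
  using F.vs.dim_mod_eq[OF ker_subspace F.vs.subspace_single_0 _ fk, of 2] z by (simp add: F.vs.dim_zero)
 then show "dim_mod (smul F) (lie_kernel F f \<inter> F.G 2)
   (ideal_generated F (lie_kernel F f \<inter> graded_part_2_below F 2) \<inter> F.G 2) + vs.dim (G 2) = card Z2 + fdim (vs.alt_on (G 1))"
  unfolding kernel_degree ideal_degree2 using ck[OF onto(2)] d2 by simp
 note da = F.vs.fdim_dual_ann[OF F.G_sub I3_sub(1,3) finFG]
 have "?q ^ fdim (F.vs.dual_ann (F.G 3) I3) = ?q ^ (card Z3 + fdim (jac (G 1) (G 2)))"
  using card_degree3 card_fs(2)[OF F.vs.subspace_dual_ann da(2)] card_fs(2)[OF subspace_jac jac_fin[OF finite_G[OF fin] finite_G[OF fin]], of 1 2]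
  by (simp add: power_add)
 then have d3: "fdim (F.vs.dual_ann (F.G 3) I3) = card Z3 + fdim (jac (G 1) (G 2))" using power_inject_exp[OF q] by blast
 have "dim_mod (smul F) (ker 3) I3 = F.vs.dim (ker 3) - F.vs.dim I3"
  by (rule F.vs.dim_mod_eq[OF ker_subspace I3_sub(1,2) fk])
 moreover have "F.vs.dim I3 <= F.vs.dim (ker 3)"
  by (rule F.vs.dim_mono_fin[OF I3_sub(2) F.vs.fin_dim_finite[OF fk]])
 ultimately show "dim_mod (smul F) (lie_kernel F f \<inter> F.G 3)
   (ideal_generated F (lie_kernel F f \<inter> graded_part_2_below F 3) \<inter> F.G 3) + vs.dim (G 3) = card Z3 + fdim (jac (G 1) (G 2))"
  unfolding kernel_degree ideal_degree3 using ck[OF onto(3)] d3 da(1) by simp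
qed

end

text \<open>The numbers of generators of degree 2 and 3 occur both in \<open>o_dim\<close> and in
  \<open>ideal_dim\<close> and cancel. The definite descriptions require that a presentation exists
  and that all presentations give the same number.\<close>

lemma (in lie3) delta_formula:
 assumes fin: "finite (carrier M)"
 shows "delta M 2 = int (vs.dim (G 1)) + int (vs.dim (G 2)) - int (fdim (vs.alt_on (G 1)))"
  "delta M 3 = delta M 2 + int (vs.dim (G 3)) - int (fdim (jac (G 1) (G 2)))"
proof -
 note o = o_dim_eq[OF fin] and oc = o_system_card[OF fin]
 have pres: "lie_presentation M Z F e f"
  if "o_system M Z" "free_lie3 F (\<lambda>j. Z \<inter> G j) e" "lie_hom F M f" "\<forall>x\<in>Z. f (e x) = x"
  for Z e f and F :: "('k, nat => 'k) glie"
  using that lie fin by unfold_locales auto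
 obtain Z where Z: "o_system M Z" using o_system_exists[OF fin] by blast
 have "(\<Union>i. Z \<inter> G i) <= Z" by blast
 then have fZ: "finite (\<Union>i. Z \<inter> G i)" using oc(4)[OF Z] finite_subset by blast
 have Zi: "Z \<inter> G i = {}" if "i ~: {1, 2, 3}" for i using G_other[of i] that oc(5)[OF Z] by auto
 obtain F :: "('k, nat => 'k) glie" and e where F: "free_lie3 F (\<lambda>i. Z \<inter> G i) e"
  by (rule free_lie3_exists[OF fZ Zi])
 obtain f where f: "lie_hom F M f" "\<forall>i. \<forall>x\<in>Z \<inter> G i. f (e x) = x"
  using free_lie3_universal[OF F lie fin, of "\<lambda>x. x"] by blast
 have f': "\<forall>x\<in>Z. f (e x) = x" using f(2) Z unfolding o_system_def by blast
 have c: "card (Y \<inter> G 2) = o_dim M 2" "card (Y \<inter> G 3) = o_dim M 3" if "o_system M Y" for Y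
  using oc(2,3)[OF that] o(2,3) by linarith+
 have i2: "ideal_dim M 2 = o_dim M 2 + fdim (vs.alt_on (G 1)) - vs.dim (G 2)"
  unfolding ideal_dim_def
 proof (rule the_equality, goal_cases)
  case 1
  then show ?case using lie_presentation.relation_dim(1)[OF pres[OF Z F f(1) f']] c(1)[OF Z] Z F f(1) f'
   by (intro exI[of _ Z] exI[of _ F] exI[of _ e] exI[of _ f]) simp
 next
  case (2 n)
  then show ?case using lie_presentation.relation_dim(1)[OF pres] c(1) by fastforce
 qed
 have i3: "ideal_dim M 3 = o_dim M 3 + fdim (jac (G 1) (G 2)) - vs.dim (G 3)"
  unfolding ideal_dim_def
 proof (rule the_equality, goal_cases)
  case 1
  then show ?case using lie_presentation.relation_dim(2)[OF pres[OF Z F f(1) f']] c(2)[OF Z] Z F f(1) f'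
   by (intro exI[of _ Z] exI[of _ F] exI[of _ e] exI[of _ f]) simp
 next
  case (2 n)
  then show ?case using lie_presentation.relation_dim(2)[OF pres] c(2) by fastforce
 qed
 have le: "vs.dim (G 2) <= o_dim M 2 + fdim (vs.alt_on (G 1))" "vs.dim (G 3) <= o_dim M 3 + fdim (jac (G 1) (G 2))"
  using lie_presentation.relation_dim[OF pres[OF Z F f(1) f']] c[OF Z] by linarith+
 have s: "{1..2::nat} = {1, 2}" "{2..2::nat} = {2}" "{1..3::nat} = {1, 2, 3}" "{2..3::nat} = {2, 3}" by auto
 show "delta M 2 = int (vs.dim (G 1)) + int (vs.dim (G 2)) - int (fdim (vs.alt_on (G 1)))"
  unfolding delta_def s using i2 le(1) o(1) by simp
 show "delta M 3 = delta M 2 + int (vs.dim (G 3)) - int (fdim (jac (G 1) (G 2)))"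
  unfolding delta_def s using i3 le(2) by simp
qed

section \<open>Forms on a finite space\<close>

text \<open>Makes \<open>dual_ann\<close> available for spaces of forms, whose functionals play the
  role of elements of exterior powers.\<close>

global_interpretation ff: fin_vspace "scl :: 'k::{field,finite} => ('i => 'k) => 'i => 'k"
 rewrites "module.subspace scl = fsubspace" and "module.span scl = fspan" and "vector_space.dim scl = fdim"
  and "vspace.fin_dim scl = ffin_dim"
 by (unfold_locales, unfold fsubspace_def fspan_def fdim_def ffin_dim_def) (rule refl)+

context fin_vspace begin

lemma adapted_basis:
 assumes Y: "subspace Y" "Y <= V" and V: "subspace V" "finite V"
 shows "\<exists>v fi. (\<forall>p<dim V. v p \<in> V & fi p \<in> dual_ann V {0} & (\<forall>r<dim V. fi p (v r) = (if p = r then 1 else 0))) &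
   (\<forall>p<dim Y. v p \<in> Y) & (\<forall>p<dim V. dim Y <= p --> (\<forall>x\<in>Y. fi p x = 0)) &
   (\<forall>x\<in>V. x = (\<Sum>p<dim V. fi p x *f v p))"
proof -
 have fY: "finite Y" using Y(2) V(2) finite_subset by blast
 obtain B where B: "B <= Y" "independent B" "Y <= span B" "card B = dim Y" "finite B"
  using fin_dim_basis[OF fin_dim_finite[OF fY]] by blast
 obtain C where C: "B <= C" "C <= V" "independent C" "V <= span C"
  using maximal_independent_subset_extend[of B V] B Y(2) by blast
 have fC: "finite C" using C(2) V(2) finite_subset by blast
 have cC: "card C = dim V" by (rule basis_card_eq_dim[OF C(2,4,3)])
 let ?e = "dim Y" and ?m = "dim V"
 have cD: "card (C - B) = ?m - ?e" using card_Diff_subset[OF B(5) C(1)] B(4) cC by simp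
 obtain f where f: "bij_betw f {..<?e} B" using ex_bij_betw_nat_finite[OF B(5)] B(4) atLeast0LessThan by auto
 obtain g where g: "bij_betw g {..<?m - ?e} (C - B)" using ex_bij_betw_nat_finite[of "C - B"] fC cD atLeast0LessThan by auto
 define v where "v p = (if p < ?e then f p else g (p - ?e))" for p
 define fi where "fi p = (\<lambda>x. if x \<in> V then representation C x (v p) else 0)" for p
 have vB: "v p \<in> B" if "p < ?e" for p using bij_betwE[OF f] that unfolding v_def by auto
 have vD: "v p \<in> C - B" if "?e <= p" "p < ?m" for p using bij_betwE[OF g] that unfolding v_def by auto
 have vC: "v p \<in> C" if "p < ?m" for p using vB[of p] vD[of p] that C(1) by (cases "p < ?e") auto
 have inj: "inj_on v {..<?m}"
 proof (rule inj_onI)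
  fix p r assume pr: "p \<in> {..<?m}" "r \<in> {..<?m}" "v p = v r"
  consider "p < ?e" "r < ?e" | "?e <= p" "?e <= r" | "p < ?e" "?e <= r" | "?e <= p" "r < ?e" by linarith
  then show "p = r"
  proof cases
   case 1
   then show ?thesis using pr(3) bij_betw_imp_inj_on[OF f] unfolding v_def inj_on_def by auto
  next
   case 2
   then have "g (p - ?e) = g (r - ?e)" "p - ?e < ?m - ?e" "r - ?e < ?m - ?e" using pr unfolding v_def by auto
   then have "p - ?e = r - ?e" using bij_betw_imp_inj_on[OF g] unfolding inj_on_def by auto
   then show ?thesis using 2 by linarith
  next
   case 3
   then show ?thesis using vB[of p] vD[of r] pr by auto
  next
   case 4
   then show ?thesis using vB[of r] vD[of p] pr by auto
  qed
 qed
 have im: "v ` {..<?m} = C"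
  by (rule card_subset_eq[OF fC]) (use vC card_image[OF inj] cC in auto)
 have spV: "x \<in> V ==> x \<in> span C" for x using C(4) by blast
 have 1: "v p \<in> V & fi p \<in> dual_ann V {0} & (\<forall>r<?m. fi p (v r) = (if p = r then 1 else 0))" if p: "p < ?m" for p
 proof (intro conjI allI impI)
  show "v p \<in> V" using vC[OF p] C(2) by blast
  show "fi p \<in> dual_ann V {0}"
   unfolding dual_ann_def fi_def using subspace_add[OF V(1)] subspace_scale[OF V(1)]
   by (auto simp: representation_add[OF C(3) spV spV] representation_scale[OF C(3) spV] representation_zero)
  fix r assume r: "r < ?m"
  have "v r = v p \<longleftrightarrow> p = r" using inj p r unfolding inj_on_def by auto
  then show "fi p (v r) = (if p = r then 1 else 0)"
   unfolding fi_def using vC[OF r] C(2) representation_basis[OF C(3) vC[OF r]] by auto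
 qed
 have 2: "fi p x = 0" if p: "p < ?m" "?e <= p" "x \<in> Y" for p x
 proof -
  have "x \<in> span B" using B(3) p(3) by blast
  then have "representation C x = representation B x"
   by (rule representation_extend[OF C(3) _ C(1)])
  moreover have "representation B x (v p) = 0"
   using vD[OF p(2,1)] representation_ne_zero[of B x "v p"] by blast
  ultimately show ?thesis unfolding fi_def by simp
 qed
 have 3: "x = (\<Sum>p<?m. fi p x *f v p)" if x: "x \<in> V" for x
 proof -
  have "(\<Sum>b\<in>C. representation C x b *f b) = x" by (rule sum_representation_eq[OF C(3) spV[OF x] fC]) simp
  moreover have "(\<Sum>b\<in>C. representation C x b *f b) = (\<Sum>p<?m. representation C x (v p) *f v p)"
   unfolding im[symmetric] by (subst sum.reindex[OF inj]) simp
  ultimately show ?thesis using x unfolding fi_def by simp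
 qed
 show ?thesis
  by (rule exI[of _ v], rule exI[of _ fi]) (use 1 2 3 vB B(1) in blast)
qed

lemma dual_ann_sum:
 assumes L: "L \<in> dual_ann V W" and V: "subspace V" and x: "!!i. i \<in> A ==> x i \<in> V"
 shows "L (\<Sum>i\<in>A. c i *f x i) = (\<Sum>i\<in>A. c i * L (x i))"
 using x
proof (induction A rule: infinite_finite_induct)
 case (insert i A)
 have "(\<Sum>i\<in>A. c i *f x i) \<in> V" by (intro subspace_sum subspace_scale V) (use insert.prems in blast)
 then show ?case
  using insert dual_annD(2)[OF L subspace_scale[OF V] , of "x i" "\<Sum>i\<in>A. c i *f x i" "c i"] dual_annD(3)[OF L] by simp
qed (use dual_annD(5)[OF L subspace_0[OF V]] in auto)

lemma projection_exists:
 assumes Y: "subspace Y" "Y <= V" and V: "subspace V" "finite V"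
 shows "\<exists>\<pi>. (\<forall>x\<in>V. \<pi> x \<in> Y) & (\<forall>x\<in>Y. \<pi> x = x) & (\<forall>x\<in>V. \<forall>y\<in>V. \<pi> (x + y) = \<pi> x + \<pi> y)
   & (\<forall>c. \<forall>x\<in>V. \<pi> (c *f x) = c *f \<pi> x)"
proof (rule complement_exists[OF Y(1) V(1) Y(2) fin_dim_finite[OF V(2)]])
 fix T
 assume T: "subspace T" "T <= V" "Y \<inter> T = {0}" "!!v. v \<in> V ==> \<exists>s\<in>Y. \<exists>t\<in>T. v = s + t"
 define \<pi> where "\<pi> x = (SOME s. s \<in> Y & x - s \<in> T)" for x
 have p: "\<pi> x \<in> Y" "x - \<pi> x \<in> T" if x: "x \<in> V" for x
 proof -
  obtain s t where st: "s \<in> Y" "t \<in> T" "x = s + t" using T(4)[OF x] by blast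
  have "\<exists>s. s \<in> Y & x - s \<in> T" by (rule exI[of _ s]) (use st in simp)
  then have "\<pi> x \<in> Y & x - \<pi> x \<in> T" unfolding \<pi>_def by (rule someI_ex)
  then show "\<pi> x \<in> Y" "x - \<pi> x \<in> T" by blast+
 qed
 have u: "\<pi> x = s" if "x \<in> V" "s \<in> Y" "x - s \<in> T" for x s
 proof -
  have "\<pi> x - s \<in> Y" using p(1)[OF that(1)] that(2) subspace_diff[OF Y(1)] by blast
  moreover have "(x - s) - (x - \<pi> x) \<in> T" using p(2)[OF that(1)] that(3) subspace_diff[OF T(1)] by blast
  then have "\<pi> x - s \<in> T" by simp
  ultimately have "\<pi> x - s = 0" using T(3) by blast
  then show ?thesis by simp
 qed
 show ?thesis
 proof (intro exI[of _ \<pi>] conjI ballI allI)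
  fix x assume x: "x \<in> V"
  show "\<pi> x \<in> Y" by (rule p(1)[OF x])
  show "\<pi> (c *f x) = c *f \<pi> x" for c
  proof (rule u)
   have "c *f (x - \<pi> x) \<in> T" using p(2)[OF x] subspace_scale[OF T(1)] by blast
   then show "c *f x - c *f \<pi> x \<in> T" by (simp add: scale_right_diff_distrib)
  qed (use x p(1)[OF x] subspace_scale[OF V(1)] subspace_scale[OF Y(1)] in auto)
  fix y assume y: "y \<in> V"
  show "\<pi> (x + y) = \<pi> x + \<pi> y"
  proof (rule u)
   have "(x - \<pi> x) + (y - \<pi> y) \<in> T" using p(2)[OF x] p(2)[OF y] subspace_add[OF T(1)] by blast
   then show "x + y - (\<pi> x + \<pi> y) \<in> T" by (simp add: algebra_simps)
  qed (use x y p(1)[OF x] p(1)[OF y] subspace_add[OF V(1)] subspace_add[OF Y(1)] in auto)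
 next
  fix x assume "x \<in> Y"
  then show "\<pi> x = x" using u[of x x] Y(2) subspace_0[OF T(1)] by auto
 qed
qed

text \<open>With points \<open>q i\<close> dual to a basis of \<open>N\<close>, subtracting a
  suitable combination of the \<open>q i\<close> moves any vector into \<open>Y\<close>. A
  functional killing \<open>Y\<close> is therefore determined by its values at these points.\<close>

lemma double_annihilator:
 assumes V: "subspace V" "finite V" and N: "fsubspace N" "N <= dual_ann V {0}"
 defines "Y \<equiv> {x\<in>V. \<forall>fi\<in>N. fi x = 0}"
 shows "subspace Y" "dual_ann V Y = N"
proof -
 note d = subsetD[OF N(2), THEN dual_annD(2)] subsetD[OF N(2), THEN dual_annD(3)] subsetD[OF N(2), THEN dual_annD(5)]
 show Y: "subspace Y" unfolding subspace_def Y_def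
  using subspace_0[OF V(1)] subspace_add[OF V(1)] subspace_scale[OF V(1)] by (auto simp: d)
 have fN: "ffin_dim N"
  by (rule fs.fin_dim_mono[OF N(2) fdim_dual_ann(2)[OF V(1) subspace_single_0 _ V(2)]]) (use subspace_0[OF V(1)] in simp)
 obtain q p where qp: "\<forall>i<fdim N. p i \<in> N" "\<forall>i<fdim N. \<forall>j<fdim N. p i (q j) = (if i = j then 1 else 0)"
   "\<forall>f\<in>N. f = (\<Sum>i<fdim N. scl (f (q i)) (p i))"
  using dual_points[OF N(1) fN refl] by blast
 let ?r = "fdim N"
 have pD: "p i \<in> dual_ann V {0}" if "i < ?r" for i using qp(1) that N(2) by blast
 have qV: "q i \<in> V" if i: "i < ?r" for i
 proof (rule ccontr)
  assume "q i ~: V"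
  then have "p i (q i) = 0" by (rule dual_annD(1)[OF pD[OF i]])
  then show False using qp(2) i by auto
 qed
 show "dual_ann V Y = N"
 proof (intro equalityI subsetI)
  fix fi assume p: "fi \<in> dual_ann V Y"
  have "fi = (\<Sum>i<?r. scl (fi (q i)) (p i))"
  proof
   fix x
   show "fi x = (\<Sum>i<?r. scl (fi (q i)) (p i)) x"
   proof (cases "x \<in> V")
    case True
    let ?s = "\<Sum>i<?r. p i x *f q i"
    have sV: "?s \<in> V" by (intro subspace_sum subspace_scale V(1)) (use qV in auto)
    have dV: "x - ?s \<in> V" by (rule subspace_diff[OF V(1) True sV])
    have pj: "p j (x - ?s) = 0" if j: "j < ?r" for j
    proof -
     have "p j ?s = (\<Sum>i<?r. p i x * p j (q i))" by (rule dual_ann_sum[OF pD[OF j] V(1)]) (use qV in auto)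
     also have "\<dots> = (\<Sum>i<?r. if j = i then p i x else 0)"
      by (rule sum.cong[OF refl]) (use qp(2) j in auto)
     also have "\<dots> = p j x" using j by simp
     finally have "p j ?s = p j x" .
     then show ?thesis using dual_annD(2)[OF pD[OF j] dV sV] by simp
    qed
    have "f (x - ?s) = 0" if f: "f \<in> N" for f
    proof -
     have "f (x - ?s) = (\<Sum>i<?r. scl (f (q i)) (p i)) (x - ?s)" using qp(3) f by simp
     then show ?thesis using pj by (simp add: sum_fun_apply fun_app)
    qed
    then have "x - ?s \<in> Y" unfolding Y_def using dV by blast
    then have "fi (x - ?s) = 0" by (rule dual_annD(4)[OF p])
    then have "fi x = fi ?s" using dual_annD(2)[OF p dV sV] by simp
    also have "\<dots> = (\<Sum>i<?r. p i x * fi (q i))" by (rule dual_ann_sum[OF p V(1)]) (use qV in auto)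
    finally show ?thesis by (simp add: sum_fun_apply fun_app mult.commute)
   next
    case False
    then show ?thesis using dual_annD(1)[OF p False] dual_annD(1)[OF pD False] by (simp add: sum_fun_apply fun_app)
   qed
  qed
  moreover have "(\<Sum>i<?r. scl (fi (q i)) (p i)) \<in> N"
   by (intro fs.subspace_sum fs.subspace_scale N(1)) (use qp(1) in auto)
  ultimately show "fi \<in> N" by simp
 next
  fix fi assume "fi \<in> N"
  then show "fi \<in> dual_ann V Y" using N(2) unfolding dual_ann_def Y_def by blast
 qed
qed

section \<open>Exterior products of forms\<close>

definition wedge2 :: "('b => 'k) => ('b => 'k) => 'b \<times> 'b => 'k" where
 "wedge2 fi ps = (\<lambda>(x, y). fi x * ps y - fi y * ps x)"

definition wedge3 :: "('b => 'k) => ('b \<times> 'b => 'k) => 'b \<times> 'b \<times> 'b => 'k" where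
 "wedge3 fi g = (\<lambda>(x, y, z). fi x * g (y, z) + fi y * g (z, x) + fi z * g (x, y))"

text \<open>Linearity is asked in the first argument only; cyclic invariance passes it on to the
  other two.\<close>

definition alt3_on :: "'b set => ('b \<times> 'b \<times> 'b => 'k) set" where
 "alt3_on V = {ta. (\<forall>x y z. ta (x, y, z) = ta (y, z, x)) & (\<forall>x y z. x ~: V --> ta (x, y, z) = 0)
   & (\<forall>x\<in>V. \<forall>x'\<in>V. \<forall>y\<in>V. \<forall>z\<in>V. ta (x + x', y, z) = ta (x, y, z) + ta (x', y, z))
   & (\<forall>c. \<forall>x\<in>V. \<forall>y\<in>V. \<forall>z\<in>V. ta (c *f x, y, z) = c * ta (x, y, z))
   & (\<forall>x\<in>V. \<forall>z\<in>V. ta (x, x, z) = 0)}"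

lemma alt3_onD:
 assumes "ta \<in> alt3_on V"
 shows "ta (x, y, z) = ta (y, z, x)" "x ~: V ==> ta (x, y, z) = 0"
  "x \<in> V ==> x' \<in> V ==> y \<in> V ==> z \<in> V ==> ta (x + x', y, z) = ta (x, y, z) + ta (x', y, z)"
  "x \<in> V ==> y \<in> V ==> z \<in> V ==> ta (c *f x, y, z) = c * ta (x, y, z)"
  "x \<in> V ==> z \<in> V ==> ta (x, x, z) = 0"
 using assms unfolding alt3_on_def by blast+

lemma alt3_onD':
 assumes t: "ta \<in> alt3_on V"
 shows "x \<in> V ==> x' \<in> V ==> y \<in> V ==> z \<in> V ==> ta (y, x + x', z) = ta (y, x, z) + ta (y, x', z)"
  "x \<in> V ==> x' \<in> V ==> y \<in> V ==> z \<in> V ==> ta (y, z, x + x') = ta (y, z, x) + ta (y, z, x')"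
  "x \<in> V ==> y \<in> V ==> z \<in> V ==> ta (y, c *f x, z) = c * ta (y, x, z)"
  "x \<in> V ==> y \<in> V ==> z \<in> V ==> ta (y, z, c *f x) = c * ta (y, z, x)"
  "x \<in> V ==> z \<in> V ==> ta (z, x, x) = 0" "x \<in> V ==> z \<in> V ==> ta (x, z, x) = 0"
 using alt3_onD(3)[OF t, of x x' z y] alt3_onD(3)[OF t, of x x' y z] alt3_onD(4)[OF t, of x z y c] alt3_onD(4)[OF t, of x y z c]
  alt3_onD(5)[OF t, of x z]
  alt3_onD(1)[OF t, of y "x + x'" z] alt3_onD(1)[OF t, of y x z] alt3_onD(1)[OF t, of y x' z]
  alt3_onD(1)[OF t, of "x + x'" y z] alt3_onD(1)[OF t, of x y z] alt3_onD(1)[OF t, of x' y z]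
  alt3_onD(1)[OF t, of y "c *f x" z] alt3_onD(1)[OF t, of "c *f x" y z]
  alt3_onD(1)[OF t, of x x z] alt3_onD(1)[OF t, of z x x]
 by metis+

lemma subspace_alt3_on: "fsubspace (alt3_on V)"
 unfolding fs.subspace_def
proof (intro conjI ballI allI)
 show "0 \<in> alt3_on V" unfolding alt3_on_def by (simp add: fun_app)
 fix sm assume s: "sm \<in> alt3_on V"
 note S = alt3_onD[OF s]
 show "scl c sm \<in> alt3_on V" for c
  unfolding alt3_on_def mem_Collect_eq fun_app
 proof (intro conjI allI impI ballI)
  show "c * sm (x, y, z) = c * sm (y, z, x)" for x y z using S(1)[of x y z] by simp
 qed (simp_all add: S(2-5) distrib_left)
 fix ta assume t: "ta \<in> alt3_on V"
 note T = alt3_onD[OF t]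
 show "sm + ta \<in> alt3_on V"
  unfolding alt3_on_def mem_Collect_eq fun_app
 proof (intro conjI allI impI ballI)
  show "sm (x, y, z) + ta (x, y, z) = sm (y, z, x) + ta (y, z, x)" for x y z using S(1)[of x y z] T(1)[of x y z] by simp
 qed (simp_all add: S(2-5) T(2-5) distrib_left)
qed

lemma alt3_on_fin: "finite V ==> ffin_dim (alt3_on V)"
proof (rule fs.fin_dim_mono[OF _ fdim_supported(2)])
 show "alt3_on V <= {f. \<forall>x. x ~: V \<times> V \<times> V --> f x = 0}"
 proof (intro subsetI CollectI allI impI)
  fix ta p assume t: "ta \<in> alt3_on V" and n: "p ~: V \<times> V \<times> V"
  obtain x y z where p: "p = (x, y, z)" by (cases p)
  note n = n[unfolded p]
  from n consider "x ~: V" | "y ~: V" | "z ~: V" by blast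
  then show "ta p = 0" unfolding p
   by cases (use alt3_onD(2)[OF t] alt3_onD(1)[OF t, of x y z] alt3_onD(1)[OF t, of y z x] in auto)
 qed
qed simp

lemma alt_onD:
 assumes b: "b \<in> alt_on V"
 shows "b \<in> bil_on V V" "x \<in> V ==> b (x, x) = 0" "subspace V ==> b (y, x) = - b (x, y)"
proof -
 show bb: "b \<in> bil_on V V" and s: "!!x. x \<in> V ==> b (x, x) = 0" using b unfolding alt_on_def by blast+
 assume V: "subspace V"
 show "b (y, x) = - b (x, y)"
 proof (cases "x \<in> V & y \<in> V")
  case True
  then have "b (x + y, x + y) = b (x, x) + b (x, y) + (b (y, x) + b (y, y))"
   using subspace_add[OF V] bil_onD(2)[OF bb, of x y "x + y"] bil_onD(3)[OF bb, of x x y] bil_onD(3)[OF bb, of y x y] by simp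
  then show ?thesis using s True subspace_add[OF V] by (simp add: add_eq_0_iff)
 next
  case False
  then show ?thesis using bil_onD(1)[OF bb] by auto
 qed
qed

lemma wedge2_alt: "subspace V ==> fi \<in> dual_ann V A ==> ps \<in> dual_ann V B ==> wedge2 fi ps \<in> alt_on V"
proof -
 assume V: "subspace V" and p: "fi \<in> dual_ann V A" and q: "ps \<in> dual_ann V B"
 show ?thesis
  unfolding alt_on_def bil_on_def wedge2_def
  using dual_annD(1)[OF p] dual_annD(1)[OF q]
  by (auto simp: dual_annD(2,3)[OF p] dual_annD(2,3)[OF q] algebra_simps)
qed

lemma wedge3_alt:
 assumes V: "subspace V" and p: "fi \<in> dual_ann V A" and g: "g \<in> alt_on V"
 shows "wedge3 fi g \<in> alt3_on V"
proof -
 note b = bil_onD[OF alt_onD(1)[OF g]] and d = dual_annD[OF p]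
 show ?thesis
  unfolding alt3_on_def wedge3_def mem_Collect_eq prod.case
 proof (intro conjI allI impI ballI)
  fix x z assume x: "x \<in> V" and z: "z \<in> V"
  show "fi x * g (x, z) + fi x * g (z, x) + fi z * g (x, x) = 0"
   using alt_onD(3)[OF g V, of z x] alt_onD(2)[OF g x] by simp
 qed (use subspace_add[OF V] subspace_scale[OF V] in \<open>simp_all add: b d algebra_simps\<close>)
qed

lemma wedge_add: "wedge2 fi (ps + ps') = wedge2 fi ps + wedge2 fi ps'" "wedge2 fi (scl c ps) = scl c (wedge2 fi ps)"
 "wedge3 fi (g + g') = wedge3 fi g + wedge3 fi g'" "wedge3 fi (scl c g) = scl c (wedge3 fi g)"
 "wedge3 (fi + fi') g = wedge3 fi g + wedge3 fi' g" "wedge3 (scl c fi) g = scl c (wedge3 fi g)"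
 "wedge2 (fi + fi') ps = wedge2 fi ps + wedge2 fi' ps" "wedge2 (scl c fi) ps = scl c (wedge2 fi ps)"
 by (auto simp: wedge2_def wedge3_def fun_eq_iff fun_app algebra_simps)

text \<open>Anticommutativity of the exterior product. The third identity exchanges the functional
  in front with one inside, up to sign, and is what links two ways of contracting an
  obstruction.\<close>

lemma wedge_swap: "wedge2 ps fi = - wedge2 fi ps" "wedge2 fi fi = 0"
 "wedge3 ps (wedge2 fi ch) = - wedge3 fi (wedge2 ps ch)"
 by (auto simp: wedge2_def wedge3_def fun_eq_iff fun_app algebra_simps)

text \<open>Removing the coordinates in \<open>I\<close> and then the one of \<open>q\<close> is the
  same as removing all at once, because \<open>fi q\<close> vanishes on the vectors
  \<open>c p\<close>.\<close>

lemma remove_coordinates: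
 assumes V: "subspace V" and I: "finite I" "q ~: I" and c: "!!p. p \<in> I ==> c p \<in> V"
  and q: "fi q \<in> dual_ann V A" and d: "!!p. p \<in> I ==> fi q (c p) = 0" and x: "x \<in> V"
 defines "s \<equiv> x - (\<Sum>p\<in>I. fi p x *f c p)"
 shows "s \<in> V" "s - fi q s *f c q = x - (\<Sum>p\<in>insert q I. fi p x *f c p)"
proof -
 have t: "(\<Sum>p\<in>I. fi p x *f c p) \<in> V" by (intro subspace_sum subspace_scale V c)
 show s: "s \<in> V" unfolding s_def by (rule subspace_diff[OF V x t])
 have "fi q (\<Sum>p\<in>I. fi p x *f c p) = (\<Sum>p\<in>I. fi p x * fi q (c p))" by (rule dual_ann_sum[OF q V c])
 also have "\<dots> = 0" by (rule sum.neutral) (simp add: d)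
 finally have "fi q s = fi q x" using dual_annD(2)[OF q s t] unfolding s_def by simp
 then show "s - fi q s *f c q = x - (\<Sum>p\<in>insert q I. fi p x *f c p)"
  unfolding s_def using I by (simp add: algebra_simps)
qed

text \<open>For any \<open>fi\<close> and \<open>c\<close>, a form is its pullback under \<open>x \<mapsto> x - fi x c\<close> plus \<open>fi\<close> times its contraction
 with \<open>c\<close> (all terms with two entries \<open>c\<close> vanish); iterating this removes a dual family.\<close>

lemma alt_on_span:
 assumes V: "subspace V" and g: "g \<in> alt_on V" and I: "finite I"
  and c: "!!p. p \<in> I ==> c p \<in> V" and fi: "!!p. p \<in> I ==> fi p \<in> dual_ann V A"
  and dual: "!!p r. p \<in> I ==> r \<in> I ==> p ~= r ==> fi p (c r) = 0"
  and van: "!!x y. x \<in> V ==> y \<in> V ==> g (x - (\<Sum>p\<in>I. fi p x *f c p), y - (\<Sum>p\<in>I. fi p y *f c p)) = 0"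
 shows "g \<in> fspan {wedge2 (fi p) ps |p ps. p \<in> I & ps \<in> dual_ann V {0}}"
 using I g c fi dual van
proof (induction I arbitrary: g rule: finite_induct)
 case empty
 have "g p = 0" for p
  using empty.prems(5) bil_onD(1)[OF alt_onD(1)[OF empty.prems(1)], of p] by (cases p) auto
 then show ?case using fs.span_zero by (metis (no_types, lifting) ext zero_fun_apply)
next
 case (insert q I)
 note b = bil_onD[OF alt_onD(1)[OF insert.prems(1)]]
 have cq: "c q \<in> V" and q: "fi q \<in> dual_ann V A" using insert.prems(2,3) by blast+
 note d = dual_annD[OF q]
 define \<pi> where "\<pi> x = x - fi q x *f c q" for x
 have pV: "\<pi> x \<in> V" if "x \<in> V" for x unfolding \<pi>_def by (intro subspace_diff subspace_scale V that cq)
 have padd: "\<pi> (x + y) = \<pi> x + \<pi> y" if "x \<in> V" "y \<in> V" for x y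
  unfolding \<pi>_def d(2)[OF that] by (simp add: scale_left_distrib)
 have psc: "\<pi> (k *f x) = k *f \<pi> x" if "x \<in> V" for x k
  unfolding \<pi>_def d(3)[OF that] by (simp add: scale_right_diff_distrib)
 define ps where "ps = (\<lambda>x. if x \<in> V then g (c q, \<pi> x) else 0)"
 have ps: "ps \<in> dual_ann V {0}"
  unfolding dual_ann_def ps_def using subspace_add[OF V] subspace_scale[OF V] pV cq subspace_0[OF V]
  by (auto simp: padd psc b bil_on_0[OF alt_onD(1)[OF insert.prems(1)]] \<pi>_def[of 0] d(5))
 have dec: "g (x, y) - wedge2 (fi q) ps (x, y) = g (\<pi> x, \<pi> y)" if x: "x \<in> V" and y: "y \<in> V" for x y
 proof -
  have xx: "x = \<pi> x + fi q x *f c q" "y = \<pi> y + fi q y *f c q" unfolding \<pi>_def by simp_all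
  have s: "fi q x *f c q \<in> V" "fi q y *f c q \<in> V" using cq subspace_scale[OF V] by blast+
  have "g (x, y) = g (\<pi> x + fi q x *f c q, \<pi> y + fi q y *f c q)" using xx by simp
  also have "\<dots> = g (\<pi> x, \<pi> y) + fi q y * g (\<pi> x, c q) + fi q x * g (c q, \<pi> y)"
   using pV[OF x] pV[OF y] cq s subspace_add[OF V pV[OF y] s(2)] alt_onD(2)[OF insert.prems(1) cq] by (simp add: b)
  finally show ?thesis
   using x y alt_onD(3)[OF insert.prems(1) V, of "\<pi> x" "c q"] unfolding wedge2_def ps_def by simp
 qed
 let ?g = "g - wedge2 (fi q) ps"
 have gV: "?g \<in> alt_on V" by (rule fs.subspace_diff[OF subspace_alt_on insert.prems(1) wedge2_alt[OF V q ps]])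
 have "?g \<in> fspan {wedge2 (fi p) ps |p ps. p \<in> I & ps \<in> dual_ann V {0}}"
 proof (rule insert.IH[OF gV])
  fix x y assume x: "x \<in> V" and y: "y \<in> V"
  have pp: "x - (\<Sum>p\<in>I. fi p x *f c p) \<in> V & \<pi> (x - (\<Sum>p\<in>I. fi p x *f c p)) = x - (\<Sum>p\<in>insert q I. fi p x *f c p)"
   if x: "x \<in> V" for x
   unfolding \<pi>_def
   by (intro conjI remove_coordinates[where fi = fi and q = q and c = c and A = A, OF V insert.hyps _ q _ x])
    (use insert.prems(2,4) insert.hyps(2) in auto)
  show "?g (x - (\<Sum>p\<in>I. fi p x *f c p), y - (\<Sum>p\<in>I. fi p y *f c p)) = 0"
   using dec[of "x - (\<Sum>p\<in>I. fi p x *f c p)" "y - (\<Sum>p\<in>I. fi p y *f c p)"] pp[OF x] pp[OF y] insert.prems(5)[OF x y]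
   by (simp add: fun_app)
 qed (use insert.prems in auto)
 moreover have "fspan {wedge2 (fi p) ps |p ps. p \<in> I & ps \<in> dual_ann V {0}}
   <= fspan {wedge2 (fi p) ps |p ps. p \<in> insert q I & ps \<in> dual_ann V {0}}" by (rule fs.span_mono) blast
 moreover have "wedge2 (fi q) ps \<in> fspan {wedge2 (fi p) ps |p ps. p \<in> insert q I & ps \<in> dual_ann V {0}}"
  by (rule fs.span_base) (use ps in blast)
 ultimately have "?g + wedge2 (fi q) ps \<in> fspan {wedge2 (fi p) ps |p ps. p \<in> insert q I & ps \<in> dual_ann V {0}}"
  by (intro fs.span_add) blast+
 then show ?case by simp
qed

text \<open>The same removal of coordinates; contraction with \<open>c q\<close> now leaves an
  alternating bilinear form.\<close>

lemma alt3_on_span: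
 assumes V: "subspace V" and t: "ta \<in> alt3_on V" and I: "finite I"
  and c: "!!p. p \<in> I ==> c p \<in> V" and fi: "!!p. p \<in> I ==> fi p \<in> dual_ann V A"
  and dual: "!!p r. p \<in> I ==> r \<in> I ==> p ~= r ==> fi p (c r) = 0"
  and van: "!!x y z. x \<in> V ==> y \<in> V ==> z \<in> V ==>
   ta (x - (\<Sum>p\<in>I. fi p x *f c p), y - (\<Sum>p\<in>I. fi p y *f c p), z - (\<Sum>p\<in>I. fi p z *f c p)) = 0"
 shows "ta \<in> fspan {wedge3 (fi p) g |p g. p \<in> I & g \<in> alt_on V}"
 using I t c fi dual van
proof (induction I arbitrary: ta rule: finite_induct)
 case empty
 note D = alt3_onD[OF empty.prems(1)]
 have "ta (x, y, z) = 0" for x y z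
 proof (cases "x \<in> V & y \<in> V & z \<in> V")
  case True
  then show ?thesis using empty.prems(5)[of x y z] by simp
 next
  case False
  then show ?thesis using D(2)[of x y z] D(2)[of y z x] D(2)[of z x y] D(1)[of x y z] D(1)[of y z x] by auto
 qed
 then have "ta = 0" by (auto simp: fun_eq_iff fun_app)
 then show ?case using fs.span_zero by simp
next
 case (insert q I)
 note b = alt3_onD(3-5)[OF insert.prems(1)] alt3_onD'[OF insert.prems(1)]
 have cq: "c q \<in> V" and q: "fi q \<in> dual_ann V A" using insert.prems(2,3) by blast+
 note d = dual_annD[OF q]
 define \<pi> where "\<pi> x = x - fi q x *f c q" for x
 have pV: "\<pi> x \<in> V" if "x \<in> V" for x unfolding \<pi>_def by (intro subspace_diff subspace_scale V that cq)
 have padd: "\<pi> (x + y) = \<pi> x + \<pi> y" if "x \<in> V" "y \<in> V" for x y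
  unfolding \<pi>_def d(2)[OF that] by (simp add: scale_left_distrib)
 have psc: "\<pi> (k *f x) = k *f \<pi> x" if "x \<in> V" for x k
  unfolding \<pi>_def d(3)[OF that] by (simp add: scale_right_diff_distrib)
 define g where "g = (\<lambda>(x, y). if x \<in> V & y \<in> V then ta (c q, \<pi> x, \<pi> y) else 0)"
 have gV: "g \<in> alt_on V"
  unfolding alt_on_def bil_on_def g_def using subspace_add[OF V] subspace_scale[OF V] pV cq
  by (auto simp: padd psc b)
 have dec: "ta (x, y, z) - wedge3 (fi q) g (x, y, z) = ta (\<pi> x, \<pi> y, \<pi> z)" if x: "x \<in> V" and y: "y \<in> V" and z: "z \<in> V" for x y z
 proof -
  have xx: "x = \<pi> x + fi q x *f c q" "y = \<pi> y + fi q y *f c q" "z = \<pi> z + fi q z *f c q" unfolding \<pi>_def by simp_all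
  have s: "fi q x *f c q \<in> V" "fi q y *f c q \<in> V" "fi q z *f c q \<in> V" using cq subspace_scale[OF V] by blast+
  have sy: "\<pi> y + fi q y *f c q \<in> V" "\<pi> z + fi q z *f c q \<in> V" using xx y z by simp_all
  have "ta (x, y, z) = ta (\<pi> x + fi q x *f c q, \<pi> y + fi q y *f c q, \<pi> z + fi q z *f c q)" using xx by simp
  also have "\<dots> = ta (\<pi> x, \<pi> y, \<pi> z) + fi q z * ta (\<pi> x, \<pi> y, c q) + fi q y * ta (\<pi> x, c q, \<pi> z) + fi q x * ta (c q, \<pi> y, \<pi> z)"
   using pV[OF x] pV[OF y] pV[OF z] cq s sy by (simp add: b)
  also have "ta (\<pi> x, \<pi> y, c q) = ta (c q, \<pi> x, \<pi> y)" using alt3_onD(1)[OF insert.prems(1)] by metis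
  also have "ta (\<pi> x, c q, \<pi> z) = ta (c q, \<pi> z, \<pi> x)" using alt3_onD(1)[OF insert.prems(1)] by metis
  finally show ?thesis using x y z unfolding wedge3_def g_def by simp
 qed
 let ?g = "ta - wedge3 (fi q) g"
 have tV: "?g \<in> alt3_on V" by (rule fs.subspace_diff[OF subspace_alt3_on insert.prems(1) wedge3_alt[OF V q gV]])
 have "?g \<in> fspan {wedge3 (fi p) g |p g. p \<in> I & g \<in> alt_on V}"
 proof (rule insert.IH[OF tV])
  fix x y z assume x: "x \<in> V" and y: "y \<in> V" and z: "z \<in> V"
  have pp: "x - (\<Sum>p\<in>I. fi p x *f c p) \<in> V & \<pi> (x - (\<Sum>p\<in>I. fi p x *f c p)) = x - (\<Sum>p\<in>insert q I. fi p x *f c p)"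
   if x: "x \<in> V" for x
   unfolding \<pi>_def
   by (intro conjI remove_coordinates[where fi = fi and q = q and c = c and A = A, OF V insert.hyps _ q _ x])
    (use insert.prems(2,4) insert.hyps(2) in auto)
  show "?g (x - (\<Sum>p\<in>I. fi p x *f c p), y - (\<Sum>p\<in>I. fi p y *f c p), z - (\<Sum>p\<in>I. fi p z *f c p)) = 0"
   using dec[of "x - (\<Sum>p\<in>I. fi p x *f c p)" "y - (\<Sum>p\<in>I. fi p y *f c p)" "z - (\<Sum>p\<in>I. fi p z *f c p)"]
    pp[OF x] pp[OF y] pp[OF z] insert.prems(5)[OF x y z]
   by (simp add: fun_app)
 qed (use insert.prems in auto)
 moreover have "fspan {wedge3 (fi p) g |p g. p \<in> I & g \<in> alt_on V}
   <= fspan {wedge3 (fi p) g |p g. p \<in> insert q I & g \<in> alt_on V}" by (rule fs.span_mono) blast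
 moreover have "wedge3 (fi q) g \<in> fspan {wedge3 (fi p) g |p g. p \<in> insert q I & g \<in> alt_on V}"
  by (rule fs.span_base) (use gV in blast)
 ultimately have "?g + wedge3 (fi q) g \<in> fspan {wedge3 (fi p) g |p g. p \<in> insert q I & g \<in> alt_on V}"
  by (intro fs.span_add) blast+
 then show ?case by simp
qed

text \<open>Forms on \<open>Y\<close> are extended by composing with a projection of
  \<open>V\<close> onto \<open>Y\<close>.\<close>

lemma alt_on_extend:
 assumes Y: "subspace Y" "Y <= V" and V: "subspace V" "finite V"
 shows "restr (Y \<times> Y) ` alt_on V = alt_on Y"
proof (intro equalityI subsetI)
 fix g assume "g \<in> restr (Y \<times> Y) ` alt_on V"
 then obtain b where b: "b \<in> alt_on V" "g = restr (Y \<times> Y) b" by blast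
 note B = bil_onD[OF alt_onD(1)[OF b(1)]]
 show "g \<in> alt_on Y" unfolding b(2) alt_on_def bil_on_def restr_def
  using subspace_add[OF Y(1)] subspace_scale[OF Y(1)] Y(2) alt_onD(2)[OF b(1)]
  by (simp add: B subset_iff)
next
 fix g assume g: "g \<in> alt_on Y"
 note B = bil_onD[OF alt_onD(1)[OF g]]
 obtain \<pi> where p: "\<forall>x\<in>V. \<pi> x \<in> Y" "\<forall>x\<in>Y. \<pi> x = x" "\<forall>x\<in>V. \<forall>y\<in>V. \<pi> (x + y) = \<pi> x + \<pi> y"
   "\<forall>c. \<forall>x\<in>V. \<pi> (c *f x) = c *f \<pi> x" using projection_exists[OF Y V] by blast
 let ?h = "\<lambda>p. if p \<in> V \<times> V then g (\<pi> (fst p), \<pi> (snd p)) else 0"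
 have "?h \<in> alt_on V" unfolding alt_on_def bil_on_def
  using subspace_add[OF V(1)] subspace_scale[OF V(1)] alt_onD(2)[OF g] p by (simp add: B)
 moreover have "restr (Y \<times> Y) ?h = g"
  using p(2) Y(2) B(1) unfolding restr_def by (auto simp: fun_eq_iff subset_iff)
 ultimately show "g \<in> restr (Y \<times> Y) ` alt_on V" by (metis (no_types, lifting) imageI)
qed

lemma bil_on_extend:
 assumes Y: "subspace Y" "Y <= V" and V: "subspace V" "finite V"
  and Z: "subspace Z" "Z <= W" and W: "subspace W" "finite W" and g: "g \<in> bil_on Y Z"
 shows "\<exists>b\<in>bil_on V W. restr (Y \<times> Z) b = g"
proof -
 note B = bil_onD[OF g]
 obtain \<pi> where p: "\<forall>x\<in>V. \<pi> x \<in> Y" "\<forall>x\<in>Y. \<pi> x = x" "\<forall>x\<in>V. \<forall>y\<in>V. \<pi> (x + y) = \<pi> x + \<pi> y"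
   "\<forall>c. \<forall>x\<in>V. \<pi> (c *f x) = c *f \<pi> x" using projection_exists[OF Y V] by blast
 obtain rh where r: "\<forall>x\<in>W. rh x \<in> Z" "\<forall>x\<in>Z. rh x = x" "\<forall>x\<in>W. \<forall>y\<in>W. rh (x + y) = rh x + rh y"
   "\<forall>c. \<forall>x\<in>W. rh (c *f x) = c *f rh x" using projection_exists[OF Z W] by blast
 let ?h = "\<lambda>p. if p \<in> V \<times> W then g (\<pi> (fst p), rh (snd p)) else 0"
 have "?h \<in> bil_on V W" unfolding bil_on_def
  using subspace_add[OF V(1)] subspace_scale[OF V(1)] subspace_add[OF W(1)] subspace_scale[OF W(1)] p r by (simp add: B)
 moreover have "restr (Y \<times> Z) ?h = g"
  using p(2) r(2) Y(2) Z(2) B(1) unfolding restr_def by (auto simp: fun_eq_iff subset_iff)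
 ultimately show ?thesis by (metis (no_types, lifting))
qed

end

lemma linear_image_fs:
 fixes f :: "('i => 'k::field) => 'j => 'k"
 assumes "flin f" "fsubspace S" "ffin_dim S"
 shows "fsubspace (f ` S)" "ffin_dim (f ` S)" "fdim (f ` S) <= fdim S"
proof -
 interpret f: Vector_Spaces.linear scl scl f by (rule assms(1))
 show "fsubspace (f ` S)" using f.subspace_image assms(2) unfolding fsubspace_def by blast
 show "ffin_dim (f ` S)" "fdim (f ` S) <= fdim S" using fsp.rank_nullity[OF assms] by auto
qed

lemma (in fin_vspace) dual_ann_span_0:
 assumes L: "L \<in> dual_ann V W" and V: "subspace V" and S: "S <= V" "!!x. x \<in> S ==> L x = 0" and x: "x \<in> span S"
 shows "L x = 0"
proof -
 have "subspace {x\<in>V. L x = 0}"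
  unfolding subspace_def using V by (simp add: dual_annD[OF L] subspace_def)
 then have "span S <= {x\<in>V. L x = 0}" by (rule span_minimal[rotated]) (use S in auto)
 then show ?thesis using x by blast
qed

section \<open>Forms relative to a subspace\<close>

context fin_vspace begin

text \<open>For a subspace \<open>E\<close> of \<open>Y\<close> this is the dual of the exterior
  square of \<open>Y\<close> modulo that of \<open>E\<close>.\<close>

definition alt0 :: "'b set => 'b set => ('b \<times> 'b => 'k) set" where
 "alt0 Y E = {g\<in>alt_on Y. \<forall>x\<in>E. \<forall>y\<in>E. g (x, y) = 0}"

lemma subspace_alt0: "fsubspace (alt0 Y E)"
 using subspace_alt_on[of Y] unfolding alt0_def fs.subspace_def mem_Collect_eq Ball_def
 by (simp add: fun_app)

lemma alt0_0: "alt0 Y {0} = alt_on Y"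
 unfolding alt0_def using bil_on_0(1)[OF alt_onD(1)] by auto

lemma alt0_fin: "finite Y ==> ffin_dim (alt0 Y E)" "finite Y ==> finite (alt0 Y E)"
proof -
 assume Y: "finite Y"
 show fd: "ffin_dim (alt0 Y E)" by (rule fs.fin_dim_mono[OF _ alt_on_fin[OF Y]]) (auto simp: alt0_def)
 show "finite (alt0 Y E)" by (rule card_fs(1)[OF subspace_alt0 fd])
qed

lemma alt0_dim:
 assumes "subspace E" "E <= Z" "subspace Z" "finite Z"
 shows "fdim (alt0 Z E) + fdim (alt_on E) = fdim (alt_on Z)"
proof -
 have "{g\<in>alt_on Z. restr (E \<times> E) g = 0} = alt0 Z E"
  unfolding alt0_def restr_def by (auto simp: fun_eq_iff fun_app)
 then show ?thesis
  using fsp.rank_nullity(1)[OF linear_restr subspace_alt_on alt_on_fin[OF assms(4)], of "E \<times> E"]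
  unfolding alt_on_extend[OF assms] by simp
qed

lemma dual_complement:
 assumes Z: "subspace Z" "Z <= V" and V: "subspace V" "finite V"
 obtains I :: "nat set" and v fi where "finite I" "!!p. p \<in> I ==> v p \<in> V" "!!p. p \<in> I ==> fi p \<in> dual_ann V Z"
  "!!p r. p \<in> I ==> r \<in> I ==> p ~= r ==> fi p (v r) = 0" "!!x. x \<in> V ==> x - (\<Sum>p\<in>I. fi p x *f v p) \<in> Z"
proof -
 obtain v fi where b: "\<forall>p<dim V. v p \<in> V & fi p \<in> dual_ann V {0} & (\<forall>r<dim V. fi p (v r) = (if p = r then 1 else 0))"
   "\<forall>p<dim Z. v p \<in> Z" "\<forall>p<dim V. dim Z <= p --> (\<forall>x\<in>Z. fi p x = 0)" "\<forall>x\<in>V. x = (\<Sum>p<dim V. fi p x *f v p)"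
  using adapted_basis[OF Z V] by blast
 let ?I = "{dim Z..<dim V}"
 have zv: "dim Z <= dim V" by (rule dim_mono_fin[OF Z(2) fin_dim_finite[OF V(2)]])
 show thesis
 proof (rule that[of ?I v fi])
  show "fi p \<in> dual_ann V Z" if "p \<in> ?I" for p using b(1,3) that unfolding dual_ann_def by simp
  fix x assume x: "x \<in> V"
  have "(\<Sum>p<dim V. fi p x *f v p) = (\<Sum>p<dim Z. fi p x *f v p) + (\<Sum>p\<in>?I. fi p x *f v p)"
   using sum.union_disjoint[of "{..<dim Z}" ?I "\<lambda>p. fi p x *f v p"] ivl_disj_un_one(2)[OF zv] by (simp add: lessThan_atLeast0)
  then have "x - (\<Sum>p\<in>?I. fi p x *f v p) = (\<Sum>p<dim Z. fi p x *f v p)" using b(4)[rule_format, OF x] by (simp add: algebra_simps)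
  also have "\<dots> \<in> Z" using b(2) by (intro subspace_sum subspace_scale Z(1)) auto
  finally show "x - (\<Sum>p\<in>?I. fi p x *f v p) \<in> Z" .
 qed (use b(1) in auto)
qed

text \<open>Functionals killing \<open>Z\<close> remove all coordinates outside \<open>Z\<close>,
  and what remains of a form vanishing on \<open>Z\<close> is 0.\<close>

lemma alt0_span:
 assumes Z: "subspace Z" "Z <= V" and V: "subspace V" "finite V"
 shows "alt0 V Z <= fspan {wedge2 fi ps |fi ps. fi \<in> dual_ann V Z & ps \<in> dual_ann V {0}}"
proof (rule dual_complement[OF Z V], rule subsetI)
 fix I v fi g
 assume I: "finite I" "!!p. p \<in> I ==> v p \<in> V" "!!p. p \<in> I ==> fi p \<in> dual_ann V Z"
  "!!p r. p \<in> I ==> r \<in> I ==> p ~= r ==> fi p (v r) = 0" and inZ: "!!x. x \<in> V ==> x - (\<Sum>p\<in>I. fi p x *f v p) \<in> Z"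
  and g: "g \<in> alt0 V Z"
 have "g \<in> fspan {wedge2 (fi p) ps |p ps. p \<in> I & ps \<in> dual_ann V {0}}"
  by (rule alt_on_span[OF V(1) _ I]) (use g inZ in \<open>auto simp: alt0_def\<close>)
 moreover have "fspan {wedge2 (fi p) ps |p ps. p \<in> I & ps \<in> dual_ann V {0}}
   <= fspan {wedge2 fi ps |fi ps. fi \<in> dual_ann V Z & ps \<in> dual_ann V {0}}"
  by (rule fs.span_mono) (use I(3) in blast)
 ultimately show "g \<in> fspan {wedge2 fi ps |fi ps. fi \<in> dual_ann V Z & ps \<in> dual_ann V {0}}" by blast
qed

lemma alt3_span:
 assumes Z: "subspace Z" "Z <= V" and V: "subspace V" "finite V"
  and t: "ta \<in> alt3_on V" "!!x y z. x \<in> Z ==> y \<in> Z ==> z \<in> Z ==> ta (x, y, z) = 0"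
 shows "ta \<in> fspan {wedge3 fi g |fi g. fi \<in> dual_ann V Z & g \<in> alt_on V}"
proof (rule dual_complement[OF Z V])
 fix I v fi
 assume I: "finite I" "!!p. p \<in> I ==> v p \<in> V" "!!p. p \<in> I ==> fi p \<in> dual_ann V Z"
  "!!p r. p \<in> I ==> r \<in> I ==> p ~= r ==> fi p (v r) = 0" and inZ: "!!x. x \<in> V ==> x - (\<Sum>p\<in>I. fi p x *f v p) \<in> Z"
 have "ta \<in> fspan {wedge3 (fi p) g |p g. p \<in> I & g \<in> alt_on V}"
  by (rule alt3_on_span[OF V(1) t(1) I]) (use t(2) inZ in auto)
 moreover have "fspan {wedge3 (fi p) g |p g. p \<in> I & g \<in> alt_on V}
   <= fspan {wedge3 fi g |fi g. fi \<in> dual_ann V Z & g \<in> alt_on V}"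
  by (rule fs.span_mono) (use I(3) in blast)
 ultimately show ?thesis by blast
qed

lemma wedge2_sum:
 "wedge2 (\<Sum>i\<in>I. scl (a i) (f i)) ps = (\<Sum>i\<in>I. scl (a i) (wedge2 (f i) ps))"
 "wedge2 ps (\<Sum>i\<in>I. scl (a i) (f i)) = (\<Sum>i\<in>I. scl (a i) (wedge2 ps (f i)))"
 by (auto simp: fun_eq_iff wedge2_def sum_fun_apply fun_app sum_distrib_left sum_distrib_right
   algebra_simps sum_subtractf intro!: sum.cong)

lemma wedge3_sum:
 "wedge3 (\<Sum>i\<in>I. scl (a i) (f i)) g = (\<Sum>i\<in>I. scl (a i) (wedge3 (f i) g))"
 by (auto simp: fun_eq_iff wedge3_def sum_fun_apply fun_app sum_distrib_left sum_distrib_right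
   algebra_simps sum.distrib intro!: sum.cong)

lemma dual_expand:
 assumes V: "subspace V" and b: "!!p. p < m ==> v p \<in> V" "!!p. p < m ==> fi p \<in> dual_ann V {0}"
  "!!x. x \<in> V ==> x = (\<Sum>p<m. fi p x *f v p)" and l: "l \<in> dual_ann V A"
 shows "l = (\<Sum>p<m. scl (l (v p)) (fi p))"
proof
 fix x
 show "l x = (\<Sum>p<m. scl (l (v p)) (fi p)) x"
 proof (cases "x \<in> V")
  case True
  have "l x = l (\<Sum>p<m. fi p x *f v p)" using b(3)[OF True] by simp
  also have "\<dots> = (\<Sum>p<m. fi p x * l (v p))" by (rule dual_ann_sum[OF l V]) (use b(1) in auto)
  finally show ?thesis by (simp add: sum_fun_apply fun_app mult.commute)
 next
  case False
  then show ?thesis using dual_annD(1)[OF l False] dual_annD(1)[OF b(2) False] by (simp add: sum_fun_apply fun_app)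
 qed
qed

end

section \<open>Bracket relations\<close>

definition (in lie3) brs :: "'a set => 'a set => 'a set" where
 "brs Z E = vs.span (E \<union> {br x y |x y. x \<in> Z & y \<in> Z})"

locale bracket_space = lie3 M for M :: "('k::{field,finite}, 'a::ab_group_add) glie" +
 fixes V W :: "'a set"
 assumes V: "vs.subspace V" "V <= G 1" "finite V" and W: "vs.subspace W" "W <= G 2" "finite W"
  and brW: "!!x y. x \<in> V ==> y \<in> V ==> br x y \<in> W"
begin

lemma Vc: "x \<in> V ==> x \<in> carrier M" using V(2) Gc by blast

lemma brs_sub: "vs.subspace (brs Z E)" "E <= brs Z E" "x \<in> Z ==> y \<in> Z ==> br x y \<in> brs Z E"
 "Z <= V ==> E <= W ==> brs Z E <= W"
proof -
 show "Z <= V ==> E <= W ==> brs Z E <= W"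
  unfolding brs_def by (rule vs.span_minimal[OF _ W(1)]) (auto simp: subset_iff intro: brW)
qed (auto simp: brs_def intro: vs.span_base)

text \<open>Pullback of a functional along the bracket.\<close>

definition lb :: "('a => 'k) => 'a \<times> 'a => 'k" where
 "lb l = (\<lambda>p. if p \<in> V \<times> V then l (br (fst p) (snd p)) else 0)"

lemma lb_linear: "flin lb"
 by (rule linear_fsI) (auto simp: lb_def fun_app)

lemma lb_alt: "l \<in> vs.dual_ann W A ==> lb l \<in> vs.alt_on V"
proof -
 assume l: "l \<in> vs.dual_ann W A"
 note d = vs.dual_annD[OF l]
 show ?thesis unfolding vs.alt_on_def vs.bil_on_def lb_def
  using vs.subspace_add[OF V(1)] vs.subspace_scale[OF V(1)] brW vs.subspace_0[OF W(1)]
  by (simp add: Vc br_add_left br_add_right br_smul_left br_smul_right br_self d)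
qed

text \<open>For \<open>E1 <= Z\<close> these are the bracket relations on \<open>Z\<close> modulo E:
  the kernel of the map from the exterior square of \<open>Z\<close> modulo that of
  \<open>E1\<close> to \<open>brs Z E2\<close> modulo \<open>E2\<close>. Functionals on
  \<open>alt0 V E1\<close> stand for elements of the exterior square of \<open>V\<close> modulo that
  of \<open>E1\<close>; killing \<open>alt0 V Z\<close> places them in the part belonging to
  \<open>Z\<close>, and killing the forms \<open>lb l\<close> makes their bracket 0.\<close>

definition QQ :: "'a set => 'a set => 'a set => (('a \<times> 'a => 'k) => 'k) set" where
 "QQ Z E1 E2 = ff.dual_ann (vs.alt0 V E1) (fspan (vs.alt0 V Z \<union> lb ` vs.dual_ann W E2))"

text \<open>Restriction to \<open>Z\<close> has the kernel \<open>alt0 V Z\<close> on both spaces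
  involved, so only the images are compared. The functionals killing \<open>E2\<close> contribute as
  many dimensions to the smaller image as \<open>brs Z E2\<close> has modulo
  \<open>E2\<close>.\<close>

lemma QQ_bound:
 assumes Z: "vs.subspace Z" "Z <= V" and E1: "vs.subspace E1" "E1 <= Z" and E2: "vs.subspace E2" "E2 <= W"
  and brE: "!!x y. x \<in> E1 ==> y \<in> E1 ==> br x y \<in> E2"
 shows "fdim (QQ Z E1 E2) + vs.dim (brs Z E2) + fdim (vs.alt_on E1) <= fdim (vs.alt_on Z) + vs.dim E2"
  "ffin_dim (QQ Z E1 E2)"
proof -
 let ?S = "fspan (vs.alt0 V Z \<union> lb ` vs.dual_ann W E2)" and ?A = "vs.alt0 V E1" and ?r = "restr (Z \<times> Z) :: ('a \<times> 'a => 'k) => 'a \<times> 'a => 'k"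
 have fZ: "finite Z" using Z(2) V(3) finite_subset by blast
 have "lb l \<in> ?A" if l: "l \<in> vs.dual_ann W E2" for l
  unfolding vs.alt0_def lb_def[of l] using lb_alt[OF l, unfolded lb_def] vs.dual_annD(4)[OF l] brE by auto
 moreover have "vs.alt0 V Z <= ?A" unfolding vs.alt0_def using E1(2) by blast
 ultimately have SA: "?S <= ?A" by (intro fs.span_minimal vs.subspace_alt0) blast
 have fS: "ffin_dim ?S" by (rule fs.fin_dim_mono[OF SA vs.alt0_fin(1)[OF V(3)]])
 have sS: "fsubspace ?S" by simp
 note da = ff.fdim_dual_ann[OF vs.subspace_alt0 sS SA vs.alt0_fin(2)[OF V(3)]]
 show "ffin_dim (QQ Z E1 E2)" unfolding QQ_def by (rule da(2))
 have k1: "{g\<in>?A. ?r g = 0} = vs.alt0 V Z"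
  unfolding vs.alt0_def restr_def using E1(2) by (auto simp: fun_eq_iff fun_app)
 have k2: "{g\<in>?S. ?r g = 0} = vs.alt0 V Z"
 proof
  show "{g\<in>?S. ?r g = 0} <= vs.alt0 V Z" using SA unfolding k1[symmetric] by blast
  show "vs.alt0 V Z <= {g\<in>?S. ?r g = 0}" using k1 fs.span_superset[of "vs.alt0 V Z \<union> lb ` vs.dual_ann W E2"] by blast
 qed
 have "?r ` ?A <= vs.alt0 Z E1"
 proof clarify
  fix g assume g: "g \<in> ?A"
  then have "?r g \<in> vs.alt_on Z" using vs.alt_on_extend[OF Z V(1,3)] unfolding vs.alt0_def by blast
  moreover have "?r g (x, y) = 0" if "x \<in> E1" "y \<in> E1" for x y using g that unfolding vs.alt0_def restr_def by auto
  ultimately show "?r g \<in> vs.alt0 Z E1" unfolding vs.alt0_def by blast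
 qed
 then have r1: "fdim (?r ` ?A) <= fdim (vs.alt0 Z E1)" by (rule fs.dim_mono_fin[OF _ vs.alt0_fin(1)[OF fZ]])
 have lin: "flin (?r \<circ> lb)" by (rule Vector_Spaces.linear_compose[OF lb_linear linear_restr])
 note dE = vs.fdim_dual_ann[OF W(1) E2 W(3)]
 note dB = vs.fdim_dual_ann[OF W(1) brs_sub(1) brs_sub(4)[OF Z(2) E2(2)] W(3)]
 have k3: "{l\<in>vs.dual_ann W E2. (?r \<circ> lb) l = 0} = vs.dual_ann W (brs Z E2)"
 proof (intro equalityI subsetI)
  fix l assume l: "l \<in> {l\<in>vs.dual_ann W E2. (?r \<circ> lb) l = 0}"
  then have lE: "l \<in> vs.dual_ann W E2" and z: "?r (lb l) = 0" by auto
  have z': "l (br x y) = 0" if xy: "x \<in> Z" "y \<in> Z" for x y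
   using fun_cong[OF z, of "(x, y)"] xy Z(2) unfolding restr_def lb_def by (auto simp: fun_app subset_iff)
  have "l x = 0" if "x \<in> brs Z E2" for x
   by (rule vs.dual_ann_span_0[OF lE W(1) _ _ that[unfolded brs_def]])
    (use E2(2) brW Z(2) z' vs.dual_annD(4)[OF lE] in auto)
  then show "l \<in> vs.dual_ann W (brs Z E2)" using lE unfolding vs.dual_ann_def by blast
 next
  fix l assume l: "l \<in> vs.dual_ann W (brs Z E2)"
  have "l (br x y) = 0" if "x \<in> Z" "y \<in> Z" for x y by (rule vs.dual_annD(4)[OF l brs_sub(3)[OF that]])
  then have "(?r \<circ> lb) l = 0" unfolding restr_def lb_def by (auto simp: fun_eq_iff fun_app)
  moreover have "l \<in> vs.dual_ann W E2" using l brs_sub(2)[of E2 Z] unfolding vs.dual_ann_def by blast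
  ultimately show "l \<in> {l\<in>vs.dual_ann W E2. (?r \<circ> lb) l = 0}" by blast
 qed
 have "(?r \<circ> lb) ` vs.dual_ann W E2 <= ?r ` ?S"
  using fs.span_superset[of "vs.alt0 V Z \<union> lb ` vs.dual_ann W E2"] by auto
 then have r3: "fdim ((?r \<circ> lb) ` vs.dual_ann W E2) <= fdim (?r ` ?S)"
  by (rule fs.dim_mono_fin[OF _ linear_image_fs(2)[OF linear_restr sS fS]])
 note n1 = fsp.rank_nullity(1)[OF linear_restr[of "Z \<times> Z"] vs.subspace_alt0[of V E1] vs.alt0_fin(1)[OF V(3)], unfolded k1]
 note n2 = fsp.rank_nullity(1)[OF linear_restr[of "Z \<times> Z"] sS fS, unfolded k2]
 note n3 = fsp.rank_nullity(1)[OF lin vs.subspace_dual_ann dE(2), unfolded k3]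
 show "fdim (QQ Z E1 E2) + vs.dim (brs Z E2) + fdim (vs.alt_on E1) <= fdim (vs.alt_on Z) + vs.dim E2"
  using da(1) n1 n2 n3 r1 r3 dE(1) dB(1) vs.alt0_dim[OF E1 Z(1) fZ] unfolding QQ_def by linarith
qed

end

section \<open>Obstructions to extending forms\<close>

locale bracket_extension = bracket_space M V W for M :: "('k::{field,finite}, 'a::ab_group_add) glie" and V W :: "'a set" +
 fixes E1 E2 :: "'a set"
 assumes E1: "vs.subspace E1" "E1 <= V" and E2: "vs.subspace E2" "E2 <= W"
  and brE: "!!x y. x \<in> E1 ==> y \<in> E1 ==> br x y \<in> E2"
begin

text \<open>The defect of a bilinear form in the cyclic identity.\<close>

definition dd :: "('a \<times> 'a => 'k) => 'a \<times> 'a \<times> 'a => 'k" where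
 "dd b = (\<lambda>(x, y, z). if x \<in> V & y \<in> V & z \<in> V then b (x, br y z) + b (y, br z x) + b (z, br x y) else 0)"

lemma dd_linear: "flin dd"
 by (rule linear_fsI) (auto simp: dd_def fun_app algebra_simps)

lemma dd_alt3: "b \<in> vs.bil_on V W ==> dd b \<in> vs.alt3_on V"
proof -
 assume b: "b \<in> vs.bil_on V W"
 note B = vs.bil_onD[OF b] and B0 = vs.bil_on_0[OF b]
 have m: "b (x, br z y) = - b (x, br y z)" if "x \<in> V" "y \<in> V" "z \<in> V" for x y z
  using B(5)[OF that(1) brW[OF that(2,3)], of "- 1"] br_anti[OF Vc[OF that(2)] Vc[OF that(3)]] by (simp add: vs.scale_minus_left)
 show ?thesis
  unfolding vs.alt3_on_def dd_def mem_Collect_eq prod.case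
 proof (intro conjI allI impI ballI)
  fix x y z
  show "(if x \<in> V & y \<in> V & z \<in> V then b (x, br y z) + b (y, br z x) + b (z, br x y) else 0) =
   (if y \<in> V & z \<in> V & x \<in> V then b (y, br z x) + b (z, br x y) + b (x, br y z) else 0)"
   by (auto simp: add_ac)
  assume "x ~: V"
  then show "(if x \<in> V & y \<in> V & z \<in> V then b (x, br y z) + b (y, br z x) + b (z, br x y) else 0) = 0" by simp
 next
  fix x x' y z assume x: "x \<in> V" "x' \<in> V" "y \<in> V" "z \<in> V"
  show "(if x + x' \<in> V & y \<in> V & z \<in> V then b (x + x', br y z) + b (y, br z (x + x')) + b (z, br (x + x') y) else 0) =
   (if x \<in> V & y \<in> V & z \<in> V then b (x, br y z) + b (y, br z x) + b (z, br x y) else 0) +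
   (if x' \<in> V & y \<in> V & z \<in> V then b (x', br y z) + b (y, br z x') + b (z, br x' y) else 0)"
   using x vs.subspace_add[OF V(1) x(1,2)] B(2)[OF x(1,2) brW[OF x(3,4)]] B(3)[OF x(3) brW[OF x(4,1)] brW[OF x(4,2)]]
    B(3)[OF x(4) brW[OF x(1,3)] brW[OF x(2,3)]] by (simp add: Vc br_add_left br_add_right)
 next
  fix c x y z assume x: "x \<in> V" "y \<in> V" "z \<in> V"
  show "(if smul M c x \<in> V & y \<in> V & z \<in> V then b (smul M c x, br y z) + b (y, br z (smul M c x)) + b (z, br (smul M c x) y) else 0) =
   c * (if x \<in> V & y \<in> V & z \<in> V then b (x, br y z) + b (y, br z x) + b (z, br x y) else 0)"
   using x vs.subspace_scale[OF V(1) x(1)] B(4)[OF x(1) brW[OF x(2,3)]] B(5)[OF x(2) brW[OF x(3,1)]]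
    B(5)[OF x(3) brW[OF x(1,2)]] by (simp add: Vc br_smul_left br_smul_right distrib_left)
 next
  fix x z assume x: "x \<in> V" "z \<in> V"
  show "(if x \<in> V & x \<in> V & z \<in> V then b (x, br x z) + b (x, br z x) + b (z, br x x) else 0) = 0"
   using x m[OF x(1) x(1) x(2)] by (simp add: Vc br_self B0)
 qed
qed

text \<open>Contains the defects of all forms whose restriction to E satisfies the cyclic identity
  there.\<close>

definition T0 :: "('a \<times> 'a \<times> 'a => 'k) set" where
 "T0 = {ta\<in>vs.alt3_on V. \<forall>x\<in>E1. \<forall>y\<in>E1. \<forall>z\<in>E1. ta (x, y, z) = 0}"

lemma T0: "fsubspace T0" "ffin_dim T0" "finite T0"
proof -
 show 1: "fsubspace T0"
  using vs.subspace_alt3_on[of V] unfolding T0_def fs.subspace_def mem_Collect_eq Ball_def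
  by (simp add: fun_app)
 show 2: "ffin_dim T0" by (rule fs.fin_dim_mono[OF _ vs.alt3_on_fin[OF V(3)]]) (auto simp: T0_def)
 show "finite T0" by (rule card_fs(1)[OF 1 2])
qed

definition Bil0 :: "('a \<times> 'a => 'k) set" where "Bil0 = {b\<in>vs.bil_on V W. restr (E1 \<times> E2) b = 0}"

lemma Bil0: "fsubspace Bil0" "ffin_dim Bil0"
proof -
 interpret r: Vector_Spaces.linear scl scl "restr (E1 \<times> E2) :: ('a \<times> 'a => 'k) => 'a \<times> 'a => 'k" by (rule linear_restr)
 show "fsubspace Bil0"
  using vs.subspace_bil_on[of V W] unfolding Bil0_def fs.subspace_def mem_Collect_eq Ball_def
  by (simp add: r.add r.scale r.zero)
 show "ffin_dim Bil0" by (rule fs.fin_dim_mono[OF _ vs.bil_on_fin[OF V(3) W(3)]]) (auto simp: Bil0_def)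
qed

lemma dd_E:
 assumes b: "restr (E1 \<times> E2) b \<in> jac E1 E2" and x: "x \<in> E1" "y \<in> E1" "z \<in> E1"
 shows "dd b (x, y, z) = 0"
proof -
 have "restr (E1 \<times> E2) b (x, br y z) + restr (E1 \<times> E2) b (y, br z x) + restr (E1 \<times> E2) b (z, br x y) = 0"
  using b x unfolding jac_def by blast
 then show ?thesis using x brE E1(2) unfolding dd_def restr_def by (auto simp: subset_iff)
qed

text \<open>Functionals that detect whether a defect can be removed by a correction vanishing on
  \<open>E1 \<times> E2\<close>.\<close>

definition obs :: "(('a \<times> 'a \<times> 'a => 'k) => 'k) set" where "obs = ff.dual_ann T0 (dd ` Bil0)"

lemma dd_Bil0_T0: "dd ` Bil0 <= T0"
proof clarify
 fix b assume b: "b \<in> Bil0"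
 have "0 \<in> jac E1 E2" by (rule fs.subspace_0[OF subspace_jac])
 then show "dd b \<in> T0" using b dd_alt3[of b] dd_E[of b] unfolding T0_def Bil0_def by simp
qed

lemma obs_dim: "fdim obs + fdim (dd ` Bil0) = fdim T0" "ffin_dim obs" "fsubspace obs"
proof -
 have s: "fsubspace (dd ` Bil0)" by (rule linear_image_fs(1)[OF dd_linear Bil0])
 show "fdim obs + fdim (dd ` Bil0) = fdim T0" "ffin_dim obs"
  using ff.fdim_dual_ann[OF T0(1) s dd_Bil0_T0 T0(3)] unfolding obs_def by auto
 show "fsubspace obs" unfolding obs_def by (rule ff.subspace_dual_ann)
qed

text \<open>A form in \<open>jac E1 E2\<close> extends to \<open>jac V W\<close> unless the cyclic sum of a bilinear extension is an
 obstruction in \<open>T0\<close> modulo the cyclic sums of forms that vanish on \<open>E1 \<times> E2\<close>.\<close>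

lemma fredholm: "fdim (jac E1 E2) <= fdim (restr (E1 \<times> E2) ` jac V W) + fdim obs"
proof -
 let ?r = "restr (E1 \<times> E2) :: ('a \<times> 'a => 'k) => 'a \<times> 'a => 'k"
 let ?B = "{b\<in>vs.bil_on V W. ?r b \<in> jac E1 E2}"
 interpret r: Vector_Spaces.linear scl scl ?r by (rule linear_restr)
 have j0: "0 \<in> jac E1 E2" by (rule fs.subspace_0[OF subspace_jac])
 have sB: "fsubspace ?B"
  using vs.subspace_bil_on[of V W] fs.subspace_add[OF subspace_jac] fs.subspace_scale[OF subspace_jac] j0
  unfolding fs.subspace_def mem_Collect_eq Ball_def by (simp add: r.add r.scale r.zero)
 have fB: "ffin_dim ?B" by (rule fs.fin_dim_mono[OF _ vs.bil_on_fin[OF V(3) W(3)]]) auto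
 have rB: "?r ` ?B = jac E1 E2"
 proof
  show "jac E1 E2 <= ?r ` ?B"
  proof
   fix g assume g: "g \<in> jac E1 E2"
   then have "g \<in> vs.bil_on E1 E2" unfolding jac_def by blast
   then obtain b where "b \<in> vs.bil_on V W" "?r b = g"
    using vs.bil_on_extend[OF E1 V(1,3) E2 W(1,3)] by blast
   then show "g \<in> ?r ` ?B" using g by blast
  qed
 qed blast
 have k1: "{b\<in>?B. ?r b = 0} = Bil0" unfolding Bil0_def using j0 by auto
 have jB: "b \<in> jac V W" if "b \<in> vs.bil_on V W" "dd b = 0" for b
 proof -
  have "b (x, br y z) + b (y, br z x) + b (z, br x y) = 0" if "x \<in> V" "y \<in> V" "z \<in> V" for x y z
   using fun_cong[OF \<open>dd b = 0\<close>, of "(x, y, z)"] that unfolding dd_def by (simp add: fun_app)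
  then show ?thesis using that(1) unfolding jac_def by blast
 qed
 have jd: "dd b = 0" if "b \<in> jac V W" for b
  using that unfolding jac_def dd_def by (auto simp: fun_eq_iff fun_app)
 have jr: "?r b \<in> jac E1 E2" if b: "b \<in> jac V W" for b
 proof -
  have "b \<in> vs.bil_on V W" using b unfolding jac_def by blast
  note B = vs.bil_onD[OF this]
  have "?r b \<in> vs.bil_on E1 E2"
   unfolding vs.bil_on_def restr_def using vs.subspace_add[OF E1(1)] vs.subspace_scale[OF E1(1)]
    vs.subspace_add[OF E2(1)] vs.subspace_scale[OF E2(1)] E1(2) E2(2) by (simp add: B subset_iff)
  moreover have "?r b (x, br y z) + ?r b (y, br z x) + ?r b (z, br x y) = 0" if x: "x \<in> E1" "y \<in> E1" "z \<in> E1" for x y z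
   using b x brE E1(2) unfolding jac_def restr_def by (auto simp: subset_iff)
  ultimately show ?thesis unfolding jac_def by blast
 qed
 have k2: "{b\<in>?B. dd b = 0} = jac V W"
 proof
  show "jac V W <= {b\<in>?B. dd b = 0}" using jd jr unfolding jac_def by blast
 qed (use jB in blast)
 have k3: "{b\<in>Bil0. dd b = 0} = {b\<in>jac V W. ?r b = 0}"
  unfolding Bil0_def using jB jd unfolding jac_def by blast
 have "dd ` ?B <= T0" using dd_alt3 dd_E unfolding T0_def by blast
 then have le: "fdim (dd ` ?B) <= fdim T0" by (rule fs.dim_mono_fin[OF _ T0(2)])
 note n1 = fsp.rank_nullity(1)[OF linear_restr[of "E1 \<times> E2"] sB fB, unfolded k1 rB]
 note n2 = fsp.rank_nullity(1)[OF dd_linear sB fB, unfolded k2]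
 note n3 = fsp.rank_nullity(1)[OF dd_linear Bil0, unfolded k3]
 note n4 = fsp.rank_nullity(1)[OF linear_restr[of "E1 \<times> E2"] subspace_jac[of V W] jac_fin[OF V(3) W(3)]]
 show ?thesis using n1 n2 n3 n4 le obs_dim(1) by linarith
qed

lemma wedge3_T0:
 assumes "fi \<in> vs.dual_ann V E1" "g \<in> vs.alt_on V" shows "vs.wedge3 fi g \<in> T0"
 using vs.wedge3_alt[OF V(1) assms] vs.dual_annD(4)[OF assms(1)] unfolding T0_def by (simp add: vs.wedge3_def)

lemma wedge3_T0':
 assumes "fi \<in> vs.dual_ann V A" "g \<in> vs.alt0 V E1" shows "vs.wedge3 fi g \<in> T0"
 using vs.wedge3_alt[OF V(1) assms(1), of g] assms(2) unfolding T0_def vs.alt0_def by (simp add: vs.wedge3_def)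

text \<open>The product of \<open>ch\<close> and \<open>l\<close> is a bilinear form with defect
  \<open>vs.wedge3 ch (lb l)\<close>, and it vanishes on \<open>E1 \<times> E2\<close> as soon as
  one of the factors kills its part of E. Obstructions therefore kill these products.\<close>

lemma wedge3_lb:
 assumes x: "ch \<in> vs.dual_ann V A" and l: "l \<in> vs.dual_ann W B" and AB: "A = E1 \<or> B = E2"
 shows "vs.wedge3 ch (lb l) \<in> dd ` Bil0"
proof -
 note dx = vs.dual_annD[OF x] and dl = vs.dual_annD[OF l]
 let ?b = "\<lambda>(x, y). ch x * l y"
 have "?b \<in> vs.bil_on V W"
  unfolding vs.bil_on_def using dx(1) dl(1) by (auto simp: dx(2,3) dl(2,3) algebra_simps)
 moreover have "restr (E1 \<times> E2) ?b = 0"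
  using AB dx(4) dl(4) unfolding restr_def by (auto simp: fun_eq_iff fun_app)
 moreover have "vs.wedge3 ch (lb l) = dd ?b"
  unfolding vs.wedge3_def lb_def dd_def using dx(1) by (auto simp: fun_eq_iff)
 ultimately show ?thesis unfolding Bil0_def by blast
qed

end

section \<open>The number of obstructions\<close>

context bracket_extension begin

text \<open>Contracting obstructions with functionals that kill \<open>E1\<close> gives bivectors
  with bracket 0, to which the rank bound is applied. Functionals contracting every obstruction to 0
  are divided out; their common zeros are \<open>Z\<close>, and what remains is a faithful family
  with \<open>b\<close> = dim \<open>Z\<close> - dim \<open>E1\<close>.\<close>

theorem deficiency_bound:
 assumes pos: "!!U. vs.subspace U ==> U <= V ==> U ~= {0} ==> fdim (vs.alt_on U) < vs.dim U + vs.dim (brs U {})"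
 shows "\<exists>Z. vs.subspace Z & E1 <= Z & Z <= V &
   fdim obs + vs.dim Z + vs.dim (brs Z E2) + fdim (vs.alt_on E1) <= vs.dim E1 + vs.dim E2 + fdim (vs.alt_on Z)"
proof (cases "fdim obs = 0")
 case True
 \<comment> \<open>Without obstructions \<open>E1\<close> itself serves as \<open>Z\<close>, since
   it adds no brackets to \<open>E2\<close>.\<close>
 have "brs E1 E2 <= E2" unfolding brs_def by (rule vs.span_minimal[OF _ E2(1)]) (auto intro: brE)
 then have "brs E1 E2 = E2" using brs_sub(2) by blast
 then show ?thesis using True E1 by (intro exI[of _ E1]) simp
next
 case False
 define m where "m = vs.dim V"
 obtain v fi where bas: "\<forall>p<m. v p \<in> V & fi p \<in> vs.dual_ann V {0} & (\<forall>r<m. fi p (v r) = (if p = r then 1 else 0))"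
   "\<forall>x\<in>V. x = (\<Sum>p<m. smul M (fi p x) (v p))"
  using vs.adapted_basis[OF E1 V(1,3)] unfolding m_def by blast
 have b1: "v p \<in> V" and b2: "fi p \<in> vs.dual_ann V {0}" and b3: "r < m ==> fi p (v r) = (if p = r then 1 else 0)"
  if "p < m" for p r using bas(1) that by blast+
 have b4: "x \<in> V ==> x = (\<Sum>p<m. smul M (fi p x) (v p))" for x using bas(2) by blast
 have expand: "l = (\<Sum>p<m. scl (l (v p)) (fi p))" if "l \<in> vs.dual_ann V A" for l A
  by (rule vs.dual_expand[OF V(1) b1 b2 b4 that])
 have V0: "0 \<in> V" by (rule vs.subspace_0[OF V(1)])
 have s0: "vs.subspace {0}" "{0} <= V" "{0} <= W" using V0 vs.subspace_0[OF W(1)] by (auto simp: vs.subspace_single_0)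
 let ?Alt = "vs.alt_on V" and ?Lam = "lb ` vs.dual_ann W {0}"
 \<comment> \<open>Dually, the kernel of the bracket on the exterior square of
   \<open>V\<close>.\<close>
 define Q0 where "Q0 = ff.dual_ann ?Alt (fspan ?Lam)"
 have Lam: "?Lam <= ?Alt" using lb_alt by blast
 have sLam: "fspan ?Lam <= ?Alt" by (rule fs.span_minimal[OF Lam vs.subspace_alt_on])
 have fAlt: "finite ?Alt" using vs.alt0_fin(2)[OF V(3), of "{0}"] unfolding vs.alt0_0 .
 have Q0: "fsubspace Q0" "ffin_dim Q0"
  unfolding Q0_def by (rule ff.subspace_dual_ann, rule ff.fdim_dual_ann(2)[OF vs.subspace_alt_on fs.subspace_span sLam fAlt])
 \<comment> \<open>The products of basis functionals span all alternating forms.\<close>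
 have kill: "L g = 0" if L: "L \<in> ff.dual_ann ?Alt Y" and z: "!!p r. p < m ==> r < m ==> L (vs.wedge2 (fi p) (fi r)) = 0"
  and g: "g \<in> ?Alt" for L Y g
 proof (rule ff.dual_ann_span_0[OF L vs.subspace_alt_on])
  show "g \<in> fspan {vs.wedge2 al be |al be. al \<in> vs.dual_ann V {0} & be \<in> vs.dual_ann V {0}}"
   using vs.alt0_span[OF s0(1,2) V(1,3)] g unfolding vs.alt0_0 by blast
  show "{vs.wedge2 al be |al be. al \<in> vs.dual_ann V {0} & be \<in> vs.dual_ann V {0}} <= ?Alt"
   using vs.wedge2_alt[OF V(1)] by blast
  fix h assume "h \<in> {vs.wedge2 al be |al be. al \<in> vs.dual_ann V {0} & be \<in> vs.dual_ann V {0}}"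
  then obtain al be where ab: "al \<in> vs.dual_ann V {0}" "be \<in> vs.dual_ann V {0}" "h = vs.wedge2 al be" by blast
  have 1: "L (vs.wedge2 (fi p) be) = 0" if p: "p < m" for p
  proof -
   have "L (vs.wedge2 (fi p) be) = L (\<Sum>r<m. scl (be (v r)) (vs.wedge2 (fi p) (fi r)))"
    unfolding vs.wedge2_sum(2)[symmetric] using expand[OF ab(2)] by simp
   also have "\<dots> = (\<Sum>r<m. be (v r) * L (vs.wedge2 (fi p) (fi r)))"
    by (rule ff.dual_ann_sum[OF L vs.subspace_alt_on]) (use vs.wedge2_alt[OF V(1) b2[OF p] b2] in auto)
   finally show ?thesis using z[OF p] by simp
  qed
  have "L (h) = L (\<Sum>p<m. scl (al (v p)) (vs.wedge2 (fi p) be))"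
   unfolding vs.wedge2_sum(1)[symmetric] ab(3) using expand[OF ab(1)] by simp
  also have "\<dots> = (\<Sum>p<m. al (v p) * L (vs.wedge2 (fi p) be))"
   by (rule ff.dual_ann_sum[OF L vs.subspace_alt_on]) (use vs.wedge2_alt[OF V(1) b2 ab(2)] in auto)
  finally show "L h = 0" using 1 by simp
 qed
 define a where "a = fdim obs"
 obtain qa pa where A: "\<forall>i<a. pa i \<in> obs" "\<forall>i<a. \<forall>j<a. pa i (qa j) = (if i = j then 1 else 0)"
   "\<forall>w\<in>obs. w = (\<Sum>i<a. scl (w (qa i)) (pa i))"
  using dual_points[OF obs_dim(3,2) refl] unfolding a_def by blast
 have a0: "0 < a" using False unfolding a_def by simp
 have oD: "w \<in> obs ==> w \<in> ff.dual_ann T0 (dd ` Bil0)" for w unfolding obs_def .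
 note od = ff.dual_annD[OF oD]
 have oneg: "w (- x) = - w x" if w: "w \<in> obs" "x \<in> T0" for w x
 proof -
  have "- x = scl (- 1) x" by (simp add: fun_eq_iff fun_app)
  then show ?thesis using od(3)[OF w, of "- 1"] by simp
 qed
 \<comment> \<open>For \<open>ch\<close> killing \<open>E1\<close>, the product of \<open>ch\<close>
   with a pullback \<open>lb l\<close> is a removable defect, so the contraction kills all
   pullbacks.\<close>
 have Lw: "(\<lambda>g. if g \<in> ?Alt then w (vs.wedge3 ch g) else 0) \<in> Q0" if w: "w \<in> obs" and x: "ch \<in> vs.dual_ann V E1" for w ch
  unfolding Q0_def
 proof (rule ff.dual_annI[OF vs.subspace_alt_on _ _ _ Lam])
  show "w (vs.wedge3 ch (g + h)) = w (vs.wedge3 ch g) + w (vs.wedge3 ch h)" if "g \<in> ?Alt" "h \<in> ?Alt" for g h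
   unfolding vs.wedge_add by (rule od(2)[OF w wedge3_T0[OF x that(1)] wedge3_T0[OF x that(2)]])
  show "w (vs.wedge3 ch (scl c g)) = c * w (vs.wedge3 ch g)" if "g \<in> ?Alt" for g c
   unfolding vs.wedge_add by (rule od(3)[OF w wedge3_T0[OF x that]])
  fix g assume "g \<in> ?Lam"
  then obtain l where l: "l \<in> vs.dual_ann W {0}" "g = lb l" by blast
  show "w (vs.wedge3 ch g) = 0" unfolding l(2) by (rule od(4)[OF w wedge3_lb[OF x l(1)]]) simp
 qed
 have B0V: "vs.dual_ann V E1 <= vs.dual_ann V {0}"
  unfolding vs.dual_ann_def using vs.subspace_0[OF E1(1)] by auto
 have finB0: "ffin_dim (vs.dual_ann V E1)" "fdim (vs.dual_ann V E1) + vs.dim E1 = m"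
  using vs.fdim_dual_ann[OF V(1) E1 V(3)] unfolding m_def by auto
 define ann where "ann = {ch\<in>vs.dual_ann V E1. \<forall>w\<in>obs. \<forall>g\<in>?Alt. w (vs.wedge3 ch g) = 0}"
 have annS: "fsubspace ann"
  unfolding fs.subspace_def
 proof (intro conjI ballI allI)
  have "vs.wedge3 0 g = 0" for g by (auto simp: vs.wedge3_def fun_eq_iff fun_app)
  then show "0 \<in> ann" unfolding ann_def
   using fs.subspace_0[OF vs.subspace_dual_ann, of V E1] od(5)[OF _ fs.subspace_0[OF T0(1)]] by auto
  fix x assume x: "x \<in> ann"
  then have x1: "x \<in> vs.dual_ann V E1" unfolding ann_def by blast
  show "scl c x \<in> ann" for c
   unfolding ann_def
  proof (intro CollectI conjI ballI)
   show "scl c x \<in> vs.dual_ann V E1" by (rule fs.subspace_scale[OF vs.subspace_dual_ann x1])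
   fix w g assume w: "w \<in> obs" and g: "g \<in> ?Alt"
   have "w (vs.wedge3 x g) = 0" using x w g unfolding ann_def by blast
   then show "w (vs.wedge3 (scl c x) g) = 0"
    unfolding vs.wedge_add od(3)[OF w wedge3_T0[OF x1 g]] by simp
  qed
  fix y assume y: "y \<in> ann"
  then have y1: "y \<in> vs.dual_ann V E1" unfolding ann_def by blast
  show "x + y \<in> ann"
   unfolding ann_def
  proof (intro CollectI conjI ballI)
   show "x + y \<in> vs.dual_ann V E1" by (rule fs.subspace_add[OF vs.subspace_dual_ann x1 y1])
   fix w g assume w: "w \<in> obs" and g: "g \<in> ?Alt"
   have "w (vs.wedge3 x g) = 0" "w (vs.wedge3 y g) = 0" using x y w g unfolding ann_def by blast+
   then show "w (vs.wedge3 (x + y) g) = 0"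
    unfolding vs.wedge_add od(2)[OF w wedge3_T0[OF x1 g] wedge3_T0[OF y1 g]] by simp
  qed
 qed
 have annB: "ann <= vs.dual_ann V E1" unfolding ann_def by blast
 \<comment> \<open>By the double annihilator \<open>ann\<close> is the full annihilator of
   \<open>Z\<close>, which fixes the dimension of the complement \<open>B\<close> chosen
   next.\<close>
 define Z where "Z = {x\<in>V. \<forall>ch\<in>ann. ch x = 0}"
 note da = vs.double_annihilator[OF V(1,3) annS subset_trans[OF annB B0V], folded Z_def]
 have Z: "vs.subspace Z" "Z <= V" "E1 <= Z" using da(1) E1(2) annB vs.dual_annD(4) unfolding Z_def by blast+
 have dimZ: "fdim ann + vs.dim Z = m"
  using vs.fdim_dual_ann(1)[OF V(1) Z(1,2) V(3)] unfolding da(2) m_def .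
 obtain B where B: "fsubspace B" "B <= vs.dual_ann V E1" "ann \<inter> B = {0}"
   "\<forall>x\<in>vs.dual_ann V E1. \<exists>s\<in>ann. \<exists>t\<in>B. x = s + t" "fdim (vs.dual_ann V E1) = fdim ann + fdim B"
 proof (rule fs.complement_exists[OF annS vs.subspace_dual_ann annB finB0(1)])
  fix T assume T: "fsubspace T" "T <= vs.dual_ann V E1" "ann \<inter> T = {0}"
   "!!x. x \<in> vs.dual_ann V E1 ==> \<exists>s\<in>ann. \<exists>t\<in>T. x = s + t" "fdim (vs.dual_ann V E1) = fdim ann + fdim T"
  show thesis by (rule that[OF T(1-3) _ T(5)]) (use T(4) in blast)
 qed
 define b where "b = fdim B"
 have bz: "b + vs.dim E1 = vs.dim Z" using finB0(2) dimZ B(5) unfolding b_def by linarith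
 obtain qb ch where X: "\<forall>j<b. ch j \<in> B" "\<forall>i<b. \<forall>j<b. ch i (qb j) = (if i = j then 1 else 0)"
   "\<forall>w\<in>B. w = (\<Sum>j<b. scl (w (qb j)) (ch j))"
  using dual_points[OF B(1) fs.fin_dim_mono[OF B(2) finB0(1)] refl] unfolding b_def by blast
 have xB0: "ch j \<in> vs.dual_ann V E1" if "j < b" for j using X(1) B(2) that by blast
 have w2: "vs.wedge2 (fi p) (fi r) \<in> ?Alt" if "p < m" "r < m" for p r by (rule vs.wedge2_alt[OF V(1) b2[OF that(1)] b2[OF that(2)]])
 \<comment> \<open>An obstruction is determined by its contractions, because \<open>T0\<close> is
   spanned by products of functionals killing \<open>E1\<close> with alternating forms; the part of
   the functional in \<open>ann\<close> contributes nothing.\<close>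
 have faith: "w = 0" if w: "w \<in> obs" and z: "!!j p r. j < b ==> p < m ==> r < m ==> w (vs.wedge3 (ch j) (vs.wedge2 (fi p) (fi r))) = 0" for w
 proof -
  have xj: "w (vs.wedge3 (ch j) g) = 0" if j: "j < b" and g: "g \<in> ?Alt" for j g
   using kill[OF Lw[OF w xB0[OF j], unfolded Q0_def] _ g] z[OF j] w2 g by simp
  have all: "w (vs.wedge3 ps g) = 0" if p: "ps \<in> vs.dual_ann V E1" and g: "g \<in> ?Alt" for ps g
  proof -
   obtain s t where st: "s \<in> ann" "t \<in> B" "ps = s + t" using B(4) p by blast
   have "w (vs.wedge3 t g) = w (\<Sum>j<b. scl (t (qb j)) (vs.wedge3 (ch j) g))"
    unfolding vs.wedge3_sum[symmetric] using X(3) st(2) by auto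
   also have "\<dots> = (\<Sum>j<b. t (qb j) * w (vs.wedge3 (ch j) g))"
    by (rule ff.dual_ann_sum[OF oD[OF w] T0(1)]) (use wedge3_T0[OF xB0 g] in auto)
   finally have "w (vs.wedge3 t g) = 0" using xj[OF _ g] by simp
   moreover have "w (vs.wedge3 s g) = 0" using st(1) w g unfolding ann_def by blast
   moreover have "s \<in> vs.dual_ann V E1" "t \<in> vs.dual_ann V E1" using st annB B(2) by blast+
   ultimately show ?thesis unfolding st(3) vs.wedge_add using od(2)[OF w wedge3_T0[OF _ g] wedge3_T0[OF _ g]] by simp
  qed
  show "w = 0"
  proof
   fix ta
   show "w ta = 0 ta"
   proof (cases "ta \<in> T0")
    case True
    have "ta \<in> fspan {vs.wedge3 ps g |ps g. ps \<in> vs.dual_ann V E1 & g \<in> ?Alt}"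
     by (rule vs.alt3_span[OF E1 V(1,3)]) (use True in \<open>auto simp: T0_def\<close>)
    then have "w ta = 0"
     by (rule ff.dual_ann_span_0[OF oD[OF w] T0(1), rotated 2]) (use all wedge3_T0 in blast)+
    then show ?thesis by (simp add: fun_app)
   next
    case False
    then show ?thesis using od(1)[OF w] by (simp add: fun_app)
   qed
  qed
 qed
 have b0: "0 < b"
 proof (rule ccontr)
  assume "\<not> 0 < b"
  then have "pa 0 = 0" using faith[of "pa 0"] A(1) a0 by auto
  moreover have "pa 0 (qa 0) = 1" using A(2) a0 by simp
  ultimately show False by (simp add: fun_app)
 qed
 \<comment> \<open>The alternating matrix of a bivector in the chosen basis.\<close>
 define cc where "cc L = (\<lambda>(p, r). if p < m & r < m then L (vs.wedge2 (fi p) (fi r)) else 0)" for L :: "('a \<times> 'a => 'k) => 'k"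
 have ccl: "flin cc" by (rule linear_fsI) (auto simp: cc_def fun_app)
 define R where "R = cc ` Q0"
 define t where "t i j = cc (\<lambda>g. if g \<in> ?Alt then pa i (vs.wedge3 (ch j) g) else 0)" for i j
 have tv: "t i j (p, r) = pa i (vs.wedge3 (ch j) (vs.wedge2 (fi p) (fi r)))" if "p < m" "r < m" for i j p r
  using w2[OF that] that unfolding t_def cc_def by simp
 have Rs: "fsubspace R" unfolding R_def by (rule linear_image_fs(1)[OF ccl Q0])
 have Rsq: "R <= sqr m" unfolding R_def sqr_def cc_def by auto
 \<comment> \<open>A subspace \<open>N\<close> of coordinate vectors is a space of functionals on
   \<open>V\<close>; let \<open>U\<close> be its common zeros. Elements of \<open>R\<close> with
   \<open>N\<close> in their radical come from bracket relations inside \<open>U\<close>, and by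
   \<open>pos\<close> there are fewer than dim \<open>U\<close> dimensions of these.\<close>
 have posR: "positive m R"
  unfolding positive_def
 proof (intro allI impI, elim conjE)
  fix N :: "(nat => 'k) set" assume N: "fsubspace N" "N <= vecs m" "N ~= vecs m"
  have fN: "ffin_dim N" by (rule fs.fin_dim_mono[OF N(2) vecs_fin(2)])
  have Nm: "fdim N < m"
  proof (rule ccontr)
   assume "\<not> fdim N < m"
   then show False using fs.subspace_eq_dim[OF N(1,2) vecs_fin(2)] vecs_fin(3)[of m, where 'k='k] N(3) by simp
  qed
  define psi where "psi x = (\<Sum>p<m. scl (x p) (fi p))" for x :: "nat => 'k"
  have psil: "flin psi"
   by (rule linear_fsI) (auto simp: psi_def sum_fun_apply fun_app sum.distrib sum_distrib_left algebra_simps)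
  have psiv: "psi x (v r) = x r" if "r < m" for x r
   unfolding psi_def using that by (simp add: sum_fun_apply fun_app b3 if_distrib cong: if_cong)
  have psiD: "psi ` N <= vs.dual_ann V {0}"
   unfolding psi_def using b2 by (auto intro!: fs.subspace_sum fs.subspace_scale vs.subspace_dual_ann)
  have ker0: "{x\<in>N. psi x = 0} = {0}"
  proof (intro equalityI subsetI)
   fix x assume x: "x \<in> {x\<in>N. psi x = 0}"
   have "x p = 0" for p
   proof (cases "p < m")
    case True
    have "psi x (v p) = 0" using x by (simp add: fun_app)
    then show ?thesis using psiv[OF True] by simp
   next
    case False
    then show ?thesis using x N(2) unfolding vecs_def by auto
   qed
   then show "x \<in> {0}" by (simp add: fun_eq_iff fun_app)
  next
   fix x :: "nat => 'k" assume "x \<in> {0}"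
   then have "x = 0" by simp
   moreover have "psi 0 = 0" by (simp add: psi_def fun_eq_iff sum_fun_apply fun_app)
   ultimately show "x \<in> {x\<in>N. psi x = 0}" using fs.subspace_0[OF N(1)] by simp
  qed
  have dN: "fdim (psi ` N) = fdim N"
   using fsp.rank_nullity(1)[OF psil N(1) fN] unfolding ker0 by (simp add: fs.dim_zero)
  define U where "U = {x\<in>V. \<forall>al\<in>psi ` N. al x = 0}"
  note dU = vs.double_annihilator[OF V(1,3) linear_image_fs(1)[OF psil N(1) fN] psiD, folded U_def]
  have U: "vs.subspace U" "U <= V" using dU(1) unfolding U_def by blast+
  have dimU: "fdim N + vs.dim U = m"
   using vs.fdim_dual_ann(1)[OF V(1) U V(3)] unfolding dU(2) dN m_def .
  have U0: "U ~= {0}" using dimU Nm by (auto simp: vs.dim_zero)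
  have "kil m R N <= cc ` QQ U {0} {0}"
  proof
   fix f assume f: "f \<in> kil m R N"
   then obtain L where L: "L \<in> Q0" "f = cc L" unfolding kil_def R_def by blast
   note LD = ff.dual_annD[OF L(1)[unfolded Q0_def]]
   have xr: "L (vs.wedge2 (psi x) (fi r)) = 0" if x: "x \<in> N" and r: "r < m" for x r
   proof -
    have "L (vs.wedge2 (psi x) (fi r)) = (\<Sum>p<m. x p * L (vs.wedge2 (fi p) (fi r)))"
     unfolding psi_def vs.wedge2_sum(1)
     by (rule ff.dual_ann_sum[OF L(1)[unfolded Q0_def] vs.subspace_alt_on]) (use w2 r in auto)
    also have "\<dots> = (\<Sum>p<m. x p * f (p, r))" using r unfolding L(2) cc_def by simp
    also have "\<dots> = bil m f x (\<lambda>j. if j = r then 1 else 0)"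
     unfolding bil_def using r by (simp add: if_distrib if_distribR cong: if_cong)
    also have "\<dots> = 0" using f x r unfolding kil_def vecs_def by auto
    finally show ?thesis .
   qed
   have "L g = 0" if g: "g \<in> vs.alt0 V U" for g
   proof (rule ff.dual_ann_span_0[OF L(1)[unfolded Q0_def] vs.subspace_alt_on])
    show "g \<in> fspan {vs.wedge2 al be |al be. al \<in> vs.dual_ann V U & be \<in> vs.dual_ann V {0}}"
     using vs.alt0_span[OF U V(1,3)] g by blast
    show "{vs.wedge2 al be |al be. al \<in> vs.dual_ann V U & be \<in> vs.dual_ann V {0}} <= ?Alt"
     using vs.wedge2_alt[OF V(1)] by blast
    fix h assume "h \<in> {vs.wedge2 al be |al be. al \<in> vs.dual_ann V U & be \<in> vs.dual_ann V {0}}"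
    then obtain x be where h: "x \<in> N" "be \<in> vs.dual_ann V {0}" "h = vs.wedge2 (psi x) be" unfolding dU(2) by blast
    have px: "psi x \<in> vs.dual_ann V {0}" using psiD h(1) by blast
    have "L (h) = L (\<Sum>r<m. scl (be (v r)) (vs.wedge2 (psi x) (fi r)))"
     unfolding vs.wedge2_sum(2)[symmetric] h(3) using expand[OF h(2)] by simp
    also have "\<dots> = (\<Sum>r<m. be (v r) * L (vs.wedge2 (psi x) (fi r)))"
     by (rule ff.dual_ann_sum[OF L(1)[unfolded Q0_def] vs.subspace_alt_on]) (use vs.wedge2_alt[OF V(1) px b2] in auto)
    finally show "L h = 0" using xr[OF h(1)] by simp
   qed
   moreover have "L g = 0" if "g \<in> ?Lam" for g by (rule LD(4)) (use that in \<open>auto intro: fs.span_base\<close>)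
   ultimately have "L g = 0" if "g \<in> fspan (vs.alt0 V U \<union> ?Lam)" for g
    by (rule_tac ff.dual_ann_span_0[OF L(1)[unfolded Q0_def] vs.subspace_alt_on _ _ that]) (use Lam in \<open>auto simp: vs.alt0_def\<close>)
   then have "L \<in> QQ U {0} {0}"
    using L(1) unfolding QQ_def Q0_def ff.dual_ann_def vs.alt0_0 by blast
   then show "f \<in> cc ` QQ U {0} {0}" using L(2) by blast
  qed
  moreover have b00: "br x y \<in> {0}" if "x \<in> {0}" "y \<in> {0}" for x y using that by simp
  have U0': "{0} <= U" using vs.subspace_0[OF U(1)] by simp
  note qb = QQ_bound[OF U s0(1) U0' s0(1,3) b00]
  have sQ: "fsubspace (QQ U {0} {0})" unfolding QQ_def by (rule ff.subspace_dual_ann)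
  ultimately have "fdim (kil m R N) <= fdim (QQ U {0} {0})"
   using fs.dim_mono_fin[OF _ linear_image_fs(2)[OF ccl sQ qb(2)]] linear_image_fs(3)[OF ccl sQ qb(2)] order.trans by blast
  moreover have "brs U {0} = brs U {}" unfolding brs_def by (simp add: vs.span_insert_0)
  ultimately have "fdim (kil m R N) + vs.dim (brs U {}) <= fdim (vs.alt_on U)"
   using qb(1) by (simp add: vs.dim_zero)
  then show "fdim (kil m R N) + fdim N < m" using pos[OF U U0] dimU by linarith
 qed
 have alt1: "f (i, j) = - f (j, i)" and alt2: "f (i, i) = 0" if f: "f \<in> R" for f i j
 proof -
  obtain L where L: "L \<in> Q0" "f = cc L" using f unfolding R_def by blast
  note LD = ff.dual_annD[OF L(1)[unfolded Q0_def]]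
  have n: "L (- g) = - L g" if "g \<in> ?Alt" for g
  proof -
   have "- g = scl (- 1) g" by (simp add: fun_eq_iff fun_app)
   then show ?thesis using LD(3)[OF that, of "- 1"] by simp
  qed
  show "f (i, j) = - f (j, i)"
   using n[OF w2[of j i]] vs.wedge_swap(1)[of "fi i" "fi j"] unfolding L(2) cc_def by auto
  show "f (i, i) = 0"
   using LD(5) fs.subspace_0[OF vs.subspace_alt_on] vs.wedge_swap(2) unfolding L(2) cc_def by simp
 qed
 have tR: "t i j \<in> R" if "i < a" "j < b" for i j
  unfolding t_def R_def using Lw A(1) xB0 that by blast
 have fa: "\<forall>i<a. al i = 0" if z: "!!j. j < b ==> (\<Sum>i<a. scl (al i) (t i j)) = 0" for al
 proof -
  define w where "w = (\<Sum>i<a. scl (al i) (pa i))"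
  have w: "w \<in> obs" unfolding w_def by (intro fs.subspace_sum fs.subspace_scale obs_dim(3)) (use A(1) in auto)
  have "w = 0"
  proof (rule faith[OF w])
   fix j p r assume j: "j < b" and pr: "p < m" "r < m"
   have "w (vs.wedge3 (ch j) (vs.wedge2 (fi p) (fi r))) = (\<Sum>i<a. scl (al i) (t i j)) (p, r)"
    unfolding w_def by (simp add: sum_fun_apply fun_app tv[OF pr])
   then show "w (vs.wedge3 (ch j) (vs.wedge2 (fi p) (fi r))) = 0" unfolding z[OF j] by (simp add: fun_app)
  qed
  show ?thesis
  proof (intro allI impI)
   fix i assume i: "i < a"
   have "w (qa i) = (\<Sum>k<a. al k * (if k = i then 1 else 0))"
    unfolding w_def sum_fun_apply fun_app by (rule sum.cong[OF refl]) (use A(2) i in auto)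
   also have "\<dots> = al i" using i by (simp add: if_distrib cong: if_cong)
   finally show "al i = 0" using \<open>w = 0\<close> by (simp add: fun_app)
  qed
 qed
 have fb: "\<forall>j<b. be j = 0" if z: "!!i. i < a ==> (\<Sum>j<b. scl (be j) (t i j)) = 0" for be
 proof -
  define x where "x = (\<Sum>j<b. scl (be j) (ch j))"
  have xB: "x \<in> B" unfolding x_def by (intro fs.subspace_sum fs.subspace_scale B(1)) (use X(1) in auto)
  then have xV: "x \<in> vs.dual_ann V E1" using B(2) by blast
  have pz: "pa i (vs.wedge3 x g) = 0" if i: "i < a" and g: "g \<in> ?Alt" for i g
  proof -
   have o: "pa i \<in> obs" using A(1) i by blast
   have "pa i (vs.wedge3 x (vs.wedge2 (fi p) (fi r))) = 0" if pr: "p < m" "r < m" for p r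
   proof -
    have "pa i (vs.wedge3 x (vs.wedge2 (fi p) (fi r))) = (\<Sum>j<b. be j * pa i (vs.wedge3 (ch j) (vs.wedge2 (fi p) (fi r))))"
     unfolding x_def vs.wedge3_sum
     by (rule ff.dual_ann_sum[OF oD[OF o] T0(1)]) (use wedge3_T0[OF xB0 w2[OF pr]] in auto)
    also have "\<dots> = (\<Sum>j<b. scl (be j) (t i j)) (p, r)" by (simp add: sum_fun_apply fun_app tv[OF pr])
    finally show ?thesis unfolding z[OF i] by (simp add: fun_app)
   qed
   then show ?thesis using kill[OF Lw[OF o xV, unfolded Q0_def] _ g] w2 g by simp
  qed
  have "x \<in> ann" unfolding ann_def
  proof (intro CollectI conjI ballI xV)
   fix w g assume w: "w \<in> obs" and g: "g \<in> ?Alt"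
   have "w (vs.wedge3 x g) = (\<Sum>i<a. scl (w (qa i)) (pa i)) (vs.wedge3 x g)" using A(3) w by auto
   then show "w (vs.wedge3 x g) = 0" using pz[OF _ g] by (simp add: sum_fun_apply fun_app)
  qed
  then have "x = 0" using xB B(3) by blast
  show ?thesis
  proof (intro allI impI)
   fix i assume i: "i < b"
   have "x (qb i) = (\<Sum>k<b. be k * (if k = i then 1 else 0))"
    unfolding x_def sum_fun_apply fun_app by (rule sum.cong[OF refl]) (use X(2) i in auto)
   also have "\<dots> = be i" using i by (simp add: if_distrib cong: if_cong)
   finally show "be i = 0" using \<open>x = 0\<close> by (simp add: fun_app)
  qed
 qed
 have main: "a + b <= fdim (fspan {(\<lambda>(j, r). if j < b & r < m then t i j (p, r) else 0) |i p. i < a & p < m})"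
 proof (rule alternating_rank_bound[OF Rs Rsq posR])
  show "f (i, j) = - f (j, i)" if "f \<in> R" for f i j by (rule alt1[OF that])
  show "f (i, i) = 0" if "f \<in> R" for f i by (rule alt2[OF that])
  show "t i j \<in> R" if "i < a" "j < b" for i j by (rule tR[OF that])
  show "\<forall>i<a. al i = 0" if "!!j. j < b ==> (\<Sum>i<a. scl (al i) (t i j)) = 0" for al by (rule fa) (rule that)
  show "\<forall>j<b. be j = 0" if "!!i. i < a ==> (\<Sum>j<b. scl (be j) (t i j)) = 0" for be by (rule fb) (rule that)
 qed (rule a0 b0)+
 \<comment> \<open>Reads off the coordinates of a bivector; the sign is the one produced by
   exchanging \<open>ch j\<close> with \<open>fi p\<close>.\<close>
 define ee where "ee L = (\<lambda>(j, r). if j < b & r < m then - L (vs.wedge2 (ch j) (fi r)) else 0)" for L :: "('a \<times> 'a => 'k) => 'k"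
 have eel: "flin ee" by (rule linear_fsI) (auto simp: ee_def fun_app)
 have qb1: "fdim (QQ Z E1 E2) + vs.dim (brs Z E2) + fdim (vs.alt_on E1) <= fdim (vs.alt_on Z) + vs.dim E2"
  by (rule QQ_bound(1)[OF Z(1,2) E1(1) Z(3) E2 brE])
 have qb2: "ffin_dim (QQ Z E1 E2)" by (rule QQ_bound(2)[OF Z(1,2) E1(1) Z(3) E2 brE])
 note qb = qb1 qb2
 have sQ: "fsubspace (QQ Z E1 E2)" unfolding QQ_def by (rule ff.subspace_dual_ann)
 have a1: "vs.wedge2 (ch j) (fi r) \<in> vs.alt0 V E1" if "j < b" "r < m" for j r
  unfolding vs.alt0_def using vs.wedge2_alt[OF V(1) xB0[OF that(1)] b2[OF that(2)]] vs.dual_annD(4)[OF xB0[OF that(1)]]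
  by (simp add: vs.wedge2_def)
 \<comment> \<open>Here an arbitrary functional \<open>ps\<close> is contracted and only forms
   vanishing on \<open>E1\<close> are inserted. Forms vanishing on \<open>Z\<close> are spanned by
   products with a factor in \<open>ann\<close>, and moving that factor to the front gives 0. Thus
   the result is a bracket relation on \<open>Z\<close> modulo E.\<close>
 have Lz: "(\<lambda>g. if g \<in> vs.alt0 V E1 then w (vs.wedge3 ps g) else 0) \<in> QQ Z E1 E2" if w: "w \<in> obs" and p: "ps \<in> vs.dual_ann V {0}" for w ps
 proof -
  define L where "L = (\<lambda>g. if g \<in> vs.alt0 V E1 then w (vs.wedge3 ps g) else 0)"
  have L: "L \<in> ff.dual_ann (vs.alt0 V E1) (fspan {})" unfolding L_def
  proof (rule ff.dual_annI[OF vs.subspace_alt0])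
   show "w (vs.wedge3 ps (g + h)) = w (vs.wedge3 ps g) + w (vs.wedge3 ps h)" if "g \<in> vs.alt0 V E1" "h \<in> vs.alt0 V E1" for g h
    unfolding vs.wedge_add by (rule od(2)[OF w wedge3_T0'[OF p that(1)] wedge3_T0'[OF p that(2)]])
   show "w (vs.wedge3 ps (scl c g)) = c * w (vs.wedge3 ps g)" if "g \<in> vs.alt0 V E1" for g c
    unfolding vs.wedge_add by (rule od(3)[OF w wedge3_T0'[OF p that]])
  qed auto
  have lE: "lb l \<in> vs.alt0 V E1" if l: "l \<in> vs.dual_ann W E2" for l
   unfolding vs.alt0_def lb_def[of l] using lb_alt[OF l, unfolded lb_def] vs.dual_annD(4)[OF l] brE by auto
  have l0: "L (lb l) = 0" if l: "l \<in> vs.dual_ann W E2" for l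
   unfolding L_def using od(4)[OF w wedge3_lb[OF p l]] by simp
  have wE: "vs.wedge2 al be \<in> vs.alt0 V E1" "L (vs.wedge2 al be) = 0" if h: "al \<in> ann" "be \<in> vs.dual_ann V {0}" for al be
  proof -
   have aE: "al \<in> vs.dual_ann V E1" using h(1) annB by blast
   show "vs.wedge2 al be \<in> vs.alt0 V E1"
    unfolding vs.alt0_def using vs.wedge2_alt[OF V(1) aE h(2)] vs.dual_annD(4)[OF aE] by (auto simp: vs.wedge2_def)
   have pb: "vs.wedge2 ps be \<in> ?Alt" by (rule vs.wedge2_alt[OF V(1) p h(2)])
   have "w (vs.wedge3 ps (vs.wedge2 al be)) = - w (vs.wedge3 al (vs.wedge2 ps be))"
    unfolding vs.wedge_swap(3)[of ps al] by (rule oneg[OF w wedge3_T0[OF aE pb]])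
   also have "\<dots> = 0" using h(1) w pb unfolding ann_def by simp
   finally show "L (vs.wedge2 al be) = 0" unfolding L_def by simp
  qed
  have z0: "L g = 0" if g: "g \<in> vs.alt0 V Z" for g
   by (rule ff.dual_ann_span_0[OF L vs.subspace_alt0 _ _ subsetD[OF vs.alt0_span[OF Z(1,2) V(1,3)] g]])
    (use wE in \<open>auto simp: da(2)\<close>)
  have zE: "vs.alt0 V Z <= vs.alt0 V E1" unfolding vs.alt0_def using Z(3) by blast
  have "L g = 0" if "g \<in> fspan (vs.alt0 V Z \<union> lb ` vs.dual_ann W E2)" for g
   by (rule ff.dual_ann_span_0[OF L vs.subspace_alt0 _ _ that]) (use z0 l0 lE zE in auto)
  then have "L \<in> QQ Z E1 E2" using L unfolding QQ_def ff.dual_ann_def by blast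
  then show ?thesis unfolding L_def .
 qed
 have "fspan {(\<lambda>(j, r). if j < b & r < m then t i j (p, r) else 0) |i p. i < a & p < m} <= ee ` QQ Z E1 E2"
 proof (rule fs.span_minimal[OF _ linear_image_fs(1)[OF eel sQ qb(2)]], clarify)
  fix i p assume i: "i < a" and p: "p < m"
  have o: "pa i \<in> obs" using A(1) i by blast
  have "(\<lambda>(j, r). if j < b & r < m then t i j (p, r) else 0) =
    ee (\<lambda>g. if g \<in> vs.alt0 V E1 then pa i (vs.wedge3 (fi p) g) else 0)"
  proof (rule ext, clarify)
   fix j r
   show "(if j < b & r < m then t i j (p, r) else 0) =
    ee (\<lambda>g. if g \<in> vs.alt0 V E1 then pa i (vs.wedge3 (fi p) g) else 0) (j, r)"
   proof (cases "j < b & r < m")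
    case True
    have "t i j (p, r) = - pa i (vs.wedge3 (fi p) (vs.wedge2 (ch j) (fi r)))"
     unfolding tv[OF p conjunct2[OF True]] vs.wedge_swap(3)[of "ch j" "fi p"]
     by (rule oneg[OF o wedge3_T0'[OF b2[OF p]]]) (use a1 True in blast)
    then show ?thesis using True a1 unfolding ee_def by simp
   next
    case False
    then show ?thesis unfolding ee_def by auto
   qed
  qed
  then show "(\<lambda>(j, r). if j < b & r < m then t i j (p, r) else 0) \<in> ee ` QQ Z E1 E2"
   using Lz[OF o b2[OF p]] by blast
 qed
 \<comment> \<open>The rows of the array lie in the image of \<open>QQ Z E1 E2\<close> under
   \<open>ee\<close>. Inserting \<open>qb1\<close> and the value of \<open>b\<close> yields the
   claim.\<close>
 then have "a + b <= fdim (QQ Z E1 E2)"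
  using main fs.dim_mono_fin[OF _ linear_image_fs(2)[OF eel sQ qb(2)]] linear_image_fs(3)[OF eel sQ qb(2)] by (meson order.trans)
 then have "fdim obs + vs.dim Z + vs.dim (brs Z E2) + fdim (vs.alt_on E1) <= vs.dim E1 + vs.dim E2 + fdim (vs.alt_on Z)"
  using qb(1) bz unfolding a_def by linarith
 then show ?thesis using Z by blast
qed

end

section \<open>Strong closures\<close>

context bracket_extension begin

text \<open>A functional on the enlarged degree 3 part that kills \<open>E3\<close> becomes, by
  composition with the bracket, a member of \<open>jac V W\<close> vanishing on
  \<open>E1 \<times> E2\<close>, and it can be recovered since the new part is spanned by brackets
  modulo \<open>E3\<close>. New elements of degree 3 are thus paid for by new forms.\<close>

lemma bracket3_bound:
 assumes E3: "vs.subspace E3" "E3 <= G 3" "finite E3" and br3: "!!x y. x \<in> E1 ==> y \<in> E2 ==> br x y \<in> E3"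
 shows "vs.dim (vs.span (E3 \<union> {br x y |x y. x \<in> V & y \<in> W})) + fdim (restr (E1 \<times> E2) ` jac V W)
   <= vs.dim E3 + fdim (jac V W)"
proof -
 define S where "S = vs.span (E3 \<union> {br x y |x y. x \<in> V & y \<in> W})"
 have S: "vs.subspace S" "E3 <= S" "finite S"
  unfolding S_def using E3(3) finite_brackets[OF V(3) W(3)] by (auto intro: vs.span_base vs.finite_span)
 have Sb: "br x y \<in> S" if "x \<in> V" "y \<in> W" for x y unfolding S_def using that by (intro vs.span_base) blast
 have Wc: "y \<in> W ==> y \<in> carrier M" for y using W(2) Gc by blast
 define lc where "lc l = (\<lambda>p. if p \<in> V \<times> W then l (br (fst p) (snd p)) else 0)" for l :: "'a => 'k"
 have lcl: "flin lc" by (rule linear_fsI) (auto simp: lc_def fun_app)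
 let ?D = "vs.dual_ann S E3"
 note fd = vs.fdim_dual_ann[OF S(1) E3(1) S(2,3)]
 have sub: "lc ` ?D <= {b\<in>jac V W. restr (E1 \<times> E2) b = 0}"
 proof clarify
  fix l assume l: "l \<in> ?D"
  note d = vs.dual_annD[OF l]
  have "lc l \<in> vs.bil_on V W"
   unfolding vs.bil_on_def lc_def
   using vs.subspace_add[OF V(1)] vs.subspace_scale[OF V(1)] vs.subspace_add[OF W(1)] vs.subspace_scale[OF W(1)] Sb
   by (simp add: Vc Wc br_add_left br_add_right br_smul_left br_smul_right d)
  moreover have "lc l (x, br y z) + lc l (y, br z x) + lc l (z, br x y) = 0" if x: "x \<in> V" "y \<in> V" "z \<in> V" for x y z
  proof -
   have b: "br x (br y z) \<in> S" "br y (br z x) \<in> S" "br z (br x y) \<in> S" using Sb brW x by blast+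
   have "l (br x (br y z)) + l (br y (br z x)) + l (br z (br x y)) = l (br x (br y z) + br y (br z x) + br z (br x y))"
    using d(2)[OF b(1,2)] d(2)[OF vs.subspace_add[OF S(1) b(1,2)] b(3)] by simp
   also have "\<dots> = 0" using jacobi[OF Vc[OF x(1)] Vc[OF x(2)] Vc[OF x(3)]] d(5) vs.subspace_0[OF S(1)] by simp
   finally show ?thesis using x brW unfolding lc_def by simp
  qed
  moreover have "restr (E1 \<times> E2) (lc l) = 0"
   unfolding restr_def lc_def using d(4) br3 by (auto simp: fun_eq_iff fun_app)
  ultimately show "lc l \<in> jac V W & restr (E1 \<times> E2) (lc l) = 0" unfolding jac_def by blast
 qed
 have k: "{l\<in>?D. lc l = 0} = {0}"
 proof (intro equalityI subsetI)
  fix l assume "l \<in> {l\<in>?D. lc l = 0}"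
  then have l: "l \<in> ?D" and z: "lc l = 0" by auto
  have z': "l (br x y) = 0" if "x \<in> V" "y \<in> W" for x y
   using fun_cong[OF z, of "(x, y)"] that unfolding lc_def by (simp add: fun_app)
  have "l x = 0" for x
  proof (cases "x \<in> S")
   case True
   show ?thesis
    by (rule vs.dual_ann_span_0[OF l S(1) _ _ True[unfolded S_def]]) (use S(2) Sb z' vs.dual_annD(4)[OF l] in auto)
  qed (use vs.dual_annD(1)[OF l] in auto)
  then show "l \<in> {0}" by (auto simp: fun_eq_iff fun_app)
 next
  fix l :: "'a => 'k" assume "l \<in> {0}"
  then have "l = 0" by simp
  moreover have "lc 0 = 0" by (auto simp: lc_def fun_eq_iff fun_app)
  ultimately show "l \<in> {l\<in>?D. lc l = 0}" using fs.subspace_0[OF vs.subspace_dual_ann] by simp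
 qed
 have "fdim ?D = fdim (lc ` ?D)"
  using fsp.rank_nullity(1)[OF lcl vs.subspace_dual_ann fd(2)] unfolding k by (simp add: fs.dim_zero)
 also have "\<dots> <= fdim {b\<in>jac V W. restr (E1 \<times> E2) b = 0}"
  by (rule fs.dim_mono_fin[OF sub fs.fin_dim_mono[OF _ jac_fin[OF V(3) W(3)]]]) blast
 finally show ?thesis
  using fd(1) fsp.rank_nullity(1)[OF linear_restr[of "E1 \<times> E2"] subspace_jac[of V W] jac_fin[OF V(3) W(3)]]
  unfolding S_def[symmetric] by linarith
qed

end

context lie3 begin

lemma restrict_formula:
 assumes A: "substructure M A" and fin: "finite A"
 shows "delta (restrict_to M A) 2 = int (vs.dim (A \<inter> G 1)) + int (vs.dim (A \<inter> G 2)) - int (fdim (vs.alt_on (A \<inter> G 1)))"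
  "delta (restrict_to M A) 3 = delta (restrict_to M A) 2 + int (vs.dim (A \<inter> G 3)) - int (fdim (jac (A \<inter> G 1) (A \<inter> G 2)))"
  "o_dim (restrict_to M A) 1 = vs.dim (A \<inter> G 1)"
  "o_dim (restrict_to M A) 2 + vs.dim (vs.span {br x y |x y. x \<in> A \<inter> G 1 & y \<in> A \<inter> G 1}) = vs.dim (A \<inter> G 2)"
  "o_dim (restrict_to M A) 3 + vs.dim (vs.span {br x y |x y. x \<in> A \<inter> G 1 & y \<in> A \<inter> G 2}) = vs.dim (A \<inter> G 3)"
proof -
 interpret N: lie3 "restrict_to M A" by unfold_locales (rule restrict_lie[OF A])
 have f: "finite (carrier (restrict_to M A))" unfolding carrier_restrict[OF A] by (rule fin)
 have g: "G i \<inter> A = A \<inter> G i" for i by (rule Int_commute)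
 have j: "N.jac U W = jac U W" for U W unfolding N.jac_def jac_def restrict_sel ..
 show "delta (restrict_to M A) 2 = int (vs.dim (A \<inter> G 1)) + int (vs.dim (A \<inter> G 2)) - int (fdim (vs.alt_on (A \<inter> G 1)))"
  using N.delta_formula(1)[OF f] unfolding restrict_sel g .
 show "delta (restrict_to M A) 3 = delta (restrict_to M A) 2 + int (vs.dim (A \<inter> G 3)) - int (fdim (jac (A \<inter> G 1) (A \<inter> G 2)))"
  using N.delta_formula(2)[OF f] unfolding restrict_sel g j .
 show "o_dim (restrict_to M A) 1 = vs.dim (A \<inter> G 1)" using N.o_dim_eq(1)[OF f] unfolding restrict_sel g .
 show "o_dim (restrict_to M A) 2 + vs.dim (vs.span {br x y |x y. x \<in> A \<inter> G 1 & y \<in> A \<inter> G 1}) = vs.dim (A \<inter> G 2)"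
  using N.o_dim_eq(2)[OF f] unfolding N.D2_def restrict_sel g .
 show "o_dim (restrict_to M A) 3 + vs.dim (vs.span {br x y |x y. x \<in> A \<inter> G 1 & y \<in> A \<inter> G 2}) = vs.dim (A \<inter> G 3)"
  using N.o_dim_eq(3)[OF f] unfolding N.D3_def restrict_sel g .
qed

text \<open>A line inside one degree has o-dimension 1, so condition (ii) makes it strong. It is
  contained in every substructure containing \<open>x\<close>, and so provides lower bounds for
  \<open>delta\<close>.\<close>

lemma line_strong:
 assumes K: "class_K3 M" and x: "x \<in> G i" "x ~= 0"
 shows "\<exists>A. strong M A & (\<forall>E. substructure M E --> x \<in> E --> A <= E) & (i = 1 --> A \<inter> G 1 = vs.span {x} & A \<inter> G 2 = {0})"
proof -
 have i: "i = 1 \<or> i = 2 \<or> i = 3" using x G_other[of i] by blast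
 define L where "L j = (if j = i then vs.span {x} else {0})" for j
 have L: "vs.subspace (L j)" for j unfolding L_def by (simp add: vs.subspace_single_0)
 have spG: "vs.span {x} <= G i" by (rule vs.span_minimal[OF _ G_sub]) (use x in simp)
 have LG: "L j <= G j" for j unfolding L_def using spG by simp
 have xc: "x \<in> carrier M" by (rule Gc[OF x(1)])
 have line: "\<exists>c. y = smul M c x" if "y \<in> vs.span {x}" for y using that unfolding vs.span_singleton by blast
 have br0: "br y z = 0" if y: "y \<in> L j" and z: "z \<in> L k" for y z j k
 proof -
  consider "y = 0" | "z = 0" | "y \<in> vs.span {x}" "z \<in> vs.span {x}" using y z unfolding L_def by (auto split: if_splits)
  then show ?thesis
  proof cases
   case 3
   then obtain c d where "y = smul M c x" "z = smul M d x" using line by blast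
   then show ?thesis using xc vs.subspace_scale[OF carrier_subspace xc] by (simp add: br_smul_left br_smul_right br_self)
  qed (use br_0(1)[OF Gc[OF subsetD[OF LG z]]] br_0(2)[OF Gc[OF subsetD[OF LG y]]] in auto)
 qed
 let ?A = "comb (L 1) (L 2) (L 3)"
 have z: "0 \<in> L j" for j by (rule vs.subspace_0[OF L])
 note cs = comb_substructure[OF L[of 1] L[of 2] L[of 3] LG[of 1] LG[of 2] LG[of 3]]
 have p1: "br x y \<in> L 2" if "x \<in> L 1" "y \<in> L 1" for x y using br0[OF that] z by simp
 have p2: "br x y \<in> L 3" if "x \<in> L 1" "y \<in> L 2" for x y using br0[OF that] z by simp
 have A: "substructure M ?A" "?A \<inter> G 1 = L 1" "?A \<inter> G 2 = L 2" "?A \<inter> G 3 = L 3"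
  by (rule cs(1)[OF p1 p2], assumption+) (rule cs(2)[OF p1 p2] cs(3)[OF p1 p2] cs(4)[OF p1 p2], assumption+)+
 have fL: "finite (L j)" for j unfolding L_def using vs.finite_span[of "{x}"] by simp
 have fA: "finite ?A" by (rule finite_comb[OF fL fL fL])
 note F = restrict_formula[OF A(1) fA, unfolded A(2-4)]
 have b: "{br y z |y z. y \<in> L j & z \<in> L k} = {0}" for j k using br0 br0[OF z z] z by (auto intro!: exI[of _ "0 :: 'a"])
 have dL: "vs.dim (L j) = (if j = i then 1 else 0)" for j
  unfolding L_def using x(2) vs.dim_eq_card_independent[of "{x}"] by (simp add: vs.dim_zero vs.dependent_single)
 have "{1..3::nat} = {1, 2, 3}" by auto
 then have "(\<Sum>j=1..3. o_dim (restrict_to M ?A) j) = 1"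
  using F(3-5) i unfolding b dL by (auto simp: vs.dim_zero)
 then have "strong M ?A" using K A(1) fA unfolding class_K3_def by simp
 moreover have "?A <= E" if E: "substructure M E" "x \<in> E" for E
 proof -
  have "L j <= E" for j
   unfolding L_def using vs.span_minimal[OF _ substructureD(2)[OF E(1)], of "{x}"] E vs.subspace_0[OF substructureD(2)[OF E(1)]] by simp
  then show ?thesis unfolding comb_def using vs.subspace_add[OF substructureD(2)[OF E(1)]] by blast
 qed
 ultimately show ?thesis using A(2,3) by (intro exI[of _ ?A]) (auto simp: L_def)
qed

text \<open>A line of degree 1 is strong and has \<open>delta\<close> equal to 1 in degree 2, so the
  subalgebra generated by \<open>U\<close> has at least this value.\<close>

lemma positivity:
 assumes K: "class_K3 M" and U: "vs.subspace U" "U <= G 1" "finite U" "U ~= {0}"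
 shows "fdim (vs.alt_on U) < vs.dim U + vs.dim (brs U {})"
proof -
 obtain x where x: "x \<in> U" "x ~= 0" using U(4) vs.subspace_0[OF U(1)] by blast
 have xG: "x \<in> G 1" using x(1) U(2) by blast
 obtain A where A: "strong M A" "\<forall>E. substructure M E --> x \<in> E --> A <= E" "A \<inter> G 1 = vs.span {x}" "A \<inter> G 2 = {0}"
  using line_strong[OF K xG x(2)] by blast
 have ge: "generated M U \<inter> G 1 = U" "generated M U \<inter> G 2 = brs U {}"
  using generated_explicit(2,3)[OF U(2), of "{}" "{}"] vs.span_eq_iff[THEN iffD2, OF U(1)] unfolding brs_def by auto
 have Uc: "U <= carrier M" using U(2) Gc by blast
 have E: "substructure M (generated M U)" "finite (generated M U)"
  by (rule generated_substructure[OF Uc], rule finite_generated[OF U(3) Uc])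
 have "x \<in> generated M U" using generated_incl[of U] x(1) by blast
 then have le: "delta (restrict_to M A) 2 <= delta (restrict_to M (generated M U)) 2"
  using A(1,2) E unfolding strong_def by simp
 have SA: "substructure M A" "finite A" using A(1) unfolding strong_def by blast+
 have "vs.alt_on (vs.span {x}) = {0}"
 proof (intro equalityI subsetI)
  fix b assume b: "b \<in> vs.alt_on (vs.span {x})"
  note B = vs.bil_onD[OF vs.alt_onD(1)[OF b]]
  have xs: "x \<in> vs.span {x}" by (simp add: vs.span_base)
  have "b (y, z) = 0" for y z
  proof (cases "(y, z) \<in> vs.span {x} \<times> vs.span {x}")
   case True
   then obtain c d where "y = smul M c x" "z = smul M d x" unfolding vs.span_singleton by blast
   then show ?thesis
    using B(4)[OF xs vs.span_scale[OF xs], of c d] B(5)[OF xs xs, of d] vs.alt_onD(2)[OF b xs] by simp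
  qed (rule B(1))
  then show "b \<in> {0}" by (auto simp: fun_eq_iff fun_app)
 qed (use fs.subspace_0[OF vs.subspace_alt_on] in auto)
 moreover have "vs.dim (vs.span {x}) = 1"
  using x(2) vs.dim_eq_card_independent[of "{x}"] by (simp add: vs.dependent_single)
 ultimately have "delta (restrict_to M A) 2 = 1"
  using restrict_formula(1)[OF SA] unfolding A(3,4) by (simp add: vs.dim_zero fs.dim_zero)
 then show ?thesis using le restrict_formula(1)[OF E] unfolding ge by linarith
qed

text \<open>\<open>delta\<close> is an integer, so minima exist only after a lower bound has been
  found.\<close>

lemma int_least:
 fixes f :: "'c => int"
 assumes "P x0" "!!x. P x ==> c <= f x"
 shows "\<exists>x. P x & (\<forall>y. P y --> f x <= f y)"
proof -
 obtain x where x: "P x" "\<forall>y. P y --> nat (f x - c) <= nat (f y - c)"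
  using ex_has_least_nat[of P x0 "\<lambda>x. nat (f x - c)"] assms(1) by blast
 have "f x <= f y" if y: "P y" for y
  using x(2)[rule_format, OF y] assms(2)[OF y] assms(2)[OF x(1)] by linarith
 then show ?thesis using x(1) by blast
qed

theorem strong_closure:
 assumes K: "class_K3 M" and D: "finite D" "D <= carrier M"
 shows "\<exists>C. strong M C & D <= C"
\<comment> \<open>Condition (ii) gives lower bounds only above a nonzero element, so the zero
  algebra is treated apart.\<close>
proof (cases "carrier M = {0}")
 case True
 have "strong M (carrier M)" unfolding strong_def
 proof (intro conjI allI impI)
  show "substructure M (carrier M)" by (rule carrier_substructure)
  show "finite (carrier M)" unfolding True by simp
  fix E assume "substructure M E & finite E & carrier M <= E"
  then have "E = carrier M" using substructureD(1) by blast
  then show "\<forall>j\<in>{2, 3}. delta (restrict_to M (carrier M)) j <= delta (restrict_to M E) j" by simp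
 qed
 then show ?thesis using D(2) by blast
next
 case False
 then obtain y where y: "y \<in> carrier M" "y ~= 0" using carrier_0 by blast
 have "\<exists>i. proj M i y ~= 0"
 proof (rule ccontr)
  assume "\<nexists>i. proj M i y ~= 0"
  then have z: "proj M i y = 0" for i by blast
  show False using proj_decomp[OF y(1)] y(2) unfolding z by simp
 qed
 then obtain i where i: "proj M i y ~= 0" by blast
 define x where "x = proj M i y"
 have x: "x \<in> G i" "x ~= 0" unfolding x_def using proj_G[OF y(1)] i by auto
 obtain A where A: "strong M A" "\<forall>E. substructure M E --> x \<in> E --> A <= E"
  using line_strong[OF K x] by blast
 \<comment> \<open>Inserting \<open>x\<close> puts the strong line \<open>A\<close> below every
   candidate.\<close>
 let ?D = "insert x D"
 have D': "finite ?D" "?D <= carrier M" using D Gc[OF x(1)] by auto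
 define P where "P E \<longleftrightarrow> substructure M E & finite E & ?D <= E" for E
 let ?d = "\<lambda>E. delta (restrict_to M E)"
 have P0: "P (generated M ?D)" unfolding P_def
  using generated_substructure[OF D'(2)] finite_generated[OF D'] generated_incl by blast
 have low: "?d A j <= ?d E j" if "P E" "j \<in> {2, 3}" for E j
  using A that unfolding P_def strong_def by blast
 obtain E0 where E0: "P E0" "\<forall>E. P E --> ?d E0 3 <= ?d E 3"
  using int_least[of P "generated M ?D" "?d A 3" "\<lambda>E. ?d E 3"] P0 low by blast
 obtain E where E: "P E" "?d E 3 <= ?d E0 3" "\<forall>E'. P E' & ?d E' 3 <= ?d E0 3 --> ?d E 2 <= ?d E' 2"
  using int_least[of "\<lambda>E. P E & ?d E 3 <= ?d E0 3" E0 "?d A 2" "\<lambda>E. ?d E 2"] E0(1) low by blast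
 have min3: "?d E 3 <= ?d E' 3" if "P E'" for E' using E0(2) E(2) that by force
 have min2: "?d E 2 <= ?d E' 2" if "P E'" "?d E' 3 <= ?d E 3" for E' using E(2,3) that by force
 have SE: "substructure M E" and fE: "finite E" and DE: "?D <= E" using E(1) unfolding P_def by blast+
 have "?d E 2 <= ?d E' 2" if SE': "substructure M E'" and fE': "finite E'" and EE': "E <= E'" for E'
 proof (rule ccontr)
  assume "\<not> ?d E 2 <= ?d E' 2"
  then have lt: "?d E' 2 < ?d E 2" by simp
  define E1 E2 E3 where E123: "E1 = E \<inter> G 1" "E2 = E \<inter> G 2" "E3 = E \<inter> G 3"
  have sE: "vs.subspace E1" "vs.subspace E2" "vs.subspace E3" unfolding E123 by (rule substructureD(6)[OF SE])+
  have fE1: "finite E1" "finite E2" "finite E3" using fE unfolding E123 by auto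
  have brE: "br x y \<in> E2" if "x \<in> E1" "y \<in> E1" for x y
   using that br_G11 substructureD(4)[OF SE] unfolding E123 by blast
  have brE3: "br x y \<in> E3" if "x \<in> E1" "y \<in> E2" for x y
   using that br_G12 substructureD(4)[OF SE] unfolding E123 by blast
  \<comment> \<open>At \<open>E1\<close> this is the degree 2 value of \<open>E\<close>, and at the
    degree 1 part of \<open>E'\<close> it is at most that of \<open>E'\<close>. A minimiser in
    between therefore still improves on \<open>E\<close>.\<close>
  define dv where "dv U = int (vs.dim U) + int (vs.dim (brs U E2)) - int (fdim (vs.alt_on U))" for U
  let ?S = "{U. vs.subspace U & E1 <= U & U <= E' \<inter> G 1}"
  have E1S: "E1 \<in> ?S" using sE(1) EE' unfolding E123 by blast
  have "finite ?S" by (rule finite_subset[of _ "Pow E'"]) (use fE' in auto)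
  then have "\<exists>V. is_arg_min dv (\<lambda>U. U \<in> ?S) V"
   by (rule ex_is_arg_min_if_finite) (use E1S in blast)
  then obtain V where V0: "is_arg_min dv (\<lambda>U. U \<in> ?S) V" by (rule exE)
  have V: "V \<in> ?S" "\<forall>U\<in>?S. dv V <= dv U"
   using V0 unfolding is_arg_min_def by (blast, meson not_le)
  have V1: "vs.subspace V" "E1 <= V" "V <= G 1" "V <= E'" using V(1) by blast+
  have fV: "finite V" using V1(4) fE' finite_subset by blast
  have b1: "brs E1 E2 = E2"
  proof
   show "brs E1 E2 <= E2" unfolding brs_def by (rule vs.span_minimal[OF _ sE(2)]) (auto intro: brE)
   show "E2 <= brs E1 E2" unfolding brs_def by (auto intro: vs.span_base)
  qed
  have dE: "?d E 2 = dv E1" using restrict_formula(1)[OF SE fE, folded E123] unfolding dv_def b1 .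
  have "brs (E' \<inter> G 1) E2 <= E' \<inter> G 2" unfolding brs_def
   by (rule vs.span_minimal[OF _ substructureD(6)[OF SE']])
    (use EE' br_G11 substructureD(4)[OF SE'] in \<open>auto simp: E123 simp del: One_nat_def\<close>)
  then have "vs.dim (brs (E' \<inter> G 1) E2) <= vs.dim (E' \<inter> G 2)"
   by (rule vs.dim_mono_fin[OF _ vs.fin_dim_finite]) (use fE' in auto)
  then have "dv (E' \<inter> G 1) <= ?d E' 2" unfolding restrict_formula(1)[OF SE' fE'] dv_def by linarith
  moreover have "dv V <= dv (E' \<inter> G 1)"
   using V(2) substructureD(6)[OF SE', of 1] EE' unfolding E123 by blast
  ultimately have dVE: "dv V < ?d E 2" using lt by linarith
  define W where "W = brs V E2"
  have W: "vs.subspace W" "E2 <= W" "W <= G 2" "finite W"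
  proof -
   show "vs.subspace W" "E2 <= W" unfolding W_def brs_def by (auto intro: vs.span_base)
   show "W <= G 2" unfolding W_def brs_def
    by (rule vs.span_minimal[OF _ G_sub]) (use br_G11 V1(3) in \<open>auto simp: E123 simp del: One_nat_def\<close>)
   show "finite W" unfolding W_def brs_def by (rule vs.finite_span) (use fE1 finite_brackets[OF fV fV] in simp)
  qed
  have brV: "br x y \<in> W" if "x \<in> V" "y \<in> V" for x y unfolding W_def brs_def using that by (intro vs.span_base) blast
  interpret X: bracket_extension M V W E1 E2
   by unfold_locales (use V1 fV W brV sE brE in auto)
  have pos: "fdim (vs.alt_on U) < vs.dim U + vs.dim (brs U {})" if "vs.subspace U" "U <= V" "U ~= {0}" for U
   by (rule positivity[OF K that(1) _ _ that(3)]) (use that(2) V1(3) fV finite_subset in blast)+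
  obtain Z where Z: "vs.subspace Z" "E1 <= Z" "Z <= V"
   "fdim X.obs + vs.dim Z + vs.dim (brs Z E2) + fdim (vs.alt_on E1) <= vs.dim E1 + vs.dim E2 + fdim (vs.alt_on Z)"
   using X.deficiency_bound[OF pos] by blast
  \<comment> \<open>\<open>Z\<close> competes with \<open>V\<close> for the minimum, so the number
    of obstructions is at most the drop from \<open>dv E1\<close> to \<open>dv V\<close>.\<close>
  have "Z \<in> ?S" using Z V1 by blast
  then have dZ: "dv V <= dv Z" using V(2) by blast
  have ZE: "int (fdim X.obs) <= dv E1 - dv Z" using Z(4) unfolding dv_def b1 by linarith
  have E3G: "E3 <= G 3" "E2 <= G 2" unfolding E123 by blast+
  note b3 = X.bracket3_bound[OF sE(3) E3G(1) fE1(3) brE3]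
  let ?E = "generated M (V \<union> E2 \<union> E3)"
  have spV: "vs.span V = V" using V1(1) by (simp add: vs.span_eq_iff)
  note ge = generated_explicit[OF V1(3) E3G(2,1), unfolded spV, folded brs_def[of V E2] W_def]
  have c: "V \<union> E2 \<union> E3 <= carrier M" using V1(3) E3G Gc by blast
  have SE'': "substructure M ?E" by (rule generated_substructure[OF c])
  have fE'': "finite ?E" by (rule finite_generated[OF _ c]) (use fV fE1 in simp)
  have "E <= ?E"
  proof
   fix x assume x: "x \<in> E"
   have "E = comb E1 E2 E3" unfolding E123 by (rule substructureD(5)[OF SE])
   then obtain a b c where abc: "x = a + b + c" "a \<in> E1" "b \<in> E2" "c \<in> E3" using x unfolding comb_def by blast
   then have "a \<in> ?E" "b \<in> ?E" "c \<in> ?E" using generated_incl[of "V \<union> E2 \<union> E3"] V1(2) by blast+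
   then show "x \<in> ?E" unfolding abc(1) using vs.subspace_add[OF substructureD(2)[OF SE'']] by blast
  qed
  then have PE: "P ?E" using SE'' fE'' DE unfolding P_def by blast
  have d2: "?d ?E 2 = dv V" unfolding restrict_formula(1)[OF SE'' fE''] ge(2,3) dv_def W_def ..
  have d3: "?d ?E 3 = dv V + int (vs.dim (vs.span (E3 \<union> {br x y |x y. x \<in> V & y \<in> W}))) - int (fdim (jac V W))"
   unfolding restrict_formula(2)[OF SE'' fE''] d2 ge(2-4) ..
  have "?d E 3 = dv E1 + int (vs.dim E3) - int (fdim (jac E1 E2))"
   using restrict_formula(2)[OF SE fE, folded E123] unfolding dE .
  \<comment> \<open>The drop in degree 2 is passed on to degree 3. New elements there are balanced
    by new forms in \<open>b3\<close>, and the forms of \<open>E\<close> that are lost number at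
    most \<open>fdim X.obs\<close>, hence at most the drop.\<close>
  then have "?d ?E 3 <= ?d E 3" using d3 b3 ZE dZ X.fredholm by linarith
  then show False using min2[OF PE] d2 dVE by linarith
 qed
 moreover have "?d E 3 <= ?d E' 3" if "substructure M E'" "finite E'" "E <= E'" for E'
  by (rule min3) (use that DE in \<open>auto simp: P_def\<close>)
 ultimately have "strong M E" unfolding strong_def using SE fE by blast
 then show ?thesis using DE by blast
qed

end

section \<open>Invariance under isomorphism\<close>

text \<open>Inequalities suffice here, as the inverse isomorphism supplies the opposite ones. Forms
  are pulled back along \<open>f\<close>, injectively because \<open>f\<close> is onto in each
  degree.\<close>

lemma (in lie3) isomorphism_le:
 assumes N: "graded_lie3 N" and f: "isomorphism M N f" and fin: "finite (carrier M)"
 shows "card (G i) = card (grade N i)" "card D2 <= card (lie3.D2 N)" "card D3 <= card (lie3.D3 N)"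
  "fdim (fin_vspace.alt_on (smul N) (grade N 1)) <= fdim (vs.alt_on (G 1))"
  "fdim (lie3.jac N (grade N 1) (grade N 2)) <= fdim (jac (G 1) (G 2))"
proof -
 interpret N: lie3 N by unfold_locales (rule N)
 have h: "lie_hom M N f" and inj: "inj_on f (carrier M)" and im: "f ` carrier M = carrier N"
  and gr: "!!i x. x \<in> carrier M ==> x \<in> G i \<longleftrightarrow> f x \<in> N.G i"
  using f unfolding isomorphism_def embedding_def by blast+
 note F = hom_facts[OF N h]
 have fN: "finite (carrier N)" using im fin by (metis finite_imageI)
 have Gim: "f ` G i = N.G i" for i
 proof
  show "f ` G i <= N.G i" using F(8) by blast
  show "N.G i <= f ` G i"
  proof
   fix y assume y: "y \<in> N.G i"
   then obtain x where x: "x \<in> carrier M" "y = f x" using N.Gc im by blast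
   then have "x \<in> G i" using gr y by blast
   then show "y \<in> f ` G i" using x(2) by blast
  qed
 qed
 have injG: "inj_on f (G i)" for i by (rule inj_on_subset[OF inj]) (use Gc in blast)
 show "card (G i) = card (grade N i)" unfolding Gim[symmetric] by (rule card_image[OF injG, symmetric])
 have sub: "vs.subspace {x\<in>G i. f x \<in> S}" if S: "N.vs.subspace S" for S i
  unfolding vs.subspace_def
  using vs.subspace_add[OF G_sub, of _ i] vs.subspace_scale[OF G_sub, of _ i] F(1) F(4,7)[OF Gc] F(4)[OF Gc Gc]
   N.vs.subspace_0[OF S] N.vs.subspace_add[OF S] N.vs.subspace_scale[OF S] by auto
 have D: "card (vs.span {br x y |x y. x \<in> G i & y \<in> G j}) <= card (N.vs.span {N.br x y |x y. x \<in> N.G i & y \<in> N.G j})"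
  (is "card (vs.span ?B) <= card ?D") for i j
 proof -
  have "vs.span ?B <= {x\<in>G (i + j). f x \<in> ?D}"
  proof (rule vs.span_minimal[OF _ sub[OF N.vs.subspace_span]], clarify)
   fix x y assume x: "x \<in> G i" and y: "y \<in> G j"
   have "f (br x y) = N.br (f x) (f y)" by (rule F(6)[OF Gc[OF x] Gc[OF y]])
   also have "\<dots> \<in> ?D" by (rule N.vs.span_base) (use F(8)[OF x] F(8)[OF y] in blast)
   finally show "br x y \<in> G (i + j) & f (br x y) \<in> ?D" using br_G[OF x y] by blast
  qed
  then have B: "vs.span ?B <= G (i + j)" "f ` vs.span ?B <= ?D" by blast+
  have "finite ?D" by (intro N.vs.finite_span N.finite_brackets N.finite_G fN)
  then show ?thesis using card_mono[OF _ B(2)] card_image[OF inj_on_subset[OF injG B(1)]] by simp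
 qed
 show "card D2 <= card N.D2" "card D3 <= card N.D3" unfolding D2_def D3_def N.D2_def N.D3_def by (rule D)+
 define pull where "pull i j b = (\<lambda>p. if p \<in> G i \<times> G j then b (f (fst p), f (snd p)) else 0)"
  for i j and b :: "'b \<times> 'b => 'k"
 have pl: "flin (pull i j)" for i j by (rule linear_fsI) (auto simp: pull_def fun_app)
 have pb: "pull i j b \<in> vs.bil_on (G i) (G j)" if b: "b \<in> N.vs.bil_on (N.G i) (N.G j)" for b i j
 proof -
  note B = N.vs.bil_onD[OF b]
  show ?thesis unfolding vs.bil_on_def pull_def
   using vs.subspace_add[OF G_sub[of i]] vs.subspace_scale[OF G_sub[of i]]
    vs.subspace_add[OF G_sub[of j]] vs.subspace_scale[OF G_sub[of j]]
   by (simp add: F(4)[OF Gc Gc] F(7)[OF Gc] F(8) B del: One_nat_def)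
 qed
 have p0: "b = 0" if b: "b \<in> N.vs.bil_on (N.G i) (N.G j)" "pull i j b = 0" for b i j
 proof
  fix p
  show "b p = 0 p"
  proof (cases "p \<in> N.G i \<times> N.G j")
   case True
   then obtain x y where xy: "x \<in> G i" "y \<in> G j" "p = (f x, f y)" unfolding Gim[symmetric] by auto
   have "pull i j b (x, y) = 0" using b(2) by (simp add: fun_app)
   then show ?thesis using xy unfolding pull_def by (simp add: fun_app)
  next
   case False
   then show ?thesis using N.vs.bil_onD(1)[OF b(1)] by (simp add: fun_app)
  qed
 qed
 have le: "fdim S <= fdim T" if S: "fsubspace S" "ffin_dim S" "S <= N.vs.bil_on (N.G i) (N.G j)"
  and T: "pull i j ` S <= T" "ffin_dim T" for S T i j
 proof -
  have "{b\<in>S. pull i j b = 0} = {0}"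
  proof (intro equalityI subsetI)
   fix b assume "b \<in> {b\<in>S. pull i j b = 0}"
   then show "b \<in> {0}" using p0[of b i j] S(3) by blast
  next
   fix b :: "'b \<times> 'b => 'k" assume "b \<in> {0}"
   then have "b = 0" by simp
   moreover have "pull i j 0 = 0" by (auto simp: pull_def fun_eq_iff fun_app)
   ultimately show "b \<in> {b\<in>S. pull i j b = 0}" using fs.subspace_0[OF S(1)] by simp
  qed
  then have "fdim S = fdim (pull i j ` S)"
   using fsp.rank_nullity(1)[OF pl S(1,2), of i j] by (simp add: fs.dim_zero)
  also have "\<dots> <= fdim T" by (rule fs.dim_mono_fin[OF T])
  finally show ?thesis .
 qed
 show "fdim (N.vs.alt_on (N.G 1)) <= fdim (vs.alt_on (G 1))"
 proof (rule le[OF N.vs.subspace_alt_on N.vs.alt_on_fin[OF N.finite_G[OF fN]]])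
  show "N.vs.alt_on (N.G 1) <= N.vs.bil_on (N.G 1) (N.G 1)" unfolding N.vs.alt_on_def by blast
  show "ffin_dim (vs.alt_on (G 1))" by (rule vs.alt_on_fin[OF finite_G[OF fin]])
  show "pull 1 1 ` N.vs.alt_on (N.G 1) <= vs.alt_on (G 1)"
  proof clarify
   fix b assume b: "b \<in> N.vs.alt_on (N.G 1)"
   show "pull 1 1 b \<in> vs.alt_on (G 1)"
    unfolding vs.alt_on_def using pb[OF N.vs.alt_onD(1)[OF b]] N.vs.alt_onD(2)[OF b] F(8)
    by (simp add: pull_def del: One_nat_def)
  qed
 qed
 show "fdim (N.jac (N.G 1) (N.G 2)) <= fdim (jac (G 1) (G 2))"
 proof (rule le[OF N.subspace_jac N.jac_fin[OF N.finite_G[OF fN] N.finite_G[OF fN]]])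
  show "N.jac (N.G 1) (N.G 2) <= N.vs.bil_on (N.G 1) (N.G 2)" unfolding N.jac_def by blast
  show "ffin_dim (jac (G 1) (G 2))" by (rule jac_fin[OF finite_G[OF fin] finite_G[OF fin]])
  show "pull 1 2 ` N.jac (N.G 1) (N.G 2) <= jac (G 1) (G 2)"
  proof clarify
   fix b assume b: "b \<in> N.jac (N.G 1) (N.G 2)"
   then have bb: "b \<in> N.vs.bil_on (N.G 1) (N.G 2)" unfolding N.jac_def by blast
   have J: "b (u, N.br v w) + b (v, N.br w u) + b (w, N.br u v) = 0"
     if "u \<in> N.G 1" "v \<in> N.G 1" "w \<in> N.G 1" for u v w
    using that b unfolding N.jac_def by blast
   have "pull 1 2 b (x, br y z) + pull 1 2 b (y, br z x) + pull 1 2 b (z, br x y) = 0"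
    if x: "x \<in> G 1" "y \<in> G 1" "z \<in> G 1" for x y z
   proof -
    have e: "pull 1 2 b (x, br y z) = b (f x, N.br (f y) (f z))" if "x \<in> G 1" "y \<in> G 1" "z \<in> G 1" for x y z
     using that br_G11[OF that(2,3)] F(6)[OF Gc[OF that(2)] Gc[OF that(3)]] unfolding pull_def by (simp del: One_nat_def)
    show ?thesis using J[OF F(8)[OF x(1)] F(8)[OF x(2)] F(8)[OF x(3)]] e x by simp
   qed
   then show "pull 1 2 b \<in> jac (G 1) (G 2)" unfolding jac_def using pb[OF bb] by blast
  qed
 qed
qed

lemma (in lie3) isomorphism_invariant:
 assumes N: "graded_lie3 N" and f: "isomorphism M N f" and fin: "finite (carrier M)"
 shows "!!j. j \<in> {2, 3} ==> delta M j = delta N j" "!!i. i \<in> {1, 2, 3} ==> o_dim M i = o_dim N i"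
proof -
 interpret N: lie3 N by unfold_locales (rule N)
 have fN: "finite (carrier N)" using f fin unfolding isomorphism_def by (metis finite_imageI)
 have q: "1 < card (UNIV :: 'k set)" by (rule card_field_gt_1)
 note A = isomorphism_le[OF N f fin] and B = N.isomorphism_le[OF lie isomorphism_inv[OF N f] fN]
 have g: "vs.dim (G i) = N.vs.dim (N.G i)" for i
  using A(1)[of i] unfolding vs.card_dim[OF G_sub finite_G[OF fin]] N.vs.card_dim[OF N.G_sub N.finite_G[OF fN]]
  using q by (simp add: power_inject_exp)
 have fD: "finite D2" "finite D3" "finite N.D2" "finite N.D3"
  using finite_subset[OF D_sub(1) finite_G[OF fin]] finite_subset[OF D_sub(2) finite_G[OF fin]]
   finite_subset[OF N.D_sub(1) N.finite_G[OF fN]] finite_subset[OF N.D_sub(2) N.finite_G[OF fN]] by blast+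
 have sD: "vs.subspace D2" "vs.subspace D3" "N.vs.subspace N.D2" "N.vs.subspace N.D3"
  unfolding D2_def D3_def N.D2_def N.D3_def by simp_all
 have "card D2 = card N.D2" "card D3 = card N.D3" using A(2,3) B(2,3) by simp_all
 then have d: "vs.dim D2 = N.vs.dim N.D2" "vs.dim D3 = N.vs.dim N.D3"
  unfolding vs.card_dim[OF sD(1) fD(1)] vs.card_dim[OF sD(2) fD(2)] N.vs.card_dim[OF sD(3) fD(3)] N.vs.card_dim[OF sD(4) fD(4)]
  using q by (simp_all add: power_inject_exp)
 have a: "fdim (N.vs.alt_on (N.G 1)) = fdim (vs.alt_on (G 1))" using A(4) B(4) by (rule antisym)
 have j: "fdim (N.jac (N.G 1) (N.G 2)) = fdim (jac (G 1) (G 2))" using A(5) B(5) by (rule antisym)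
 have d2: "delta M 2 = delta N 2" unfolding delta_formula(1)[OF fin] N.delta_formula(1)[OF fN] a g ..
 have d3: "delta M 3 = delta N 3" unfolding delta_formula(2)[OF fin] N.delta_formula(2)[OF fN] j g d2 ..
 show "!!j. j \<in> {2, 3} ==> delta M j = delta N j" using d2 d3 by blast
 note o = o_dim_eq[OF fin] and oN = N.o_dim_eq[OF fN]
 have "o_dim M 1 = o_dim N 1" "o_dim M 2 = o_dim N 2" "o_dim M 3 = o_dim N 3"
  using o oN g[of 1] g[of 2] g[of 3] d by linarith+
 then show "!!i. i \<in> {1, 2, 3} ==> o_dim M i = o_dim N i" by blast
qed

lemma (in lie3) embedding_restrict:
 assumes N: "graded_lie3 N" and f: "embedding M N f" and A: "substructure M A"
 shows "embedding (restrict_to M A) N f"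
proof (rule embeddingI[OF restrict_lie[OF A] N])
 have h: "lie_hom M N f" and inj: "inj_on f (carrier M)" using f unfolding embedding_def by blast+
 note D = substructureD[OF A]
 show "inj_on f (carrier (restrict_to M A))" unfolding carrier_restrict[OF A] by (rule inj_on_subset[OF inj D(1)])
 note F = hom_facts[OF N h]
 show "lie_hom (restrict_to M A) N f"
  by (rule lie_homI) (use F D(1) in \<open>auto simp: carrier_restrict[OF A] subset_iff\<close>)
qed

lemma (in lie3) inclusion_embedding:
 assumes A: "substructure M A"
 shows "embedding (restrict_to M A) M (\<lambda>x. x)"
proof -
 have "embedding M M (\<lambda>x. x)" unfolding embedding_def lie_hom_def by auto
 then show ?thesis by (rule embedding_restrict[OF lie _ A])
qed

lemma (in lie3) embedding_invariant:
 assumes N: "graded_lie3 N" and f: "embedding M N f" and A: "substructure M A" "finite A"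
 shows "!!j. j \<in> {2, 3} ==> delta (restrict_to M A) j = delta (restrict_to N (f ` A)) j"
  "!!i. i \<in> {1, 2, 3} ==> o_dim (restrict_to M A) i = o_dim (restrict_to N (f ` A)) i"
proof -
 interpret N: lie3 N by unfold_locales (rule N)
 interpret R: lie3 "restrict_to M A" by unfold_locales (rule restrict_lie[OF A(1)])
 note im = embedding_image[OF N f A(1)]
 have fin: "finite (carrier (restrict_to M A))" unfolding carrier_restrict[OF A(1)] by (rule A(2))
 note I = R.isomorphism_invariant[OF N.restrict_lie[OF im(1)] im(2) fin]
 show "!!j. j \<in> {2, 3} ==> delta (restrict_to M A) j = delta (restrict_to N (f ` A)) j" by (rule I(1))
 show "!!i. i \<in> {1, 2, 3} ==> o_dim (restrict_to M A) i = o_dim (restrict_to N (f ` A)) i" by (rule I(2))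
qed

text \<open>Substructures above \<open>A\<close> are mapped to substructures above its image, with
  the same values of \<open>delta\<close>.\<close>

lemma (in lie3) strong_pullback:
 assumes N: "graded_lie3 N" and f: "embedding M N f" and A: "substructure M A" "finite A" and S: "strong N (f ` A)"
 shows "strong M A"
 unfolding strong_def
proof (intro conjI allI impI ballI A)
 fix E j assume E: "substructure M E & finite E & A <= E" and j: "j \<in> {2, 3 :: nat}"
 have "substructure N (f ` E)" by (rule embedding_image(1)[OF N f]) (use E in blast)
 then have "delta (restrict_to N (f ` A)) j <= delta (restrict_to N (f ` E)) j"
  using S E j unfolding strong_def by blast
 then show "delta (restrict_to M A) j <= delta (restrict_to M E) j"
  using embedding_invariant(1)[OF N f A j] embedding_invariant(1)[OF N f _ _ j, of E] E by simp
qed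

text \<open>Shows that copies of finite substructures stay in the class, as is required before
  richness can be applied to them.\<close>

lemma (in lie3) embedding_class_K3:
 assumes N: "class_K3 N" and f: "embedding M N f"
 shows "class_K3 M"
proof -
 have gN: "graded_lie3 N" using N unfolding class_K3_def by blast
 have h: "lie_hom M N f" and inj: "inj_on f (carrier M)" using f unfolding embedding_def by blast+
 note F = hom_facts[OF gN h]
 have f0: "f x = 0 ==> x = 0" if "x \<in> carrier M" for x
  using inj_onD[OF inj, of x 0] that F(1) by simp
 show ?thesis
  unfolding class_K3_def
 proof (intro conjI ballI allI impI lie)
  fix i j x y
  assume ij: "i \<in> {1, 2, 3 :: nat}" "j \<in> {1, 2, 3 :: nat}" "i + j <= 3" and xy: "x \<in> G i" "y \<in> G j"
   and n: "x ~= 0 & y ~= 0 & (\<nexists>c. x = smul M c y)"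
  note xc = Gc[OF xy(1)] and yc = Gc[OF xy(2)]
  have "\<nexists>c. f x = smul N c (f y)"
  proof clarify
   fix c assume "f x = smul N c (f y)"
   then have "f x = f (smul M c y)" using F(7)[OF yc] by simp
   then have "x = smul M c y" by (rule inj_onD[OF inj _ xc vs.subspace_scale[OF carrier_subspace yc]])
   then show False using n by blast
  qed
  moreover have "f x ~= 0" "f y ~= 0" using f0 xc yc n by blast+
  ultimately have "bracket N (f x) (f y) ~= 0"
   using N ij F(8)[OF xy(1)] F(8)[OF xy(2)] unfolding class_K3_def by blast
  then show "br x y ~= 0" using F(6)[OF xc yc] F(1) by auto
 next
  fix A assume A: "substructure M A & finite A & 0 < (\<Sum>i=1..3. o_dim (restrict_to M A) i) &
   (\<Sum>i=1..3. o_dim (restrict_to M A) i) <= 2"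
  then have A1: "substructure M A" "finite A" by blast+
  have "(\<Sum>i=1..3. o_dim (restrict_to M A) i) = (\<Sum>i=1..3. o_dim (restrict_to N (f ` A)) i)"
  proof (rule sum.cong[OF refl])
   fix i assume "i \<in> {1..3 :: nat}"
   then have "i \<in> {1, 2, 3}" by auto
   then show "o_dim (restrict_to M A) i = o_dim (restrict_to N (f ` A)) i" by (rule embedding_invariant(2)[OF gN f A1])
  qed
  then have "strong N (f ` A)"
   using N A embedding_image(1)[OF gN f A1(1)] unfolding class_K3_def by simp
  then show "strong M A" by (rule strong_pullback[OF gN f A1])
 qed
qed

section \<open>Back and forth\<close>

text \<open>The positions of the back-and-forth game.\<close>

definition strong_iso :: "('k::{field,finite}, 'a::ab_group_add) glie => ('k, 'b::ab_group_add) glie => 'a set => 'b set => ('a => 'b) => bool" where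
 "strong_iso M N A B h \<longleftrightarrow> strong M A & strong N B & isomorphism (restrict_to M A) (restrict_to N B) h"

text \<open>The new element is enclosed in a finite strong substructure \<open>A'\<close>. A copy of
  \<open>A'\<close> on the ambient type of richness takes the role of the larger structure, with the
  image of \<open>A\<close> as its strong part.\<close>

lemma strong_iso_extend:
 fixes M :: "('k::{field,finite}, 'a::ab_group_add) glie" and N :: "('k, 'b::ab_group_add) glie"
 assumes M: "class_K3 M" and N: "rich N" and h: "strong_iso M N A B h" and x: "x \<in> carrier M"
 shows "\<exists>A' B' g. strong_iso M N A' B' g & A <= A' & B <= B' & x \<in> A' & (\<forall>y\<in>A. g y = h y)"
proof -
 have K: "class_K3 N" using N unfolding rich_def by blast
 interpret M: lie3 M by unfold_locales (use M in \<open>simp add: class_K3_def\<close>)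
 interpret N: lie3 N by unfold_locales (use K in \<open>simp add: class_K3_def\<close>)
 have SA: "substructure M A" "finite A" "strong M A" and SB: "substructure N B" "strong N B"
  and iso: "isomorphism (restrict_to M A) (restrict_to N B) h"
  using h unfolding strong_iso_def strong_def by blast+
 have "finite (insert x A)" "insert x A <= carrier M" using SA(2) x M.substructureD(1)[OF SA(1)] by auto
 then obtain A' where A': "strong M A'" "insert x A <= A'" using M.strong_closure[OF M] by blast
 have sA': "substructure M A'" "finite A'" using A'(1) unfolding strong_def by blast+
 interpret L: lie3 "restrict_to M A'" by unfold_locales (rule M.restrict_lie[OF sA'(1)])
 have cL: "carrier (restrict_to M A') = A'" by (rule M.carrier_restrict[OF sA'(1)])
 have fL: "finite (carrier (restrict_to M A'))" unfolding cL by (rule sA'(2))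
 obtain P :: "('k, nat => 'k) glie" and \<theta> where P: "graded_lie3 P" and th: "isomorphism (restrict_to M A') P \<theta>"
  by (rule L.finite_copy[OF fL])
 interpret P: lie3 P by unfold_locales (rule P)
 define e where "e = inv_into A' \<theta>"
 have ei: "isomorphism P (restrict_to M A') e"
  using L.isomorphism_inv[OF P th] unfolding cL e_def .
 have inj: "inj_on \<theta> A'" and im: "\<theta> ` A' = carrier P"
  using th unfolding isomorphism_def embedding_def cL by blast+
 have et: "e (\<theta> y) = y" if "y \<in> A'" for y unfolding e_def by (rule inv_into_f_f[OF inj that])
 have eP: "embedding P M e"
  using embedding_comp[OF _ M.inclusion_embedding[OF sA'(1)], of P e] ei unfolding isomorphism_def by (simp add: comp_def)
 have KP: "class_K3 P" by (rule P.embedding_class_K3[OF M eP])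
 define B0 where "B0 = \<theta> ` A"
 have "substructure (restrict_to M A') A" unfolding M.substructure_restrict[OF sA'(1)] using SA(1) A'(2) by blast
 moreover have "embedding (restrict_to M A') P \<theta>" using th unfolding isomorphism_def by blast
 ultimately have B0: "substructure P B0" unfolding B0_def by (intro L.embedding_image(1)[OF P])
 have fB0: "finite B0" unfolding B0_def using SA(2) by simp
 have "e ` B0 = (\<lambda>y. y) ` A" unfolding B0_def image_image by (rule image_cong[OF refl]) (use et A'(2) in auto)
 then have eB0: "e ` B0 = A" by simp
 \<comment> \<open>\<open>A\<close> is strong in all of \<open>M\<close>, so its copy is strong in
   the copy \<open>P\<close> of \<open>A'\<close>.\<close>
 have sB0: "strong P B0" by (rule P.strong_pullback[OF M.lie eP B0 fB0]) (simp add: eB0 SA(3))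
 interpret R: lie3 "restrict_to P B0" by unfold_locales (rule P.restrict_lie[OF B0])
 have KB0: "class_K3 (restrict_to P B0)"
  by (rule R.embedding_class_K3[OF KP P.inclusion_embedding[OF B0]])
 have e0: "isomorphism (restrict_to P B0) (restrict_to M A) e"
  using P.embedding_image(2)[OF M.lie eP B0] unfolding eB0 .
 have f: "embedding (restrict_to P B0) N (h \<circ> e)"
  using embedding_comp[OF embedding_comp N.inclusion_embedding[OF SB(1)], of "restrict_to P B0" "restrict_to M A" e h] e0 iso
  unfolding isomorphism_def by (simp add: comp_def)
 have hA: "h ` A = B" using iso unfolding isomorphism_def M.carrier_restrict[OF SA(1)] N.carrier_restrict[OF SB(1)] by blast
 have "strong N ((h \<circ> e) ` B0)" unfolding image_comp[symmetric] eB0 hA by (rule SB(2))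
 moreover have "finite (carrier P)" using im sA'(2) by (metis finite_imageI)
 ultimately obtain g where g: "embedding P N g" "\<forall>y\<in>B0. g y = (h \<circ> e) y" "strong N (g ` carrier P)"
  using N KP KB0 sB0 f unfolding rich_def by blast
 have gt: "isomorphism (restrict_to M A') (restrict_to N (g ` carrier P)) (g \<circ> \<theta>)"
  using isomorphism_comp[OF th] P.embedding_image(2)[OF N.lie g(1) P.carrier_substructure]
  unfolding P.restrict_carrier by blast
 have eq: "(g \<circ> \<theta>) y = h y" if y: "y \<in> A" for y
 proof -
  have "\<theta> y \<in> B0" unfolding B0_def using y by blast
  then have "g (\<theta> y) = h (e (\<theta> y))" using g(2) by simp
  then show ?thesis using et[of y] y A'(2) by auto
 qed
 have "B <= g ` carrier P"
 proof
  fix b assume "b \<in> B"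
  then obtain y where y: "y \<in> A" "b = h y" using hA by blast
  have "\<theta> y \<in> carrier P" using im y(1) A'(2) by blast
  then show "b \<in> g ` carrier P" using eq[OF y(1)] y(2) by (metis comp_apply image_eqI)
 qed
 then show ?thesis using A' g(3) gt eq unfolding strong_iso_def
  by (intro exI[of _ A'] exI[of _ "g ` carrier P"] exI[of _ "g \<circ> \<theta>"]) blast
qed

lemma strong_iso_inv:
 fixes M :: "('k::{field,finite}, 'a::ab_group_add) glie" and N :: "('k, 'b::ab_group_add) glie"
 assumes M: "graded_lie3 M" and N: "graded_lie3 N" and h: "strong_iso M N A B h"
 shows "strong_iso N M B A (inv_into A h)" "!!x. x \<in> A ==> inv_into A h (h x) = x" "h ` A = B"
proof -
 interpret M: lie3 M by unfold_locales (rule M)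
 interpret N: lie3 N by unfold_locales (rule N)
 have A: "substructure M A" and B: "substructure N B" using h unfolding strong_iso_def strong_def by blast+
 interpret R: lie3 "restrict_to M A" by unfold_locales (rule M.restrict_lie[OF A])
 have iso: "isomorphism (restrict_to M A) (restrict_to N B) h" using h unfolding strong_iso_def by blast
 have inj: "inj_on h A" and im: "h ` A = B"
  using iso unfolding isomorphism_def embedding_def M.carrier_restrict[OF A] N.carrier_restrict[OF B] by blast+
 show "strong_iso N M B A (inv_into A h)"
  using h R.isomorphism_inv[OF N.restrict_lie[OF B] iso] unfolding strong_iso_def M.carrier_restrict[OF A] by blast
 show "inv_into A h (h x) = x" if "x \<in> A" for x by (rule inv_into_f_f[OF inj that])
 show "h ` A = B" by (rule im)
qed

lemma strong_iso_extend_back: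
 fixes M :: "('k::{field,finite}, 'a::ab_group_add) glie" and N :: "('k, 'b::ab_group_add) glie"
 assumes M: "rich M" and N: "class_K3 N" and h: "strong_iso M N A B h" and y: "y \<in> carrier N"
 shows "\<exists>A' B' g. strong_iso M N A' B' g & A <= A' & B <= B' & y \<in> B' & (\<forall>x\<in>A. g x = h x)"
proof -
 have gM: "graded_lie3 M" and gN: "graded_lie3 N" using M N unfolding rich_def class_K3_def by blast+
 note i = strong_iso_inv[OF gM gN h]
 obtain B' A' g where g: "strong_iso N M B' A' g" "B <= B'" "A <= A'" "y \<in> B'" "\<forall>z\<in>B. g z = inv_into A h z"
  using strong_iso_extend[OF N M i(1) y] by blast
 note j = strong_iso_inv[OF gN gM g(1)]
 have "inv_into B' g x = h x" if x: "x \<in> A" for x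
 proof -
  have hx: "h x \<in> B" using i(3) x by blast
  then have "g (h x) = x" using g(5) i(2)[OF x] by simp
  then show ?thesis using j(2)[of "h x"] hx g(2) by auto
 qed
 then show ?thesis using j(1) g(2-4) by blast
qed

lemma strong_iso_term:
 fixes M :: "('k::{field,finite}, 'a::ab_group_add) glie" and N :: "('k, 'b::ab_group_add) glie"
 assumes M: "graded_lie3 M" and N: "graded_lie3 N" and h: "strong_iso M N A B h"
  and as: "set as <= A" and v: "range v <= A" and w: "\<forall>n. w n = h (v n)" and t: "term_consts t <= {..<length as}"
 shows "term_value M as v t \<in> A & h (term_value M as v t) = term_value N (map h as) w t"
 using t
proof (induction t)
 interpret M: lie3 M by unfold_locales (rule M)
 interpret N: lie3 N by unfold_locales (rule N)
 have A: "substructure M A" and B: "substructure N B" using h unfolding strong_iso_def strong_def by blast+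
 interpret R: lie3 "restrict_to M A" by unfold_locales (rule M.restrict_lie[OF A])
 have "lie_hom (restrict_to M A) (restrict_to N B) h"
  using h unfolding strong_iso_def isomorphism_def embedding_def by blast
 note F = R.hom_facts[OF N.restrict_lie[OF B] this, unfolded M.carrier_restrict[OF A] M.restrict_sel N.restrict_sel]
 note D = M.substructureD[OF A]
 have hB: "h x \<in> B" if "x \<in> A" for x using strong_iso_inv(3)[OF M N h] that by blast
 have hp: "h (proj M i x) = proj N i (h x)" if "x \<in> A" for x i
  using F(3)[OF that, of i] M.proj_restrict[OF A that] N.proj_restrict[OF B hB[OF that]] by simp
 {
  case (Var n)
  then show ?case using v w by auto
 next
  case (Const i)
  then show ?case using as by auto
 next
  case Zero
  then show ?case using F(1) M.vs.subspace_0[OF D(2)] by simp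
 next
  case (Plus s t)
  then show ?case using F(4) M.vs.subspace_add[OF D(2)] by auto
 next
  case (Minus t)
  then have t: "term_value M as v t \<in> A" "h (term_value M as v t) = term_value N (map h as) w t" by auto
  have "h (0 - term_value M as v t) = h 0 - h (term_value M as v t)"
   by (rule F(5)[OF M.vs.subspace_0[OF D(2)] t(1)])
  then show ?case using t F(1) M.vs.subspace_neg[OF D(2)] by simp
 next
  case (Smul c t)
  then show ?case using F(7) M.vs.subspace_scale[OF D(2)] by auto
 next
  case (Proj i t)
  then show ?case using hp D(3) by auto
 next
  case (Bracket s t)
  then show ?case using F(6) D(4) by auto
 }
qed

text \<open>The partial isomorphism changes only at quantifiers, so conjunctions of any size pass
  through the induction. Valuations are total functions, hence the values of all variables are kept
  inside \<open>A\<close>, whether or not the variables occur.\<close>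

lemma strong_iso_satisfies:
 fixes M :: "('k::{field,finite}, 'a::ab_group_add) glie" and N :: "('k, 'b::ab_group_add) glie"
 assumes M: "rich M" and N: "rich N"
 shows "strong_iso M N A B h ==> set as <= A ==> range v <= A ==> \<forall>n. w n = h (v n) ==> form_consts fi <= {..<length as} ==>
  satisfies M as v fi \<longleftrightarrow> satisfies N (map h as) w fi"
proof (induction fi arbitrary: A B h v w)
 have KM: "class_K3 M" and KN: "class_K3 N" using M N unfolding rich_def by blast+
 then have gM: "graded_lie3 M" and gN: "graded_lie3 N" unfolding class_K3_def by blast+
 interpret M: lie3 M by unfold_locales (rule gM)
 interpret N: lie3 N by unfold_locales (rule gN)
 {
  case (Eq s t)
  note tv = strong_iso_term[OF gM gN Eq.prems(1-4)]
  have inj: "inj_on h A"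
   using strong_iso_inv(2)[OF gM gN Eq.prems(1)] by (metis inj_on_def)
  then show ?case using tv[of s] tv[of t] inj_onD[OF inj, of "term_value M as v s" "term_value M as v t"] Eq.prems(5) by auto
 next
  case (InGrade i t)
  note tv = strong_iso_term[OF gM gN InGrade.prems(1-4), of t]
  have A: "substructure M A" and B: "substructure N B" using InGrade.prems(1) unfolding strong_iso_def strong_def by blast+
  have "x \<in> M.G i \<longleftrightarrow> h x \<in> N.G i" if "x \<in> A" for x
   using InGrade.prems(1) that strong_iso_inv(3)[OF gM gN InGrade.prems(1)]
   unfolding strong_iso_def isomorphism_def embedding_def M.carrier_restrict[OF A] M.restrict_sel N.restrict_sel by blast
  then show ?case using tv InGrade.prems(5) by auto
 next
  case (Neg fi)
  then show ?case by simp
 next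
  case (Conj I Ph)
  have "satisfies M as v (Ph i) \<longleftrightarrow> satisfies N (map h as) w (Ph i)" if "i \<in> I" for i
   by (rule Conj.IH[OF _ Conj.prems(1-4)]) (use Conj.prems(5) that in auto)
  then show ?case by simp
 next
  case (Ex n fi)
  have step: "satisfies M as (v(n := x)) fi \<longleftrightarrow> satisfies N (map h as) (w(n := g x)) fi"
   if g: "strong_iso M N A' B' g" "A <= A'" "\<forall>y\<in>A. g y = h y" "x \<in> A'" for A' B' g x
  proof -
   have "satisfies M as (v(n := x)) fi \<longleftrightarrow> satisfies N (map g as) (w(n := g x)) fi"
   proof (rule Ex.IH[OF g(1)])
    show "\<forall>k. (w(n := g x)) k = g ((v(n := x)) k)"
     using Ex.prems(3,4) g(3) by (auto simp: image_subset_iff)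
    show "range (v(n := x)) <= A'" using Ex.prems(3) g(2,4) by (auto simp: image_subset_iff subset_iff)
   qed (use Ex.prems g in auto)
   \<comment> \<open>The constants keep their meaning because \<open>g\<close> extends
     \<open>h\<close> on \<open>A\<close>.\<close>
   moreover have "map g as = map h as" using Ex.prems(2) g(3) by auto
   ultimately show ?thesis by simp
  qed
  show ?case
  proof
   assume "satisfies M as v (Ex n fi)"
   then obtain x where x: "x \<in> carrier M" "satisfies M as (v(n := x)) fi" by auto
   obtain A' B' g where g: "strong_iso M N A' B' g" "A <= A'" "B <= B'" "x \<in> A'" "\<forall>y\<in>A. g y = h y"
    using strong_iso_extend[OF KM N Ex.prems(1) x(1)] by blast
   have "g x \<in> B'" using strong_iso_inv(3)[OF gM gN g(1)] g(4) by blast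
   moreover have "substructure N B'" using g(1) unfolding strong_iso_def strong_def by blast
   ultimately have "g x \<in> carrier N" using N.substructureD(1) by blast
   then show "satisfies N (map h as) w (Ex n fi)" using step[OF g(1,2,5,4)] x(2) by auto
  next
   assume "satisfies N (map h as) w (Ex n fi)"
   then obtain y where y: "y \<in> carrier N" "satisfies N (map h as) (w(n := y)) fi" by auto
   obtain A' B' g where g: "strong_iso M N A' B' g" "A <= A'" "B <= B'" "y \<in> B'" "\<forall>x\<in>A. g x = h x"
    using strong_iso_extend_back[OF M KN Ex.prems(1) y(1)] by blast
   obtain x where x: "x \<in> A'" "y = g x" using strong_iso_inv(3)[OF gM gN g(1)] g(4) by blast
   have "substructure M A'" using g(1) unfolding strong_iso_def strong_def by blast
   then have "x \<in> carrier M" using M.substructureD(1) x(1) by blast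
   then show "satisfies M as v (Ex n fi)" using step[OF g(1,2,5) x(1)] y(2) x(2) by auto
  qed
 }
qed

theorem theorem7p3:
  fixes M :: "('k::{field,finite}, 'a::ab_group_add) glie"
    and N :: "('k, 'b::ab_group_add) glie"
    and as :: "'a list" and bs :: "'b list"
  assumes "rich M" and "rich N"
    and "set as \<subseteq> carrier M" and "set bs \<subseteq> carrier N"
    and "strong M (generated M (set as))" and "strong N (generated N (set bs))"
    and "\<exists>h. isomorphism (restrict_to M (generated M (set as)))
                         (restrict_to N (generated N (set bs))) h \<and> map h as = bs"
  shows "Linf_equiv TYPE('i) M as N bs"
proof -
 have gM: "graded_lie3 M" and gN: "graded_lie3 N" using assms(1,2) unfolding rich_def class_K3_def by blast+
 interpret M: lie3 M by unfold_locales (rule gM)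
 interpret N: lie3 N by unfold_locales (rule gN)
 let ?A = "generated M (set as)" and ?B = "generated N (set bs)"
 obtain h where h: "isomorphism (restrict_to M ?A) (restrict_to N ?B) h" "map h as = bs" using assms(7) by blast
 have si: "strong_iso M N ?A ?B h" unfolding strong_iso_def using assms(5,6) h(1) by blast
 have A: "substructure M ?A" and B: "substructure N ?B" using assms(5,6) unfolding strong_def by blast+
 interpret R: lie3 "restrict_to M ?A" by unfold_locales (rule M.restrict_lie[OF A])
 have "lie_hom (restrict_to M ?A) (restrict_to N ?B) h" using h(1) unfolding isomorphism_def embedding_def by blast
 then have h0: "h 0 = 0" by (rule R.hom_facts(1)[OF N.restrict_lie[OF B]])
 have as: "set as <= ?A" by (rule M.generated_incl)
 \<comment> \<open>The valuation in \<open>models\<close> is constantly 0, and 0 lies in every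
   substructure.\<close>
 have v: "range (\<lambda>_. 0) <= ?A" using M.vs.subspace_0[OF M.substructureD(2)[OF A]] by auto
 have "models M as \<phi> = models N bs \<phi>" if "sentence (length as) \<phi>" for \<phi> :: "('k, 'i) lform"
  unfolding models_def h(2)[symmetric]
  by (rule strong_iso_satisfies[OF assms(1,2) si as v]) (use that h0 in \<open>simp_all add: sentence_def\<close>)
 then show ?thesis unfolding Linf_equiv_def using h(2) by auto
qed

end
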